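(* Let $(M,\nabla,\langle\cdot,\cdot\rangle)$ be an affine-Riemann manifold with difference tensor $\gamma$ and canonical sequence $(T^kM,J_k,g_k,\nabla^k)_{k\ge1}$. Then: 1. If $\gamma=0$ then, for every $k\ge1$, $\nabla^k$ is the Levi-Civita connection of $g_k$ and $(T^kM,J_k,g_k)$ is Kähler flat. 2. For any given $k\ge2$, $(T^kM,J_k,g_k)$ is Kähler if and only if $\gamma=0$. 3. For any given $k\ge1$, $(T^kM,J_k,g_k)$ is locally conformally balanced if and only if $(TM,J_1,g_1)$ is locally conformally balanced, and this is equivalent to $d\xi=0$. 4. For any given $k_0\ge1$, $(T^{k_0}M,J_{k_0},g_{k_0})$ is balanced if and only if $$\mathrm{tr}_{\langle,\rangle}(\gamma)=(2^{k_0}-1)\,\mathrm{tr}_{\langle,\rangle}(\gamma^* ).$$ In this case, $(T^{k_0+1}M,J_{k_0+1},g_{k_0+1})$ is Calabi-Yau with torsion and, for every $k\ne k_0$, $(T^kM,J_k,g_k)$ is locally conformally balanced. 5. If $\mathrm{tr}_{\langle,\rangle}(\gamma)=\mathrm{tr}_{\langle,\rangle}(\gamma^* )=0$ then, for every $k\ge1$, $(T^kM,J_k,g_k)$ is balanced, Calabi-Yau with torsion, and its Chern Ricci form vanishes.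
   Context: An affine-Riemann manifold $(M,\nabla,\langle\cdot,\cdot\rangle)$ is a manifold with a flat torsionless connection $\nabla$ and a Riemannian metric. $D$ is the Levi-Civita connection of the metric; the difference tensor is $\gamma_XY=D_XY-\nabla_XY$, and $\gamma^*$ is defined by $\langle\gamma^*_XY,Z\rangle=\langle Y,\gamma_XZ\rangle$. For a local orthonormal frame $(E_i)$, $\mathrm{tr}_{\langle,\rangle}(\gamma)=\sum_i\gamma_{E_i}E_i$, $\mathrm{tr}_{\langle,\rangle}(\gamma^* )=\sum_i\gamma^*_{E_i}E_i$; $\xi(X)=\langle\mathrm{tr}_{\langle,\rangle}(\gamma),X\rangle$. Canonical sequence: for a vector field $X$ on $M$, $X^h$ is the horizontal lift to $TM$ with respect to $\nabla$ and $X^v$ the vertical lift; $\pi_1:TM\to M$ is the projection. On $TM$: $J_1X^h=X^v$, $J_1X^v=-X^h$; $g_1(X^h,Y^h)=g_1(X^v,Y^v)=\langle X,Y\rangle\circ\pi_1$, $g_1(X^h,Y^v)=0$; $\nabla^1_{X^h}Y^h=(\nabla_XY)^h$, $\nabla^1_{X^h}Y^v=(\nabla_XY)^v$, $\nabla^1_{X^v}Y^h=\nabla^1_{X^v}Y^v=0$. Then $(TM,J_1,g_1)$ is Hermitian and $\nabla^1$ is flat torsionless. Inductively, with $T^1M=TM$, $T^kM=T(T^{k-1}M)$, applying the construction to $(T^{k-1}M,\nabla^{k-1},g_{k-1})$ gives $(J_k,g_k,\nabla^k)$ on $T^kM$. For a Hermitian manifold $(N,J,g)$ of real dimension $2m$,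 with Levi-Civita connection $\nabla^{LC}$: $\omega=g(J\cdot,\cdot)$, $d^*\omega(\cdot)=-\sum_i(\nabla^{LC}_{E_i}\omega)(E_i,\cdot)$, Lee form $\theta=-d^*\omega\circ J$. It is Kähler if $d\omega=0$, balanced if $\theta=0$, locally conformally balanced if $d\theta=0$. The Bismut and Chern connections are $g(\nabla^B_XY,Z)=g(\nabla^{LC}_XY,Z)+\frac12d\omega(JX,JY,JZ)$ and $g(\nabla^C_XY,Z)=g(\nabla^{LC}_XY,Z)-\frac12d\omega(JX,Y,Z)$. For $\tau\in\{B,C\}$, $R^\tau(X,Y)=\nabla^\tau_{[X,Y]}-\nabla^\tau_X\nabla^\tau_Y+\nabla^\tau_Y\nabla^\tau_X$ and the Ricci form is $\rho^\tau(X,Y)=\frac12\sum_{i=1}^{2m}g(R^\tau(X,Y)E_i,JE_i)$. Calabi-Yau with torsion means $\rho^B=0$; the Chern Ricci form is $\rho^C$. *)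

theory Defs
  imports "HOL-Analysis.Analysis" "HOL-Library.Function_Algebras"
begin

text \<open>Pointwise real vector space structure on function types; the additive group structure is
  that of \<^theory>\<open>HOL-Library.Function_Algebras\<close>.\<close>

instantiation "fun" :: (type, real_vector) real_vector
begin

definition scaleR_fun_def: "c *\<^sub>R f = (\<lambda>x. c *\<^sub>R f x)"

instance
  by standard (simp_all add: scaleR_fun_def plus_fun_def fun_eq_iff
      scaleR_add_right scaleR_add_left)

end

text \<open>The dimension of the iterated tangent bundles grows with the number of iterations, so the
  model space of dimension \<open>n\<close> is the library's \<^const>\<open>Euclidean_space\<close>, whose points are the
  sequences of type \<^typ>\<open>nat \<Rightarrow> real\<close> vanishing from index \<open>n\<close> on.\<close>

definition pderiv_at :: "nat \<Rightarrow> ((nat \<Rightarrow> real) \<Rightarrow> real) \<Rightarrow> (nat \<Rightarrow> real) \<Rightarrow> real" where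
  "pderiv_at a f x = deriv (\<lambda>t. f (x(a := t))) (x a)"

primrec iter_pderiv :: "nat list \<Rightarrow> ((nat \<Rightarrow> real) \<Rightarrow> real) \<Rightarrow> (nat \<Rightarrow> real) \<Rightarrow> real" where
  "iter_pderiv [] f = f"
| "iter_pderiv (a # as) f = pderiv_at a (iter_pderiv as f)"

definition smooth_coord :: "nat \<Rightarrow> (nat \<Rightarrow> real) set \<Rightarrow> ((nat \<Rightarrow> real) \<Rightarrow> real) \<Rightarrow> bool" where
  "smooth_coord n U f \<longleftrightarrow> openin (Euclidean_space n) U \<and>
     (\<forall>as. set as \<subseteq> {..<n} \<longrightarrow>
        continuous_map (subtopology (Euclidean_space n) U) euclideanreal (iter_pderiv as f) \<and>
        (\<forall>a<n. \<forall>x\<in>U. (\<lambda>t. iter_pderiv as f (x(a := t))) differentiable (at (x a))))"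

record ('p, 'i) manifold =
  points :: "'p set"
  mdim :: nat
  charts :: "'i set"
  cdom :: "'i \<Rightarrow> 'p set"
  coords :: "'i \<Rightarrow> 'p \<Rightarrow> nat \<Rightarrow> real"

abbreviation chart_around :: "('p, 'i) manifold \<Rightarrow> 'p \<Rightarrow> 'i \<Rightarrow> bool" where
  "chart_around M p i \<equiv> i \<in> charts M \<and> p \<in> cdom M i"

definition param :: "('p, 'i) manifold \<Rightarrow> 'i \<Rightarrow> (nat \<Rightarrow> real) \<Rightarrow> 'p" where
  "param M i = inv_into (cdom M i) (coords M i)"

definition mtop :: "('p, 'i) manifold \<Rightarrow> 'p topology" where
  "mtop M = topology (\<lambda>U. U \<subseteq> points M \<and>
     (\<forall>i\<in>charts M. openin (Euclidean_space (mdim M)) (coords M i ` (U \<inter> cdom M i))))"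

definition smooth_manifold :: "('p, 'i) manifold \<Rightarrow> bool" where
  "smooth_manifold M \<longleftrightarrow>
     (\<Union>i\<in>charts M. cdom M i) = points M \<and>
     (\<forall>i\<in>charts M. inj_on (coords M i) (cdom M i)) \<and>
     (\<forall>i\<in>charts M. openin (Euclidean_space (mdim M)) (coords M i ` cdom M i)) \<and>
     (\<forall>i\<in>charts M. \<forall>j\<in>charts M. \<forall>b<mdim M.
        smooth_coord (mdim M) (coords M i ` (cdom M i \<inter> cdom M j))
          (\<lambda>x. coords M j (param M i x) b)) \<and>
     (\<forall>i\<in>charts M. \<forall>j\<in>charts M.
        openin (Euclidean_space (mdim M)) (coords M i ` (cdom M i \<inter> cdom M j))) \<and>
     Hausdorff_space (mtop M) \<and> second_countable (mtop M)"

definition smooth_fun_on :: "('p, 'i) manifold \<Rightarrow> 'p set \<Rightarrow> ('p \<Rightarrow> real) \<Rightarrow> bool" where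
  "smooth_fun_on M U f \<longleftrightarrow> openin (mtop M) U \<and>
     (\<forall>i\<in>charts M. smooth_coord (mdim M) (coords M i ` (U \<inter> cdom M i)) (\<lambda>x. f (param M i x)))"

text \<open>A tangent vector at \<open>p\<close> is the family of its components \<open>v i\<close> in all charts \<open>i\<close> around \<open>p\<close>,
  related by the Jacobians of the coordinate changes (and \<open>v i = 0\<close> for the other indices \<open>i\<close>).\<close>

type_synonym 'i tvec = "'i \<Rightarrow> nat \<Rightarrow> real"

definition tangent_space :: "('p, 'i) manifold \<Rightarrow> 'p \<Rightarrow> 'i tvec set" where
  "tangent_space M p = {v.
     (\<forall>i. chart_around M p i \<longrightarrow> v i \<in> topspace (Euclidean_space (mdim M))) \<and>
     (\<forall>i. \<not> chart_around M p i \<longrightarrow> v i = 0) \<and>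
     (\<forall>i j. chart_around M p i \<longrightarrow> chart_around M p j \<longrightarrow>
        (\<forall>b<mdim M. v j b =
           (\<Sum>a<mdim M. pderiv_at a (\<lambda>x. coords M j (param M i x) b) (coords M i p) * v i a)))}"

type_synonym ('p, 'i) vfield = "'p \<Rightarrow> 'i tvec"

definition vector_field_on :: "('p, 'i) manifold \<Rightarrow> 'p set \<Rightarrow> ('p, 'i) vfield \<Rightarrow> bool" where
  "vector_field_on M U X \<longleftrightarrow> openin (mtop M) U \<and> (\<forall>p\<in>U. X p \<in> tangent_space M p) \<and>
     (\<forall>i\<in>charts M. \<forall>a<mdim M.
        smooth_coord (mdim M) (coords M i ` (U \<inter> cdom M i)) (\<lambda>x. X (param M i x) i a))"

text \<open>The derivative \<open>v(f)\<close> of a function along a tangent vector at \<open>p\<close>; it does not depend on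
  the chart.\<close>

definition dirderiv :: "('p, 'i) manifold \<Rightarrow> 'p \<Rightarrow> 'i tvec \<Rightarrow> ('p \<Rightarrow> real) \<Rightarrow> real" where
  "dirderiv M p v f =
     (let i = (SOME i. chart_around M p i)
      in \<Sum>a<mdim M. v i a * pderiv_at a (\<lambda>x. f (param M i x)) (coords M i p))"

definition lie_bracket ::
    "('p, 'i) manifold \<Rightarrow> ('p, 'i) vfield \<Rightarrow> ('p, 'i) vfield \<Rightarrow> ('p, 'i) vfield" where
  "lie_bracket M X Y p = (\<lambda>i b. if chart_around M p i
     then dirderiv M p (X p) (\<lambda>q. Y q i b) - dirderiv M p (Y p) (\<lambda>q. X q i b) else 0)"

definition fscale :: "('p \<Rightarrow> real) \<Rightarrow> ('p, 'i) vfield \<Rightarrow> ('p, 'i) vfield" where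
  "fscale f X p = f p *\<^sub>R X p"

definition differential ::
    "('p, 'i) manifold \<Rightarrow> ('q, 'j) manifold \<Rightarrow> ('p \<Rightarrow> 'q) \<Rightarrow> 'p \<Rightarrow> 'i tvec \<Rightarrow> 'j tvec" where
  "differential M N F p v = (\<lambda>j b. if chart_around N (F p) j
     then dirderiv M p v (\<lambda>q. coords N j (F q) b) else 0)"

text \<open>Connections act on local vector fields, that is, on fields that are smooth on some open
  set \<open>U\<close>; only the values on \<open>U\<close> are constrained. Locality follows from the Leibniz rule and
  linearity over locally smooth functions, applied to indicator functions of open sets.\<close>

type_synonym ('p, 'i) conn = "('p, 'i) vfield \<Rightarrow> ('p, 'i) vfield \<Rightarrow> ('p, 'i) vfield"

definition connection :: "('p, 'i) manifold \<Rightarrow> ('p, 'i) conn \<Rightarrow> bool" where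
  "connection M nab \<longleftrightarrow>
     (\<forall>U X Y. vector_field_on M U X \<longrightarrow> vector_field_on M U Y \<longrightarrow>
        vector_field_on M U (nab X Y)) \<and>
     (\<forall>U X X' Y. vector_field_on M U X \<longrightarrow> vector_field_on M U X' \<longrightarrow> vector_field_on M U Y \<longrightarrow>
        (\<forall>p\<in>U. nab (X + X') Y p = nab X Y p + nab X' Y p)) \<and>
     (\<forall>U X Y Y'. vector_field_on M U X \<longrightarrow> vector_field_on M U Y \<longrightarrow> vector_field_on M U Y' \<longrightarrow>
        (\<forall>p\<in>U. nab X (Y + Y') p = nab X Y p + nab X Y' p)) \<and>
     (\<forall>U f X Y. smooth_fun_on M U f \<longrightarrow> vector_field_on M U X \<longrightarrow> vector_field_on M U Y \<longrightarrow>
        (\<forall>p\<in>U. nab (fscale f X) Y p = f p *\<^sub>R nab X Y p)) \<and>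
     (\<forall>U f X Y. smooth_fun_on M U f \<longrightarrow> vector_field_on M U X \<longrightarrow> vector_field_on M U Y \<longrightarrow>
        (\<forall>p\<in>U. nab X (fscale f Y) p = dirderiv M p (X p) f *\<^sub>R Y p + f p *\<^sub>R nab X Y p))"

definition torsion_free :: "('p, 'i) manifold \<Rightarrow> ('p, 'i) conn \<Rightarrow> bool" where
  "torsion_free M nab \<longleftrightarrow>
     (\<forall>U X Y. vector_field_on M U X \<longrightarrow> vector_field_on M U Y \<longrightarrow>
        (\<forall>p\<in>U. nab X Y p - nab Y X p = lie_bracket M X Y p))"

definition curvature :: "('p, 'i) manifold \<Rightarrow> ('p, 'i) conn \<Rightarrow>
    ('p, 'i) vfield \<Rightarrow> ('p, 'i) vfield \<Rightarrow> ('p, 'i) vfield \<Rightarrow> ('p, 'i) vfield" where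
  "curvature M nab X Y Z p =
     nab (lie_bracket M X Y) Z p - nab X (nab Y Z) p + nab Y (nab X Z) p"

definition flat_connection :: "('p, 'i) manifold \<Rightarrow> ('p, 'i) conn \<Rightarrow> bool" where
  "flat_connection M nab \<longleftrightarrow>
     (\<forall>U X Y Z. vector_field_on M U X \<longrightarrow> vector_field_on M U Y \<longrightarrow> vector_field_on M U Z \<longrightarrow>
        (\<forall>p\<in>U. curvature M nab X Y Z p = 0))"

type_synonym ('p, 'i) metric_tensor = "'p \<Rightarrow> 'i tvec \<Rightarrow> 'i tvec \<Rightarrow> real"

definition riemannian_metric :: "('p, 'i) manifold \<Rightarrow> ('p, 'i) metric_tensor \<Rightarrow> bool" where
  "riemannian_metric M g \<longleftrightarrow>
     (\<forall>p\<in>points M.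
        (\<forall>x\<in>tangent_space M p. \<forall>y\<in>tangent_space M p. g p x y = g p y x) \<and>
        (\<forall>x\<in>tangent_space M p. \<forall>y\<in>tangent_space M p. \<forall>z\<in>tangent_space M p.
           g p (x + y) z = g p x z + g p y z) \<and>
        (\<forall>c. \<forall>x\<in>tangent_space M p. \<forall>y\<in>tangent_space M p. g p (c *\<^sub>R x) y = c * g p x y) \<and>
        (\<forall>x\<in>tangent_space M p. x \<noteq> 0 \<longrightarrow> g p x x > 0)) \<and>
     (\<forall>U X Y. vector_field_on M U X \<longrightarrow> vector_field_on M U Y \<longrightarrow>
        smooth_fun_on M U (\<lambda>p. g p (X p) (Y p)))"

definition is_levi_civita ::
    "('p, 'i) manifold \<Rightarrow> ('p, 'i) metric_tensor \<Rightarrow> ('p, 'i) conn \<Rightarrow> bool" where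
  "is_levi_civita M g D \<longleftrightarrow> connection M D \<and> torsion_free M D \<and>
     (\<forall>U X Y Z. vector_field_on M U X \<longrightarrow> vector_field_on M U Y \<longrightarrow> vector_field_on M U Z \<longrightarrow>
        (\<forall>p\<in>U. dirderiv M p (X p) (\<lambda>q. g q (Y q) (Z q)) =
           g p (D X Y p) (Z p) + g p (Y p) (D X Z p)))"

text \<open>The Levi-Civita connection is unique as far as its values on smooth local fields are
  concerned; its values on other arguments are irrelevant.\<close>

definition levi_civita :: "('p, 'i) manifold \<Rightarrow> ('p, 'i) metric_tensor \<Rightarrow> ('p, 'i) conn" where
  "levi_civita M g = (SOME D. is_levi_civita M g D)"

definition orthonormal_frame_on ::
    "('p, 'i) manifold \<Rightarrow> ('p, 'i) metric_tensor \<Rightarrow> 'p set \<Rightarrow> (nat \<Rightarrow> ('p, 'i) vfield) \<Rightarrow> bool" where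
  "orthonormal_frame_on M g U E \<longleftrightarrow>
     (\<forall>a<mdim M. vector_field_on M U (E a)) \<and>
     (\<forall>p\<in>U. \<forall>a<mdim M. \<forall>b<mdim M. g p (E a p) (E b p) = (if a = b then 1 else 0))"

text \<open>Some smooth orthonormal frame on a neighbourhood of \<open>p\<close>; the traces below do not depend on
  the choice.\<close>

definition frame_at ::
    "('p, 'i) manifold \<Rightarrow> ('p, 'i) metric_tensor \<Rightarrow> 'p \<Rightarrow> nat \<Rightarrow> ('p, 'i) vfield" where
  "frame_at M g p = (SOME E. \<exists>U. openin (mtop M) U \<and> p \<in> U \<and> orthonormal_frame_on M g U E)"

definition affine_riemann ::
    "('p, 'i) manifold \<Rightarrow> ('p, 'i) conn \<Rightarrow> ('p, 'i) metric_tensor \<Rightarrow> bool" where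
  "affine_riemann M nab g \<longleftrightarrow> smooth_manifold M \<and> connection M nab \<and> torsion_free M nab \<and>
     flat_connection M nab \<and> riemannian_metric M g"

definition diff_tensor ::
    "('p, 'i) manifold \<Rightarrow> ('p, 'i) conn \<Rightarrow> ('p, 'i) metric_tensor \<Rightarrow> ('p, 'i) conn" where
  "diff_tensor M nab g X Y p = levi_civita M g X Y p - nab X Y p"

definition diff_tensor_adj ::
    "('p, 'i) manifold \<Rightarrow> ('p, 'i) conn \<Rightarrow> ('p, 'i) metric_tensor \<Rightarrow> ('p, 'i) conn" where
  "diff_tensor_adj M nab g X Y p = (THE w. w \<in> tangent_space M p \<and>
     (\<forall>U Z. p \<in> U \<longrightarrow> vector_field_on M U Z \<longrightarrow>
        g p w (Z p) = g p (Y p) (diff_tensor M nab g X Z p)))"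

definition metric_trace ::
    "('p, 'i) manifold \<Rightarrow> ('p, 'i) metric_tensor \<Rightarrow> ('p, 'i) conn \<Rightarrow> ('p, 'i) vfield" where
  "metric_trace M g S p = (\<Sum>a<mdim M. S (frame_at M g p a) (frame_at M g p a) p)"

abbreviation tr_gamma ::
    "('p, 'i) manifold \<Rightarrow> ('p, 'i) conn \<Rightarrow> ('p, 'i) metric_tensor \<Rightarrow> ('p, 'i) vfield" where
  "tr_gamma M nab g \<equiv> metric_trace M g (diff_tensor M nab g)"

abbreviation tr_gamma_adj ::
    "('p, 'i) manifold \<Rightarrow> ('p, 'i) conn \<Rightarrow> ('p, 'i) metric_tensor \<Rightarrow> ('p, 'i) vfield" where
  "tr_gamma_adj M nab g \<equiv> metric_trace M g (diff_tensor_adj M nab g)"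

definition diff_tensor_zero ::
    "('p, 'i) manifold \<Rightarrow> ('p, 'i) conn \<Rightarrow> ('p, 'i) metric_tensor \<Rightarrow> bool" where
  "diff_tensor_zero M nab g \<longleftrightarrow>
     (\<forall>U X Y. vector_field_on M U X \<longrightarrow> vector_field_on M U Y \<longrightarrow>
        (\<forall>p\<in>U. diff_tensor M nab g X Y p = 0))"

text \<open>Forms are multilinear maps from local vector fields to functions; the exterior derivative
  is normalised so that \<open>d\<alpha>(X,Y) = X(\<alpha>(Y)) - Y(\<alpha>(X)) - \<alpha>([X,Y])\<close>.\<close>

type_synonym ('p, 'i) form1 = "('p, 'i) vfield \<Rightarrow> 'p \<Rightarrow> real"
type_synonym ('p, 'i) form2 = "('p, 'i) vfield \<Rightarrow> ('p, 'i) vfield \<Rightarrow> 'p \<Rightarrow> real"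
type_synonym ('p, 'i) form3 =
  "('p, 'i) vfield \<Rightarrow> ('p, 'i) vfield \<Rightarrow> ('p, 'i) vfield \<Rightarrow> 'p \<Rightarrow> real"

definition ext_deriv1 :: "('p, 'i) manifold \<Rightarrow> ('p, 'i) form1 \<Rightarrow> ('p, 'i) form2" where
  "ext_deriv1 M \<alpha> X Y p =
     dirderiv M p (X p) (\<alpha> Y) - dirderiv M p (Y p) (\<alpha> X) - \<alpha> (lie_bracket M X Y) p"

definition ext_deriv2 :: "('p, 'i) manifold \<Rightarrow> ('p, 'i) form2 \<Rightarrow> ('p, 'i) form3" where
  "ext_deriv2 M \<beta> X Y Z p =
     dirderiv M p (X p) (\<beta> Y Z) + dirderiv M p (Y p) (\<beta> Z X) + dirderiv M p (Z p) (\<beta> X Y)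
     - \<beta> (lie_bracket M X Y) Z p - \<beta> (lie_bracket M Y Z) X p - \<beta> (lie_bracket M Z X) Y p"

definition form1_zero :: "('p, 'i) manifold \<Rightarrow> ('p, 'i) form1 \<Rightarrow> bool" where
  "form1_zero M \<alpha> \<longleftrightarrow> (\<forall>U X. vector_field_on M U X \<longrightarrow> (\<forall>p\<in>U. \<alpha> X p = 0))"

definition form2_zero :: "('p, 'i) manifold \<Rightarrow> ('p, 'i) form2 \<Rightarrow> bool" where
  "form2_zero M \<beta> \<longleftrightarrow>
     (\<forall>U X Y. vector_field_on M U X \<longrightarrow> vector_field_on M U Y \<longrightarrow> (\<forall>p\<in>U. \<beta> X Y p = 0))"

definition form3_zero :: "('p, 'i) manifold \<Rightarrow> ('p, 'i) form3 \<Rightarrow> bool" where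
  "form3_zero M \<eta> \<longleftrightarrow>
     (\<forall>U X Y Z. vector_field_on M U X \<longrightarrow> vector_field_on M U Y \<longrightarrow> vector_field_on M U Z \<longrightarrow>
        (\<forall>p\<in>U. \<eta> X Y Z p = 0))"

definition xi_form ::
    "('p, 'i) manifold \<Rightarrow> ('p, 'i) conn \<Rightarrow> ('p, 'i) metric_tensor \<Rightarrow> ('p, 'i) form1" where
  "xi_form M nab g X p = g p (tr_gamma M nab g p) (X p)"

type_synonym ('p, 'i) endo = "'p \<Rightarrow> 'i tvec \<Rightarrow> 'i tvec"

definition endo_field :: "('p, 'i) endo \<Rightarrow> ('p, 'i) vfield \<Rightarrow> ('p, 'i) vfield" where
  "endo_field J X p = J p (X p)"

definition complex_structure :: "('p, 'i) manifold \<Rightarrow> ('p, 'i) endo \<Rightarrow> bool" where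
  "complex_structure N J \<longleftrightarrow>
     (\<forall>p\<in>points N.
        (\<forall>x\<in>tangent_space N p. J p x \<in> tangent_space N p \<and> J p (J p x) = - x) \<and>
        (\<forall>x\<in>tangent_space N p. \<forall>y\<in>tangent_space N p. J p (x + y) = J p x + J p y) \<and>
        (\<forall>c. \<forall>x\<in>tangent_space N p. J p (c *\<^sub>R x) = c *\<^sub>R J p x)) \<and>
     (\<forall>U X. vector_field_on N U X \<longrightarrow> vector_field_on N U (endo_field J X)) \<and>
     (\<forall>U X Y. vector_field_on N U X \<longrightarrow> vector_field_on N U Y \<longrightarrow>
        (\<forall>p\<in>U. lie_bracket N (endo_field J X) (endo_field J Y) p
           - J p (lie_bracket N (endo_field J X) Y p)
           - J p (lie_bracket N X (endo_field J Y) p) - lie_bracket N X Y p = 0))"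

definition hermitian_manifold ::
    "('p, 'i) manifold \<Rightarrow> ('p, 'i) endo \<Rightarrow> ('p, 'i) metric_tensor \<Rightarrow> bool" where
  "hermitian_manifold N J g \<longleftrightarrow>
     smooth_manifold N \<and> complex_structure N J \<and> riemannian_metric N g \<and>
     (\<forall>p\<in>points N. \<forall>x\<in>tangent_space N p. \<forall>y\<in>tangent_space N p. g p (J p x) (J p y) = g p x y)"

definition fundamental_form ::
    "('p, 'i) endo \<Rightarrow> ('p, 'i) metric_tensor \<Rightarrow> ('p, 'i) form2" where
  "fundamental_form J g X Y p = g p (J p (X p)) (Y p)"

definition cov_form2 ::
    "('p, 'i) manifold \<Rightarrow> ('p, 'i) conn \<Rightarrow> ('p, 'i) form2 \<Rightarrow> ('p, 'i) form3" where
  "cov_form2 N nab \<beta> X Y Z p =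
     dirderiv N p (X p) (\<beta> Y Z) - \<beta> (nab X Y) Z p - \<beta> Y (nab X Z) p"

definition codiff_fundamental ::
    "('p, 'i) manifold \<Rightarrow> ('p, 'i) endo \<Rightarrow> ('p, 'i) metric_tensor \<Rightarrow> ('p, 'i) form1" where
  "codiff_fundamental N J g X p =
     - (\<Sum>a<mdim N. cov_form2 N (levi_civita N g) (fundamental_form J g)
          (frame_at N g p a) (frame_at N g p a) X p)"

definition lee_form ::
    "('p, 'i) manifold \<Rightarrow> ('p, 'i) endo \<Rightarrow> ('p, 'i) metric_tensor \<Rightarrow> ('p, 'i) form1" where
  "lee_form N J g X p = - codiff_fundamental N J g (endo_field J X) p"

definition kahler ::
    "('p, 'i) manifold \<Rightarrow> ('p, 'i) endo \<Rightarrow> ('p, 'i) metric_tensor \<Rightarrow> bool" where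
  "kahler N J g \<longleftrightarrow> hermitian_manifold N J g \<and>
     form3_zero N (ext_deriv2 N (fundamental_form J g))"

definition kahler_flat ::
    "('p, 'i) manifold \<Rightarrow> ('p, 'i) endo \<Rightarrow> ('p, 'i) metric_tensor \<Rightarrow> bool" where
  "kahler_flat N J g \<longleftrightarrow> kahler N J g \<and> flat_connection N (levi_civita N g)"

definition balanced ::
    "('p, 'i) manifold \<Rightarrow> ('p, 'i) endo \<Rightarrow> ('p, 'i) metric_tensor \<Rightarrow> bool" where
  "balanced N J g \<longleftrightarrow> hermitian_manifold N J g \<and> form1_zero N (lee_form N J g)"

definition loc_conf_balanced ::
    "('p, 'i) manifold \<Rightarrow> ('p, 'i) endo \<Rightarrow> ('p, 'i) metric_tensor \<Rightarrow> bool" where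
  "loc_conf_balanced N J g \<longleftrightarrow> hermitian_manifold N J g \<and>
     form2_zero N (ext_deriv1 N (lee_form N J g))"

definition bismut ::
    "('p, 'i) manifold \<Rightarrow> ('p, 'i) endo \<Rightarrow> ('p, 'i) metric_tensor \<Rightarrow> ('p, 'i) conn" where
  "bismut N J g X Y p = (THE w. w \<in> tangent_space N p \<and>
     (\<forall>U Z. p \<in> U \<longrightarrow> vector_field_on N U Z \<longrightarrow>
        g p w (Z p) = g p (levi_civita N g X Y p) (Z p)
          + 1/2 * ext_deriv2 N (fundamental_form J g)
                    (endo_field J X) (endo_field J Y) (endo_field J Z) p))"

definition chern ::
    "('p, 'i) manifold \<Rightarrow> ('p, 'i) endo \<Rightarrow> ('p, 'i) metric_tensor \<Rightarrow> ('p, 'i) conn" where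
  "chern N J g X Y p = (THE w. w \<in> tangent_space N p \<and>
     (\<forall>U Z. p \<in> U \<longrightarrow> vector_field_on N U Z \<longrightarrow>
        g p w (Z p) = g p (levi_civita N g X Y p) (Z p)
          - 1/2 * ext_deriv2 N (fundamental_form J g) (endo_field J X) Y Z p))"

definition ricci_form :: "('p, 'i) manifold \<Rightarrow> ('p, 'i) endo \<Rightarrow> ('p, 'i) metric_tensor \<Rightarrow>
    ('p, 'i) conn \<Rightarrow> ('p, 'i) form2" where
  "ricci_form N J g nab X Y p =
     1/2 * (\<Sum>a<mdim N. g p (curvature N nab X Y (frame_at N g p a) p)
                           (J p (frame_at N g p a p)))"

definition calabi_yau_torsion ::
    "('p, 'i) manifold \<Rightarrow> ('p, 'i) endo \<Rightarrow> ('p, 'i) metric_tensor \<Rightarrow> bool" where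
  "calabi_yau_torsion N J g \<longleftrightarrow> hermitian_manifold N J g \<and>
     form2_zero N (ricci_form N J g (bismut N J g))"

text \<open>To have all iterated tangent bundles in one type, points are taken from a type that is closed
  under attaching a tangent vector. Manifolds with points in an arbitrary type \<open>'a\<close> embed
  via \<open>Base\<close>. The selector \<open>proj\<close> is the bundle projection.\<close>

datatype ('a, 'i) tpoint =
    Base 'a
  | Tan (proj: "('a, 'i) tpoint") (vec: "'i tvec")

type_synonym ('a, 'i) tmanifold = "(('a, 'i) tpoint, 'i) manifold"

text \<open>Every chart \<open>i\<close> of \<open>M\<close> induces a chart of the tangent bundle with the same label; the first
  \<open>n\<close> coordinates are those of the base point, the last \<open>n\<close> the components of the vector.\<close>

definition tangent_bundle :: "('a, 'i) tmanifold \<Rightarrow> ('a, 'i) tmanifold" where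
  "tangent_bundle M = \<lparr>
     points = {Tan p v | p v. p \<in> points M \<and> v \<in> tangent_space M p},
     mdim = 2 * mdim M,
     charts = charts M,
     cdom = (\<lambda>i. {Tan p v | p v. p \<in> cdom M i \<and> v \<in> tangent_space M p}),
     coords = (\<lambda>i u a. if a < mdim M then coords M i (proj u) a
                       else if a < 2 * mdim M then vec u i (a - mdim M) else 0) \<rparr>"

text \<open>The vertical lift of \<open>X\<close> at \<open>(p, v)\<close> is the velocity at \<open>0\<close> of \<open>t \<mapsto> (p, v + t X(p))\<close>.\<close>

definition vlift :: "('a, 'i) tmanifold \<Rightarrow>
    (('a, 'i) tpoint, 'i) vfield \<Rightarrow> (('a, 'i) tpoint, 'i) vfield" where
  "vlift M X u = (\<lambda>i b. if chart_around (tangent_bundle M) u i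
     then deriv (\<lambda>t. coords (tangent_bundle M) i (Tan (proj u) (vec u + t *\<^sub>R X (proj u))) b) 0
     else 0)"

text \<open>The horizontal lift of \<open>X\<close> at \<open>(p, v)\<close> is obtained from any local section \<open>Y\<close> through \<open>(p, v)\<close>
  by removing the vertical part \<open>\<nabla>\<^sub>X Y\<close> from \<open>dY(X)\<close>; in particular it is \<open>dY(X)\<close>
  if \<open>Y\<close> is parallel along \<open>X\<close> at \<open>p\<close>.\<close>

definition hlift :: "('a, 'i) tmanifold \<Rightarrow> (('a, 'i) tpoint, 'i) conn \<Rightarrow>
    (('a, 'i) tpoint, 'i) vfield \<Rightarrow> (('a, 'i) tpoint, 'i) vfield" where
  "hlift M nab X u = (THE w. \<forall>U Y. proj u \<in> U \<longrightarrow> vector_field_on M U Y \<longrightarrow> Y (proj u) = vec u \<longrightarrow>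
     w = differential M (tangent_bundle M) (\<lambda>q. Tan q (Y q)) (proj u) (X (proj u))
         - vlift M (nab X Y) u)"

definition lift_J :: "('a, 'i) tmanifold \<Rightarrow> (('a, 'i) tpoint, 'i) conn \<Rightarrow>
    (('a, 'i) tpoint, 'i) endo" where
  "lift_J M nab u w = (THE w'. \<exists>U X Y. proj u \<in> U \<and> vector_field_on M U X \<and> vector_field_on M U Y \<and>
     w = hlift M nab X u + vlift M Y u \<and> w' = vlift M X u - hlift M nab Y u)"

definition lift_metric :: "('a, 'i) tmanifold \<Rightarrow> (('a, 'i) tpoint, 'i) conn \<Rightarrow>
    (('a, 'i) tpoint, 'i) metric_tensor \<Rightarrow> (('a, 'i) tpoint, 'i) metric_tensor" where
  "lift_metric M nab g u w w' = (THE r. \<exists>U X Y X' Y'. proj u \<in> U \<and>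
     vector_field_on M U X \<and> vector_field_on M U Y \<and>
     vector_field_on M U X' \<and> vector_field_on M U Y' \<and>
     w = hlift M nab X u + vlift M Y u \<and> w' = hlift M nab X' u + vlift M Y' u \<and>
     r = g (proj u) (X (proj u)) (X' (proj u)) + g (proj u) (Y (proj u)) (Y' (proj u)))"

definition is_lift_conn :: "('a, 'i) tmanifold \<Rightarrow> (('a, 'i) tpoint, 'i) conn \<Rightarrow>
    (('a, 'i) tpoint, 'i) conn \<Rightarrow> bool" where
  "is_lift_conn M nab nab' \<longleftrightarrow> connection (tangent_bundle M) nab' \<and>
     (\<forall>U X Y. vector_field_on M U X \<longrightarrow> vector_field_on M U Y \<longrightarrow>
       (\<forall>u\<in>points (tangent_bundle M). proj u \<in> U \<longrightarrow>
          nab' (hlift M nab X) (hlift M nab Y) u = hlift M nab (nab X Y) u \<and>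
          nab' (hlift M nab X) (vlift M Y) u = vlift M (nab X Y) u \<and>
          nab' (vlift M X) (hlift M nab Y) u = 0 \<and>
          nab' (vlift M X) (vlift M Y) u = 0))"

text \<open>Horizontal and vertical lifts of a local frame form a local frame of the tangent bundle, so
  the lifted connection is determined on smooth local fields.\<close>

definition lift_conn :: "('a, 'i) tmanifold \<Rightarrow> (('a, 'i) tpoint, 'i) conn \<Rightarrow>
    (('a, 'i) tpoint, 'i) conn" where
  "lift_conn M nab = (SOME nab'. is_lift_conn M nab nab')"

primrec iter_tangent :: "('a, 'i) tmanifold \<Rightarrow> nat \<Rightarrow> ('a, 'i) tmanifold" where
  "iter_tangent M 0 = M"
| "iter_tangent M (Suc k) = tangent_bundle (iter_tangent M k)"

primrec conn_seq :: "('a, 'i) tmanifold \<Rightarrow> (('a, 'i) tpoint, 'i) conn \<Rightarrow> nat \<Rightarrow>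
    (('a, 'i) tpoint, 'i) conn" where
  "conn_seq M nab 0 = nab"
| "conn_seq M nab (Suc k) = lift_conn (iter_tangent M k) (conn_seq M nab k)"

primrec metric_seq :: "('a, 'i) tmanifold \<Rightarrow> (('a, 'i) tpoint, 'i) conn \<Rightarrow>
    (('a, 'i) tpoint, 'i) metric_tensor \<Rightarrow> nat \<Rightarrow> (('a, 'i) tpoint, 'i) metric_tensor" where
  "metric_seq M nab g 0 = g"
| "metric_seq M nab g (Suc k) =
     lift_metric (iter_tangent M k) (conn_seq M nab k) (metric_seq M nab g k)"

text \<open>Only meaningful for \<open>k \<ge> 1\<close>.\<close>

definition J_seq :: "('a, 'i) tmanifold \<Rightarrow> (('a, 'i) tpoint, 'i) conn \<Rightarrow> nat \<Rightarrow>
    (('a, 'i) tpoint, 'i) endo" where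
  "J_seq M nab k = lift_J (iter_tangent M (k - 1)) (conn_seq M nab (k - 1))"

end

theory Submission
  imports Defs
begin

text \<open>
  Let \<open>C = \<nabla> g\<close>, with traces \<open>\<alpha>(z) = \<Sum> C(e\<^sub>a, e\<^sub>a, z)\<close> and \<open>\<beta>(z) = \<Sum> C(z, e\<^sub>a, e\<^sub>a)\<close> over an orthonormal
  basis. Every quantity of the theorem is determined by \<open>C\<close>: \<open>\<gamma> = 0\<close> means \<open>C = 0\<close>, the traces of \<open>\<gamma>\<close> and
  \<open>\<gamma>\<^sup>*\<close> are combinations of \<open>\<alpha>\<close> and \<open>\<beta>\<close>, and \<open>\<beta>\<close> is closed because \<open>\<nabla>\<close> is flat (locally it is the
  logarithmic differential of \<open>det g\<close>). On \<open>TM\<close> the tensor \<open>C\<^sub>1 = \<nabla>\<^sup>1 g\<^sub>1\<close> vanishes when its first argument is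
  vertical or its last two are of different type, and is the pull-back of \<open>C\<close> otherwise; hence
  \<open>\<alpha>\<^sub>1 = \<pi>\<^sup>* \<alpha>\<close> and \<open>\<beta>\<^sub>1 = 2 \<pi>\<^sup>* \<beta>\<close>, and the statements about all \<open>k\<close> follow by induction.

  Since \<open>J\<^sub>1\<close> is parallel for \<open>\<nabla>\<^sup>1\<close>, the form \<open>d\<omega>\<close> and the Lee form are algebraic in \<open>C\<^sub>1\<close>: the Lee form
  is \<open>\<beta>\<^sub>1 / 2 - \<alpha>\<^sub>1\<close>, and \<open>d\<omega> = 0\<close> on \<open>TM\<close> means that \<open>C\<close> is totally symmetric. On \<open>T\<^sup>2 M\<close> this applies to \<open>C\<^sub>1\<close>, which is
  symmetric only if \<open>C = 0\<close>. Both Ricci forms are the differentials of connection traces in a frame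
  of horizontal lifts, and these traces are \<open>\<alpha> - \<beta> / 2\<close> (Bismut) and \<open>\<beta> / 2\<close> (Chern), evaluated on the
  vertical part.
\<close>

section \<open>Calculus on open subsets of coordinate spaces\<close>

text \<open>The tensor C replaces \<gamma> because the Koszul formula 2 g(\<gamma>(x,y), z) =
  C(x,y,z) + C(y,x,z) - C(z,x,y) makes \<gamma> algebraic in C, while the lifted \<gamma> would mix
  horizontal and vertical parts. The trace of \<gamma> is then \<alpha> - \<beta>/2 and that of its
  adjoint \<beta>/2. On the k-th bundle \<alpha> is pulled back and \<beta> acquires the factor 2^k,
  so the balanced condition at step k reads \<alpha> = 2^(k-1) \<beta> on M; this is where 2^k - 1
  comes from. The trace that governs the Bismut Ricci form at step k + 1 vanishes if \<alpha> =
  \<beta>/2 holds at step k, which is the same identity; hence the shift of index in the fourth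
  claim. The obstacle is that connections, lifts and structures act on fields that are meaningful
  only locally, and many are definite or indefinite descriptions. Each is identified with an
  explicit formula on tangent vectors or smooth local fields; identities on the bundle are obtained
  by showing that both sides are tensorial and comparing them on lifts of fields of M. Besides the
  closedness of \<beta>, flatness is what makes the bracket of two horizontal lifts
  horizontal.\<close>

abbreviation coord_space :: "nat \<Rightarrow> (nat \<Rightarrow> real) set" where
  "coord_space n \<equiv> {x. \<forall>i\<ge>n. x i = 0}"

abbreviation open_coord :: "nat \<Rightarrow> (nat \<Rightarrow> real) set \<Rightarrow> bool" where
  "open_coord n U \<equiv> openin (Euclidean_space n) U"

lemma Euclidean_space_top_of_set: "Euclidean_space n = top_of_set (coord_space n)"
  by (simp add: Euclidean_space_def euclidean_product_topology)

lemma open_coord_subset: "open_coord n U \<Longrightarrow> U \<subseteq> coord_space n"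
  by (metis openin_subset topspace_Euclidean_space)

text \<open>A basic open set of the product topology constrains finitely many coordinates, and on
  \<open>coord_space n\<close> those from n on are fixed at 0, so a sup-norm box in the first n
  coordinates is enough. Openness and continuity are handled through such boxes below.\<close>

lemma open_coord_iff_box:
  "open_coord n U \<longleftrightarrow> U \<subseteq> coord_space n \<and>
     (\<forall>x\<in>U. \<exists>e>0. \<forall>y\<in>coord_space n. (\<forall>a<n. \<bar>y a - x a\<bar> < e) \<longrightarrow> y \<in> U)" (is "?L \<longleftrightarrow> ?R")
proof
  assume L: ?L
  have sub: "U \<subseteq> coord_space n" using L by (rule open_coord_subset)
  moreover have "\<exists>e>0. \<forall>y\<in>coord_space n. (\<forall>a<n. \<bar>y a - x a\<bar> < e) \<longrightarrow> y \<in> U" if x: "x \<in> U" for x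
  proof -
    obtain T where T: "open T" "U = coord_space n \<inter> T"
      using L unfolding Euclidean_space_top_of_set openin_open by auto
    have "openin (product_topology (\<lambda>i. euclidean) UNIV) T"
      using T(1) by (simp add: open_fun_def)
    then obtain W where W: "finite {i. W i \<noteq> (UNIV::real set)}" "\<And>i. open (W i)" "x \<in> Pi\<^sub>E UNIV W"
        "Pi\<^sub>E UNIV W \<subseteq> T"
      unfolding openin_product_topology_alt using x T(2) by fastforce
    have "\<forall>a. \<exists>e>0. \<forall>r. \<bar>r - x a\<bar> < e \<longrightarrow> r \<in> W a"
    proof
      fix a
      have "x a \<in> W a" using W(3) by auto
      then show "\<exists>e>0. \<forall>r. \<bar>r - x a\<bar> < e \<longrightarrow> r \<in> W a"
        using W(2)[of a] by (auto simp: open_dist dist_real_def)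
    qed
    then obtain e where e: "\<And>a. e a > 0" "\<And>a r. \<bar>r - x a\<bar> < e a \<Longrightarrow> r \<in> W a" by metis
    \<comment> \<open>The extra element 1 keeps the minimum defined when n = 0.\<close>
    define d where "d = Min (insert 1 (e ` {..<n}))"
    have d0: "d > 0" unfolding d_def using e(1) by (subst Min_gr_iff) auto
    have dle: "d \<le> e a" if "a < n" for a unfolding d_def using that by (intro Min_le) auto
    have "y \<in> U" if y: "y \<in> coord_space n" "\<forall>a<n. \<bar>y a - x a\<bar> < d" for y
    proof -
      have "y a \<in> W a" for a
      proof (cases "a < n")
        case True then show ?thesis using y(2) dle[OF True] e(2)[of "y a" a] by force
      next
        case False
        then have "y a = x a" using y(1) x sub by (auto simp: subset_iff)
        then show ?thesis using W(3) by auto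
      qed
      then have "y \<in> Pi\<^sub>E UNIV W" by auto
      then show ?thesis using W(4) T(2) y(1) by auto
    qed
    then show ?thesis using d0 by blast
  qed
  ultimately show ?R by blast
next
  assume R: ?R
  then have "\<forall>x\<in>U. \<exists>e>0. \<forall>y\<in>coord_space n. (\<forall>a<n. \<bar>y a - x a\<bar> < e) \<longrightarrow> y \<in> U" by (rule conjunct2)
  from bchoice[OF this] obtain e where e0:
    "\<forall>x\<in>U. e x > 0 \<and> (\<forall>y\<in>coord_space n. (\<forall>a<n. \<bar>y a - x a\<bar> < e x) \<longrightarrow> y \<in> U)" ..
  have e: "\<And>x. x \<in> U \<Longrightarrow> e x > 0"
      "\<And>x y. \<lbrakk>x \<in> U; y \<in> coord_space n; \<forall>a<n. \<bar>y a - x a\<bar> < e x\<rbrakk> \<Longrightarrow> y \<in> U"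
    using e0 by blast+
  define T where "T = (\<Union>x\<in>U. \<Inter>a\<in>{..<n}. {y::nat\<Rightarrow>real. \<bar>y a - x a\<bar> < e x})"
  have "open T" unfolding T_def
    by (intro open_UN open_INT ballI finite_lessThan open_Collect_less continuous_intros
        continuous_on_product_coordinates)
  moreover have "U = coord_space n \<inter> T"
  proof
    show "U \<subseteq> coord_space n \<inter> T"
    proof
      fix x assume x: "x \<in> U"
      then have "x \<in> T" unfolding T_def using e(1)[OF x] by (intro UN_I[OF x]) simp
      then show "x \<in> coord_space n \<inter> T" using R x by blast
    qed
    show "coord_space n \<inter> T \<subseteq> U" using e(2) unfolding T_def by blast
  qed
  ultimately show ?L unfolding Euclidean_space_top_of_set openin_open by blast
qed

lemma open_coord_boxE:
  assumes "open_coord n U" "x \<in> U"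
  obtains e where "e > 0"
    "\<And>y. \<lbrakk>y \<in> coord_space n; \<And>a. a < n \<Longrightarrow> \<bar>y a - x a\<bar> < e\<rbrakk> \<Longrightarrow> y \<in> U"
proof -
  obtain e where "e > 0" "\<forall>y\<in>coord_space n. (\<forall>a<n. \<bar>y a - x a\<bar> < e) \<longrightarrow> y \<in> U"
    using assms(1)[unfolded open_coord_iff_box, THEN conjunct2, rule_format, OF assms(2)] by blast
  then show thesis by (intro that[of e]) auto
qed

lemma continuous_on_box:
  assumes "open_coord n U" "continuous_on U f" "x \<in> U" "e > 0"
  obtains d where "d > 0"
    "\<And>y. \<lbrakk>y \<in> coord_space n; \<And>a. a < n \<Longrightarrow> \<bar>y a - x a\<bar> < d\<rbrakk> \<Longrightarrow> y \<in> U \<and> \<bar>f y - f x\<bar> < (e::real)"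
proof -
  have "openin (top_of_set U) (U \<inter> f -` ball (f x) e)"
    using assms(2) by (rule continuous_openin_preimage_gen) auto
  then have "open_coord n (U \<inter> f -` ball (f x) e)"
    using assms(1) unfolding Euclidean_space_top_of_set by (rule openin_trans)
  moreover have "x \<in> U \<inter> f -` ball (f x) e" using assms(3,4) by simp
  ultimately obtain d where "d > 0"
    "\<And>y. \<lbrakk>y \<in> coord_space n; \<And>a. a < n \<Longrightarrow> \<bar>y a - x a\<bar> < d\<rbrakk> \<Longrightarrow> y \<in> U \<inter> f -` ball (f x) e"
    using open_coord_boxE by blast
  then show thesis
    by (intro that[of d]) (auto simp: dist_real_def abs_minus_commute)
qed

text \<open>Partial derivatives are ordinary derivatives along \<open>x(a := t)\<close>. As U is
  open, this line stays in U for t near \<open>x a\<close>, so that \<open>pderiv_at\<close> sees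
  only the values on U.\<close>

lemma eventually_update:
  assumes "open_coord n U" "x \<in> U" "a < n"
  shows "eventually (\<lambda>t. x(a := t) \<in> U) (nhds (x a))"
proof -
  obtain e where e: "e > 0" "\<And>y. \<lbrakk>y \<in> coord_space n; \<And>a. a < n \<Longrightarrow> \<bar>y a - x a\<bar> < e\<rbrakk> \<Longrightarrow> y \<in> U"
    using open_coord_boxE[OF assms(1,2)] by blast
  have "x \<in> coord_space n" using assms open_coord_subset by blast
  then have "x(a := t) \<in> U" if "dist t (x a) < e" for t
    using that e(1) assms(3) by (intro e(2)) (auto simp: dist_real_def)
  then show ?thesis unfolding eventually_nhds_metric using e(1) by blast
qed

section \<open>Partial derivatives, mean values and the chain rule\<close>

definition partially_differentiable ::
    "nat \<Rightarrow> (nat \<Rightarrow> real) set \<Rightarrow> ((nat \<Rightarrow> real) \<Rightarrow> real) \<Rightarrow> bool" where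
  "partially_differentiable n U f \<longleftrightarrow>
     (\<forall>a<n. \<forall>x\<in>U. (\<lambda>t. f (x(a := t))) differentiable (at (x a)))"

lemma partially_differentiableD:
  assumes "partially_differentiable n U f" "a < n" "x \<in> U"
  shows "((\<lambda>t. f (x(a := t))) has_real_derivative pderiv_at a f x) (at (x a))"
  using assms unfolding partially_differentiable_def pderiv_at_def
  by (simp add: DERIV_deriv_iff_real_differentiable)

lemma has_partial_derivative_at:
  assumes "partially_differentiable n U f" "a < n" "x(a := s) \<in> U"
  shows "((\<lambda>t. f (x(a := t))) has_real_derivative pderiv_at a f (x(a := s))) (at s)"
  using partially_differentiableD[OF assms] by simp

lemma pderiv_at_eqI:
  assumes "((\<lambda>t. f (x(a := t))) has_real_derivative D) (at (x a))"
  shows "pderiv_at a f x = D"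
  unfolding pderiv_at_def using assms by (rule DERIV_imp_deriv)

lemma pderiv_at_cong:
  assumes "open_coord n U" "\<And>y. y \<in> U \<Longrightarrow> f y = g y" "x \<in> U" "a < n"
  shows "pderiv_at a f x = pderiv_at a g x"
  unfolding pderiv_at_def
  by (rule deriv_cong_ev) (use eventually_update[OF assms(1,3,4)] assms(2) in
      \<open>auto elim: eventually_mono\<close>)

text \<open>The endpoint s may lie on either side of r or coincide with it, so that the increments
  below can have any sign.\<close>

lemma mean_value_segment:
  fixes h :: "real \<Rightarrow> real"
  assumes "\<And>t. \<bar>t - r\<bar> \<le> \<bar>s - r\<bar> \<Longrightarrow> (h has_real_derivative h' t) (at t)"
  shows "\<exists>z. \<bar>z - r\<bar> \<le> \<bar>s - r\<bar> \<and> h s - h r = h' z * (s - r)"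
proof -
  consider "r < s" | "r = s" | "s < r" by linarith
  then show ?thesis
  proof cases
    case 1
    have "\<exists>z>r. z < s \<and> h s - h r = (s - r) * h' z"
      by (rule MVT2[OF 1]) (rule assms, use 1 in auto)
    then obtain z where "z > r" "z < s" "h s - h r = (s - r) * h' z" by blast
    then show ?thesis using 1 by (intro exI[of _ z]) (auto simp: algebra_simps)
  next
    case 2 then show ?thesis by auto
  next
    case 3
    have "\<exists>z>s. z < r \<and> h r - h s = (r - s) * h' z"
      by (rule MVT2[OF 3]) (rule assms, use 3 in auto)
    then obtain z where "z > s" "z < r" "h r - h s = (r - s) * h' z" by blast
    then show ?thesis using 3 by (intro exI[of _ z]) (auto simp: algebra_simps)
  qed
qed

text \<open>Replacing the coordinates of x by those of y one at a time turns the increment of f into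
  n increments in one variable. Each of them has its own intermediate point, no farther from x in
  any coordinate than y is.\<close>

lemma mean_value_coordinates:
  assumes pd: "partially_differentiable n U f" and x: "x \<in> coord_space n" and y: "y \<in> coord_space n"
    and box: "\<And>z. \<lbrakk>z \<in> coord_space n; \<And>a. a < n \<Longrightarrow> \<bar>z a - x a\<bar> \<le> \<bar>y a - x a\<bar>\<rbrakk> \<Longrightarrow> z \<in> U"
  shows "\<exists>\<xi>. (\<forall>b<n. \<xi> b \<in> coord_space n \<and> (\<forall>a<n. \<bar>\<xi> b a - x a\<bar> \<le> \<bar>y a - x a\<bar>)) \<and>
           f y - f x = (\<Sum>b<n. pderiv_at b f (\<xi> b) * (y b - x b))"
proof -
  define z where "z k = (\<lambda>a. if a < k then y a else x a)" for k
  have z0: "z 0 = x" and zn: "z n = y" using x y by (auto simp: z_def fun_eq_iff)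
  have step: "\<exists>\<xi>. \<xi> \<in> coord_space n \<and> (\<forall>a<n. \<bar>\<xi> a - x a\<bar> \<le> \<bar>y a - x a\<bar>) \<and>
      f (z (Suc k)) - f (z k) = pderiv_at k f \<xi> * (y k - x k)" if k: "k < n" for k
  proof -
    have up: "(z k)(k := t) \<in> coord_space n" for t using k x y by (auto simp: z_def)
    have "(z k)(k := t) \<in> U" if "\<bar>t - x k\<bar> \<le> \<bar>y k - x k\<bar>" for t
      by (rule box[OF up]) (use that in \<open>auto simp: z_def\<close>)
    then have "\<exists>t. \<bar>t - x k\<bar> \<le> \<bar>y k - x k\<bar> \<and>
        f ((z k)(k := y k)) - f ((z k)(k := x k)) = pderiv_at k f ((z k)(k := t)) * (y k - x k)"
      using has_partial_derivative_at[OF pd k] by (intro mean_value_segment) blast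
    then obtain t where t: "\<bar>t - x k\<bar> \<le> \<bar>y k - x k\<bar>"
        "f ((z k)(k := y k)) - f ((z k)(k := x k)) = pderiv_at k f ((z k)(k := t)) * (y k - x k)"
      by blast
    have eqs: "(z k)(k := y k) = z (Suc k)" "(z k)(k := x k) = z k"
      by (auto simp: z_def fun_eq_iff)
    show ?thesis
      using t up unfolding eqs by (intro exI[of _ "(z k)(k := t)"]) (auto simp: z_def)
  qed
  then have "\<forall>k\<in>{..<n}. \<exists>\<xi>. \<xi> \<in> coord_space n \<and> (\<forall>a<n. \<bar>\<xi> a - x a\<bar> \<le> \<bar>y a - x a\<bar>) \<and>
      f (z (Suc k)) - f (z k) = pderiv_at k f \<xi> * (y k - x k)" by blast
  from bchoice[OF this] obtain \<xi> where \<xi>0: "\<forall>k\<in>{..<n}. \<xi> k \<in> coord_space n \<and>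
      (\<forall>a<n. \<bar>\<xi> k a - x a\<bar> \<le> \<bar>y a - x a\<bar>) \<and>
      f (z (Suc k)) - f (z k) = pderiv_at k f (\<xi> k) * (y k - x k)" ..
  have \<xi>: "\<And>k. k < n \<Longrightarrow> \<xi> k \<in> coord_space n \<and> (\<forall>a<n. \<bar>\<xi> k a - x a\<bar> \<le> \<bar>y a - x a\<bar>) \<and>
      f (z (Suc k)) - f (z k) = pderiv_at k f (\<xi> k) * (y k - x k)" using \<xi>0 by blast
  have "f y - f x = (\<Sum>k<n. f (z (Suc k)) - f (z k))"
    using sum_lessThan_telescope[of "\<lambda>k. f (z k)" n] by (simp add: z0 zn)
  also have "\<dots> = (\<Sum>b<n. pderiv_at b f (\<xi> b) * (y b - x b))"
    using \<xi> by (intro sum.cong) auto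
  finally show ?thesis using \<xi> by blast
qed

text \<open>The difference quotient of f along c is a sum of partial derivatives at intermediate
  points times difference quotients of the coordinates of c. The intermediate points are squeezed
  towards \<open>c t0\<close>, where the partial derivatives are continuous.\<close>

lemma chain_rule_curve:
  assumes U: "open_coord n U" and pd: "partially_differentiable n U f"
    and cont: "\<And>b. b < n \<Longrightarrow> continuous_on U (pderiv_at b f)"
    and c: "\<And>b. b < n \<Longrightarrow> ((\<lambda>t. c t b) has_real_derivative d b) (at t0)"
    and c0: "c t0 \<in> U" and cE: "eventually (\<lambda>t. c t \<in> coord_space n) (at t0)"
  shows "((\<lambda>t. f (c t)) has_real_derivative (\<Sum>b<n. pderiv_at b f (c t0) * d b)) (at t0)"
proof -
  have x0: "c t0 \<in> coord_space n" using c0 U open_coord_subset by blast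
  obtain e0 where e0: "e0 > 0"
      "\<And>y. \<lbrakk>y \<in> coord_space n; \<And>a. a < n \<Longrightarrow> \<bar>y a - c t0 a\<bar> < e0\<rbrakk> \<Longrightarrow> y \<in> U"
    using open_coord_boxE[OF U c0] by blast
  have near: "eventually (\<lambda>t. c t \<in> coord_space n \<and> (\<forall>a<n. \<bar>c t a - c t0 a\<bar> < e)) (at t0)"
    if "e > 0" for e
  proof -
    have "eventually (\<lambda>t. \<bar>c t a - c t0 a\<bar> < e) (at t0)" if "a < n" for a
    proof -
      have "((\<lambda>t. c t a) \<longlongrightarrow> c t0 a) (at t0)"
        using DERIV_isCont[OF c[OF that]] by (simp add: isCont_def)
      from tendstoD[OF this \<open>e > 0\<close>] show ?thesis by (simp add: dist_real_def)
    qed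
    then have "eventually (\<lambda>t. \<forall>a\<in>{..<n}. \<bar>c t a - c t0 a\<bar> < e) (at t0)"
      by (simp add: eventually_ball_finite_distrib)
    with cE show ?thesis by eventually_elim auto
  qed
  \<comment> \<open>A simultaneous choice for all y makes the intermediate points a function of y,
    so that they can be followed along \<open>c t\<close> as t tends to \<open>t0\<close>.\<close>
  have "\<forall>y. \<exists>\<xi>. y \<in> coord_space n \<and> (\<forall>a<n. \<bar>y a - c t0 a\<bar> < e0) \<longrightarrow>
      (\<forall>b<n. \<xi> b \<in> coord_space n \<and> (\<forall>a<n. \<bar>\<xi> b a - c t0 a\<bar> \<le> \<bar>y a - c t0 a\<bar>)) \<and>
           f y - f (c t0) = (\<Sum>b<n. pderiv_at b f (\<xi> b) * (y b - c t0 b))"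
  proof
    fix y
    show "\<exists>\<xi>. y \<in> coord_space n \<and> (\<forall>a<n. \<bar>y a - c t0 a\<bar> < e0) \<longrightarrow>
      (\<forall>b<n. \<xi> b \<in> coord_space n \<and> (\<forall>a<n. \<bar>\<xi> b a - c t0 a\<bar> \<le> \<bar>y a - c t0 a\<bar>)) \<and>
           f y - f (c t0) = (\<Sum>b<n. pderiv_at b f (\<xi> b) * (y b - c t0 b))"
    proof (cases "y \<in> coord_space n \<and> (\<forall>a<n. \<bar>y a - c t0 a\<bar> < e0)")
      case True
      have "z \<in> U" if "z \<in> coord_space n" "\<And>a. a < n \<Longrightarrow> \<bar>z a - c t0 a\<bar> \<le> \<bar>y a - c t0 a\<bar>" for z
        using that(1)
      proof (rule e0(2))
        show "\<bar>z a - c t0 a\<bar> < e0" if "a < n" for a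
          using True \<open>\<And>a. a < n \<Longrightarrow> \<bar>z a - c t0 a\<bar> \<le> \<bar>y a - c t0 a\<bar>\<close>[OF that] that
          by (meson le_less_trans)
      qed
      with mean_value_coordinates[OF pd x0 conjunct1[OF True]] show ?thesis by blast
    qed blast
  qed
  from choice[OF this] obtain \<xi> where \<xi>0: "\<forall>y. y \<in> coord_space n \<and> (\<forall>a<n. \<bar>y a - c t0 a\<bar> < e0) \<longrightarrow>
      (\<forall>b<n. \<xi> y b \<in> coord_space n \<and> (\<forall>a<n. \<bar>\<xi> y b a - c t0 a\<bar> \<le> \<bar>y a - c t0 a\<bar>)) \<and>
           f y - f (c t0) = (\<Sum>b<n. pderiv_at b f (\<xi> y b) * (y b - c t0 b))" ..
  have \<xi>: "\<And>y. \<lbrakk>y \<in> coord_space n; \<forall>a<n. \<bar>y a - c t0 a\<bar> < e0\<rbrakk> \<Longrightarrow>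
      (\<forall>b<n. \<xi> y b \<in> coord_space n \<and> (\<forall>a<n. \<bar>\<xi> y b a - c t0 a\<bar> \<le> \<bar>y a - c t0 a\<bar>)) \<and>
           f y - f (c t0) = (\<Sum>b<n. pderiv_at b f (\<xi> y b) * (y b - c t0 b))"
    using \<xi>0 by blast
  have lim: "((\<lambda>t. pderiv_at b f (\<xi> (c t) b)) \<longlongrightarrow> pderiv_at b f (c t0)) (at t0)" if b: "b < n" for b
  proof (rule tendstoI)
    fix e :: real assume "e > 0"
    obtain d where d: "d > 0" "\<And>y. \<lbrakk>y \<in> coord_space n; \<And>a. a < n \<Longrightarrow> \<bar>y a - c t0 a\<bar> < d\<rbrakk> \<Longrightarrow>
        y \<in> U \<and> \<bar>pderiv_at b f y - pderiv_at b f (c t0)\<bar> < e"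
      using continuous_on_box[OF U cont[OF b] c0 \<open>e > 0\<close>] by blast
    have "min d e0 > 0" using d(1) e0(1) by simp
    from near[OF this] show "eventually (\<lambda>t. dist (pderiv_at b f (\<xi> (c t) b)) (pderiv_at b f (c t0)) < e) (at t0)"
    proof eventually_elim
      case (elim t)
      then have "\<forall>a<n. \<bar>\<xi> (c t) b a - c t0 a\<bar> \<le> \<bar>c t a - c t0 a\<bar>" "\<xi> (c t) b \<in> coord_space n"
        using \<xi>[of "c t"] b by auto
      moreover have "\<And>a. a < n \<Longrightarrow> \<bar>c t a - c t0 a\<bar> < d" using elim by auto
      ultimately have "\<bar>pderiv_at b f (\<xi> (c t) b) - pderiv_at b f (c t0)\<bar> < e"
        using d(2)[of "\<xi> (c t) b"] by (meson le_less_trans)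
      then show ?case by (simp add: dist_real_def)
    qed
  qed
  have "((\<lambda>t. \<Sum>b<n. pderiv_at b f (\<xi> (c t) b) * ((c t b - c t0 b) / (t - t0))) \<longlongrightarrow>
     (\<Sum>b<n. pderiv_at b f (c t0) * d b)) (at t0)"
    by (intro tendsto_sum tendsto_mult lim) (use c in \<open>auto simp: has_field_derivative_iff\<close>)
  moreover have "eventually (\<lambda>t. (f (c t) - f (c t0)) / (t - t0) =
      (\<Sum>b<n. pderiv_at b f (\<xi> (c t) b) * ((c t b - c t0 b) / (t - t0)))) (at t0)"
    using near[OF e0(1)]
    by eventually_elim (use \<xi> in \<open>simp add: sum_divide_distrib\<close>)
  ultimately show ?thesis unfolding has_field_derivative_iff
    by (subst tendsto_cong) auto
qed

section \<open>Functions of class k and their closure properties\<close>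

primrec Ck :: "nat \<Rightarrow> nat \<Rightarrow> (nat \<Rightarrow> real) set \<Rightarrow> ((nat \<Rightarrow> real) \<Rightarrow> real) \<Rightarrow> bool" where
  "Ck n 0 U f \<longleftrightarrow> continuous_on U f"
| "Ck n (Suc k) U f \<longleftrightarrow> continuous_on U f \<and> partially_differentiable n U f \<and>
     (\<forall>a<n. Ck n k U (pderiv_at a f))"

lemma Ck_continuous: "Ck n k U f \<Longrightarrow> continuous_on U f"
  by (cases k) auto

lemma Ck_Suc_imp: "Ck n (Suc k) U f \<Longrightarrow> Ck n k U f"
  by (induction k arbitrary: f) (auto intro: Ck_continuous)

lemma iter_pderiv_snoc: "iter_pderiv (as @ [a]) f = iter_pderiv as (pderiv_at a f)"
  by (induction as) auto

lemma continuous_map_coord_iff: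
  assumes "open_coord n U"
  shows "continuous_map (subtopology (Euclidean_space n) U) euclideanreal f \<longleftrightarrow> continuous_on U f"
  using open_coord_subset[OF assms]
  by (simp add: Euclidean_space_top_of_set subtopology_subtopology Int_absorb1)

text \<open>\<open>smooth_coord\<close> speaks of all iterated derivatives at once; the classes of
  finite order open the closure properties to induction on k. \<open>Ck\<close> splits off the
  innermost derivative and \<open>iter_pderiv\<close> the outermost one, hence the induction over
  reversed lists.\<close>

lemma smooth_coord_iff_Ck:
  "smooth_coord n U f \<longleftrightarrow> open_coord n U \<and> (\<forall>k. Ck n k U f)"
proof (cases "open_coord n U")
  case U: True
  have sm: "smooth_coord n U f \<longleftrightarrow> (\<forall>as. set as \<subseteq> {..<n} \<longrightarrow> continuous_on U (iter_pderiv as f) \<and>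
     partially_differentiable n U (iter_pderiv as f))" for f
    unfolding smooth_coord_def partially_differentiable_def
    using U by (simp add: continuous_map_coord_iff)
  have "Ck n k U f" if "smooth_coord n U f" for k f
    using that
  proof (induction k arbitrary: f)
    case 0
    then show ?case unfolding sm by (auto dest: spec[of _ "[]"])
  next
    case (Suc k)
    have "smooth_coord n U (pderiv_at a f)" if "a < n" for a
      unfolding sm
    proof (intro allI impI)
      fix as assume "set as \<subseteq> {..<n}"
      then have "set (as @ [a]) \<subseteq> {..<n}" using that by auto
      then show "continuous_on U (iter_pderiv as (pderiv_at a f)) \<and>
          partially_differentiable n U (iter_pderiv as (pderiv_at a f))"
        using Suc.prems unfolding sm iter_pderiv_snoc[symmetric] by blast
    qed
    moreover have "continuous_on U f \<and> partially_differentiable n U f"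
      using Suc.prems unfolding sm by (auto dest: spec[of _ "[]"])
    ultimately show ?case using Suc.IH by auto
  qed
  moreover have "continuous_on U (iter_pderiv as f) \<and> partially_differentiable n U (iter_pderiv as f)"
    if "\<forall>k. Ck n k U f" "set as \<subseteq> {..<n}" for as f
    using that
  proof (induction as arbitrary: f rule: rev_induct)
    case Nil
    then show ?case by (auto dest: spec[of _ "Suc 0"])
  next
    case (snoc a as)
    have "\<forall>k. Ck n k U (pderiv_at a f)"
    proof
      fix k
      show "Ck n k U (pderiv_at a f)" using snoc.prems(1)[rule_format, of "Suc k"] snoc.prems(2) by auto
    qed
    then show ?case unfolding iter_pderiv_snoc using snoc by auto
  qed
  ultimately show ?thesis using U sm by blast
qed (simp add: smooth_coord_def)

lemma partially_differentiable_cong: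
  assumes "open_coord n U" "\<And>x. x \<in> U \<Longrightarrow> f x = g x" "partially_differentiable n U f"
  shows "partially_differentiable n U g"
  unfolding partially_differentiable_def
proof (intro allI impI ballI)
  fix a x assume a: "a < n" "x \<in> U"
  have "((\<lambda>t. g (x(a := t))) has_real_derivative pderiv_at a f x) (at (x a))"
  proof (subst DERIV_cong_ev[OF refl _ refl])
    show "eventually (\<lambda>t. g (x(a := t)) = f (x(a := t))) (nhds (x a))"
      using eventually_update[OF assms(1) a(2,1)] by eventually_elim (simp add: assms(2))
    show "((\<lambda>t. f (x(a := t))) has_real_derivative pderiv_at a f x) (at (x a))"
      using assms(3) a by (rule partially_differentiableD)
  qed
  then show "(\<lambda>t. g (x(a := t))) differentiable (at (x a))"
    by (auto simp: real_differentiable_def)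
qed

lemma Ck_cong:
  assumes "open_coord n U" "\<And>x. x \<in> U \<Longrightarrow> f x = g x" "Ck n k U f"
  shows "Ck n k U g"
  using assms(2,3)
proof (induction k arbitrary: f g)
  case 0
  then show ?case using continuous_on_cong by fastforce
next
  case (Suc k)
  have "continuous_on U g" using Suc.prems continuous_on_cong[OF refl Suc.prems(1)] by fastforce
  moreover have "partially_differentiable n U g"
    using partially_differentiable_cong[OF assms(1) Suc.prems(1)] Suc.prems(2) by auto
  moreover have "Ck n k U (pderiv_at a g)" if "a < n" for a
  proof (rule Suc.IH)
    show "pderiv_at a f x = pderiv_at a g x" if "x \<in> U" for x
      using Suc.prems(1) that \<open>a < n\<close> by (rule pderiv_at_cong[OF assms(1)])
  qed (use Suc.prems that in auto)
  ultimately show ?case by auto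
qed

text \<open>The derivatives are supplied as formulas that have to be correct only on U;
  \<open>Ck_cong\<close> carries their regularity over to \<open>pderiv_at\<close>.\<close>

lemma Ck_SucI:
  assumes "open_coord n U" "continuous_on U f"
    "\<And>a x. a < n \<Longrightarrow> x \<in> U \<Longrightarrow> ((\<lambda>t. f (x(a := t))) has_real_derivative f' a x) (at (x a))"
    "\<And>a. a < n \<Longrightarrow> Ck n k U (f' a)"
  shows "Ck n (Suc k) U f"
proof -
  have "partially_differentiable n U f" unfolding partially_differentiable_def
    using assms(3) by (auto simp: real_differentiable_def)
  moreover have "Ck n k U (pderiv_at a f)" if "a < n" for a
    by (rule Ck_cong[OF assms(1) _ assms(4)[OF that]])
      (use assms(3) that in \<open>auto intro!: pderiv_at_eqI[symmetric]\<close>)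
  ultimately show ?thesis using assms(2) by auto
qed

lemma Ck_mono:
  assumes "V \<subseteq> U" "Ck n k U f" shows "Ck n k V f"
  using assms(2)
  by (induction k arbitrary: f)
    (use assms(1) in \<open>auto intro: continuous_on_subset simp: partially_differentiable_def\<close>)

lemma Ck_local:
  assumes "\<And>x. x \<in> U \<Longrightarrow> \<exists>V. open_coord n V \<and> x \<in> V \<and> V \<subseteq> U \<and> Ck n k V f"
  shows "Ck n k U f"
  using assms
proof (induction k arbitrary: f)
  case 0
  have sub: "U \<subseteq> coord_space n"
    using 0 open_coord_subset by blast
  show ?case
    unfolding Ck.simps continuous_on_def
  proof
    fix x assume x: "x \<in> U"
    from 0[OF x] obtain V where V: "open_coord n V" "x \<in> V" "V \<subseteq> U" "continuous_on V f" by auto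
    obtain T where T: "open T" "V = coord_space n \<inter> T"
      using V(1) unfolding Euclidean_space_top_of_set openin_open by auto
    have "at x within U = at x within V"
      by (rule at_within_nhd[of x T]) (use T V sub in auto)
    then show "(f \<longlongrightarrow> f x) (at x within U)" using V(2,4) by (simp add: continuous_on_def)
  qed
next
  case (Suc k)
  have "Ck n k U (pderiv_at a f)" if "a < n" for a
  proof (rule Suc.IH)
    fix x assume "x \<in> U"
    from Suc.prems[OF this] obtain V where "open_coord n V" "x \<in> V" "V \<subseteq> U" "Ck n (Suc k) V f" by blast
    then show "\<exists>V. open_coord n V \<and> x \<in> V \<and> V \<subseteq> U \<and> Ck n k V (pderiv_at a f)"
      using that by (intro exI[of _ V]) simp
  qed
  moreover have "partially_differentiable n U f"
    unfolding partially_differentiable_def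
  proof (intro allI impI ballI)
    fix a x assume a: "a < n" "x \<in> U"
    obtain V where "x \<in> V" "partially_differentiable n V f" using Suc.prems[OF a(2)] by auto
    then show "(\<lambda>t. f (x(a := t))) differentiable (at (x a))"
      using a(1) unfolding partially_differentiable_def by blast
  qed
  moreover have "Ck n k U f"
  proof (rule Suc.IH)
    fix x assume "x \<in> U"
    from Suc.prems[OF this] obtain V where "open_coord n V" "x \<in> V" "V \<subseteq> U" "Ck n (Suc k) V f" by blast
    then show "\<exists>V. open_coord n V \<and> x \<in> V \<and> V \<subseteq> U \<and> Ck n k V f"
      using Ck_Suc_imp by (intro exI[of _ V]) blast
  qed
  ultimately show ?case using Ck_continuous by auto
qed

lemma Ck_const: "Ck n k U (\<lambda>x. c)"
proof (induction k arbitrary: c)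
  case (Suc k)
  have "pderiv_at a (\<lambda>x. c) = (\<lambda>x. 0)" for a by (auto simp: pderiv_at_def)
  then show ?case using Suc by (auto simp: partially_differentiable_def)
qed auto

lemma Ck_coord:
  assumes "open_coord n U" shows "Ck n k U (\<lambda>x. x b)"
proof (cases k)
  case 0 then show ?thesis by (auto intro: continuous_on_subset continuous_on_product_coordinates)
next
  case (Suc m)
  show ?thesis unfolding Suc
  proof (rule Ck_SucI[OF assms, of _ "\<lambda>a x. if a = b then 1 else 0"])
    show "continuous_on U (\<lambda>x. x b)"
      by (auto intro: continuous_on_subset continuous_on_product_coordinates)
    show "((\<lambda>t. (x(a := t)) b) has_real_derivative (if a = b then 1 else 0)) (at (x a))" for a x
      by (cases "a = b") (auto intro!: derivative_eq_intros)
  qed (rule Ck_const)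
qed

lemma Ck_add:
  assumes "open_coord n U" "Ck n k U f" "Ck n k U g" shows "Ck n k U (\<lambda>x. f x + g x)"
  using assms(2,3)
proof (induction k arbitrary: f g)
  case 0 then show ?case by (auto intro: continuous_intros)
next
  case (Suc k)
  show ?case
  proof (rule Ck_SucI[OF assms(1), of _ "\<lambda>a x. pderiv_at a f x + pderiv_at a g x"])
    fix a x assume "a < n" "x \<in> U"
    then show "((\<lambda>t. f (x(a := t)) + g (x(a := t))) has_real_derivative
        pderiv_at a f x + pderiv_at a g x) (at (x a))"
      using Suc.prems by (intro DERIV_add partially_differentiableD[of n U]) auto
  qed (use Suc in \<open>auto intro: continuous_intros\<close>)
qed

lemma Ck_mult:
  assumes "open_coord n U" "Ck n k U f" "Ck n k U g" shows "Ck n k U (\<lambda>x. f x * g x)"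
  using assms(2,3)
proof (induction k arbitrary: f g)
  case 0 then show ?case by (auto intro: continuous_intros)
next
  case (Suc k)
  show ?case
  proof (rule Ck_SucI[OF assms(1), of _ "\<lambda>a x. pderiv_at a f x * g x + pderiv_at a g x * f x"])
    fix a x assume a: "a < n" "x \<in> U"
    have "((\<lambda>t. f (x(a := t)) * g (x(a := t))) has_real_derivative
         pderiv_at a f x * g (x(a := x a)) + pderiv_at a g x * f (x(a := x a))) (at (x a))"
      by (rule DERIV_mult) (use Suc.prems a in \<open>auto intro!: partially_differentiableD\<close>)
    then show "((\<lambda>t. f (x(a := t)) * g (x(a := t))) has_real_derivative
         pderiv_at a f x * g x + pderiv_at a g x * f x) (at (x a))" by simp
  next
    show "Ck n k U (\<lambda>x. pderiv_at a f x * g x + pderiv_at a g x * f x)" if "a < n" for a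
      using Suc.prems that by (intro Ck_add[OF assms(1)] Suc.IH) (auto intro: Ck_Suc_imp)
  qed (use Suc in \<open>auto intro: continuous_intros\<close>)
qed

lemma Ck_sum:
  assumes "open_coord n U" "\<And>i. i \<in> I \<Longrightarrow> Ck n k U (f i)"
  shows "Ck n k U (\<lambda>x. \<Sum>i\<in>I. f i x)"
  using assms(2)
  by (induction I rule: infinite_finite_induct) (auto intro: Ck_const Ck_add[OF assms(1)])

text \<open>The derivative of 1/f is a product of a derivative of f with two factors 1/f, and these
  are of class k by the induction hypothesis. The square root is treated in the same way.\<close>

lemma Ck_inverse:
  assumes "open_coord n U" "Ck n k U f" "\<And>x. x \<in> U \<Longrightarrow> f x \<noteq> 0"
  shows "Ck n k U (\<lambda>x. inverse (f x))"
  using assms(2)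
proof (induction k)
  case 0 then show ?case using assms(3) by (simp add: continuous_on_inverse)
next
  case (Suc k)
  show ?case
  proof (rule Ck_SucI[OF assms(1), of _ "\<lambda>a x. (-1) * (pderiv_at a f x * (inverse (f x) * inverse (f x)))"])
    fix a x assume a: "a < n" "x \<in> U"
    have "((\<lambda>t. inverse (f (x(a := t)))) has_real_derivative
         - (pderiv_at a f x * inverse ((f (x(a := x a)))\<^sup>2))) (at (x a))"
      using Suc.prems a assms(3)
      by (intro DERIV_inverse_fun[unfolded numeral_2_eq_2[symmetric]]) (auto intro!: partially_differentiableD)
    then show "((\<lambda>t. inverse (f (x(a := t)))) has_real_derivative
         (-1) * (pderiv_at a f x * (inverse (f x) * inverse (f x)))) (at (x a))"
      by (simp add: power2_eq_square)
  next
    have IH: "Ck n k U (\<lambda>x. inverse (f x))" using Suc Ck_Suc_imp by blast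
    show "Ck n k U (\<lambda>x. (-1) * (pderiv_at a f x * (inverse (f x) * inverse (f x))))" if "a < n" for a
      using Suc.prems that IH by (intro Ck_mult[OF assms(1)] Ck_const) auto
  qed (use Suc.prems assms(3) in \<open>simp add: continuous_on_inverse\<close>)
qed

lemma Ck_sqrt:
  assumes "open_coord n U" "Ck n k U f" "\<And>x. x \<in> U \<Longrightarrow> f x > 0"
  shows "Ck n k U (\<lambda>x. sqrt (f x))"
  using assms(2)
proof (induction k)
  case 0 then show ?case by (simp add: continuous_on_real_sqrt)
next
  case (Suc k)
  show ?case
  proof (rule Ck_SucI[OF assms(1), of _ "\<lambda>a x. (1/2) * (inverse (sqrt (f x)) * pderiv_at a f x)"])
    fix a x assume a: "a < n" "x \<in> U"
    have "(sqrt has_real_derivative inverse (sqrt (f x)) / 2) (at (f (x(a := x a))))"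
      using DERIV_real_sqrt[of "f x"] assms(3)[OF a(2)] by simp
    from DERIV_chain2[OF this partially_differentiableD[of n U f a x]] 
    show "((\<lambda>t. sqrt (f (x(a := t)))) has_real_derivative
         (1/2) * (inverse (sqrt (f x)) * pderiv_at a f x)) (at (x a))"
      using Suc.prems a by simp
  next
    have IH: "Ck n k U (\<lambda>x. sqrt (f x))" using Suc Ck_Suc_imp by blast
    show "Ck n k U (\<lambda>x. (1/2) * (inverse (sqrt (f x)) * pderiv_at a f x))" if "a < n" for a
      using Suc.prems that IH assms(3)
      by (intro Ck_mult[OF assms(1)] Ck_const Ck_inverse[OF assms(1)]) (use assms(3) in fastforce)+
  qed (use Suc.prems in \<open>simp add: continuous_on_real_sqrt\<close>)
qed

lemma chain_rule_pderiv:
  assumes U: "open_coord m U" and V: "open_coord n V" and f: "Ck n (Suc k) V f"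
    and \<phi>: "\<And>b. b < n \<Longrightarrow> partially_differentiable m U (\<lambda>x. \<phi> x b)" and UV: "\<And>x. x \<in> U \<Longrightarrow> \<phi> x \<in> V"
    and a: "a < m" "x \<in> U"
  shows "((\<lambda>t. f (\<phi> (x(a := t)))) has_real_derivative
           (\<Sum>b<n. pderiv_at b f (\<phi> x) * pderiv_at a (\<lambda>x. \<phi> x b) x)) (at (x a))"
proof -
  have ev: "eventually (\<lambda>t. \<phi> (x(a := t)) \<in> coord_space n) (at (x a))"
    using eventually_update[OF U a(2,1)] unfolding eventually_at_filter
    by eventually_elim (use UV V open_coord_subset in blast)
  have "((\<lambda>t. f (\<phi> (x(a := t)))) has_real_derivative
           (\<Sum>b<n. pderiv_at b f (\<phi> (x(a := x a))) * pderiv_at a (\<lambda>x. \<phi> x b) x)) (at (x a))"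
    by (rule chain_rule_curve[OF V _ _ _ _ ev])
      (use f Ck_continuous UV a \<phi> in \<open>auto intro!: partially_differentiableD\<close>)
  then show ?thesis by simp
qed

text \<open>By the chain rule a derivative of the composite is a sum of products of a composite with
  a derivative of f and a derivative of \<phi>, all covered one order lower.\<close>

lemma Ck_compose:
  assumes U: "open_coord m U" and V: "open_coord n V" and UV: "\<And>x. x \<in> U \<Longrightarrow> \<phi> x \<in> V"
    and f: "Ck n k V f" and \<phi>: "\<And>b. b < n \<Longrightarrow> Ck m k U (\<lambda>x. \<phi> x b)"
  shows "Ck m k U (\<lambda>x. f (\<phi> x))"
proof -
  have cont: "continuous_on U (\<lambda>x. f (\<phi> x))" if "continuous_on V f" for f
  proof (rule continuous_on_compose2[OF that])
    show "continuous_on U \<phi>"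
    proof (rule continuous_on_coordinatewise_then_product)
      fix b
      show "continuous_on U (\<lambda>x. \<phi> x b)"
      proof (cases "b < n")
        case True then show ?thesis using \<phi> Ck_continuous by blast
      next
        case False
        \<comment> \<open>Points of V vanish from index n on, so these components of \<phi> are
          constant.\<close>
        then have "\<And>x. x \<in> U \<Longrightarrow> \<phi> x b = 0" using UV V open_coord_subset by fastforce
        then show ?thesis by (simp cong: continuous_on_cong)
      qed
    qed
  qed (use UV in auto)
  show ?thesis using f \<phi>
  proof (induction k arbitrary: f)
    case 0 then show ?case using cont by auto
  next
    case (Suc k)
    show ?case
    proof (rule Ck_SucI[OF U])
      show "continuous_on U (\<lambda>x. f (\<phi> x))" using Suc.prems(1) by (intro cont) auto
      show "((\<lambda>t. f (\<phi> (x(a := t)))) has_real_derivative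
           (\<Sum>b<n. pderiv_at b f (\<phi> x) * pderiv_at a (\<lambda>x. \<phi> x b) x)) (at (x a))"
        if "a < m" "x \<in> U" for a x
        using Suc.prems that by (intro chain_rule_pderiv[OF U V Suc.prems(1) _ UV]) auto
      show "Ck m k U (\<lambda>x. \<Sum>b<n. pderiv_at b f (\<phi> x) * pderiv_at a (\<lambda>x. \<phi> x b) x)" if "a < m" for a
      proof (intro Ck_sum[OF U] Ck_mult[OF U])
        fix b assume "b \<in> {..<n}"
        then have "Ck n k V (pderiv_at b f)" using Suc.prems(1) by auto
        then show "Ck m k U (\<lambda>x. pderiv_at b f (\<phi> x))"
          by (rule Suc.IH) (rule Ck_Suc_imp[OF Suc.prems(2)])
        show "Ck m k U (pderiv_at a (\<lambda>x. \<phi> x b))"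
          using Suc.prems(2)[of b] \<open>b \<in> {..<n}\<close> that by auto
      qed
    qed
  qed
qed

section \<open>Symmetry of second derivatives\<close>

lemma mixed_difference:
  assumes pd: "partially_differentiable n U f" and pda: "partially_differentiable n U (pderiv_at a f)"
    and ab: "a < n" "b < n" "a \<noteq> b"
    and box: "\<And>r t. \<lbrakk>\<bar>r - x a\<bar> \<le> \<bar>s\<bar>; \<bar>t - x b\<bar> \<le> \<bar>s\<bar>\<rbrakk> \<Longrightarrow> x(a := r, b := t) \<in> U"
  shows "\<exists>r t. \<bar>r - x a\<bar> \<le> \<bar>s\<bar> \<and> \<bar>t - x b\<bar> \<le> \<bar>s\<bar> \<and>
     f (x(a := x a + s, b := x b + s)) - f (x(a := x a + s)) - f (x(b := x b + s)) + f x =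
     pderiv_at b (pderiv_at a f) (x(a := r, b := t)) * s * s"
proof -
  \<comment> \<open>The second difference is the increment in direction a of a difference in
    direction b. The mean value theorem is used once in direction a and once, for the derivative so
    obtained, in direction b.\<close>
  let ?h = "\<lambda>r. f (x(b := x b + s, a := r)) - f (x(a := r))"
  have "\<exists>r. \<bar>r - x a\<bar> \<le> \<bar>x a + s - x a\<bar> \<and> ?h (x a + s) - ?h (x a) =
      (pderiv_at a f (x(b := x b + s, a := r)) - pderiv_at a f (x(a := r))) * (x a + s - x a)"
  proof (rule mean_value_segment)
    fix r assume r: "\<bar>r - x a\<bar> \<le> \<bar>x a + s - x a\<bar>"
    have "x(b := x b + s, a := r) \<in> U" "x(a := r) \<in> U"
      using box[of r "x b + s"] box[of r "x b"] r ab(3) fun_upd_idem[of "x(a := r)" b "x b"]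
      by (auto simp: fun_upd_twist)
    then show "(?h has_real_derivative pderiv_at a f (x(b := x b + s, a := r)) - pderiv_at a f (x(a := r))) (at r)"
      by (intro DERIV_diff has_partial_derivative_at[OF pd ab(1)])
  qed
  then obtain r where r: "\<bar>r - x a\<bar> \<le> \<bar>s\<bar>" "?h (x a + s) - ?h (x a) =
      (pderiv_at a f (x(b := x b + s, a := r)) - pderiv_at a f (x(a := r))) * s" by auto
  let ?k = "\<lambda>t. pderiv_at a f (x(a := r, b := t))"
  have "\<exists>t. \<bar>t - x b\<bar> \<le> \<bar>x b + s - x b\<bar> \<and> ?k (x b + s) - ?k (x b) =
      pderiv_at b (pderiv_at a f) (x(a := r, b := t)) * (x b + s - x b)"
    by (rule mean_value_segment) (intro has_partial_derivative_at[OF pda ab(2)] box, use r(1) in auto)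
  then obtain t where t: "\<bar>t - x b\<bar> \<le> \<bar>s\<bar>" "?k (x b + s) - ?k (x b) =
      pderiv_at b (pderiv_at a f) (x(a := r, b := t)) * s" by auto
  have e1: "x(b := x b + s, a := r) = x(a := r, b := x b + s)" for r using ab(3) by (simp add: fun_upd_twist)
  have e2: "x(a := r, b := x b) = x(a := r)" "x(a := x a, b := x b + s) = x(b := x b + s)"
    using ab(3) by (auto simp: fun_eq_iff)
  have "f (x(a := x a + s, b := x b + s)) - f (x(a := x a + s)) - f (x(b := x b + s)) + f x =
      ?h (x a + s) - ?h (x a)"
    using ab(3) by (simp add: e1 e2)
  also have "\<dots> = pderiv_at b (pderiv_at a f) (x(a := r, b := t)) * s * s"
    unfolding r(2) t(2)[symmetric] using e1 e2 by simp
  finally show ?thesis using r(1) t(1) by blast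
qed

text \<open>The second difference is symmetric in a and b. Divided by s * s it is a value of either
  mixed derivative at a point close to x, and continuity of both at x does the rest.\<close>

lemma pderiv_at_commute:
  assumes U: "open_coord n U" and f: "Ck n (Suc (Suc k)) U f" and x: "x \<in> U" and ab: "a < n" "b < n"
  shows "pderiv_at a (pderiv_at b f) x = pderiv_at b (pderiv_at a f) x"
proof (cases "a = b")
  case False
  have "\<bar>pderiv_at a (pderiv_at b f) x - pderiv_at b (pderiv_at a f) x\<bar> \<le> e" if e: "e > 0" for e
  proof -
    have c: "continuous_on U (pderiv_at a (pderiv_at b f))" "continuous_on U (pderiv_at b (pderiv_at a f))"
      using f ab by (auto intro: Ck_continuous)
    obtain d1 where d1: "d1 > 0" "\<And>y. \<lbrakk>y \<in> coord_space n; \<And>c. c < n \<Longrightarrow> \<bar>y c - x c\<bar> < d1\<rbrakk> \<Longrightarrow>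
        y \<in> U \<and> \<bar>pderiv_at a (pderiv_at b f) y - pderiv_at a (pderiv_at b f) x\<bar> < e / 2"
      using continuous_on_box[OF U c(1) x half_gt_zero[OF e]] by blast
    obtain d2 where d2: "d2 > 0" "\<And>y. \<lbrakk>y \<in> coord_space n; \<And>c. c < n \<Longrightarrow> \<bar>y c - x c\<bar> < d2\<rbrakk> \<Longrightarrow>
        y \<in> U \<and> \<bar>pderiv_at b (pderiv_at a f) y - pderiv_at b (pderiv_at a f) x\<bar> < e / 2"
      using continuous_on_box[OF U c(2) x half_gt_zero[OF e]] by blast
    define s where "s = min d1 d2 / 2"
    have s: "s > 0" "s < d1" "s < d2" using d1 d2 by (auto simp: s_def)
    have xE: "x \<in> coord_space n" using x U open_coord_subset by blast
    have box: "x(a := r, b := t) \<in> coord_space n"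
      "\<And>c. c < n \<Longrightarrow> \<bar>(x(a := r, b := t)) c - x c\<bar> < d1"
      "\<And>c. c < n \<Longrightarrow> \<bar>(x(a := r, b := t)) c - x c\<bar> < d2"
      if "\<bar>r - x a\<bar> \<le> \<bar>s\<bar>" "\<bar>t - x b\<bar> \<le> \<bar>s\<bar>" for r t
      using that s xE ab d1(1) d2(1) by auto
    have inU: "x(a := r, b := t) \<in> U" if "\<bar>r - x a\<bar> \<le> \<bar>s\<bar>" "\<bar>t - x b\<bar> \<le> \<bar>s\<bar>" for r t
      using d1(2)[OF box(1,2)[OF that]] by blast
    have pd: "partially_differentiable n U f" "partially_differentiable n U (pderiv_at a f)"
      "partially_differentiable n U (pderiv_at b f)"
      using f ab by auto
    have "\<exists>r t. \<bar>r - x a\<bar> \<le> \<bar>s\<bar> \<and> \<bar>t - x b\<bar> \<le> \<bar>s\<bar> \<and>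
     f (x(a := x a + s, b := x b + s)) - f (x(a := x a + s)) - f (x(b := x b + s)) + f x =
     pderiv_at b (pderiv_at a f) (x(a := r, b := t)) * s * s"
      by (rule mixed_difference[OF pd(1,2) ab False]) (use inU in blast)
    then obtain r t where rt: "\<bar>r - x a\<bar> \<le> \<bar>s\<bar>" "\<bar>t - x b\<bar> \<le> \<bar>s\<bar>"
      "f (x(a := x a + s, b := x b + s)) - f (x(a := x a + s)) - f (x(b := x b + s)) + f x =
     pderiv_at b (pderiv_at a f) (x(a := r, b := t)) * s * s" by blast
    have tw: "x(b := t, a := r) = x(a := r, b := t)" for r t using False by (simp add: fun_upd_twist)
    have "\<exists>t r. \<bar>t - x b\<bar> \<le> \<bar>s\<bar> \<and> \<bar>r - x a\<bar> \<le> \<bar>s\<bar> \<and>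
     f (x(b := x b + s, a := x a + s)) - f (x(b := x b + s)) - f (x(a := x a + s)) + f x =
     pderiv_at a (pderiv_at b f) (x(b := t, a := r)) * s * s"
      by (rule mixed_difference[OF pd(1,3) ab(2,1) False[symmetric]]) (use inU tw in auto)
    then obtain r' t' where rt': "\<bar>r' - x a\<bar> \<le> \<bar>s\<bar>" "\<bar>t' - x b\<bar> \<le> \<bar>s\<bar>"
      "f (x(a := x a + s, b := x b + s)) - f (x(b := x b + s)) - f (x(a := x a + s)) + f x =
     pderiv_at a (pderiv_at b f) (x(a := r', b := t')) * s * s" unfolding tw by blast
    have eq: "pderiv_at a (pderiv_at b f) (x(a := r', b := t')) = pderiv_at b (pderiv_at a f) (x(a := r, b := t))"
    proof -
      have "pderiv_at a (pderiv_at b f) (x(a := r', b := t')) * (s * s) =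
          pderiv_at b (pderiv_at a f) (x(a := r, b := t)) * (s * s)"
        using rt(3) rt'(3) by (simp only: mult.assoc[symmetric])
      then show ?thesis using s(1) by simp
    qed
    have "\<bar>pderiv_at a (pderiv_at b f) (x(a := r', b := t')) - pderiv_at a (pderiv_at b f) x\<bar> < e / 2"
      using d1(2)[OF box(1,2)[OF rt'(1,2)]] by blast
    moreover have "\<bar>pderiv_at b (pderiv_at a f) (x(a := r, b := t)) - pderiv_at b (pderiv_at a f) x\<bar> < e / 2"
      using d2(2)[OF box(1,3)[OF rt(1,2)]] by blast
    ultimately show ?thesis using eq by argo
  qed
  then have "\<bar>pderiv_at a (pderiv_at b f) x - pderiv_at b (pderiv_at a f) x\<bar> \<le> 0"
    by (rule field_le_epsilon[of _ 0, simplified])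
  then show ?thesis by simp
qed simp

section \<open>Smooth functions of coordinates\<close>

lemma smooth_coord_open: "smooth_coord n U f \<Longrightarrow> open_coord n U"
  by (simp add: smooth_coord_def)

lemma smooth_coord_differentiable: "smooth_coord n U f \<Longrightarrow> partially_differentiable n U f"
  unfolding smooth_coord_iff_Ck by (auto dest: spec[of _ "Suc 0"])

lemma smooth_coord_continuous: "smooth_coord n U f \<Longrightarrow> continuous_on U f"
  unfolding smooth_coord_iff_Ck by (auto dest: spec[of _ 0])

lemma smooth_coord_pderiv: "smooth_coord n U f \<Longrightarrow> a < n \<Longrightarrow> smooth_coord n U (pderiv_at a f)"
  unfolding smooth_coord_iff_Ck using Ck.simps(2) by blast

lemma smooth_coord_cong:
  "smooth_coord n U f \<Longrightarrow> (\<And>x. x \<in> U \<Longrightarrow> f x = g x) \<Longrightarrow> smooth_coord n U g"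
  unfolding smooth_coord_iff_Ck using Ck_cong by blast

lemma smooth_coord_mono:
  "smooth_coord n U f \<Longrightarrow> open_coord n V \<Longrightarrow> V \<subseteq> U \<Longrightarrow> smooth_coord n V f"
  unfolding smooth_coord_iff_Ck using Ck_mono by blast

lemma smooth_coord_local:
  assumes "\<And>x. x \<in> U \<Longrightarrow> \<exists>V. x \<in> V \<and> V \<subseteq> U \<and> smooth_coord n V f"
  shows "smooth_coord n U f"
proof -
  have "\<forall>x\<in>U. \<exists>V. x \<in> V \<and> V \<subseteq> U \<and> smooth_coord n V f" using assms by blast
  from bchoice[OF this] obtain V where V: "\<forall>x\<in>U. x \<in> V x \<and> V x \<subseteq> U \<and> smooth_coord n (V x) f" ..
  have "U = (\<Union>x\<in>U. V x)" using V by blast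
  moreover have "open_coord n (\<Union>x\<in>U. V x)"
    using V smooth_coord_open by (intro openin_Union) blast
  ultimately have "open_coord n U" by simp
  then show ?thesis unfolding smooth_coord_iff_Ck
    using V[unfolded smooth_coord_iff_Ck] by (blast intro: Ck_local)
qed

lemma smooth_coord_const: "open_coord n U \<Longrightarrow> smooth_coord n U (\<lambda>x. c)"
  and smooth_coord_coord: "open_coord n U \<Longrightarrow> smooth_coord n U (\<lambda>x. x b)"
  by (auto simp: smooth_coord_iff_Ck intro: Ck_const Ck_coord)

lemma smooth_coord_add: "smooth_coord n U f \<Longrightarrow> smooth_coord n U h \<Longrightarrow> smooth_coord n U (\<lambda>x. f x + h x)"
  and smooth_coord_mult: "smooth_coord n U f \<Longrightarrow> smooth_coord n U h \<Longrightarrow> smooth_coord n U (\<lambda>x. f x * h x)"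
  by (auto simp: smooth_coord_iff_Ck intro: Ck_add Ck_mult)

lemma smooth_coord_sum:
  "open_coord n U \<Longrightarrow> (\<And>i. i \<in> I \<Longrightarrow> smooth_coord n U (F i)) \<Longrightarrow> smooth_coord n U (\<lambda>x. \<Sum>i\<in>I. F i x)"
  by (auto simp: smooth_coord_iff_Ck intro: Ck_sum)

lemma smooth_coord_inverse:
  "smooth_coord n U f \<Longrightarrow> (\<And>x. x \<in> U \<Longrightarrow> f x \<noteq> 0) \<Longrightarrow> smooth_coord n U (\<lambda>x. inverse (f x))"
  and smooth_coord_sqrt:
  "smooth_coord n U f \<Longrightarrow> (\<And>x. x \<in> U \<Longrightarrow> f x > 0) \<Longrightarrow> smooth_coord n U (\<lambda>x. sqrt (f x))"
  by (auto simp: smooth_coord_iff_Ck intro: Ck_inverse Ck_sqrt)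

lemma smooth_coord_compose:
  assumes "smooth_coord n V f" "open_coord m U" "\<And>x. x \<in> U \<Longrightarrow> \<phi> x \<in> V"
    "\<And>b. b < n \<Longrightarrow> smooth_coord m U (\<lambda>x. \<phi> x b)"
  shows "smooth_coord m U (\<lambda>x. f (\<phi> x))"
  unfolding smooth_coord_iff_Ck
proof (intro conjI allI)
  fix k
  show "Ck m k U (\<lambda>x. f (\<phi> x))"
    by (rule Ck_compose[OF assms(2) smooth_coord_open[OF assms(1)] assms(3)])
      (use assms(1,4) in \<open>auto simp: smooth_coord_iff_Ck\<close>)
qed (rule assms(2))

lemma smooth_coord_pderiv_compose:
  assumes "smooth_coord n V f" "open_coord m U" "\<And>x. x \<in> U \<Longrightarrow> \<phi> x \<in> V"
    "\<And>b. b < n \<Longrightarrow> smooth_coord m U (\<lambda>x. \<phi> x b)" "a < m" "x \<in> U"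
  shows "pderiv_at a (\<lambda>x. f (\<phi> x)) x = (\<Sum>b<n. pderiv_at b f (\<phi> x) * pderiv_at a (\<lambda>x. \<phi> x b) x)"
proof (rule pderiv_at_eqI, rule chain_rule_pderiv[OF assms(2) smooth_coord_open[OF assms(1)] _ _ assms(3,5,6)])
  show "Ck n (Suc 0) V f" using assms(1) unfolding smooth_coord_iff_Ck by blast
  show "partially_differentiable m U (\<lambda>x. \<phi> x b)" if "b < n" for b
    using assms(4)[OF that] by (rule smooth_coord_differentiable)
qed

lemma smooth_coord_pderiv_commute:
  "smooth_coord n U f \<Longrightarrow> x \<in> U \<Longrightarrow> a < n \<Longrightarrow> b < n \<Longrightarrow>
     pderiv_at a (pderiv_at b f) x = pderiv_at b (pderiv_at a f) x"
  unfolding smooth_coord_iff_Ck by (blast intro: pderiv_at_commute[of n U 0])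

lemma pderiv_at_add:
  "smooth_coord n U f \<Longrightarrow> smooth_coord n U h \<Longrightarrow> x \<in> U \<Longrightarrow> a < n \<Longrightarrow>
     pderiv_at a (\<lambda>x. f x + h x) x = pderiv_at a f x + pderiv_at a h x"
  by (auto intro!: pderiv_at_eqI DERIV_add partially_differentiableD dest: smooth_coord_differentiable)

lemma pderiv_at_mult:
  assumes "smooth_coord n U f" "smooth_coord n U h" "x \<in> U" "a < n"
  shows "pderiv_at a (\<lambda>x. f x * h x) x = pderiv_at a f x * h x + f x * pderiv_at a h x"
proof (rule pderiv_at_eqI)
  have "((\<lambda>t. f (x(a := t)) * h (x(a := t))) has_real_derivative
         pderiv_at a f x * h (x(a := x a)) + pderiv_at a h x * f (x(a := x a))) (at (x a))"
    using assms by (intro DERIV_mult) (auto intro!: partially_differentiableD dest: smooth_coord_differentiable)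
  then show "((\<lambda>t. f (x(a := t)) * h (x(a := t))) has_real_derivative
         pderiv_at a f x * h x + f x * pderiv_at a h x) (at (x a))" by (simp add: mult.commute)
qed

lemma pderiv_at_const [simp]: "pderiv_at a (\<lambda>x. c) x = 0"
  by (simp add: pderiv_at_def)

lemma pderiv_at_coord: "pderiv_at a (\<lambda>x. x b) x = (if a = b then 1 else 0)"
  by (auto intro!: pderiv_at_eqI derivative_eq_intros)

section \<open>Smooth functions, vector fields and brackets\<close>

lemma scaleR_fun_apply [simp]: "(c *\<^sub>R f) x = c *\<^sub>R f x"
  by (simp add: scaleR_fun_def)

lemma sum_fun_apply: "(\<Sum>a\<in>A. f a) x = (\<Sum>a\<in>A. f a x)"
  by (induction A rule: infinite_finite_induct) auto

section \<open>Atlases and the manifold topology\<close>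

definition smooth_atlas :: "('p, 'i) manifold \<Rightarrow> bool" where
  "smooth_atlas M \<longleftrightarrow>
     (\<Union>i\<in>charts M. cdom M i) = points M \<and>
     (\<forall>i\<in>charts M. inj_on (coords M i) (cdom M i)) \<and>
     (\<forall>i\<in>charts M. openin (Euclidean_space (mdim M)) (coords M i ` cdom M i)) \<and>
     (\<forall>i\<in>charts M. \<forall>j\<in>charts M. \<forall>b<mdim M.
        smooth_coord (mdim M) (coords M i ` (cdom M i \<inter> cdom M j))
          (\<lambda>x. coords M j (param M i x) b)) \<and>
     (\<forall>i\<in>charts M. \<forall>j\<in>charts M.
        openin (Euclidean_space (mdim M)) (coords M i ` (cdom M i \<inter> cdom M j)))"

text \<open>The calculus is developed for a \<open>smooth_atlas\<close>; the two topological
  conditions pass to the tangent bundle by arguments of their own.\<close>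

lemma smooth_manifold_iff:
  "smooth_manifold M \<longleftrightarrow> smooth_atlas M \<and> Hausdorff_space (mtop M) \<and> second_countable (mtop M)"
  unfolding smooth_manifold_def smooth_atlas_def by (simp only: conj_assoc)

locale smooth_mfd =
  fixes M :: "('p, 'i) manifold"
  assumes smooth_M: "smooth_atlas M"
begin

abbreviation "sf \<equiv> smooth_fun_on M"
abbreviation "vf \<equiv> vector_field_on M"
abbreviation "opn \<equiv> openin (mtop M)"
abbreviation "TS \<equiv> tangent_space M"
abbreviation "dd \<equiv> dirderiv M"

lemma points_eq: "points M = (\<Union>i\<in>charts M. cdom M i)"
  and inj_coords: "i \<in> charts M \<Longrightarrow> inj_on (coords M i) (cdom M i)"
  and open_coords_cdom: "i \<in> charts M \<Longrightarrow> open_coord (mdim M) (coords M i ` cdom M i)"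
  and smooth_transition: "i \<in> charts M \<Longrightarrow> j \<in> charts M \<Longrightarrow> b < mdim M \<Longrightarrow>
        smooth_coord (mdim M) (coords M i ` (cdom M i \<inter> cdom M j)) (\<lambda>x. coords M j (param M i x) b)"
  and open_coords_overlap: "i \<in> charts M \<Longrightarrow> j \<in> charts M \<Longrightarrow>
        open_coord (mdim M) (coords M i ` (cdom M i \<inter> cdom M j))"
  using smooth_M unfolding smooth_atlas_def by blast+

lemma chart_at: assumes "p \<in> points M" obtains i where "i \<in> charts M" "p \<in> cdom M i"
  using assms points_eq by auto

lemma some_chart: "p \<in> points M \<Longrightarrow> chart_around M p (SOME i. chart_around M p i)"
  by (rule someI_ex) (auto simp: points_eq)

lemma cdom_subset: "i \<in> charts M \<Longrightarrow> cdom M i \<subseteq> points M"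
  using points_eq by auto

lemma param_coords [simp]: "i \<in> charts M \<Longrightarrow> p \<in> cdom M i \<Longrightarrow> param M i (coords M i p) = p"
  unfolding param_def by (simp add: inj_coords inv_into_f_f)

lemma param_mem: "i \<in> charts M \<Longrightarrow> x \<in> coords M i ` cdom M i \<Longrightarrow> param M i x \<in> cdom M i"
  by auto

text \<open>\<open>topology\<close> has the intended open sets once the family is closed under
  binary intersections and unions. For intersections this holds because a chart is injective, so
  that taking images commutes with them.\<close>

lemma openin_mtop: "opn U \<longleftrightarrow> U \<subseteq> points M \<and>
     (\<forall>i\<in>charts M. open_coord (mdim M) (coords M i ` (U \<inter> cdom M i)))"
proof -
  have "istopology (\<lambda>U. U \<subseteq> points M \<and>
     (\<forall>i\<in>charts M. open_coord (mdim M) (coords M i ` (U \<inter> cdom M i))))"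
    unfolding istopology_def
  proof (rule conjI; intro allI impI)
    fix S T assume S: "S \<subseteq> points M \<and> (\<forall>i\<in>charts M. open_coord (mdim M) (coords M i ` (S \<inter> cdom M i)))"
      and T: "T \<subseteq> points M \<and> (\<forall>i\<in>charts M. open_coord (mdim M) (coords M i ` (T \<inter> cdom M i)))"
    have "coords M i ` ((S \<inter> T) \<inter> cdom M i) = coords M i ` (S \<inter> cdom M i) \<inter> coords M i ` (T \<inter> cdom M i)"
      if "i \<in> charts M" for i
      using inj_on_image_Int[OF inj_coords[OF that], of "S \<inter> cdom M i" "T \<inter> cdom M i"]
      by (simp add: Int_ac inf_assoc)
    then show "S \<inter> T \<subseteq> points M \<and> (\<forall>i\<in>charts M. open_coord (mdim M) (coords M i ` (S \<inter> T \<inter> cdom M i)))"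
      using S T by auto
  next
    fix K assume K: "\<forall>S\<in>K. S \<subseteq> points M \<and> (\<forall>i\<in>charts M. open_coord (mdim M) (coords M i ` (S \<inter> cdom M i)))"
    have "coords M i ` (\<Union>K \<inter> cdom M i) = (\<Union>S\<in>K. coords M i ` (S \<inter> cdom M i))" for i by auto
    moreover have "open_coord (mdim M) (\<Union>S\<in>K. coords M i ` (S \<inter> cdom M i))" if "i \<in> charts M" for i
      using K that by (intro openin_Union) auto
    ultimately show "\<Union>K \<subseteq> points M \<and> (\<forall>i\<in>charts M. open_coord (mdim M) (coords M i ` (\<Union>K \<inter> cdom M i)))"
      using K by auto
  qed
  then show ?thesis unfolding mtop_def by (simp add: topology_inverse')
qed

lemma opn_subset: "opn U \<Longrightarrow> U \<subseteq> points M"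
  using openin_mtop by blast

lemma open_coords_image: "opn U \<Longrightarrow> i \<in> charts M \<Longrightarrow> open_coord (mdim M) (coords M i ` (U \<inter> cdom M i))"
  using openin_mtop by blast

lemma open_cdom: "i \<in> charts M \<Longrightarrow> opn (cdom M i)"
  unfolding openin_mtop using cdom_subset open_coords_overlap by (simp add: Int_commute)

lemma coords_mem: "i \<in> charts M \<Longrightarrow> p \<in> cdom M i \<Longrightarrow> coords M i p \<in> coord_space (mdim M)"
  using open_coords_cdom open_coord_subset by blast

lemma smooth_transition_mono:
  assumes "i \<in> charts M" "j \<in> charts M" "b < mdim M" "opn W" "W \<subseteq> cdom M j"
  shows "smooth_coord (mdim M) (coords M i ` (W \<inter> cdom M i)) (\<lambda>x. coords M j (param M i x) b)"
  by (rule smooth_coord_mono[OF smooth_transition[OF assms(1-3)] open_coords_image[OF assms(4,1)]])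
    (use assms(5) in auto)

text \<open>Seen in another chart j, the set is the preimage of W under the transition map, which is
  continuous on the open image of the overlap.\<close>

lemma open_param_image:
  assumes i: "i \<in> charts M" and W: "open_coord (mdim M) W" "W \<subseteq> coords M i ` cdom M i"
  shows "opn (param M i ` W)"
  unfolding openin_mtop
proof (intro conjI ballI)
  show "param M i ` W \<subseteq> points M" using W(2) param_mem[OF i] cdom_subset[OF i] by blast
  fix j assume j: "j \<in> charts M"
  let ?S = "coords M j ` (cdom M j \<inter> cdom M i)" and ?t = "\<lambda>x. coords M i (param M j x)"
  have S: "open_coord (mdim M) ?S" using open_coords_overlap[OF j i] .
  have "continuous_on ?S ?t"
  proof (rule continuous_on_coordinatewise_then_product)
    fix b
    show "continuous_on ?S (\<lambda>x. ?t x b)"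
    proof (cases "b < mdim M")
      case True then show ?thesis using smooth_transition[OF j i] smooth_coord_continuous by blast
    next
      case False
      then have "?t x b = 0" if "x \<in> ?S" for x using that j coords_mem[OF i] by auto
      then show ?thesis by (simp cong: continuous_on_cong)
    qed
  qed
  moreover obtain T where T: "open T" "W = coord_space (mdim M) \<inter> T"
    using W(1) unfolding Euclidean_space_top_of_set openin_open by auto
  ultimately have "openin (top_of_set ?S) (?S \<inter> ?t -` T)"
    by (intro continuous_openin_preimage_gen)
  then have "open_coord (mdim M) (?S \<inter> ?t -` T)"
    using S unfolding Euclidean_space_top_of_set by (rule openin_trans)
  moreover have "coords M j ` (param M i ` W \<inter> cdom M j) = ?S \<inter> ?t -` T"
  proof (intro equalityI subsetI)
    fix x assume "x \<in> coords M j ` (param M i ` W \<inter> cdom M j)"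
    then obtain p where p: "p \<in> cdom M j" "x = coords M j p" "p \<in> param M i ` W" by blast
    then obtain y where y: "y \<in> W" "p = param M i y" by blast
    then obtain q where "q \<in> cdom M i" "y = coords M i q" using W(2) by blast
    then have "p \<in> cdom M i" "coords M i p = y" using y i by auto
    then show "x \<in> ?S \<inter> ?t -` T" using p y T(2) j by auto
  next
    fix x assume "x \<in> ?S \<inter> ?t -` T"
    then obtain p where p: "p \<in> cdom M j" "p \<in> cdom M i" "x = coords M j p" "coords M i p \<in> T"
      using j by auto
    then have "coords M i p \<in> W" using T(2) coords_mem[OF i] by auto
    then have "p \<in> param M i ` W" using i p by (metis image_eqI param_coords)
    then show "x \<in> coords M j ` (param M i ` W \<inter> cdom M j)" using p by auto
  qed
  ultimately show "open_coord (mdim M) (coords M j ` (param M i ` W \<inter> cdom M j))" by simp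
qed

section \<open>Smooth functions on a manifold\<close>

lemma sf_open: "sf U f \<Longrightarrow> opn U"
  unfolding smooth_fun_on_def by blast

lemma sf_coordD: "sf U f \<Longrightarrow> i \<in> charts M \<Longrightarrow>
    smooth_coord (mdim M) (coords M i ` (U \<inter> cdom M i)) (\<lambda>x. f (param M i x))"
  unfolding smooth_fun_on_def by blast

text \<open>Inside one chart domain a single coordinate expression suffices, since passing to
  another chart means composing with a smooth transition map.\<close>

lemma sf_chartI:
  assumes i: "i \<in> charts M" and W: "opn W" "W \<subseteq> cdom M i"
    and f: "smooth_coord (mdim M) (coords M i ` W) (\<lambda>x. f (param M i x))"
  shows "sf W f"
  unfolding smooth_fun_on_def
proof (intro conjI ballI)
  fix j assume j: "j \<in> charts M"
  have "smooth_coord (mdim M) (coords M j ` (W \<inter> cdom M j)) (\<lambda>x. f (param M i (coords M i (param M j x))))"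
    by (rule smooth_coord_compose[OF f open_coords_image[OF W(1) j]])
      (use j i W smooth_transition_mono in auto)
  then show "smooth_coord (mdim M) (coords M j ` (W \<inter> cdom M j)) (\<lambda>x. f (param M j x))"
    by (rule smooth_coord_cong) (use j i W in auto)
qed (rule W)

lemma sf_mono: assumes "sf U f" "opn V" "V \<subseteq> U" shows "sf V f"
  unfolding smooth_fun_on_def
proof (intro conjI ballI)
  fix i assume i: "i \<in> charts M"
  show "smooth_coord (mdim M) (coords M i ` (V \<inter> cdom M i)) (\<lambda>x. f (param M i x))"
    by (rule smooth_coord_mono[OF sf_coordD[OF assms(1) i] open_coords_image[OF assms(2) i]])
      (use assms(3) in auto)
qed (rule assms)

lemma sf_cong: assumes "sf U f" "\<And>p. p \<in> U \<Longrightarrow> f p = g p" shows "sf U g"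
  unfolding smooth_fun_on_def
proof (intro conjI ballI)
  fix i assume i: "i \<in> charts M"
  show "smooth_coord (mdim M) (coords M i ` (U \<inter> cdom M i)) (\<lambda>x. g (param M i x))"
    by (rule smooth_coord_cong[OF sf_coordD[OF assms(1) i]]) (use assms(2) i in auto)
qed (use assms sf_open in blast)

lemma opn_local: assumes "\<And>p. p \<in> U \<Longrightarrow> \<exists>W. p \<in> W \<and> W \<subseteq> U \<and> opn W" shows "opn U"
  using assms by (subst openin_subopen) blast

lemma sf_local: assumes "\<And>p. p \<in> U \<Longrightarrow> \<exists>W. p \<in> W \<and> W \<subseteq> U \<and> sf W f" shows "sf U f"
  unfolding smooth_fun_on_def
proof (intro conjI ballI)
  show "opn U" using assms sf_open by (intro opn_local) blast
  fix i assume i: "i \<in> charts M"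
  show "smooth_coord (mdim M) (coords M i ` (U \<inter> cdom M i)) (\<lambda>x. f (param M i x))"
  proof (rule smooth_coord_local)
    fix x assume "x \<in> coords M i ` (U \<inter> cdom M i)"
    then obtain p where p: "p \<in> U" "p \<in> cdom M i" "x = coords M i p" by blast
    from assms[OF p(1)] obtain W where W: "p \<in> W" "W \<subseteq> U" "sf W f" by blast
    show "\<exists>V. x \<in> V \<and> V \<subseteq> coords M i ` (U \<inter> cdom M i) \<and> smooth_coord (mdim M) V (\<lambda>x. f (param M i x))"
      using sf_coordD[OF W(3) i] p W(1,2) by (intro exI[of _ "coords M i ` (W \<inter> cdom M i)"]) auto
  qed
qed

lemma sf_const: "opn U \<Longrightarrow> sf U (\<lambda>p. c)"
  unfolding smooth_fun_on_def using open_coords_image smooth_coord_const by blast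

lemma sf_add: "sf U f \<Longrightarrow> sf U g \<Longrightarrow> sf U (\<lambda>p. f p + g p)"
  and sf_mult: "sf U f \<Longrightarrow> sf U g \<Longrightarrow> sf U (\<lambda>p. f p * g p)"
  unfolding smooth_fun_on_def by (auto intro: smooth_coord_add smooth_coord_mult)

lemma sf_cmult: "sf U f \<Longrightarrow> sf U (\<lambda>p. c * f p)"
  using sf_mult[OF sf_const[OF sf_open]] by blast

lemma sf_uminus: "sf U f \<Longrightarrow> sf U (\<lambda>p. - f p)"
  using sf_cmult[of U f "-1"] by simp

lemma sf_diff: "sf U f \<Longrightarrow> sf U g \<Longrightarrow> sf U (\<lambda>p. f p - g p)"
  using sf_add[OF _ sf_uminus, of U f g] by simp

lemma sf_sum: "opn U \<Longrightarrow> (\<And>a. a \<in> A \<Longrightarrow> sf U (f a)) \<Longrightarrow> sf U (\<lambda>p. \<Sum>a\<in>A. f a p)"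
  by (induction A rule: infinite_finite_induct) (auto intro: sf_const sf_add)

lemma sf_inverse: "sf U f \<Longrightarrow> (\<And>p. p \<in> U \<Longrightarrow> f p \<noteq> 0) \<Longrightarrow> sf U (\<lambda>p. inverse (f p))"
  and sf_sqrt: "sf U f \<Longrightarrow> (\<And>p. p \<in> U \<Longrightarrow> f p > 0) \<Longrightarrow> sf U (\<lambda>p. sqrt (f p))"
  unfolding smooth_fun_on_def by (auto intro!: smooth_coord_inverse smooth_coord_sqrt)

lemma sf_coord: assumes "i \<in> charts M" shows "sf (cdom M i) (\<lambda>q. coords M i q b)"
proof (rule sf_chartI[OF assms open_cdom[OF assms] order_refl])
  show "smooth_coord (mdim M) (coords M i ` cdom M i) (\<lambda>x. coords M i (param M i x) b)"
    by (rule smooth_coord_cong[OF smooth_coord_coord[OF open_coords_cdom[OF assms], of b]])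
      (use assms in auto)
qed

lemma sf_pos_open:
  assumes "sf U f" shows "opn {p \<in> U. f p > 0}"
  unfolding openin_mtop
proof (intro conjI ballI)
  show "{p \<in> U. f p > 0} \<subseteq> points M" using opn_subset[OF sf_open[OF assms]] by auto
  fix i assume i: "i \<in> charts M"
  let ?S = "coords M i ` (U \<inter> cdom M i)"
  have "openin (top_of_set ?S) (?S \<inter> (\<lambda>x. f (param M i x)) -` {0<..})"
    by (rule continuous_openin_preimage_gen[OF smooth_coord_continuous[OF sf_coordD[OF assms i]]]) simp
  then have "open_coord (mdim M) (?S \<inter> (\<lambda>x. f (param M i x)) -` {0<..})"
    using open_coords_image[OF sf_open[OF assms] i] unfolding Euclidean_space_top_of_set by (rule openin_trans)
  moreover have "coords M i ` ({p \<in> U. f p > 0} \<inter> cdom M i) = ?S \<inter> (\<lambda>x. f (param M i x)) -` {0<..}"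
    using i by auto
  ultimately show "open_coord (mdim M) (coords M i ` ({p \<in> U. f p > 0} \<inter> cdom M i))" by simp
qed

section \<open>Tangent vectors and directional derivatives\<close>

definition jac :: "'i \<Rightarrow> 'i \<Rightarrow> 'p \<Rightarrow> nat \<Rightarrow> nat \<Rightarrow> real" where
  "jac i j p b a = pderiv_at a (\<lambda>x. coords M j (param M i x) b) (coords M i p)"

lemma pderiv_at_transition:
  assumes f: "sf U f" "p \<in> U" and i: "chart_around M p i" and j: "chart_around M p j" and a: "a < mdim M"
  shows "pderiv_at a (\<lambda>x. f (param M i x)) (coords M i p) =
    (\<Sum>b<mdim M. pderiv_at b (\<lambda>x. f (param M j x)) (coords M j p) * jac i j p b a)"
proof -
  let ?W = "U \<inter> cdom M j"
  have W: "opn ?W" using sf_open[OF f(1)] open_cdom j by auto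
  let ?S = "coords M i ` (?W \<inter> cdom M i)"
  have S: "open_coord (mdim M) ?S" using open_coords_image[OF W] i by blast
  have pS: "coords M i p \<in> ?S" using f i j by auto
  have "pderiv_at a (\<lambda>x. f (param M i x)) (coords M i p) =
      pderiv_at a (\<lambda>x. f (param M j (coords M j (param M i x)))) (coords M i p)"
    by (rule pderiv_at_cong[OF S _ pS a]) (use i j in auto)
  also have "\<dots> = (\<Sum>b<mdim M. pderiv_at b (\<lambda>x. f (param M j x)) (coords M j (param M i (coords M i p))) *
      pderiv_at a (\<lambda>x. coords M j (param M i x) b) (coords M i p))"
    by (rule smooth_coord_pderiv_compose[OF sf_coordD[OF f(1)] S _ _ a pS])
      (use i j W smooth_transition_mono in auto)
  finally show ?thesis using i by (simp add: jac_def)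
qed

lemma tangentD:
  "v \<in> TS p \<Longrightarrow> chart_around M p i \<Longrightarrow> chart_around M p j \<Longrightarrow> b < mdim M \<Longrightarrow>
     v j b = (\<Sum>a<mdim M. jac i j p b a * v i a)"
  "v \<in> TS p \<Longrightarrow> \<not> chart_around M p i \<Longrightarrow> v i = 0"
  "v \<in> TS p \<Longrightarrow> b \<ge> mdim M \<Longrightarrow> v i b = 0"
  unfolding tangent_space_def jac_def topspace_Euclidean_space
  by (blast, blast, cases "chart_around M p i", auto)

lemma tangentI:
  assumes "\<And>i j b. \<lbrakk>chart_around M p i; chart_around M p j; b < mdim M\<rbrakk> \<Longrightarrow>
       v j b = (\<Sum>a<mdim M. jac i j p b a * v i a)"
    "\<And>i b. \<not> chart_around M p i \<or> b \<ge> mdim M \<Longrightarrow> v i b = 0"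
  shows "v \<in> TS p"
  unfolding tangent_space_def topspace_Euclidean_space jac_def[symmetric]
proof (intro CollectI conjI allI impI)
  show "v i b = 0" if "mdim M \<le> b" for i b using assms(2) that by blast
  show "v i = 0" if "\<not> chart_around M p i" for i by (rule ext) (use assms(2) that in auto)
qed (rule assms(1))

lemma subspace_TS: "subspace (TS p)"
  unfolding subspace_def
proof (intro conjI ballI allI)
  show "0 \<in> TS p" by (rule tangentI) auto
  fix v w assume v: "v \<in> TS p" and w: "w \<in> TS p"
  show "v + w \<in> TS p"
    by (rule tangentI)
      (use tangentD[OF v] tangentD[OF w] in \<open>auto simp: distrib_left sum.distrib\<close>)
next
  fix c v assume v: "v \<in> TS p"
  show "c *\<^sub>R v \<in> TS p"
  proof (rule tangentI)
    show "(c *\<^sub>R v) j b = (\<Sum>a<mdim M. jac i j p b a * (c *\<^sub>R v) i a)"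
      if "chart_around M p i" "chart_around M p j" "b < mdim M" for i j b
      using tangentD(1)[OF v that] by (simp add: sum_distrib_left mult.left_commute)
  qed (use tangentD[OF v] in auto)
qed

lemmas TS_add = subspace_add[OF subspace_TS] and TS_scale = subspace_scale[OF subspace_TS]
  and TS_diff = subspace_diff[OF subspace_TS] and TS_neg = subspace_neg[OF subspace_TS]
  and TS_zero = subspace_0[OF subspace_TS] and TS_sum = subspace_sum[OF subspace_TS]

lemma tangent_ext:
  assumes "v \<in> TS p" "w \<in> TS p" "chart_around M p i" "\<And>a. a < mdim M \<Longrightarrow> v i a = w i a"
  shows "v = w"
proof (intro ext)
  fix j b
  show "v j b = w j b"
  proof (cases "chart_around M p j \<and> b < mdim M")
    case True
    then show ?thesis using tangentD(1)[OF assms(1,3)] tangentD(1)[OF assms(2,3)] assms(4)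
      by (auto intro!: sum.cong)
  next
    case False
    then show ?thesis using tangentD(2,3)[OF assms(1)] tangentD(2,3)[OF assms(2)]
      by (metis not_le_imp_less zero_fun_apply)
  qed
qed

lemma dd_add_vec: "dd p (v + w) f = dd p v f + dd p w f"
  and dd_scale_vec: "dd p (c *\<^sub>R v) f = c * dd p v f"
  by (simp_all add: dirderiv_def Let_def distrib_right sum.distrib sum_distrib_left mult.assoc)

lemma dd_zero_vec: "dd p 0 f = 0"
  by (simp add: dirderiv_def)

text \<open>\<open>dirderiv\<close> uses a chart picked by choice. When f is rewritten in chart i,
  the chain rule produces the Jacobian that transforms the components of v, so every chart around p
  gives the same value.\<close>

lemma dd_chart:
  assumes f: "sf U f" "p \<in> U" and v: "v \<in> TS p" and i: "chart_around M p i"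
  shows "dd p v f = (\<Sum>a<mdim M. v i a * pderiv_at a (\<lambda>x. f (param M i x)) (coords M i p))"
proof -
  define j where "j = (SOME i. chart_around M p i)"
  have j: "chart_around M p j" unfolding j_def by (rule someI) (rule i)
  have "dd p v f = (\<Sum>a<mdim M. v j a * pderiv_at a (\<lambda>x. f (param M j x)) (coords M j p))"
    unfolding dirderiv_def Let_def j_def ..
  also have "\<dots> = (\<Sum>a<mdim M. \<Sum>b<mdim M. v j a * (pderiv_at b (\<lambda>x. f (param M i x)) (coords M i p) * jac j i p b a))"
    using pderiv_at_transition[OF f j i] by (simp add: sum_distrib_left)
  also have "\<dots> = (\<Sum>b<mdim M. \<Sum>a<mdim M. v j a * (pderiv_at b (\<lambda>x. f (param M i x)) (coords M i p) * jac j i p b a))"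
    by (rule sum.swap)
  also have "\<dots> = (\<Sum>b<mdim M. v i b * pderiv_at b (\<lambda>x. f (param M i x)) (coords M i p))"
    using tangentD(1)[OF v j i] by (simp add: sum_distrib_left sum_distrib_right mult_ac)
  finally show ?thesis .
qed

lemma dd_cong:
  assumes "opn W" "p \<in> W" "\<And>q. q \<in> W \<Longrightarrow> f q = g q"
  shows "dd p v f = dd p v g"
proof -
  have "p \<in> points M" using assms opn_subset by blast
  from some_chart[OF this] show ?thesis unfolding dirderiv_def Let_def
    using assms by (intro sum.cong refl arg_cong2[of _ _ _ _ "(*)"]
        pderiv_at_cong[OF open_coords_image[OF assms(1)]]) auto
qed

lemma dd_const: "dd p v (\<lambda>q. c) = 0"
  by (simp add: dirderiv_def)

lemma dd_add:
  assumes "sf U f" "sf U g" "p \<in> U" shows "dd p v (\<lambda>q. f q + g q) = dd p v f + dd p v g"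
proof -
  have "p \<in> points M" using assms sf_open opn_subset by blast
  note i = some_chart[OF this]
  show ?thesis unfolding dirderiv_def Let_def
    using i assms(3) pderiv_at_add[OF sf_coordD[OF assms(1)] sf_coordD[OF assms(2)]]
    by (simp add: distrib_left sum.distrib)
qed

lemma dd_mult:
  assumes "sf U f" "sf U g" "p \<in> U"
  shows "dd p v (\<lambda>q. f q * g q) = dd p v f * g p + f p * dd p v g"
proof -
  have "p \<in> points M" using assms sf_open opn_subset by blast
  note i = some_chart[OF this]
  show ?thesis unfolding dirderiv_def Let_def
    using i assms(3) pderiv_at_mult[OF sf_coordD[OF assms(1)] sf_coordD[OF assms(2)]]
    by (simp add: distrib_left sum.distrib sum_distrib_left sum_distrib_right mult_ac)
qed

lemma dd_cmult: "sf U f \<Longrightarrow> p \<in> U \<Longrightarrow> dd p v (\<lambda>q. c * f q) = c * dd p v f"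
  using dd_mult[OF sf_const[OF sf_open], of U f f p v c] by (simp add: dd_const)

lemma dd_uminus: "sf U f \<Longrightarrow> p \<in> U \<Longrightarrow> dd p v (\<lambda>q. - f q) = - dd p v f"
  using dd_cmult[of U f p v "-1"] by simp

lemma dd_diff: "sf U f \<Longrightarrow> sf U g \<Longrightarrow> p \<in> U \<Longrightarrow> dd p v (\<lambda>q. f q - g q) = dd p v f - dd p v g"
  using dd_add[OF _ sf_uminus, of U f g p v] dd_uminus[of U g p v] by simp

lemma dd_sum:
  assumes "opn U" "\<And>a. a \<in> A \<Longrightarrow> sf U (f a)" "p \<in> U"
  shows "dd p v (\<lambda>q. \<Sum>a\<in>A. f a q) = (\<Sum>a\<in>A. dd p v (f a))"
  using assms(2)
  by (induction A rule: infinite_finite_induct)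
    (auto simp: dd_const assms(1,3) sf_sum dd_add[of U])

lemma jac_self: "chart_around M p i \<Longrightarrow> a < mdim M \<Longrightarrow> jac i i p b a = (if a = b then 1 else 0)"
  unfolding jac_def
  by (subst pderiv_at_cong[OF open_coords_cdom[of i], of _ "\<lambda>x. x b"]) (auto simp: pderiv_at_coord)

lemma jac_cocycle:
  assumes "chart_around M p i" "chart_around M p j" "chart_around M p k" "a < mdim M"
  shows "jac i k p b a = (\<Sum>c<mdim M. jac j k p b c * jac i j p c a)"
  using pderiv_at_transition[OF sf_coord[of k b] _ assms(1,2,4)] assms(3) by (simp add: jac_def)

definition tvec_of :: "'i \<Rightarrow> 'p \<Rightarrow> (nat \<Rightarrow> real) \<Rightarrow> 'i tvec" where
  "tvec_of i p c = (\<lambda>j b. if chart_around M p j \<and> b < mdim M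
     then \<Sum>a<mdim M. jac i j p b a * c a else 0)"

text \<open>Components prescribed in chart i are transported to the other charts by Jacobians; their
  cocycle rule makes the resulting family a tangent vector.\<close>

lemma tvec_of_in: assumes i: "chart_around M p i" shows "tvec_of i p c \<in> TS p"
proof (rule tangentI)
  fix j k b assume j: "chart_around M p j" and k: "chart_around M p k" and b: "b < mdim M"
  have "(\<Sum>a<mdim M. jac j k p b a * tvec_of i p c j a) =
      (\<Sum>a<mdim M. \<Sum>d<mdim M. jac j k p b a * (jac i j p a d * c d))"
    using j by (simp add: tvec_of_def sum_distrib_left)
  also have "\<dots> = (\<Sum>d<mdim M. \<Sum>a<mdim M. jac j k p b a * (jac i j p a d * c d))" by (rule sum.swap)
  also have "\<dots> = (\<Sum>d<mdim M. jac i k p b d * c d)"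
    using jac_cocycle[OF i j k] by (simp add: sum_distrib_right mult.assoc)
  finally show "tvec_of i p c k b = (\<Sum>a<mdim M. jac j k p b a * tvec_of i p c j a)"
    using k b by (simp add: tvec_of_def)
qed (auto simp: tvec_of_def)

lemma tvec_of_comp: "chart_around M p i \<Longrightarrow> b < mdim M \<Longrightarrow> tvec_of i p c i b = c b"
  by (simp add: tvec_of_def jac_self if_distrib[of "\<lambda>r. r * _"] cong: if_cong)

text \<open>The coordinate field of chart i in direction a; only its values over the domain of i are
  meaningful.\<close>

definition cfield :: "'i \<Rightarrow> nat \<Rightarrow> ('p, 'i) vfield" where
  "cfield i a p = tvec_of i p (\<lambda>b. if b = a then 1 else 0)"

lemma cfield_in: "chart_around M p i \<Longrightarrow> cfield i a p \<in> TS p"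
  by (simp add: cfield_def tvec_of_in)

lemma cfield_self: "chart_around M p i \<Longrightarrow> b < mdim M \<Longrightarrow> cfield i a p i b = (if b = a then 1 else 0)"
  by (simp add: cfield_def tvec_of_comp)

lemma cfield_comp: "chart_around M p j \<Longrightarrow> a < mdim M \<Longrightarrow> b < mdim M \<Longrightarrow> cfield i a p j b = jac i j p b a"
  by (simp add: cfield_def tvec_of_def if_distrib[of "\<lambda>r. _ * r"] cong: if_cong)

lemma tvec_expand:
  assumes "v \<in> TS p" "chart_around M p i"
  shows "v = (\<Sum>a<mdim M. v i a *\<^sub>R cfield i a p)"
proof (rule tangent_ext[OF assms(1) _ assms(2)])
  show "(\<Sum>a<mdim M. v i a *\<^sub>R cfield i a p) \<in> TS p"
    by (intro TS_sum TS_scale cfield_in assms)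
  show "v i b = (\<Sum>a<mdim M. v i a *\<^sub>R cfield i a p) i b" if "b < mdim M" for b
    using that assms(2) by (simp add: sum_fun_apply cfield_self if_distrib[of "\<lambda>r. _ * r"] cong: if_cong)
qed

section \<open>Vector fields\<close>

lemma vf_open: "vf U X \<Longrightarrow> opn U" and vf_in: "vf U X \<Longrightarrow> p \<in> U \<Longrightarrow> X p \<in> TS p"
  unfolding vector_field_on_def by blast+

lemma vf_comp:
  assumes "vf U X" "i \<in> charts M" shows "sf (U \<inter> cdom M i) (\<lambda>q. X q i a)"
proof (cases "a < mdim M")
  case True
  have o: "opn (U \<inter> cdom M i)" using vf_open[OF assms(1)] open_cdom[OF assms(2)] by auto
  show ?thesis
    by (rule sf_chartI[OF assms(2) o]) (use assms True in \<open>auto simp: vector_field_on_def\<close>)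
next
  case False
  have o: "opn (U \<inter> cdom M i)" using vf_open[OF assms(1)] open_cdom[OF assms(2)] by auto
  show ?thesis
    by (rule sf_cong[OF sf_const[OF o, of 0]]) (use False tangentD(3) vf_in[OF assms(1)] in force)
qed

lemma vfI:
  assumes "opn U" "\<And>p. p \<in> U \<Longrightarrow> X p \<in> TS p"
    "\<And>i a. \<lbrakk>i \<in> charts M; a < mdim M\<rbrakk> \<Longrightarrow> sf (U \<inter> cdom M i) (\<lambda>q. X q i a)"
  shows "vf U X"
  unfolding vector_field_on_def
proof (intro conjI ballI allI impI)
  fix i a assume i: "i \<in> charts M" "a < mdim M"
  show "smooth_coord (mdim M) (coords M i ` (U \<inter> cdom M i)) (\<lambda>x. X (param M i x) i a)"
    using sf_coordD[OF assms(3)[OF i] i(1)] by (simp add: Int_assoc)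
qed (use assms in auto)

lemma vf_mono: assumes "vf U X" "opn V" "V \<subseteq> U" shows "vf V X"
proof (rule vfI[OF assms(2)])
  show "X p \<in> TS p" if "p \<in> V" for p using that assms(1,3) vf_in by blast
  show "sf (V \<inter> cdom M i) (\<lambda>q. X q i a)" if "i \<in> charts M" for i a
    by (rule sf_mono[OF vf_comp[OF assms(1) that]]) (use assms(2,3) open_cdom[OF that] in auto)
qed

lemma vf_cong: assumes "vf U X" "\<And>p. p \<in> U \<Longrightarrow> X p = Y p" shows "vf U Y"
proof (rule vfI[OF vf_open[OF assms(1)]])
  show "Y p \<in> TS p" if "p \<in> U" for p using that assms vf_in by metis
  show "sf (U \<inter> cdom M i) (\<lambda>q. Y q i a)" if "i \<in> charts M" for i a
    by (rule sf_cong[OF vf_comp[OF assms(1) that, of a]]) (use assms(2) in auto)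
qed

lemma vf_local: assumes "\<And>p. p \<in> U \<Longrightarrow> \<exists>W. p \<in> W \<and> W \<subseteq> U \<and> vf W X" shows "vf U X"
proof (rule vfI)
  show "opn U" using assms vf_open by (intro opn_local) blast
  show "X p \<in> TS p" if "p \<in> U" for p using assms[OF that] vf_in by blast
  show "sf (U \<inter> cdom M i) (\<lambda>q. X q i a)" if i: "i \<in> charts M" for i a
  proof (rule sf_local)
    fix p assume p: "p \<in> U \<inter> cdom M i"
    then obtain W where "p \<in> W" "W \<subseteq> U" "vf W X" using assms by blast
    then show "\<exists>W. p \<in> W \<and> W \<subseteq> U \<inter> cdom M i \<and> sf W (\<lambda>q. X q i a)"
      using vf_comp[of W X i a] i p by (intro exI[of _ "W \<inter> cdom M i"]) auto
  qed
qed

lemma vf_zero: "opn U \<Longrightarrow> vf U 0"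
  using open_cdom by (intro vfI) (auto intro: TS_zero sf_const)

lemma vf_add: assumes "vf U X" "vf U Y" shows "vf U (X + Y)"
proof (rule vfI[OF vf_open[OF assms(1)]])
  show "(X + Y) p \<in> TS p" if "p \<in> U" for p using that assms by (simp add: TS_add vf_in)
  show "sf (U \<inter> cdom M i) (\<lambda>q. (X + Y) q i a)" if "i \<in> charts M" for i a
    using sf_add[OF vf_comp[OF assms(1) that] vf_comp[OF assms(2) that]] by simp
qed

lemma vf_fscale: assumes "sf U f" "vf U X" shows "vf U (fscale f X)"
proof (rule vfI[OF vf_open[OF assms(2)]])
  show "fscale f X p \<in> TS p" if "p \<in> U" for p using that assms by (simp add: fscale_def TS_scale vf_in)
  show "sf (U \<inter> cdom M i) (\<lambda>q. fscale f X q i a)" if "i \<in> charts M" for i a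
    using sf_mult[OF sf_mono[OF assms(1)] vf_comp[OF assms(2) that], of a]
      sf_open[OF vf_comp[OF assms(2) that]] by (auto simp: fscale_def)
qed

lemma vf_sum: "opn U \<Longrightarrow> (\<And>a. a \<in> A \<Longrightarrow> vf U (X a)) \<Longrightarrow> vf U (\<Sum>a\<in>A. X a)"
  by (induction A rule: infinite_finite_induct) (auto intro: vf_zero vf_add)

lemma vf_uminus: "vf U X \<Longrightarrow> vf U (- X)"
  by (rule vf_cong[OF vf_fscale[OF sf_const[of U "-1"]]]) (auto simp: fscale_def vf_open)

lemma vf_diff: "vf U X \<Longrightarrow> vf U Y \<Longrightarrow> vf U (X - Y)"
  using vf_add[OF _ vf_uminus, of U X Y] by simp

lemma vf_lincomb:
  "opn U \<Longrightarrow> (\<And>a. a \<in> A \<Longrightarrow> sf U (f a)) \<Longrightarrow> (\<And>a. a \<in> A \<Longrightarrow> vf U (X a)) \<Longrightarrow>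
     vf U (\<lambda>p. \<Sum>a\<in>A. f a p *\<^sub>R X a p)"
  by (rule vf_cong[OF vf_sum[of U A "\<lambda>a. fscale (f a) (X a)"]])
    (auto simp: sum_fun_apply fscale_def intro: vf_fscale)

lemma cfield_vf: assumes i: "i \<in> charts M" and a: "a < mdim M" shows "vf (cdom M i) (cfield i a)"
proof (rule vfI[OF open_cdom[OF i]])
  show "cfield i a p \<in> TS p" if "p \<in> cdom M i" for p using that i by (simp add: cfield_in)
  fix j b assume j: "j \<in> charts M" and b: "b < mdim M"
  let ?W = "cdom M i \<inter> cdom M j"
  have W: "opn ?W" using open_cdom i j by auto
  show "sf ?W (\<lambda>q. cfield i a q j b)"
  proof (rule sf_chartI[OF i W])
    show "smooth_coord (mdim M) (coords M i ` ?W) (\<lambda>x. cfield i a (param M i x) j b)"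
      by (rule smooth_coord_cong[OF smooth_coord_pderiv[OF smooth_transition[OF i j b] a]])
        (use i j a b in \<open>auto simp: cfield_comp jac_def\<close>)
  qed auto
qed

text \<open>The extension has constant components in one chart.\<close>

lemma vec_extend:
  assumes "p \<in> points M" "v \<in> TS p"
  obtains U X where "p \<in> U" "vf U X" "X p = v"
proof -
  obtain i where i: "i \<in> charts M" "p \<in> cdom M i" using assms(1) by (rule chart_at)
  let ?X = "\<lambda>q. \<Sum>a<mdim M. v i a *\<^sub>R cfield i a q"
  have "vf (cdom M i) ?X"
    using vf_lincomb[OF open_cdom[OF i(1)], of "{..<mdim M}" "\<lambda>a p. v i a" "cfield i"]
      sf_const[OF open_cdom[OF i(1)]] cfield_vf[OF i(1)] by auto
  from i(2) this show thesis
    by (rule that) (use i tvec_expand[OF assms(2), of i] in simp)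
qed

lemma vf_points: "vf U X \<Longrightarrow> p \<in> U \<Longrightarrow> p \<in> points M"
  using vf_open opn_subset by blast

lemma dd_coord:
  assumes "v \<in> TS p" "chart_around M p i" "b < mdim M"
  shows "dd p v (\<lambda>q. coords M i q b) = v i b"
  using dd_chart[OF sf_coord[of i b] _ assms(1,2)] assms(2) jac_self[OF assms(2)] assms(3)
  by (simp add: jac_def if_distrib[of "\<lambda>r. _ * r"] cong: if_cong)

lemma sf_coord_fun:
  assumes i: "i \<in> charts M" and W: "opn W" "W \<subseteq> cdom M i"
    and h: "smooth_coord (mdim M) (coords M i ` W) h"
  shows "sf W (\<lambda>q. h (coords M i q))"
  by (rule sf_chartI[OF i W], rule smooth_coord_cong[OF h]) (use i W in auto)

lemma dd_sf: assumes X: "vf U X" and f: "sf U f" shows "sf U (\<lambda>p. dd p (X p) f)"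
proof (rule sf_local)
  fix p assume p: "p \<in> U"
  obtain i where i: "i \<in> charts M" "p \<in> cdom M i" using chart_at vf_points[OF X p] by metis
  let ?W = "U \<inter> cdom M i"
  have W: "opn ?W" using vf_open[OF X] open_cdom[OF i(1)] by auto
  have "sf ?W (\<lambda>q. \<Sum>a<mdim M. X q i a * pderiv_at a (\<lambda>x. f (param M i x)) (coords M i q))"
    by (intro sf_sum[OF W] sf_mult vf_comp[OF X i(1)] sf_coord_fun[OF i(1) W] smooth_coord_pderiv
        sf_coordD[OF f i(1)]) auto
  then have "sf ?W (\<lambda>p. dd p (X p) f)"
    by (rule sf_cong) (use i(1) vf_in[OF X] in \<open>auto simp: dd_chart[OF f]\<close>)
  then show "\<exists>W. p \<in> W \<and> W \<subseteq> U \<and> sf W (\<lambda>p. dd p (X p) f)" using p i by blast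
qed

text \<open>The second-order terms cancel by the symmetry of second derivatives.\<close>

lemma bracket_chart:
  assumes X: "vf U X" and Y: "vf U Y" and f: "sf U f" and p: "p \<in> U" and i: "chart_around M p i"
  shows "(\<Sum>b<mdim M. lie_bracket M X Y p i b * pderiv_at b (\<lambda>x. f (param M i x)) (coords M i p)) =
    dd p (X p) (\<lambda>q. dd q (Y q) f) - dd p (Y p) (\<lambda>q. dd q (X q) f)"
proof -
  let ?W = "U \<inter> cdom M i" and ?n = "mdim M"
  have ic: "i \<in> charts M" using i by blast
  have W: "opn ?W" "p \<in> ?W" using vf_open[OF X] open_cdom p i by auto
  define D where "D b q = pderiv_at b (\<lambda>x. f (param M i x)) (coords M i q)" for b q
  have smD: "smooth_coord ?n (coords M i ` ?W) (\<lambda>x. f (param M i x))" using sf_coordD[OF f ic] .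
  have D: "sf ?W (D b)" if "b < ?n" for b
    unfolding D_def using that by (intro sf_coord_fun[OF ic W(1)] smooth_coord_pderiv[OF smD]) auto
  have DD: "dd p v (D b) = (\<Sum>a<?n. v i a * pderiv_at a (pderiv_at b (\<lambda>x. f (param M i x))) (coords M i p))"
    if "b < ?n" "v \<in> TS p" for b v
    unfolding dd_chart[OF D[OF that(1)] W(2) that(2) i]
  proof (intro sum.cong refl arg_cong2[of _ _ _ _ "(*)"])
    fix a assume "a \<in> {..<?n}"
    then show "pderiv_at a (\<lambda>x. D b (param M i x)) (coords M i p) =
        pderiv_at a (pderiv_at b (\<lambda>x. f (param M i x))) (coords M i p)"
      by (intro pderiv_at_cong[OF open_coords_cdom[OF ic]]) (use i in \<open>auto simp: D_def\<close>)
  qed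
  have key: "dd p (X p) (\<lambda>q. dd q (Y q) f) = (\<Sum>b<?n. dd p (X p) (\<lambda>q. Y q i b) * D b p) +
      (\<Sum>b<?n. \<Sum>a<?n. Y p i b * X p i a * pderiv_at a (pderiv_at b (\<lambda>x. f (param M i x))) (coords M i p))"
    if X: "vf U X" and Y: "vf U Y" for X Y
  proof -
    have "dd p (X p) (\<lambda>q. dd q (Y q) f) = dd p (X p) (\<lambda>q. \<Sum>b<?n. Y q i b * D b q)"
      by (rule dd_cong[OF W]) (use ic vf_in[OF Y] in \<open>auto simp: dd_chart[OF f] D_def\<close>)
    also have "\<dots> = (\<Sum>b<?n. dd p (X p) (\<lambda>q. Y q i b * D b q))"
      using sf_mult[OF vf_comp[OF Y ic] D] by (intro dd_sum[OF W(1) _ W(2)]) auto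
    also have "\<dots> = (\<Sum>b<?n. dd p (X p) (\<lambda>q. Y q i b) * D b p + Y p i b * dd p (X p) (D b))"
      using dd_mult[OF vf_comp[OF Y ic] D W(2)] by (intro sum.cong refl) auto
    finally show ?thesis
      using DD vf_in[OF X p] by (simp add: sum.distrib sum_distrib_left mult.assoc)
  qed
  have "(\<Sum>b<?n. \<Sum>a<?n. Y p i b * X p i a * pderiv_at a (pderiv_at b (\<lambda>x. f (param M i x))) (coords M i p)) =
        (\<Sum>a<?n. \<Sum>b<?n. Y p i b * X p i a * pderiv_at a (pderiv_at b (\<lambda>x. f (param M i x))) (coords M i p))"
    by (rule sum.swap)
  also have "\<dots> = (\<Sum>b<?n. \<Sum>a<?n. X p i b * Y p i a * pderiv_at a (pderiv_at b (\<lambda>x. f (param M i x))) (coords M i p))"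
    using W(2) by (intro sum.cong refl) (simp add: smooth_coord_pderiv_commute[OF smD] mult.commute)
  finally show ?thesis
    using i unfolding key[OF X Y] key[OF Y X] lie_bracket_def D_def
    by (simp add: left_diff_distrib sum_subtractf)
qed

text \<open>The transformation law of the bracket is \<open>bracket_chart\<close> applied to the
  coordinate functions of the second chart.\<close>

lemma bracket_in: assumes X: "vf U X" and Y: "vf U Y" and p: "p \<in> U" shows "lie_bracket M X Y p \<in> TS p"
proof (rule tangentI)
  fix i j b assume i: "chart_around M p i" and j: "chart_around M p j" and b: "b < mdim M"
  let ?W = "U \<inter> cdom M j"
  have W: "opn ?W" "p \<in> ?W" using vf_open[OF X] open_cdom p j by auto
  have XW: "vf ?W X" and YW: "vf ?W Y" using X Y W vf_mono by auto
  have f: "sf ?W (\<lambda>q. coords M j q b)" using sf_mono[OF sf_coord W(1)] j by auto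
  have "(\<Sum>a<mdim M. lie_bracket M X Y p i a * jac i j p b a) =
    dd p (X p) (\<lambda>q. dd q (Y q) (\<lambda>q. coords M j q b)) - dd p (Y p) (\<lambda>q. dd q (X q) (\<lambda>q. coords M j q b))"
    unfolding jac_def by (rule bracket_chart[OF XW YW f W(2) i])
  moreover have "dd p (X p) (\<lambda>q. dd q (Y q) (\<lambda>q. coords M j q b)) = dd p (X p) (\<lambda>q. Y q j b)"
    by (rule dd_cong[OF W]) (use j b vf_in[OF Y] in \<open>auto simp: dd_coord\<close>)
  moreover have "dd p (Y p) (\<lambda>q. dd q (X q) (\<lambda>q. coords M j q b)) = dd p (Y p) (\<lambda>q. X q j b)"
    by (rule dd_cong[OF W]) (use j b vf_in[OF X] in \<open>auto simp: dd_coord\<close>)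
  ultimately show "lie_bracket M X Y p j b = (\<Sum>a<mdim M. jac i j p b a * lie_bracket M X Y p i a)"
    using j by (simp add: lie_bracket_def mult.commute)
next
  fix i b assume *: "\<not> chart_around M p i \<or> mdim M \<le> b"
  have "dd p v (\<lambda>q. X q i b) = 0" if "chart_around M p i" "vf U X" for v X
  proof -
    have "dd p v (\<lambda>q. X q i b) = dd p v (\<lambda>q. 0)"
      by (rule dd_cong[OF vf_open[OF that(2)] p]) (use * that tangentD(3) vf_in[OF that(2)] in blast)
    then show ?thesis by (simp add: dd_const)
  qed
  then show "lie_bracket M X Y p i b = 0" using X Y by (auto simp: lie_bracket_def)
qed

lemma bracket_dd:
  assumes "vf U X" "vf U Y" "sf U f" "p \<in> U"
  shows "dd p (lie_bracket M X Y p) f = dd p (X p) (\<lambda>q. dd q (Y q) f) - dd p (Y p) (\<lambda>q. dd q (X q) f)"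
proof -
  obtain i where i: "i \<in> charts M" "p \<in> cdom M i" using chart_at vf_points[OF assms(1,4)] by metis
  then show ?thesis
    using bracket_chart[OF assms] dd_chart[OF assms(3,4) bracket_in[OF assms(1,2,4)]] by auto
qed

lemma bracket_vf: assumes "vf U X" "vf U Y" shows "vf U (lie_bracket M X Y)"
proof (rule vfI[OF vf_open[OF assms(1)]])
  show "lie_bracket M X Y p \<in> TS p" if "p \<in> U" for p using assms that by (rule bracket_in)
  fix i a assume i: "i \<in> charts M"
  let ?W = "U \<inter> cdom M i"
  have W: "opn ?W" using vf_open[OF assms(1)] open_cdom[OF i] by auto
  have "sf ?W (\<lambda>q. dd q (X q) (\<lambda>q. Y q i a) - dd q (Y q) (\<lambda>q. X q i a))"
    by (intro sf_diff dd_sf vf_comp assms i vf_mono[OF assms(1) W] vf_mono[OF assms(2) W]) auto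
  then show "sf ?W (\<lambda>q. lie_bracket M X Y q i a)"
    by (rule sf_cong) (use i in \<open>auto simp: lie_bracket_def\<close>)
qed

lemma vf_comp_at:
  assumes "vf U X" "p \<in> U" "chart_around M p i"
  shows "opn (U \<inter> cdom M i)" "p \<in> U \<inter> cdom M i" "sf (U \<inter> cdom M i) (\<lambda>q. X q i a)"
  using assms vf_open[OF assms(1)] open_cdom vf_comp by auto

lemma bracket_antisym: "lie_bracket M X Y p = - lie_bracket M Y X p"
  by (auto simp: lie_bracket_def fun_eq_iff)

lemma bracket_add:
  assumes "vf U X" "vf U Y" "vf U Z" "p \<in> U"
  shows "lie_bracket M X (Y + Z) p = lie_bracket M X Y p + lie_bracket M X Z p"
proof (intro ext)
  fix i b
  show "lie_bracket M X (Y + Z) p i b = (lie_bracket M X Y p + lie_bracket M X Z p) i b"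
  proof (cases "chart_around M p i")
    case True
    note W = vf_comp_at[OF assms(2,4) True]
    have "dd p (X p) (\<lambda>q. (Y + Z) q i b) = dd p (X p) (\<lambda>q. Y q i b) + dd p (X p) (\<lambda>q. Z q i b)"
      using dd_add[OF W(3) vf_comp_at(3)[OF assms(3,4) True] W(2)] by simp
    then show ?thesis using dd_add_vec[of p "Y p" "Z p"] True by (simp add: lie_bracket_def)
  qed (auto simp: lie_bracket_def)
qed

lemma bracket_fscale:
  assumes "sf U f" "vf U X" "vf U Y" "p \<in> U"
  shows "lie_bracket M X (fscale f Y) p = dd p (X p) f *\<^sub>R Y p + f p *\<^sub>R lie_bracket M X Y p"
proof (intro ext)
  fix i b
  show "lie_bracket M X (fscale f Y) p i b = (dd p (X p) f *\<^sub>R Y p + f p *\<^sub>R lie_bracket M X Y p) i b"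
  proof (cases "chart_around M p i")
    case True
    note W = vf_comp_at[OF assms(3,4) True]
    have "dd p (X p) (\<lambda>q. fscale f Y q i b) = dd p (X p) f * Y p i b + f p * dd p (X p) (\<lambda>q. Y q i b)"
      using dd_mult[OF sf_mono[OF assms(1) W(1)] W(3) W(2), of "X p" b] by (simp add: fscale_def)
    then show ?thesis using True
      by (simp add: lie_bracket_def fscale_def dd_scale_vec algebra_simps)
  next
    case False
    then show ?thesis using tangentD(2)[OF vf_in[OF assms(3,4)] False] by (auto simp: lie_bracket_def)
  qed
qed

lemma bracket_add1:
  assumes "vf U X" "vf U Y" "vf U Z" "p \<in> U"
  shows "lie_bracket M (X + Y) Z p = lie_bracket M X Z p + lie_bracket M Y Z p"
  unfolding bracket_antisym[of "X + Y"] bracket_add[OF assms(3,1,2,4)]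
  by (simp add: bracket_antisym[of X] bracket_antisym[of Y])

lemma bracket_fscale1:
  assumes "sf U f" "vf U X" "vf U Y" "p \<in> U"
  shows "lie_bracket M (fscale f X) Y p = f p *\<^sub>R lie_bracket M X Y p - dd p (Y p) f *\<^sub>R X p"
  using bracket_fscale[OF assms(1,3,2,4)] bracket_antisym[of Y X p]
  by (subst bracket_antisym) simp

section \<open>Tensorial maps and connections\<close>

text \<open>Linearity over smooth functions, tested at the single point p on local fields. Such a
  map depends only on the value of the field at p (\<open>tensorial_cong\<close>), which turns maps
  on fields into maps on tangent vectors. A general codomain covers forms and vector-valued maps
  alike.\<close>

definition tensorial_at :: "'p \<Rightarrow> (('p, 'i) vfield \<Rightarrow> 'b::real_vector) \<Rightarrow> bool" where
  "tensorial_at p \<Phi> \<longleftrightarrow>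
     (\<forall>U X Y. p \<in> U \<longrightarrow> vf U X \<longrightarrow> vf U Y \<longrightarrow> \<Phi> (X + Y) = \<Phi> X + \<Phi> Y) \<and>
     (\<forall>U f X. p \<in> U \<longrightarrow> sf U f \<longrightarrow> vf U X \<longrightarrow> \<Phi> (fscale f X) = f p *\<^sub>R \<Phi> X)"

lemma tensorialI:
  assumes "\<And>U X Y. p \<in> U \<Longrightarrow> vf U X \<Longrightarrow> vf U Y \<Longrightarrow> \<Phi> (X + Y) = \<Phi> X + \<Phi> Y"
    "\<And>U f X. p \<in> U \<Longrightarrow> sf U f \<Longrightarrow> vf U X \<Longrightarrow> \<Phi> (fscale f X) = f p *\<^sub>R \<Phi> X"
  shows "tensorial_at p \<Phi>"
  using assms unfolding tensorial_at_def by blast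

lemma tensorial_add: "tensorial_at p \<Phi> \<Longrightarrow> p \<in> U \<Longrightarrow> vf U X \<Longrightarrow> vf U Y \<Longrightarrow> \<Phi> (X + Y) = \<Phi> X + \<Phi> Y"
  and tensorial_fscale: "tensorial_at p \<Phi> \<Longrightarrow> p \<in> U \<Longrightarrow> sf U f \<Longrightarrow> vf U X \<Longrightarrow> \<Phi> (fscale f X) = f p *\<^sub>R \<Phi> X"
  unfolding tensorial_at_def by blast+

lemma tensorial_sum:
  assumes "tensorial_at p \<Phi>" "p \<in> U" "opn U" "\<And>a. a \<in> A \<Longrightarrow> vf U (X a)"
  shows "\<Phi> (\<Sum>a\<in>A. X a) = (\<Sum>a\<in>A. \<Phi> (X a))"
proof -
  have "\<Phi> (fscale (\<lambda>q. 0) 0) = 0 *\<^sub>R \<Phi> 0"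
    using tensorial_fscale[OF assms(1,2) sf_const[OF assms(3), of 0] vf_zero[OF assms(3)]] by simp
  moreover have "fscale (\<lambda>q. 0) (0 :: ('p, 'i) vfield) = 0" by (auto simp: fscale_def fun_eq_iff)
  ultimately have zero: "\<Phi> 0 = 0" by simp
  show ?thesis using assms(4)
    by (induction A rule: infinite_finite_induct)
      (auto simp: zero tensorial_add[OF assms(1,2)] vf_sum[OF assms(3)])
qed

text \<open>Multiplication by the indicator function of a small open set turns an identity between the
  values of two fields near a point into an identity between fields.\<close>

lemma sf_indicator: "opn W \<Longrightarrow> sf W (indicator W :: 'p \<Rightarrow> real)"
  by (rule sf_cong[OF sf_const[of W 1]]) auto

lemma tensorial_expand:
  assumes \<Phi>: "tensorial_at p \<Phi>" and X: "vf U X" "p \<in> U" and i: "chart_around M p i"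
  shows "\<Phi> X = (\<Sum>a<mdim M. X p i a *\<^sub>R \<Phi> (cfield i a))"
proof -
  let ?W = "U \<inter> cdom M i"
  let ?f = "\<lambda>a q. indicator ?W q * X q i a"
  note W = vf_comp_at[OF X i]
  have ic: "i \<in> charts M" using i by blast
  \<comment> \<open>Both sides vanish off \<open>?W\<close>, so this is an equality of fields
    everywhere and \<Phi> may be applied to it.\<close>
  have eq: "fscale (indicator ?W) X = (\<Sum>a<mdim M. fscale (?f a) (cfield i a))"
  proof (rule ext)
    fix q
    show "fscale (indicator ?W) X q = (\<Sum>a<mdim M. fscale (?f a) (cfield i a)) q"
      using tvec_expand[OF vf_in[OF X(1), of q], of i] ic
      by (cases "q \<in> ?W") (auto simp: fscale_def sum_fun_apply)
  qed
  have f: "sf ?W (?f a)" for a using W by (intro sf_mult sf_indicator) auto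
  have c: "vf ?W (cfield i a)" if "a < mdim M" for a using vf_mono[OF cfield_vf[OF ic that] W(1)] by auto
  have "\<Phi> X = \<Phi> (fscale (indicator ?W) X)"
    using tensorial_fscale[OF \<Phi> W(2) sf_indicator[OF W(1)] vf_mono[OF X(1) W(1)]] W(2) by simp
  also have "\<dots> = (\<Sum>a<mdim M. \<Phi> (fscale (?f a) (cfield i a)))"
    unfolding eq using vf_fscale[OF f c] by (intro tensorial_sum[OF \<Phi> W(2) W(1)]) auto
  also have "\<dots> = (\<Sum>a<mdim M. X p i a *\<^sub>R \<Phi> (cfield i a))"
    using tensorial_fscale[OF \<Phi> W(2) f c] W(2) by (intro sum.cong) auto
  finally show ?thesis .
qed

lemma tensorial_cong:
  assumes "tensorial_at p \<Phi>" "vf U X" "p \<in> U" "vf V Y" "p \<in> V" "X p = Y p"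
  shows "\<Phi> X = \<Phi> Y"
proof -
  obtain i where "i \<in> charts M" "p \<in> cdom M i" using chart_at vf_points[OF assms(2,3)] by metis
  then show ?thesis using tensorial_expand[OF assms(1-3)] tensorial_expand[OF assms(1,4,5)] assms(6) by auto
qed

end

section \<open>Connections and their locality\<close>

locale conn_mfd = smooth_mfd M for M :: "('p, 'i) manifold" +
  fixes nab :: "('p, 'i) conn"
  assumes conn: "connection M nab"
begin

lemma nab_vf: "vf U X \<Longrightarrow> vf U Y \<Longrightarrow> vf U (nab X Y)"
  and nab_add1: "vf U X \<Longrightarrow> vf U X' \<Longrightarrow> vf U Y \<Longrightarrow> p \<in> U \<Longrightarrow> nab (X + X') Y p = nab X Y p + nab X' Y p"
  and nab_add2: "vf U X \<Longrightarrow> vf U Y \<Longrightarrow> vf U Y' \<Longrightarrow> p \<in> U \<Longrightarrow> nab X (Y + Y') p = nab X Y p + nab X Y' p"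
  and nab_fscale1: "sf U f \<Longrightarrow> vf U X \<Longrightarrow> vf U Y \<Longrightarrow> p \<in> U \<Longrightarrow> nab (fscale f X) Y p = f p *\<^sub>R nab X Y p"
  and nab_fscale2: "sf U f \<Longrightarrow> vf U X \<Longrightarrow> vf U Y \<Longrightarrow> p \<in> U \<Longrightarrow>
     nab X (fscale f Y) p = dd p (X p) f *\<^sub>R Y p + f p *\<^sub>R nab X Y p"
proof -
  note c = conn[unfolded connection_def]
  note c2 = c[THEN conjunct2] note c3 = c2[THEN conjunct2] note c4 = c3[THEN conjunct2]
  show "vf U X \<Longrightarrow> vf U Y \<Longrightarrow> vf U (nab X Y)"
    by (rule c[THEN conjunct1, rule_format])
  show "vf U X \<Longrightarrow> vf U X' \<Longrightarrow> vf U Y \<Longrightarrow> p \<in> U \<Longrightarrow> nab (X + X') Y p = nab X Y p + nab X' Y p"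
    by (rule c2[THEN conjunct1, rule_format])
  show "vf U X \<Longrightarrow> vf U Y \<Longrightarrow> vf U Y' \<Longrightarrow> p \<in> U \<Longrightarrow> nab X (Y + Y') p = nab X Y p + nab X Y' p"
    by (rule c3[THEN conjunct1, rule_format])
  show "sf U f \<Longrightarrow> vf U X \<Longrightarrow> vf U Y \<Longrightarrow> p \<in> U \<Longrightarrow> nab (fscale f X) Y p = f p *\<^sub>R nab X Y p"
    by (rule c4[THEN conjunct1, rule_format])
  show "sf U f \<Longrightarrow> vf U X \<Longrightarrow> vf U Y \<Longrightarrow> p \<in> U \<Longrightarrow>
     nab X (fscale f Y) p = dd p (X p) f *\<^sub>R Y p + f p *\<^sub>R nab X Y p"
    by (rule c4[THEN conjunct2, rule_format])
qed

lemma nab_in: "vf U X \<Longrightarrow> vf U Y \<Longrightarrow> p \<in> U \<Longrightarrow> nab X Y p \<in> TS p"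
  using nab_vf vf_in by blast

lemma nab_tensorial1:
  assumes "vf U Y" "p \<in> U" shows "tensorial_at p (\<lambda>X. nab X Y p)"
proof (rule tensorialI)
  fix V X X' assume V: "p \<in> V" "vf V X" "vf V X'"
  have o: "opn (U \<inter> V)" using vf_open assms V by auto
  show "nab (X + X') Y p = nab X Y p + nab X' Y p"
    by (rule nab_add1[of "U \<inter> V"]) (use V assms o in \<open>auto intro: vf_mono\<close>)
next
  fix V f X assume V: "p \<in> V" "sf V f" "vf V X"
  have o: "opn (U \<inter> V)" using vf_open assms V by auto
  show "nab (fscale f X) Y p = f p *\<^sub>R nab X Y p"
    by (rule nab_fscale1[of "U \<inter> V"]) (use V assms o in \<open>auto intro: vf_mono sf_mono\<close>)
qed

text \<open>The indicator of U is smooth on U with derivative 0 there, so by the Leibniz rule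
  multiplying a field by it changes nothing at p; after multiplication the two fields coincide
  everywhere.\<close>

lemma nab_local:
  assumes "vf U X" "vf U Y" "vf U Y'" "p \<in> U" "\<And>q. q \<in> U \<Longrightarrow> Y q = Y' q"
  shows "nab X Y p = nab X Y' p"
proof -
  have o: "opn U" using assms vf_open by blast
  have "dd p (X p) (indicator U) = dd p (X p) (\<lambda>q. 1)"
    by (rule dd_cong[OF o assms(4)]) auto
  then have "nab X (fscale (indicator U) Z) p = nab X Z p" if "vf U Z" for Z
    using nab_fscale2[OF sf_indicator[OF o] assms(1) that assms(4)] assms(4) by (simp add: dd_const)
  moreover have "fscale (indicator U) Y = fscale (indicator U) Y'"
    using assms(5) by (auto simp: fscale_def fun_eq_iff indicator_def)
  ultimately show ?thesis using assms(2,3) by metis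
qed

lemma nab_sum2:
  assumes "opn U" "vf U X" "\<And>a. a \<in> A \<Longrightarrow> vf U (Y a)" "p \<in> U" "finite A"
  shows "nab X (\<Sum>a\<in>A. Y a) p = (\<Sum>a\<in>A. nab X (Y a) p)"
  using assms(5,3)
proof (induction A rule: finite_induct)
  case empty
  have "nab X (0 + 0) p = nab X 0 p + nab X 0 p"
    using nab_add2[OF assms(2) vf_zero[OF assms(1)] vf_zero[OF assms(1)] assms(4)] .
  then have "nab X 0 p = 0" by simp
  then show ?case unfolding sum.empty .
next
  case (insert a A)
  then have "nab X (Y a + (\<Sum>a\<in>A. Y a)) p = nab X (Y a) p + nab X (\<Sum>a\<in>A. Y a) p"
    by (intro nab_add2[OF assms(2) _ vf_sum[OF assms(1)] assms(4)]) auto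
  moreover have "nab X (\<Sum>a\<in>A. Y a) p = (\<Sum>a\<in>A. nab X (Y a) p)" using insert by blast
  ultimately show ?case unfolding sum.insert[OF insert(1,2)] by (simp only:)
qed

lemma nab_lincomb:
  assumes U: "vf U X" "p \<in> U" "finite A" and f: "\<And>a. a \<in> A \<Longrightarrow> sf U (f a)" and Y: "\<And>a. a \<in> A \<Longrightarrow> vf U (Y a)"
    and Z: "vf U Z" "\<And>q. q \<in> U \<Longrightarrow> Z q = (\<Sum>a\<in>A. f a q *\<^sub>R Y a q)"
  shows "nab X Z p = (\<Sum>a\<in>A. dd p (X p) (f a) *\<^sub>R Y a p + f a p *\<^sub>R nab X (Y a) p)"
proof -
  have o: "opn U" using vf_open[OF U(1)] .
  have "nab X Z p = nab X (\<Sum>a\<in>A. fscale (f a) (Y a)) p"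
    by (rule nab_local[OF U(1) Z(1) vf_sum[OF o vf_fscale[OF f Y]] U(2)])
      (auto simp: Z(2) sum_fun_apply fscale_def)
  also have "\<dots> = (\<Sum>a\<in>A. nab X (fscale (f a) (Y a)) p)"
    using vf_fscale[OF f Y] by (intro nab_sum2[OF o U(1) _ U(2,3)]) auto
  also have "\<dots> = (\<Sum>a\<in>A. dd p (X p) (f a) *\<^sub>R Y a p + f a p *\<^sub>R nab X (Y a) p)"
    using nab_fscale2[OF f U(1) Y U(2)] by (intro sum.cong refl)
  finally show ?thesis .
qed

end

section \<open>Orthonormal frames and the Levi-Civita connection\<close>

context smooth_mfd
begin

text \<open>Linearity on the subspace \<open>TS p\<close> alone, since metrics and bundle maps are
  unconstrained on the other elements of the type.\<close>

definition lin :: "'p \<Rightarrow> ('i tvec \<Rightarrow> 'b::real_vector) \<Rightarrow> bool" where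
  "lin p \<phi> \<longleftrightarrow> (\<forall>x\<in>TS p. \<forall>y\<in>TS p. \<phi> (x + y) = \<phi> x + \<phi> y) \<and> (\<forall>c. \<forall>x\<in>TS p. \<phi> (c *\<^sub>R x) = c *\<^sub>R \<phi> x)"

lemma linI:
  "(\<And>x y. x \<in> TS p \<Longrightarrow> y \<in> TS p \<Longrightarrow> \<phi> (x + y) = \<phi> x + \<phi> y) \<Longrightarrow>
   (\<And>c x. x \<in> TS p \<Longrightarrow> \<phi> (c *\<^sub>R x) = c *\<^sub>R \<phi> x) \<Longrightarrow> lin p \<phi>"
  unfolding lin_def by blast

lemma lin_add: "lin p \<phi> \<Longrightarrow> x \<in> TS p \<Longrightarrow> y \<in> TS p \<Longrightarrow> \<phi> (x + y) = \<phi> x + \<phi> y"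
  and lin_scale: "lin p \<phi> \<Longrightarrow> x \<in> TS p \<Longrightarrow> \<phi> (c *\<^sub>R x) = c *\<^sub>R \<phi> x"
  unfolding lin_def by blast+

lemma lin_zero: "lin p \<phi> \<Longrightarrow> \<phi> 0 = 0"
  using lin_scale[OF _ TS_zero, of p \<phi> 0] by simp

lemma lin_neg: "lin p \<phi> \<Longrightarrow> x \<in> TS p \<Longrightarrow> \<phi> (- x) = - \<phi> x"
  using lin_scale[of p \<phi> x "-1"] by simp

lemma lin_diff: "lin p \<phi> \<Longrightarrow> x \<in> TS p \<Longrightarrow> y \<in> TS p \<Longrightarrow> \<phi> (x - y) = \<phi> x - \<phi> y"
  using lin_add[of p \<phi> x "- y"] lin_neg[of p \<phi> y] TS_neg[of y p] by simp

lemma lin_sum: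
  assumes "lin p \<phi>" "\<And>a. a \<in> A \<Longrightarrow> x a \<in> TS p"
  shows "\<phi> (\<Sum>a\<in>A. x a) = (\<Sum>a\<in>A. \<phi> (x a))"
  using assms(2)
proof (induction A rule: infinite_finite_induct)
  case (insert a A)
  then have "\<phi> (x a + (\<Sum>a\<in>A. x a)) = \<phi> (x a) + \<phi> (\<Sum>a\<in>A. x a)"
    by (intro lin_add[OF assms(1)] TS_sum) auto
  moreover have "\<phi> (\<Sum>a\<in>A. x a) = (\<Sum>a\<in>A. \<phi> (x a))" using insert by blast
  ultimately show ?case unfolding sum.insert[OF insert(1,2)] by (simp only:)
qed (simp_all only: sum.infinite sum.empty lin_zero[OF assms(1)] not_False_eq_True)

lemma lin_lincomb:
  assumes "lin p \<phi>" "\<And>a. a \<in> A \<Longrightarrow> x a \<in> TS p"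
  shows "\<phi> (\<Sum>a\<in>A. c a *\<^sub>R x a) = (\<Sum>a\<in>A. c a *\<^sub>R \<phi> (x a))"
  using lin_sum[OF assms(1), of A "\<lambda>a. c a *\<^sub>R x a"] assms(2) lin_scale[OF assms(1)] TS_scale by simp

lemma lin_plus: "lin p \<phi> \<Longrightarrow> lin p \<psi> \<Longrightarrow> lin p (\<lambda>x. \<phi> x + \<psi> x)"
  by (rule linI) (auto simp: lin_add lin_scale scaleR_add_right)

lemma lin_cmult: "lin p \<phi> \<Longrightarrow> lin p (\<lambda>x. c *\<^sub>R \<phi> x)"
  by (rule linI) (auto simp: lin_add lin_scale scaleR_add_right)

lemma lin_minus: "lin p \<phi> \<Longrightarrow> lin p \<psi> \<Longrightarrow> lin p (\<lambda>x. \<phi> x - \<psi> x)"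
  using lin_plus[OF _ lin_cmult[of p \<psi> "-1"], of \<phi>] by simp

lemma lin_sum_fun: "(\<And>a. a \<in> A \<Longrightarrow> lin p (\<phi> a)) \<Longrightarrow> lin p (\<lambda>x. \<Sum>a\<in>A. \<phi> a x)"
  unfolding lin_def scaleR_sum_right sum.distrib[symmetric] by (auto intro!: sum.cong)

text \<open>An arbitrary smooth local field through v, used to evaluate tensorial maps on
  vectors.\<close>

definition extend :: "'p \<Rightarrow> 'i tvec \<Rightarrow> ('p, 'i) vfield" where
  "extend p v = (SOME X. \<exists>U. p \<in> U \<and> vf U X \<and> X p = v)"

lemma extend:
  assumes "p \<in> points M" "v \<in> TS p"
  obtains U where "p \<in> U" "vf U (extend p v)" "extend p v p = v"
proof -
  have "\<exists>X U. p \<in> U \<and> vf U X \<and> X p = v" using vec_extend[OF assms] by metis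
  from someI_ex[OF this] show thesis using that unfolding extend_def[symmetric] by blast
qed

lemma common_domain:
  assumes "vf U X" "p \<in> U" "vf V Y" "p \<in> V"
  obtains W where "p \<in> W" "vf W X" "vf W Y" "W \<subseteq> U" "W \<subseteq> V"
proof
  have o: "opn (U \<inter> V)" using assms vf_open by auto
  show "p \<in> U \<inter> V" "vf (U \<inter> V) X" "vf (U \<inter> V) Y" using assms o vf_mono by auto
qed auto

lemma tensorial_lin:
  assumes "tensorial_at p \<Phi>" "p \<in> points M"
  shows "lin p (\<lambda>x. \<Phi> (extend p x))"
proof (rule linI)
  fix x y assume x: "x \<in> TS p" and y: "y \<in> TS p"
  obtain U where U: "p \<in> U" "vf U (extend p x)" "extend p x p = x" using extend[OF assms(2) x] .
  obtain V where V: "p \<in> V" "vf V (extend p y)" "extend p y p = y" using extend[OF assms(2) y] .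
  obtain W where W: "p \<in> W" "vf W (extend p x)" "vf W (extend p y)" using common_domain[OF U(2,1) V(2,1)] .
  obtain Q where Q: "p \<in> Q" "vf Q (extend p (x + y))" "extend p (x + y) p = x + y"
    using extend[OF assms(2) TS_add[OF x y]] .
  have "\<Phi> (extend p (x + y)) = \<Phi> (extend p x + extend p y)"
    by (rule tensorial_cong[OF assms(1) Q(2,1) vf_add[OF W(2,3)] W(1)]) (use U V Q in simp)
  then show "\<Phi> (extend p (x + y)) = \<Phi> (extend p x) + \<Phi> (extend p y)"
    using tensorial_add[OF assms(1) W] by simp
next
  fix c x assume x: "x \<in> TS p"
  obtain U where U: "p \<in> U" "vf U (extend p x)" "extend p x p = x" using extend[OF assms(2) x] .
  obtain Q where Q: "p \<in> Q" "vf Q (extend p (c *\<^sub>R x))" "extend p (c *\<^sub>R x) p = c *\<^sub>R x"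
    using extend[OF assms(2) TS_scale[OF x]] .
  have s: "sf U (\<lambda>q. c)" using sf_const vf_open U by blast
  have "\<Phi> (extend p (c *\<^sub>R x)) = \<Phi> (fscale (\<lambda>q. c) (extend p x))"
    by (rule tensorial_cong[OF assms(1) Q(2,1) vf_fscale[OF s U(2)] U(1)]) (use U Q in \<open>simp add: fscale_def\<close>)
  then show "\<Phi> (extend p (c *\<^sub>R x)) = c *\<^sub>R \<Phi> (extend p x)"
    using tensorial_fscale[OF assms(1) U(1) s U(2)] by simp
qed

end

section \<open>Metrics, orthonormal frames and duality\<close>

locale riem_mfd = smooth_mfd M for M :: "('p, 'i) manifold" +
  fixes g :: "('p, 'i) metric_tensor"
  assumes metric: "riemannian_metric M g"
begin

lemma g_sym: "p \<in> points M \<Longrightarrow> x \<in> TS p \<Longrightarrow> y \<in> TS p \<Longrightarrow> g p x y = g p y x"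
  using metric unfolding riemannian_metric_def by blast

lemma g_lin1: "p \<in> points M \<Longrightarrow> y \<in> TS p \<Longrightarrow> lin p (\<lambda>x. g p x y)"
  using metric unfolding riemannian_metric_def by (intro linI) auto

lemma g_lin2: assumes "p \<in> points M" "x \<in> TS p" shows "lin p (\<lambda>y. g p x y)"
proof (rule linI)
  show "g p x (y + z) = g p x y + g p x z" if "y \<in> TS p" "z \<in> TS p" for y z
    using lin_add[OF g_lin1[OF assms] that] g_sym[OF assms] that TS_add by simp
  show "g p x (c *\<^sub>R y) = c *\<^sub>R g p x y" if "y \<in> TS p" for c y
    using lin_scale[OF g_lin1[OF assms] that] g_sym[OF assms] that TS_scale by simp
qed

lemma g_pos: "p \<in> points M \<Longrightarrow> x \<in> TS p \<Longrightarrow> x \<noteq> 0 \<Longrightarrow> g p x x > 0"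
  using metric unfolding riemannian_metric_def by blast

lemma g_sf: "vf U X \<Longrightarrow> vf U Y \<Longrightarrow> sf U (\<lambda>p. g p (X p) (Y p))"
  by (rule metric[unfolded riemannian_metric_def, THEN conjunct2, rule_format])

lemma g_nondegenerate:
  assumes "p \<in> points M" "x \<in> TS p" "y \<in> TS p" "\<And>z. z \<in> TS p \<Longrightarrow> g p x z = g p y z"
  shows "x = y"
proof (rule ccontr)
  assume "x \<noteq> y"
  then have "g p (x - y) (x - y) > 0" using assms by (intro g_pos) (auto intro: TS_diff)
  moreover have "g p (x - y) (x - y) = 0"
    using lin_diff[OF g_lin1[OF assms(1) TS_diff[OF assms(2,3)]] assms(2,3)] assms(4) TS_diff[OF assms(2,3)] by simp
  ultimately show False by simp
qed

definition onb :: "'p \<Rightarrow> (nat \<Rightarrow> 'i tvec) \<Rightarrow> bool" where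
  "onb p E \<longleftrightarrow> (\<forall>a<mdim M. E a \<in> TS p) \<and>
     (\<forall>a<mdim M. \<forall>b<mdim M. g p (E a) (E b) = (if a = b then 1 else 0))"

text \<open>Orthogonal vectors of nonzero square are independent, and the \<open>mdim M\<close>
  coordinate vectors of a chart span the tangent space.\<close>

lemma orthogonal_bound:
  assumes p: "p \<in> points M" and F: "\<And>a. a < m \<Longrightarrow> F a \<in> TS p"
    and orth: "\<And>a b. a < m \<Longrightarrow> b < m \<Longrightarrow> a \<noteq> b \<Longrightarrow> g p (F a) (F b) = 0"
    and nz: "\<And>a. a < m \<Longrightarrow> g p (F a) (F a) \<noteq> 0"
  shows "m \<le> mdim M"
proof -
  obtain i where i: "i \<in> charts M" "p \<in> cdom M i" using p by (rule chart_at)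
  have inj: "inj_on F {..<m}"
    by (rule inj_onI) (use orth nz in fastforce)
  have "independent (F ` {..<m})"
  proof (rule independent_if_scalars_zero)
    fix f x assume s: "(\<Sum>x\<in>F ` {..<m}. f x *\<^sub>R x) = 0" and x: "x \<in> F ` {..<m}"
    then obtain b where b: "b < m" "x = F b" by auto
    have "(\<Sum>a<m. f (F a) *\<^sub>R F a) = 0" using s by (simp add: sum.reindex[OF inj])
    then have "0 = g p (\<Sum>a<m. f (F a) *\<^sub>R F a) (F b)"
      using lin_zero[OF g_lin1[OF p F[OF b(1)]]] by simp
    also have "\<dots> = (\<Sum>a<m. f (F a) * g p (F a) (F b))"
      using lin_lincomb[OF g_lin1[OF p F[OF b(1)]], of "{..<m}" F "\<lambda>a. f (F a)"] F by simp
    also have "\<dots> = (\<Sum>a<m. if a = b then f (F b) * g p (F b) (F b) else 0)"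
      using orth b(1) by (intro sum.cong) auto
    finally show "f x = 0" using nz b by simp
  qed simp
  moreover have "F ` {..<m} \<subseteq> span ((\<lambda>a. cfield i a p) ` {..<mdim M})"
  proof
    fix x assume "x \<in> F ` {..<m}"
    then have "x \<in> TS p" using F by auto
    then have "x = (\<Sum>a<mdim M. x i a *\<^sub>R cfield i a p)" using tvec_expand i by blast
    moreover have "(\<Sum>a<mdim M. x i a *\<^sub>R cfield i a p) \<in> span ((\<lambda>a. cfield i a p) ` {..<mdim M})"
      by (intro span_sum span_scale span_base) auto
    ultimately show "x \<in> span ((\<lambda>a. cfield i a p) ` {..<mdim M})" by simp
  qed
  ultimately have "card (F ` {..<m}) \<le> card ((\<lambda>a. cfield i a p) ` {..<mdim M})"
    using independent_span_bound by blast
  also have "\<dots> \<le> mdim M" using card_image_le[of "{..<mdim M}"] by simp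
  finally show ?thesis by (simp add: card_image inj)
qed

text \<open>A nonzero remainder could be appended to E and would give \<open>mdim M\<close> + 1
  orthogonal vectors of nonzero square.\<close>

lemma onb_expand:
  assumes p: "p \<in> points M" and E: "onb p E" and x: "x \<in> TS p"
  shows "x = (\<Sum>a<mdim M. g p x (E a) *\<^sub>R E a)"
proof (rule ccontr)
  let ?s = "\<Sum>a<mdim M. g p x (E a) *\<^sub>R E a"
  assume ne: "x \<noteq> ?s"
  have E': "E a \<in> TS p" if "a < mdim M" for a using E that by (simp add: onb_def)
  have s: "?s \<in> TS p" by (intro TS_sum TS_scale E') auto
  have y: "x - ?s \<in> TS p" using x s by (rule TS_diff)
  have o: "g p (x - ?s) (E b) = 0" if b: "b < mdim M" for b
  proof -
    have "g p ?s (E b) = (\<Sum>a<mdim M. g p x (E a) * g p (E a) (E b))"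
      using lin_lincomb[OF g_lin1[OF p E'[OF b]], of "{..<mdim M}" E] E' by simp
    also have "\<dots> = (\<Sum>a<mdim M. if a = b then g p x (E b) else 0)"
      using E b unfolding onb_def by (intro sum.cong) auto
    finally have "g p ?s (E b) = g p x (E b)" using b by simp
    then show ?thesis using lin_diff[OF g_lin1[OF p E'[OF b]] x s] by simp
  qed
  let ?F = "\<lambda>a. if a < mdim M then E a else x - ?s"
  have pos: "g p (x - ?s) (x - ?s) > 0" using ne y p by (intro g_pos) auto
  have "Suc (mdim M) \<le> mdim M"
  proof (rule orthogonal_bound[OF p, of _ ?F])
    show "g p (?F a) (?F b) = 0" if "a < Suc (mdim M)" "b < Suc (mdim M)" "a \<noteq> b" for a b
      using that E o g_sym[OF p y E'] by (auto simp: onb_def)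
    show "g p (?F a) (?F a) \<noteq> 0" for a using E pos by (auto simp: onb_def)
  qed (use E' y in auto)
  then show False by simp
qed

definition bilin :: "'p \<Rightarrow> ('i tvec \<Rightarrow> 'i tvec \<Rightarrow> 'b::real_vector) \<Rightarrow> bool" where
  "bilin p B \<longleftrightarrow> (\<forall>x\<in>TS p. lin p (B x)) \<and> (\<forall>y\<in>TS p. lin p (\<lambda>x. B x y))"

text \<open>Expanding the first argument of B(E a, E a) in F, and the second argument of B(F b, F b)
  in E, leads to the same double sum. Traces over the arbitrarily chosen \<open>frame_at\<close>
  thus become computable in any orthonormal basis.\<close>

lemma trace_onb:
  assumes p: "p \<in> points M" and E: "onb p E" and F: "onb p F" and B: "bilin p B"
  shows "(\<Sum>a<mdim M. B (E a) (E a)) = (\<Sum>a<mdim M. B (F a) (F a))"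
proof -
  let ?n = "mdim M"
  have E': "E a \<in> TS p" if "a < ?n" for a using E that by (simp add: onb_def)
  have F': "F a \<in> TS p" if "a < ?n" for a using F that by (simp add: onb_def)
  have 1: "B (E a) (E a) = (\<Sum>b<?n. g p (E a) (F b) *\<^sub>R B (F b) (E a))" if a: "a < ?n" for a
  proof -
    have "lin p (\<lambda>x. B x (E a))" using B E'[OF a] by (simp add: bilin_def)
    from lin_lincomb[OF this, of "{..<?n}" F "\<lambda>b. g p (E a) (F b)"] show ?thesis
      using F' onb_expand[OF p F E'[OF a]] by simp
  qed
  have 2: "B (F b) (F b) = (\<Sum>a<?n. g p (F b) (E a) *\<^sub>R B (F b) (E a))" if b: "b < ?n" for b
  proof -
    have "lin p (B (F b))" using B F'[OF b] by (simp add: bilin_def)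
    from lin_lincomb[OF this, of "{..<?n}" E "\<lambda>a. g p (F b) (E a)"] show ?thesis
      using E' onb_expand[OF p E F'[OF b]] by simp
  qed
  have "(\<Sum>a<?n. B (E a) (E a)) = (\<Sum>a<?n. \<Sum>b<?n. g p (E a) (F b) *\<^sub>R B (F b) (E a))"
    using 1 by (intro sum.cong) auto
  also have "\<dots> = (\<Sum>b<?n. \<Sum>a<?n. g p (E a) (F b) *\<^sub>R B (F b) (E a))" by (rule sum.swap)
  also have "\<dots> = (\<Sum>b<?n. B (F b) (F b))"
    using 2 g_sym[OF p E' F'] by (intro sum.cong refl) simp
  finally show ?thesis .
qed

text \<open>Gram--Schmidt, one vector at a time; at each step some coordinate vector is not in the span
  of the vectors found so far.\<close>

lemma partial_frame:
  assumes p: "p \<in> points M" and k: "k \<le> mdim M"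
  shows "\<exists>U E. opn U \<and> p \<in> U \<and> (\<forall>a<k. vf U (E a)) \<and>
     (\<forall>q\<in>U. \<forall>a<k. \<forall>b<k. g q (E a q) (E b q) = (if a = b then 1 else 0))"
  using k
proof (induction k)
  case 0
  obtain i where i: "i \<in> charts M" "p \<in> cdom M i" using p by (rule chart_at)
  then show ?case using open_cdom by auto
next
  case (Suc k)
  then obtain U E where U: "opn U" "p \<in> U" and E: "\<forall>a<k. vf U (E a)"
    and on: "\<forall>q\<in>U. \<forall>a<k. \<forall>b<k. g q (E a q) (E b q) = (if a = b then 1 else 0)" by auto
  obtain i where i: "i \<in> charts M" "p \<in> cdom M i" using p by (rule chart_at)
  let ?V = "U \<inter> cdom M i"
  have V: "opn ?V" "p \<in> ?V" using U i open_cdom by auto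
  have EV: "vf ?V (E a)" if "a < k" for a using E that V vf_mono by blast
  have ET: "E a q \<in> TS q" if "a < k" "q \<in> ?V" for a q using EV[OF that(1)] that(2) vf_in by blast
  define w where "w c q = cfield i c q - (\<Sum>a<k. g q (cfield i c q) (E a q) *\<^sub>R E a q)" for c q
  have c: "vf ?V (cfield i c)" if "c < mdim M" for c using vf_mono[OF cfield_vf[OF i(1) that] V(1)] by auto
  have wV: "vf ?V (w c)" if "c < mdim M" for c
  proof (rule vf_cong)
    show "vf ?V (cfield i c - (\<lambda>q. \<Sum>a<k. g q (cfield i c q) (E a q) *\<^sub>R E a q))"
      by (intro vf_diff c[OF that] vf_lincomb V g_sf EV) auto
  qed (simp add: w_def)
  have "\<exists>c<mdim M. w c p \<noteq> 0"
  proof (rule ccontr)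
    assume "\<not> ?thesis"
    then have w0: "cfield i c p = (\<Sum>a<k. g p (cfield i c p) (E a p) *\<^sub>R E a p)" if "c < mdim M" for c
      using that by (simp add: w_def)
    have cs: "cfield i a p i b = (if b = a then 1 else 0)" if "b < mdim M" for a b
      using that i by (simp add: cfield_self)
    have inj: "inj_on (\<lambda>a. cfield i a p) {..<mdim M}"
    proof (rule inj_onI)
      fix a b assume "a \<in> {..<mdim M}" "b \<in> {..<mdim M}" "cfield i a p = cfield i b p"
      then show "a = b" using cs[of a a] cs[of a b] by (auto split: if_splits)
    qed
    have "independent ((\<lambda>a. cfield i a p) ` {..<mdim M})"
    proof (rule independent_if_scalars_zero)
      fix f x assume s: "(\<Sum>x\<in>(\<lambda>a. cfield i a p) ` {..<mdim M}. f x *\<^sub>R x) = 0"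
        and x: "x \<in> (\<lambda>a. cfield i a p) ` {..<mdim M}"
      then obtain b where b: "b < mdim M" "x = cfield i b p" by auto
      have "(\<Sum>a<mdim M. f (cfield i a p) *\<^sub>R cfield i a p) i b = 0"
        using s by (simp add: sum.reindex[OF inj])
      then show "f x = 0" using b cs[OF b(1)] 
        by (simp add: sum_fun_apply if_distrib[of "\<lambda>r. _ * r"] cong: if_cong)
    qed simp
    moreover have "(\<lambda>a. cfield i a p) ` {..<mdim M} \<subseteq> span ((\<lambda>a. E a p) ` {..<k})"
    proof
      fix x assume "x \<in> (\<lambda>a. cfield i a p) ` {..<mdim M}"
      then obtain c where c: "c < mdim M" "x = cfield i c p" by auto
      have "(\<Sum>a<k. g p (cfield i c p) (E a p) *\<^sub>R E a p) \<in> span ((\<lambda>a. E a p) ` {..<k})"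
        by (intro span_sum span_scale span_base) auto
      then show "x \<in> span ((\<lambda>a. E a p) ` {..<k})" using w0[OF c(1)] c(2) by simp
    qed
    ultimately have "card ((\<lambda>a. cfield i a p) ` {..<mdim M}) \<le> card ((\<lambda>a. E a p) ` {..<k})"
      using independent_span_bound[of "(\<lambda>a. E a p) ` {..<k}"] by blast
    also have "\<dots> \<le> k" using card_image_le[of "{..<k}"] by simp
    finally show False using Suc.prems by (simp add: card_image inj)
  qed
  then obtain c where c: "c < mdim M" "w c p \<noteq> 0" by blast
  \<comment> \<open>The residual is known to be nonzero at p only. On the open set where its square
    is positive it can be normalised by a smooth function.\<close>
  let ?W = "{q \<in> ?V. g q (w c q) (w c q) > 0}"
  have W: "opn ?W" using sf_pos_open[OF g_sf[OF wV[OF c(1)] wV[OF c(1)]]] .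
  have pW: "p \<in> ?W" using V(2) g_pos[OF p vf_in[OF wV[OF c(1)] V(2)] c(2)] by simp
  have wW: "vf ?W (w c)" using vf_mono[OF wV[OF c(1)] W] by auto
  have EW: "vf ?W (E a)" if "a < k" for a using vf_mono[OF EV[OF that] W] by auto
  define r where "r q = inverse (sqrt (g q (w c q) (w c q)))" for q
  have r: "sf ?W r" unfolding r_def
    by (intro sf_inverse sf_sqrt g_sf wW) (auto simp: less_imp_neq[symmetric])
  define E' where "E' a = (if a < k then E a else fscale r (w c))" for a
  have "vf ?W (E' a)" for a using EW vf_fscale[OF r wW] by (simp add: E'_def)
  moreover have "g q (E' a q) (E' b q) = (if a = b then 1 else 0)"
    if q: "q \<in> ?W" and ab: "a < Suc k" "b < Suc k" for q a b
  proof -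
    have qp: "q \<in> points M" using q W opn_subset by blast
    have wT: "w c q \<in> TS q" using vf_in[OF wW q] .
    have cT: "cfield i c q \<in> TS q" using q i by (auto intro: cfield_in)
    have ET': "E a q \<in> TS q" if "a < k" for a using ET that q by auto
    have orth: "g q (w c q) (E b q) = 0" if b: "b < k" for b
    proof -
      let ?s = "\<Sum>a<k. g q (cfield i c q) (E a q) *\<^sub>R E a q"
      have s: "?s \<in> TS q" by (intro TS_sum TS_scale ET') auto
      have "g q ?s (E b q) = (\<Sum>a<k. g q (cfield i c q) (E a q) * g q (E a q) (E b q))"
        using lin_lincomb[OF g_lin1[OF qp ET'[OF b]], of "{..<k}" "\<lambda>a. E a q"] ET' by simp
      also have "\<dots> = (\<Sum>a<k. if a = b then g q (cfield i c q) (E b q) else 0)"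
        using on q b by (intro sum.cong) auto
      finally show ?thesis using lin_diff[OF g_lin1[OF qp ET'[OF b]] cT s] b by (simp add: w_def)
    qed
    have orth2: "g q (r q *\<^sub>R w c q) (E b q) = 0" "g q (E b q) (r q *\<^sub>R w c q) = 0" if "b < k" for b
      using lin_scale[OF g_lin1[OF qp ET'[OF that]] wT, of "r q"] orth[OF that]
        g_sym[OF qp ET'[OF that] TS_scale[OF wT]] by auto
    have pos: "g q (w c q) (w c q) > 0" using q by simp
    have "g q (r q *\<^sub>R w c q) (r q *\<^sub>R w c q) = r q * (r q * g q (w c q) (w c q))"
      using lin_scale[OF g_lin1[OF qp TS_scale[OF wT]] wT] lin_scale[OF g_lin2[OF qp wT] wT] by simp
    also have "\<dots> = 1" using pos by (simp add: r_def field_simps flip: real_sqrt_mult)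
    finally have unit: "g q (r q *\<^sub>R w c q) (r q *\<^sub>R w c q) = 1" .
    show ?thesis
      using ab on q orth2 unit by (auto simp: E'_def fscale_def less_Suc_eq)
  qed
  ultimately show ?case using W pW by blast
qed

lemma frame_exists:
  assumes "p \<in> points M"
  shows "\<exists>E U. opn U \<and> p \<in> U \<and> orthonormal_frame_on M g U E"
  using partial_frame[OF assms order_refl] unfolding orthonormal_frame_on_def by blast

lemma frame_at:
  assumes "p \<in> points M"
  obtains U where "opn U" "p \<in> U" "orthonormal_frame_on M g U (frame_at M g p)"
  using someI_ex[OF frame_exists[OF assms]] unfolding frame_at_def[symmetric] by blast

lemma frame_onb: "orthonormal_frame_on M g U E \<Longrightarrow> q \<in> U \<Longrightarrow> onb q (\<lambda>a. E a q)"
  unfolding orthonormal_frame_on_def onb_def using vf_in by blast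

abbreviation fr :: "'p \<Rightarrow> nat \<Rightarrow> 'i tvec" where "fr p a \<equiv> frame_at M g p a p"

lemma fr_onb: "p \<in> points M \<Longrightarrow> onb p (fr p)"
  using frame_at[of p] frame_onb by metis

lemma fr_in: "p \<in> points M \<Longrightarrow> a < mdim M \<Longrightarrow> fr p a \<in> TS p"
  using fr_onb by (simp add: onb_def)

text \<open>Near each point X is the combination of a smooth orthonormal frame with coefficients
  g(X, E a). Smoothness of vectors built with \<open>riesz\<close> is obtained in this way, since
  the formula of \<open>riesz\<close> uses a frame chosen anew at every point.\<close>

lemma vf_of_pairing:
  assumes U: "opn U" and X: "\<And>p. p \<in> U \<Longrightarrow> X p \<in> TS p"
    and sm: "\<And>V Z. vf V Z \<Longrightarrow> V \<subseteq> U \<Longrightarrow> sf V (\<lambda>q. g q (X q) (Z q))"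
  shows "vf U X"
proof (rule vf_local)
  fix p assume p: "p \<in> U"
  then have pM: "p \<in> points M" using U opn_subset by blast
  then obtain V E where V: "opn V" "p \<in> V" "orthonormal_frame_on M g V E"
    using frame_exists by blast
  let ?W = "U \<inter> V"
  have W: "opn ?W" using U V by auto
  have E: "vf ?W (E a)" if "a < mdim M" for a
    using V(3) that unfolding orthonormal_frame_on_def by (auto intro: vf_mono[OF _ W])
  have "vf ?W (\<lambda>q. \<Sum>a<mdim M. g q (X q) (E a q) *\<^sub>R E a q)"
    by (intro vf_lincomb W sm E) auto
  then have "vf ?W X"
  proof (rule vf_cong)
    fix q assume q: "q \<in> ?W"
    then have "q \<in> points M" using W opn_subset by blast
    from onb_expand[OF this frame_onb[OF V(3)] X] q
    show "(\<Sum>a<mdim M. g q (X q) (E a q) *\<^sub>R E a q) = X q" by auto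
  qed
  then show "\<exists>W. p \<in> W \<and> W \<subseteq> U \<and> vf W X" using p V(2) by blast
qed

text \<open>The vector that represents a linear form \<phi> with respect to g; by
  \<open>riesz_eqI\<close> it does not depend on the frame.\<close>

definition riesz :: "'p \<Rightarrow> ('i tvec \<Rightarrow> real) \<Rightarrow> 'i tvec" where
  "riesz p \<phi> = (\<Sum>a<mdim M. \<phi> (fr p a) *\<^sub>R fr p a)"

lemma riesz_in: "p \<in> points M \<Longrightarrow> riesz p \<phi> \<in> TS p"
  unfolding riesz_def by (intro TS_sum TS_scale fr_in) auto

lemma g_riesz:
  assumes p: "p \<in> points M" and \<phi>: "lin p \<phi>" and z: "z \<in> TS p"
  shows "g p (riesz p \<phi>) z = \<phi> z"
proof -
  have "g p (riesz p \<phi>) z = (\<Sum>a<mdim M. \<phi> (fr p a) * g p (fr p a) z)"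
    unfolding riesz_def
    using lin_lincomb[OF g_lin1[OF p z], of "{..<mdim M}" "fr p" "\<lambda>a. \<phi> (fr p a)"] fr_in[OF p] by simp
  also have "\<dots> = (\<Sum>a<mdim M. g p z (fr p a) * \<phi> (fr p a))"
    using g_sym[OF p _ z] fr_in[OF p] by (simp add: mult.commute)
  also have "\<dots> = \<phi> (\<Sum>a<mdim M. g p z (fr p a) *\<^sub>R fr p a)"
    using lin_lincomb[OF \<phi>, of "{..<mdim M}" "fr p" "\<lambda>a. g p z (fr p a)"] fr_in[OF p] by simp
  also have "\<dots> = \<phi> z" using onb_expand[OF p fr_onb[OF p] z] by simp
  finally show ?thesis .
qed

lemma riesz_eqI:
  "p \<in> points M \<Longrightarrow> lin p \<phi> \<Longrightarrow> w \<in> TS p \<Longrightarrow> (\<And>z. z \<in> TS p \<Longrightarrow> g p w z = \<phi> z) \<Longrightarrow> w = riesz p \<phi>"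
  by (rule g_nondegenerate[OF _ _ riesz_in]) (auto simp: g_riesz)

end

section \<open>The covariant derivative of the metric on an affine-Riemann manifold\<close>

locale affr = fixes M :: "('p, 'i) manifold" and nab :: "('p, 'i) conn" and g :: "('p, 'i) metric_tensor"
  assumes aff: "affine_riemann M nab g"

sublocale affr \<subseteq> conn_mfd M nab
  using aff by unfold_locales (auto simp: affine_riemann_def smooth_manifold_iff)

sublocale affr \<subseteq> riem_mfd M g
  using aff by unfold_locales (auto simp: affine_riemann_def smooth_manifold_iff)

context affr
begin

lemma torsion: "vf U X \<Longrightarrow> vf U Y \<Longrightarrow> p \<in> U \<Longrightarrow> nab X Y p - nab Y X p = lie_bracket M X Y p"
  using aff unfolding affine_riemann_def torsion_free_def by blast

lemma flat:
  assumes "vf U X" "vf U Y" "vf U Z" "p \<in> U"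
  shows "nab (lie_bracket M X Y) Z p = nab X (nab Y Z) p - nab Y (nab X Z) p"
proof -
  have "flat_connection M nab" using aff by (simp add: affine_riemann_def)
  then have "nab (lie_bracket M X Y) Z p - nab X (nab Y Z) p + nab Y (nab X Z) p = 0"
    using assms unfolding flat_connection_def curvature_def by blast
  then have "nab (lie_bracket M X Y) Z p + nab Y (nab X Z) p = nab X (nab Y Z) p"
    by (simp only: diff_add_eq right_minus_eq)
  then show ?thesis by (simp only: eq_diff_eq)
qed

text \<open>The covariant derivative \<open>(\<nabla>\<^sub>X g)(Y, Z)\<close>; the whole proof is phrased in terms of it instead of \<open>\<gamma>\<close>.\<close>

definition Cf :: "('p, 'i) vfield \<Rightarrow> ('p, 'i) vfield \<Rightarrow> ('p, 'i) vfield \<Rightarrow> 'p \<Rightarrow> real" where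
  "Cf X Y Z p = dd p (X p) (\<lambda>q. g q (Y q) (Z q)) - g p (nab X Y p) (Z p) - g p (Y p) (nab X Z p)"

lemma Cf_sym:
  assumes "vf U X" "vf U Y" "vf U Z" "p \<in> U" shows "Cf X Y Z p = Cf X Z Y p"
proof -
  have pM: "p \<in> points M" using vf_points assms by blast
  have "dd p (X p) (\<lambda>q. g q (Y q) (Z q)) = dd p (X p) (\<lambda>q. g q (Z q) (Y q))"
    by (rule dd_cong[OF vf_open[OF assms(1)] assms(4)])
      (use g_sym vf_points[OF assms(1)] vf_in assms in blast)
  moreover have "g p (nab X Y p) (Z p) = g p (Z p) (nab X Y p)" "g p (Y p) (nab X Z p) = g p (nab X Z p) (Y p)"
    using g_sym[OF pM] nab_in assms vf_in by blast+
  ultimately show ?thesis by (simp add: Cf_def)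
qed

lemma Cf_tensorial1:
  assumes "vf U Y" "vf U Z" "p \<in> U" shows "tensorial_at p (\<lambda>X. Cf X Y Z p)"
proof (rule tensorialI)
  have pM: "p \<in> points M" using vf_points assms by blast
  note Yp = vf_in[OF assms(1,3)] and Zp = vf_in[OF assms(2,3)]
  fix V X X' assume V: "p \<in> V" "vf V X" "vf V X'"
  obtain W where W: "p \<in> W" "vf W X" "vf W Y" "W \<subseteq> V" "W \<subseteq> U" using common_domain[OF V(2,1) assms(1,3)] .
  note o = vf_open[OF W(2)]
  have X': "vf W X'" and Z: "vf W Z" using vf_mono o W V assms by blast+
  note n = nab_in[OF W(2) W(3) W(1)] nab_in[OF X' W(3) W(1)] nab_in[OF W(2) Z W(1)] nab_in[OF X' Z W(1)]
  show "Cf (X + X') Y Z p = Cf X Y Z p + Cf X' Y Z p"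
    using nab_add1[OF W(2) X' W(3) W(1)] nab_add1[OF W(2) X' Z W(1)] n
      lin_add[OF g_lin1[OF pM Zp]] lin_add[OF g_lin2[OF pM Yp]]
    by (simp add: Cf_def dd_add_vec)
next
  have pM: "p \<in> points M" using vf_points assms by blast
  note Yp = vf_in[OF assms(1,3)] and Zp = vf_in[OF assms(2,3)]
  fix V f X assume V: "p \<in> V" "sf V f" "vf V X"
  obtain W where W: "p \<in> W" "vf W X" "vf W Y" "W \<subseteq> V" "W \<subseteq> U" using common_domain[OF V(3,1) assms(1,3)] .
  note o = vf_open[OF W(2)]
  have f: "sf W f" and Z: "vf W Z" using sf_mono vf_mono o W V assms by blast+
  note n = nab_in[OF W(2) W(3) W(1)] nab_in[OF W(2) Z W(1)]
  show "Cf (fscale f X) Y Z p = f p *\<^sub>R Cf X Y Z p"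
    using nab_fscale1[OF f W(2) W(3) W(1)] nab_fscale1[OF f W(2) Z W(1)] n
      lin_scale[OF g_lin1[OF pM Zp]] lin_scale[OF g_lin2[OF pM Yp]]
    by (simp add: Cf_def fscale_def dd_scale_vec algebra_simps)
qed

lemma Cf_tensorial2:
  assumes "vf U X" "vf U Z" "p \<in> U" shows "tensorial_at p (\<lambda>Y. Cf X Y Z p)"
proof (rule tensorialI)
  have pM: "p \<in> points M" using vf_points assms by blast
  note Xp = vf_in[OF assms(1,3)] and Zp = vf_in[OF assms(2,3)]
  fix V Y Y' assume V: "p \<in> V" "vf V Y" "vf V Y'"
  obtain W where W: "p \<in> W" "vf W Y" "vf W X" "W \<subseteq> V" "W \<subseteq> U" using common_domain[OF V(2,1) assms(1,3)] .
  note o = vf_open[OF W(2)]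
  have Y': "vf W Y'" and Z: "vf W Z" using vf_mono o W V assms by blast+
  note n = nab_in[OF W(3) W(2) W(1)] nab_in[OF W(3) Y' W(1)] nab_in[OF W(3) Z W(1)]
    vf_in[OF W(2,1)] vf_in[OF Y' W(1)]
  have "dd p (X p) (\<lambda>q. g q ((Y + Y') q) (Z q)) = dd p (X p) (\<lambda>q. g q (Y q) (Z q) + g q (Y' q) (Z q))"
  proof (rule dd_cong[OF o W(1)])
    fix q assume q: "q \<in> W"
    show "g q ((Y + Y') q) (Z q) = g q (Y q) (Z q) + g q (Y' q) (Z q)"
      using lin_add[OF g_lin1[OF vf_points[OF Z q] vf_in[OF Z q]] vf_in[OF W(2) q] vf_in[OF Y' q]] by simp
  qed
  then have "dd p (X p) (\<lambda>q. g q ((Y + Y') q) (Z q)) =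
      dd p (X p) (\<lambda>q. g q (Y q) (Z q)) + dd p (X p) (\<lambda>q. g q (Y' q) (Z q))"
    using dd_add[OF g_sf[OF W(2) Z] g_sf[OF Y' Z] W(1)] by simp
  then show "Cf X (Y + Y') Z p = Cf X Y Z p + Cf X Y' Z p"
    using nab_add2[OF W(3) W(2) Y' W(1)] n
      lin_add[OF g_lin1[OF pM Zp]] lin_add[OF g_lin1[OF pM n(3)]]
    by (simp add: Cf_def)
next
  have pM: "p \<in> points M" using vf_points assms by blast
  note Xp = vf_in[OF assms(1,3)] and Zp = vf_in[OF assms(2,3)]
  fix V f Y assume V: "p \<in> V" "sf V f" "vf V Y"
  obtain W where W: "p \<in> W" "vf W Y" "vf W X" "W \<subseteq> V" "W \<subseteq> U" using common_domain[OF V(3,1) assms(1,3)] .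
  note o = vf_open[OF W(2)]
  have f: "sf W f" and Z: "vf W Z" using sf_mono vf_mono o W V assms by blast+
  note n = nab_in[OF W(3) W(2) W(1)] nab_in[OF W(3) Z W(1)] vf_in[OF W(2,1)]
  have "dd p (X p) (\<lambda>q. g q (fscale f Y q) (Z q)) = dd p (X p) (\<lambda>q. f q * g q (Y q) (Z q))"
  proof (rule dd_cong[OF o W(1)])
    fix q assume q: "q \<in> W"
    show "g q (fscale f Y q) (Z q) = f q * g q (Y q) (Z q)"
      using lin_scale[OF g_lin1[OF vf_points[OF Z q] vf_in[OF Z q]] vf_in[OF W(2) q]] by (simp add: fscale_def)
  qed
  then have "dd p (X p) (\<lambda>q. g q (fscale f Y q) (Z q)) =
      dd p (X p) f * g p (Y p) (Z p) + f p * dd p (X p) (\<lambda>q. g q (Y q) (Z q))"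
    using dd_mult[OF f g_sf[OF W(2) Z] W(1)] by simp
  then show "Cf X (fscale f Y) Z p = f p *\<^sub>R Cf X Y Z p"
    using nab_fscale2[OF f W(3) W(2) W(1)] n TS_scale
      lin_add[OF g_lin1[OF pM Zp]] lin_scale[OF g_lin1[OF pM Zp]] lin_scale[OF g_lin1[OF pM n(2)]]
    by (simp add: Cf_def fscale_def algebra_simps)
qed

text \<open>The tensor behind \<open>Cf\<close>, as a function of tangent vectors;
  \<open>Ct_Cf\<close> removes the arbitrary extensions.\<close>

definition Ct :: "'p \<Rightarrow> 'i tvec \<Rightarrow> 'i tvec \<Rightarrow> 'i tvec \<Rightarrow> real" where
  "Ct p x y z = Cf (extend p x) (extend p y) (extend p z) p"

text \<open>The fields are exchanged one at a time by tensoriality; for the third one, symmetry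
  moves it to the second slot and back.\<close>

lemma Cf_cong:
  assumes "vf U X" "vf U Y" "vf U Z" "p \<in> U" "vf V X'" "vf V Y'" "vf V Z'" "p \<in> V"
    "X p = X' p" "Y p = Y' p" "Z p = Z' p"
  shows "Cf X Y Z p = Cf X' Y' Z' p"
proof -
  obtain W where W: "p \<in> W" "vf W X" "vf W X'" "W \<subseteq> U" "W \<subseteq> V" using common_domain[OF assms(1,4,5,8)] .
  note o = vf_open[OF W(2)]
  have w: "vf W Y" "vf W Z" "vf W Y'" "vf W Z'" using vf_mono o W assms by blast+
  have "Cf X Y Z p = Cf X' Y Z p" by (rule tensorial_cong[OF Cf_tensorial1[OF w(1,2) W(1)] W(2,1) W(3,1)]) fact
  also have "\<dots> = Cf X' Y' Z p" by (rule tensorial_cong[OF Cf_tensorial2[OF W(3) w(2) W(1)] w(1) W(1) w(3) W(1)]) fact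
  also have "\<dots> = Cf X' Z Y' p" by (rule Cf_sym[OF W(3) w(3,2) W(1)])
  also have "\<dots> = Cf X' Z' Y' p" by (rule tensorial_cong[OF Cf_tensorial2[OF W(3) w(3) W(1)] w(2) W(1) w(4) W(1)]) fact
  also have "\<dots> = Cf X' Y' Z' p" by (rule Cf_sym[OF W(3) w(4,3) W(1)])
  finally show ?thesis .
qed

lemma extend3:
  assumes "p \<in> points M" "x \<in> TS p" "y \<in> TS p" "z \<in> TS p"
  obtains U where "p \<in> U" "vf U (extend p x)" "vf U (extend p y)" "vf U (extend p z)"
    "extend p x p = x" "extend p y p = y" "extend p z p = z"
proof -
  obtain U where U: "p \<in> U" "vf U (extend p x)" "extend p x p = x" using extend[OF assms(1,2)] .
  obtain V where V: "p \<in> V" "vf V (extend p y)" "extend p y p = y" using extend[OF assms(1,3)] .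
  obtain Q where Q: "p \<in> Q" "vf Q (extend p z)" "extend p z p = z" using extend[OF assms(1,4)] .
  have o: "opn (U \<inter> V \<inter> Q)" using U V Q vf_open by auto
  show thesis
    by (rule that[of "U \<inter> V \<inter> Q"]) (use U V Q o in \<open>auto intro: vf_mono\<close>)
qed

lemma Ct_Cf:
  assumes "vf U X" "vf U Y" "vf U Z" "p \<in> U"
  shows "Ct p (X p) (Y p) (Z p) = Cf X Y Z p"
proof -
  obtain V where V: "p \<in> V" "vf V (extend p (X p))" "vf V (extend p (Y p))" "vf V (extend p (Z p))"
    "extend p (X p) p = X p" "extend p (Y p) p = Y p" "extend p (Z p) p = Z p"
    by (rule extend3[OF vf_points[OF assms(1,4)] vf_in[OF assms(1,4)] vf_in[OF assms(2,4)] vf_in[OF assms(3,4)]])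
  show ?thesis unfolding Ct_def by (rule Cf_cong[OF V(2-4,1) assms V(5-7)])
qed

lemma Ct_sym: assumes "p \<in> points M" "x \<in> TS p" "y \<in> TS p" "z \<in> TS p" shows "Ct p x y z = Ct p x z y"
proof -
  obtain U where "p \<in> U" "vf U (extend p x)" "vf U (extend p y)" "vf U (extend p z)"
    by (rule extend3[OF assms])
  then show ?thesis unfolding Ct_def by (intro Cf_sym)
qed

lemma Ct_lin1: assumes "p \<in> points M" "y \<in> TS p" "z \<in> TS p" shows "lin p (\<lambda>x. Ct p x y z)"
proof -
  obtain U where "p \<in> U" "vf U (extend p y)" "vf U (extend p z)"
    by (rule extend3[OF assms(1,2,2,3)])
  then show ?thesis unfolding Ct_def by (intro tensorial_lin Cf_tensorial1 assms)
qed

lemma Ct_lin2: assumes "p \<in> points M" "x \<in> TS p" "z \<in> TS p" shows "lin p (\<lambda>y. Ct p x y z)"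
proof -
  obtain U where U: "p \<in> U" "vf U (extend p x)" "vf U (extend p z)"
    by (rule extend3[OF assms(1,2,2,3)])
  show ?thesis unfolding Ct_def by (intro tensorial_lin Cf_tensorial2[OF U(2,3,1)] assms)
qed

lemma Ct_lin3: assumes "p \<in> points M" "x \<in> TS p" "y \<in> TS p" shows "lin p (\<lambda>z. Ct p x y z)"
  using Ct_lin2[OF assms] Ct_sym[OF assms] unfolding lin_def by (auto simp: TS_add TS_scale)

lemma Ct_sf: assumes "vf U X" "vf U Y" "vf U Z" shows "sf U (\<lambda>q. Ct q (X q) (Y q) (Z q))"
proof (rule sf_cong)
  show "sf U (\<lambda>q. Cf X Y Z q)" unfolding Cf_def
    by (intro sf_diff dd_sf g_sf nab_vf assms)
qed (simp add: Ct_Cf[OF assms])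

text \<open>\<open>Kt p x y z = g(\<gamma>\<^sub>x y, z)\<close>, by the Koszul formula.\<close>

definition Kt :: "'p \<Rightarrow> 'i tvec \<Rightarrow> 'i tvec \<Rightarrow> 'i tvec \<Rightarrow> real" where
  "Kt p x y z = (Ct p x y z + Ct p y x z - Ct p z x y) / 2"

lemma lin_half: "lin p \<phi> \<Longrightarrow> lin p (\<lambda>x. \<phi> x / (2::real))"
  using lin_cmult[of p \<phi> "1/2"] by simp

lemma Kt_lin:
  assumes "p \<in> points M" "x \<in> TS p" "y \<in> TS p"
  shows "lin p (\<lambda>z. Kt p x y z)" "lin p (\<lambda>z. Kt p x z y)" "lin p (\<lambda>z. Kt p z x y)"
  unfolding Kt_def by (intro lin_half lin_minus lin_plus Ct_lin1 Ct_lin2 Ct_lin3 assms)+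

lemma Kt_sym: "p \<in> points M \<Longrightarrow> x \<in> TS p \<Longrightarrow> y \<in> TS p \<Longrightarrow> z \<in> TS p \<Longrightarrow> Kt p x y z = Kt p y x z"
  using Ct_sym[of p z x y] by (simp add: Kt_def)

section \<open>The difference tensor and the Levi-Civita connection\<close>

definition gam :: "'p \<Rightarrow> 'i tvec \<Rightarrow> 'i tvec \<Rightarrow> 'i tvec" where
  "gam p x y = riesz p (Kt p x y)"

lemma gam_in: "p \<in> points M \<Longrightarrow> gam p x y \<in> TS p"
  unfolding gam_def by (rule riesz_in)

lemma g_gam: "p \<in> points M \<Longrightarrow> x \<in> TS p \<Longrightarrow> y \<in> TS p \<Longrightarrow> z \<in> TS p \<Longrightarrow> g p (gam p x y) z = Kt p x y z"
  unfolding gam_def by (rule g_riesz[OF _ Kt_lin(1)])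

lemma gam_sym: "p \<in> points M \<Longrightarrow> x \<in> TS p \<Longrightarrow> y \<in> TS p \<Longrightarrow> gam p x y = gam p y x"
  by (rule g_nondegenerate) (auto simp: gam_in g_gam Kt_sym)

lemma gam_lin: assumes "p \<in> points M" "x \<in> TS p" shows "lin p (\<lambda>y. gam p x y)" "lin p (\<lambda>y. gam p y x)"
proof -
  have 1: "gam p x y = (\<Sum>a<mdim M. Kt p x y (fr p a) *\<^sub>R fr p a)" for x y
    by (simp add: gam_def riesz_def)
  have s: "lin p (\<lambda>y. \<phi> y *\<^sub>R v)" if "lin p \<phi>" for v :: "'i tvec" and \<phi>
    using that by (intro linI) (auto simp: lin_add lin_scale scaleR_add_left)
  show "lin p (\<lambda>y. gam p x y)" "lin p (\<lambda>y. gam p y x)"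
    unfolding 1 by (intro lin_sum_fun s Kt_lin fr_in assms; simp)+
qed

lemma Kt_sf: assumes "vf U X" "vf U Y" "vf U Z" shows "sf U (\<lambda>q. Kt q (X q) (Y q) (Z q))"
  using sf_cmult[OF sf_diff[OF sf_add[OF Ct_sf[OF assms] Ct_sf[OF assms(2,1,3)]] Ct_sf[OF assms(3,1,2)]], of "1/2"]
  by (simp add: Kt_def)

lemma gam_vf: assumes "vf U X" "vf U Y" shows "vf U (\<lambda>q. gam q (X q) (Y q))"
proof (rule vf_of_pairing[OF vf_open[OF assms(1)]])
  show "gam q (X q) (Y q) \<in> TS q" if "q \<in> U" for q using gam_in vf_points[OF assms(1) that] .
  fix V Z assume Z: "vf V Z" "V \<subseteq> U"
  have X: "vf V X" and Y: "vf V Y" using vf_mono vf_open[OF Z(1)] Z(2) assms by blast+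
  show "sf V (\<lambda>q. g q (gam q (X q) (Y q)) (Z q))"
    by (rule sf_cong[OF Kt_sf[OF X Y Z(1)]]) (use g_gam vf_points[OF X] vf_in X Y Z(1) in auto)
qed

text \<open>Connections form an affine space over tensor fields. This is used for the Levi-Civita
  connection here and, through \<open>connection_riesz\<close>, for the Bismut and Chern
  connections.\<close>

lemma connection_plus_tensor:
  assumes "\<And>U X Y. vf U X \<Longrightarrow> vf U Y \<Longrightarrow> vf U (\<lambda>q. S q (X q) (Y q))"
    and "\<And>p x. p \<in> points M \<Longrightarrow> x \<in> TS p \<Longrightarrow> lin p (\<lambda>y. S p x y)"
    and "\<And>p y. p \<in> points M \<Longrightarrow> y \<in> TS p \<Longrightarrow> lin p (\<lambda>x. S p x y)"
    and D: "\<And>U X Y p. vf U X \<Longrightarrow> vf U Y \<Longrightarrow> p \<in> U \<Longrightarrow> D X Y p = nab X Y p + S p (X p) (Y p)"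
  shows "connection M D"
  unfolding connection_def
proof (intro conjI allI impI ballI)
  fix U X Y assume "vf U X" "vf U Y"
  then show "vf U (D X Y)"
    using vf_cong[OF vf_add[OF nab_vf assms(1)], of U X Y X Y "D X Y"] D by simp
next
  fix U X X' Y p assume *: "vf U X" "vf U X'" "vf U Y" "p \<in> U"
  show "D (X + X') Y p = D X Y p + D X' Y p"
    using * nab_add1[OF *] D[OF vf_add[OF *(1,2)] *(3,4)] D[OF *(1,3,4)] D[OF *(2,3,4)]
      lin_add[OF assms(3)[OF vf_points[OF *(3,4)] vf_in[OF *(3,4)]] vf_in[OF *(1,4)] vf_in[OF *(2,4)]]
    by simp
next
  fix U X Y Y' p assume *: "vf U X" "vf U Y" "vf U Y'" "p \<in> U"
  show "D X (Y + Y') p = D X Y p + D X Y' p"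
    using * nab_add2[OF *] D[OF *(1) vf_add[OF *(2,3)] *(4)] D[OF *(1,2,4)] D[OF *(1,3,4)]
      lin_add[OF assms(2)[OF vf_points[OF *(1,4)] vf_in[OF *(1,4)]] vf_in[OF *(2,4)] vf_in[OF *(3,4)]]
    by simp
next
  fix U f X Y p assume *: "sf U f" "vf U X" "vf U Y" "p \<in> U"
  show "D (fscale f X) Y p = f p *\<^sub>R D X Y p"
    using * nab_fscale1[OF *] D[OF vf_fscale[OF *(1,2)] *(3,4)] D[OF *(2,3,4)]
      lin_scale[OF assms(3)[OF vf_points[OF *(3,4)] vf_in[OF *(3,4)]] vf_in[OF *(2,4)]]
    by (simp add: fscale_def scaleR_add_right)
next
  fix U f X Y p assume *: "sf U f" "vf U X" "vf U Y" "p \<in> U"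
  show "D X (fscale f Y) p = dd p (X p) f *\<^sub>R Y p + f p *\<^sub>R D X Y p"
    using * nab_fscale2[OF *] D[OF *(2) vf_fscale[OF *(1,3)] *(4)] D[OF *(2,3,4)]
      lin_scale[OF assms(2)[OF vf_points[OF *(2,4)] vf_in[OF *(2,4)]] vf_in[OF *(3,4)]]
    by (simp add: fscale_def scaleR_add_right)
qed

text \<open>Existence: symmetry of K in its first two arguments keeps the torsion zero, and K(x,y,z)
  + K(x,z,y) = C(x,y,z) makes g parallel.\<close>

lemma is_levi_civita_gam:
  assumes D: "\<And>U X Y p. vf U X \<Longrightarrow> vf U Y \<Longrightarrow> p \<in> U \<Longrightarrow> D X Y p = nab X Y p + gam p (X p) (Y p)"
  shows "is_levi_civita M g D"
  unfolding is_levi_civita_def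
proof (intro conjI)
  show "connection M D"
    using gam_vf gam_lin D by (rule connection_plus_tensor)
  show "torsion_free M D" unfolding torsion_free_def
  proof (intro allI impI ballI)
    fix U X Y p assume *: "vf U X" "vf U Y" "p \<in> U"
    show "D X Y p - D Y X p = lie_bracket M X Y p"
      using D[OF *] D[OF *(2,1,3)] torsion[OF *]
        gam_sym[OF vf_points[OF *(1,3)] vf_in[OF *(1,3)] vf_in[OF *(2,3)]] by simp
  qed
  show "\<forall>U X Y Z. vf U X \<longrightarrow> vf U Y \<longrightarrow> vf U Z \<longrightarrow> (\<forall>p\<in>U. dd p (X p) (\<lambda>q. g q (Y q) (Z q)) =
           g p (D X Y p) (Z p) + g p (Y p) (D X Z p))"
  proof (intro allI impI ballI)
    fix U X Y Z p assume *: "vf U X" "vf U Y" "vf U Z" "p \<in> U"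
    note pM = vf_points[OF *(1,4)] and x = vf_in[OF *(1,4)] and y = vf_in[OF *(2,4)] and z = vf_in[OF *(3,4)]
    have "g p (D X Y p) (Z p) = g p (nab X Y p) (Z p) + Kt p (X p) (Y p) (Z p)"
      using D[OF *(1,2,4)] lin_add[OF g_lin1[OF pM z] nab_in[OF *(1,2,4)] gam_in[OF pM]] g_gam[OF pM x y z] by simp
    moreover have "g p (Y p) (D X Z p) = g p (Y p) (nab X Z p) + Kt p (X p) (Z p) (Y p)"
      using D[OF *(1,3,4)] lin_add[OF g_lin2[OF pM y] nab_in[OF *(1,3,4)] gam_in[OF pM]] g_gam[OF pM x z y]
        g_sym[OF pM y gam_in[OF pM]] by simp
    moreover have "Kt p (X p) (Y p) (Z p) + Kt p (X p) (Z p) (Y p) = Cf X Y Z p"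
      using Ct_sym[OF pM x y z] Ct_sym[OF pM y x z] Ct_sym[OF pM z x y] Ct_Cf[OF *] by (simp add: Kt_def field_simps)
    ultimately show "dd p (X p) (\<lambda>q. g q (Y q) (Z q)) = g p (D X Y p) (Z p) + g p (Y p) (D X Z p)"
      by (simp add: Cf_def)
  qed
qed

text \<open>Uniqueness: the difference d of D and \<open>nab\<close> is symmetric because both are
  torsion-free, and metricity of D gives g(d(X,Y), Z) + g(Y, d(X,Z)) = C(X,Y,Z). The Koszul
  combination of three such equations solves for d. As \<open>levi_civita\<close> is only a choice,
  its values become known through this statement.\<close>

lemma levi_civita_unique:
  assumes D: "is_levi_civita M g D" and *: "vf U X" "vf U Y" "p \<in> U"
  shows "D X Y p = nab X Y p + gam p (X p) (Y p)"
proof -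
  interpret D: conn_mfd M D using D by unfold_locales (simp add: is_levi_civita_def)
  note pM = vf_points[OF *(1,3)] and x = vf_in[OF *(1,3)] and y = vf_in[OF *(2,3)]
  define d where "d X Y = D X Y p - nab X Y p" for X Y
  have d_in: "d X Y \<in> TS p" if "vf U X" "vf U Y" "p \<in> U" for U X Y
    unfolding d_def by (intro TS_diff D.nab_in[OF that] nab_in[OF that])
  have d_sym: "d X Y = d Y X" if "vf U X" "vf U Y" "p \<in> U" for U X Y
  proof -
    have "D X Y p - D Y X p = lie_bracket M X Y p"
      using D that unfolding is_levi_civita_def torsion_free_def by blast
    then show ?thesis using torsion[OF that] by (simp add: d_def algebra_simps)
  qed
  have d_C: "g p (d X Y) (Z p) + g p (Y p) (d X Z) = Cf X Y Z p"
    if v: "vf U X" "vf U Y" "vf U Z" "p \<in> U" for U X Y Z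
  proof -
    have "dd p (X p) (\<lambda>q. g q (Y q) (Z q)) = g p (D X Y p) (Z p) + g p (Y p) (D X Z p)"
      using D v unfolding is_levi_civita_def by blast
    then show ?thesis
      using lin_diff[OF g_lin1[OF pM vf_in[OF v(3,4)]] D.nab_in[OF v(1,2,4)] nab_in[OF v(1,2,4)]]
        lin_diff[OF g_lin2[OF pM vf_in[OF v(2,4)]] D.nab_in[OF v(1,3,4)] nab_in[OF v(1,3,4)]]
      by (simp add: d_def Cf_def)
  qed
  have "d X Y = gam p (X p) (Y p)"
  proof (rule g_nondegenerate[OF pM d_in[OF *] gam_in[OF pM]])
    fix z assume z: "z \<in> TS p"
    obtain V where V: "p \<in> V" "vf V (extend p z)" "extend p z p = z" using extend[OF pM z] .
    let ?Z = "extend p z"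
    obtain W where W: "p \<in> W" "vf W X" "vf W ?Z" "W \<subseteq> U" using common_domain[OF *(1,3) V(2,1)] .
    have Y: "vf W Y" using vf_mono[OF *(2) vf_open[OF W(2)] W(4)] .
    note i = d_in[OF W(2) Y W(1)] d_in[OF W(2,3,1)] d_in[OF Y W(3,1)]
    have "Cf X Y ?Z p + Cf Y X ?Z p - Cf ?Z X Y p = 2 * g p (d X Y) z"
      using d_C[OF W(2) Y W(3,1)] d_C[OF Y W(2,3,1)] d_C[OF W(3,2) Y W(1)] V(3)
        d_sym[OF W(2) Y W(1)] d_sym[OF W(2,3,1)] d_sym[OF Y W(3,1)]
        g_sym[OF pM i(2) y] g_sym[OF pM i(3) x] by simp
    then show "g p (d X Y) z = g p (gam p (X p) (Y p)) z"
      using g_gam[OF pM x y z] Ct_Cf[OF W(2) Y W(3,1)] Ct_Cf[OF Y W(2,3,1)] Ct_Cf[OF W(3,2) Y W(1)] V(3)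
      by (simp add: Kt_def)
  qed
  then show ?thesis by (simp add: d_def algebra_simps)
qed

lemma levi_civita: "is_levi_civita M g (levi_civita M g)"
  unfolding levi_civita_def by (rule someI[of _ "\<lambda>X Y p. nab X Y p + gam p (X p) (Y p)"], rule is_levi_civita_gam) (rule refl)

lemma lc_eq: "vf U X \<Longrightarrow> vf U Y \<Longrightarrow> p \<in> U \<Longrightarrow> levi_civita M g X Y p = nab X Y p + gam p (X p) (Y p)"
  using levi_civita_unique[OF levi_civita] .

lemma diff_tensor_eq: "vf U X \<Longrightarrow> vf U Y \<Longrightarrow> p \<in> U \<Longrightarrow> diff_tensor M nab g X Y p = gam p (X p) (Y p)"
  by (simp add: diff_tensor_def lc_eq)

text \<open>The defining equation asks for a vector whose product with z is g(Y, \<gamma>(X, z)) =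
  K(X, z, Y). This is linear in z, so \<open>riesz\<close> gives the unique solution.\<close>

lemma diff_tensor_adj_eq:
  assumes *: "vf U X" "vf U Y" "p \<in> U"
  shows "diff_tensor_adj M nab g X Y p = riesz p (\<lambda>z. Kt p (X p) z (Y p))"
proof -
  note pM = vf_points[OF *(1,3)] and x = vf_in[OF *(1,3)] and y = vf_in[OF *(2,3)]
  have key: "g p (Y p) (diff_tensor M nab g X Z p) = Kt p (X p) (Z p) (Y p)" if Z: "p \<in> V" "vf V Z" for V Z
  proof -
    obtain W where W: "p \<in> W" "vf W X" "vf W Z" "W \<subseteq> U" using common_domain[OF *(1,3) Z(2,1)] .
    show ?thesis using diff_tensor_eq[OF W(2,3,1)] g_sym[OF pM y gam_in[OF pM]] g_gam[OF pM x vf_in[OF Z(2,1)] y] by simp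
  qed
  show ?thesis unfolding diff_tensor_adj_def
  proof (rule the_equality)
    show "riesz p (\<lambda>z. Kt p (X p) z (Y p)) \<in> TS p \<and> (\<forall>U Z. p \<in> U \<longrightarrow> vf U Z \<longrightarrow>
        g p (riesz p (\<lambda>z. Kt p (X p) z (Y p))) (Z p) = g p (Y p) (diff_tensor M nab g X Z p))"
      using riesz_in[OF pM] g_riesz[OF pM Kt_lin(2)[OF pM x y]] key vf_in by auto
    fix w assume w: "w \<in> TS p \<and> (\<forall>U Z. p \<in> U \<longrightarrow> vf U Z \<longrightarrow> g p w (Z p) = g p (Y p) (diff_tensor M nab g X Z p))"
    show "w = riesz p (\<lambda>z. Kt p (X p) z (Y p))"
    proof (rule riesz_eqI[OF pM Kt_lin(2)[OF pM x y]])
      fix z assume z: "z \<in> TS p"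
      obtain V where V: "p \<in> V" "vf V (extend p z)" "extend p z p = z" using extend[OF pM z] .
      then show "g p w z = Kt p (X p) z (Y p)" using w key[OF V(1,2)] by metis
    qed (use w in blast)
  qed
qed

text \<open>The two traces of \<open>\<nabla> g\<close>: \<open>\<langle>tr \<gamma>, z\<rangle> = al z - be z / 2\<close> and \<open>\<langle>tr \<gamma>\<^sup>*, z\<rangle> = be z / 2\<close>.\<close>

definition al :: "'p \<Rightarrow> 'i tvec \<Rightarrow> real" where "al p z = (\<Sum>a<mdim M. Ct p (fr p a) (fr p a) z)"
definition be :: "'p \<Rightarrow> 'i tvec \<Rightarrow> real" where "be p z = (\<Sum>a<mdim M. Ct p z (fr p a) (fr p a))"

lemma al_lin: "p \<in> points M \<Longrightarrow> lin p (al p)" and be_lin: "p \<in> points M \<Longrightarrow> lin p (be p)"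
  unfolding al_def be_def by (intro lin_sum_fun Ct_lin3 Ct_lin1 fr_in; simp)+

lemma al_onb: assumes "p \<in> points M" "onb p E" "z \<in> TS p" shows "al p z = (\<Sum>a<mdim M. Ct p (E a) (E a) z)"
  unfolding al_def
  by (rule trace_onb[OF assms(1) fr_onb[OF assms(1)] assms(2), of "\<lambda>x y. Ct p x y z"])
    (use assms in \<open>simp add: bilin_def Ct_lin1 Ct_lin2\<close>)

lemma be_onb: assumes "p \<in> points M" "onb p E" "z \<in> TS p" shows "be p z = (\<Sum>a<mdim M. Ct p z (E a) (E a))"
  unfolding be_def
  by (rule trace_onb[OF assms(1) fr_onb[OF assms(1)] assms(2), of "Ct p z"])
    (use assms in \<open>simp add: bilin_def Ct_lin3 Ct_lin2\<close>)

lemma frame_at_vf: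
  assumes "p \<in> points M"
  obtains U where "opn U" "p \<in> U" "\<forall>a<mdim M. vf U (frame_at M g p a)"
proof -
  obtain U where U: "opn U" "p \<in> U" "orthonormal_frame_on M g U (frame_at M g p)" using frame_at[OF assms] .
  then have "\<forall>a<mdim M. vf U (frame_at M g p a)" unfolding orthonormal_frame_on_def by blast
  with U(1,2) show thesis by (rule that)
qed

lemma tr_gamma_in: assumes p: "p \<in> points M" shows "tr_gamma M nab g p \<in> TS p"
  and g_tr_gamma: "z \<in> TS p \<Longrightarrow> g p (tr_gamma M nab g p) z = al p z - be p z / 2"
proof -
  obtain U where U': "opn U" "p \<in> U" "\<forall>a<mdim M. vf U (frame_at M g p a)" using frame_at_vf[OF p] .
  note U = U'(1,2) U'(3)[rule_format]
  have eq: "tr_gamma M nab g p = (\<Sum>a<mdim M. gam p (fr p a) (fr p a))"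
    unfolding metric_trace_def using diff_tensor_eq[OF U(3) U(3) U(2)] by (intro sum.cong) auto
  show "tr_gamma M nab g p \<in> TS p" unfolding eq by (intro TS_sum gam_in p)
  show "g p (tr_gamma M nab g p) z = al p z - be p z / 2" if z: "z \<in> TS p"
  proof -
    have "g p (tr_gamma M nab g p) z = (\<Sum>a<mdim M. g p (gam p (fr p a) (fr p a)) z)"
      unfolding eq by (rule lin_sum[OF g_lin1[OF p z]]) (rule gam_in[OF p])
    also have "\<dots> = (\<Sum>a<mdim M. Kt p (fr p a) (fr p a) z)"
      by (intro sum.cong refl g_gam[OF p] fr_in[OF p] z) auto
    finally show ?thesis
      by (simp add: Kt_def al_def be_def sum_subtractf sum_divide_distrib[symmetric] sum_distrib_left[symmetric] field_simps)
  qed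
qed

lemma tr_gamma_adj_in: assumes p: "p \<in> points M" shows "tr_gamma_adj M nab g p \<in> TS p"
  and g_tr_gamma_adj: "z \<in> TS p \<Longrightarrow> g p (tr_gamma_adj M nab g p) z = be p z / 2"
proof -
  obtain U where U': "opn U" "p \<in> U" "\<forall>a<mdim M. vf U (frame_at M g p a)" using frame_at_vf[OF p] .
  note U = U'(1,2) U'(3)[rule_format]
  have eq: "tr_gamma_adj M nab g p = (\<Sum>a<mdim M. riesz p (\<lambda>z. Kt p (fr p a) z (fr p a)))"
    unfolding metric_trace_def using diff_tensor_adj_eq[OF U(3) U(3) U(2)] by (intro sum.cong) auto
  show "tr_gamma_adj M nab g p \<in> TS p" unfolding eq by (intro TS_sum riesz_in p)
  show "g p (tr_gamma_adj M nab g p) z = be p z / 2" if z: "z \<in> TS p"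
  proof -
    have "g p (tr_gamma_adj M nab g p) z = (\<Sum>a<mdim M. g p (riesz p (\<lambda>z. Kt p (fr p a) z (fr p a))) z)"
      unfolding eq by (rule lin_sum[OF g_lin1[OF p z]]) (rule riesz_in[OF p])
    also have "\<dots> = (\<Sum>a<mdim M. Kt p (fr p a) z (fr p a))"
      by (intro sum.cong refl g_riesz[OF p] Kt_lin(2)[OF p] fr_in[OF p] z) auto
    also have "\<dots> = (\<Sum>a<mdim M. Ct p z (fr p a) (fr p a) / 2)"
      using Ct_sym[OF p fr_in[OF p] fr_in[OF p] z] by (intro sum.cong) (auto simp: Kt_def)
    finally show ?thesis by (simp add: be_def sum_divide_distrib)
  qed
qed

definition Czero :: bool where
  "Czero \<longleftrightarrow> (\<forall>p\<in>points M. \<forall>x\<in>TS p. \<forall>y\<in>TS p. \<forall>z\<in>TS p. Ct p x y z = 0)"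

text \<open>C is recovered from \<gamma> by C(x,y,z) = g(\<gamma>(x,y), z) + g(\<gamma>(x,z), y);
  conversely \<gamma> is given by the Koszul formula.\<close>

lemma diff_tensor_zero_iff: "diff_tensor_zero M nab g \<longleftrightarrow> Czero"
proof
  assume 0: "diff_tensor_zero M nab g"
  have K0: "Kt p x y z = 0" if t: "p \<in> points M" "x \<in> TS p" "y \<in> TS p" "z \<in> TS p" for p x y z
  proof -
    obtain U where U: "p \<in> U" "vf U (extend p x)" "vf U (extend p y)" "vf U (extend p z)"
        "extend p x p = x" "extend p y p = y" "extend p z p = z"
      by (rule extend3[OF t])
    then have "gam p x y = 0" using 0 diff_tensor_eq[OF U(2,3,1)] unfolding diff_tensor_zero_def by metis
    then show ?thesis using g_gam[OF that] lin_zero[OF g_lin1[OF that(1,4)]] by simp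
  qed
  show Czero unfolding Czero_def
  proof (intro ballI)
    fix p x y z assume t: "p \<in> points M" "x \<in> TS p" "y \<in> TS p" "z \<in> TS p"
    show "Ct p x y z = 0"
      using K0[OF t] K0[OF t(1,2,4,3)] Ct_sym[OF t] Ct_sym[OF t(1,3,2,4)] Ct_sym[OF t(1,4,2,3)] by (simp add: Kt_def)
  qed
next
  assume 0: Czero
  show "diff_tensor_zero M nab g" unfolding diff_tensor_zero_def
  proof (intro allI impI ballI)
    fix U X Y p assume *: "vf U X" "vf U Y" "p \<in> U"
    note pM = vf_points[OF *(1,3)]
    have "gam p (X p) (Y p) = 0"
      by (rule g_nondegenerate[OF pM gam_in[OF pM] TS_zero])
        (use 0 pM vf_in[OF *(1,3)] vf_in[OF *(2,3)] lin_zero[OF g_lin1[OF pM]] in \<open>auto simp: g_gam Kt_def Czero_def\<close>)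
    then show "diff_tensor M nab g X Y p = 0" using diff_tensor_eq[OF *] by simp
  qed
qed

text \<open>Both traces are sums over frames selected separately at each point. Near a given point
  they equal the same sums over one smooth orthonormal frame, because the trace does not depend on
  the basis.\<close>

lemma be_sf: assumes "vf U X" shows "sf U (\<lambda>q. be q (X q))"
  and al_sf: "sf U (\<lambda>q. al q (X q))"
proof -
  have "\<exists>W. p \<in> W \<and> W \<subseteq> U \<and> sf W (\<lambda>q. be q (X q)) \<and> sf W (\<lambda>q. al q (X q))" if p: "p \<in> U" for p
  proof -
    obtain V E where V: "opn V" "p \<in> V" "orthonormal_frame_on M g V E"
      using frame_exists[OF vf_points[OF assms p]] by blast
    let ?W = "U \<inter> V"
    have W: "opn ?W" using vf_open[OF assms] V by auto
    have E: "vf ?W (E a)" if "a < mdim M" for a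
      using V(3) that unfolding orthonormal_frame_on_def by (auto intro: vf_mono[OF _ W])
    have X: "vf ?W X" using vf_mono[OF assms W] by auto
    have "sf ?W (\<lambda>q. \<Sum>a<mdim M. Ct q (X q) (E a q) (E a q))" by (intro sf_sum W Ct_sf X E) auto
    then have "sf ?W (\<lambda>q. be q (X q))"
      by (rule sf_cong) (use be_onb[OF vf_points[OF X] frame_onb[OF V(3)] vf_in[OF X]] in auto)
    moreover have "sf ?W (\<lambda>q. \<Sum>a<mdim M. Ct q (E a q) (E a q) (X q))" by (intro sf_sum W Ct_sf X E) auto
    then have "sf ?W (\<lambda>q. al q (X q))"
      by (rule sf_cong) (use al_onb[OF vf_points[OF X] frame_onb[OF V(3)] vf_in[OF X]] in auto)
    ultimately show ?thesis using p V by blast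
  qed
  note loc = this
  show "sf U (\<lambda>q. be q (X q))" by (rule sf_local) (use loc in blast)
  show "sf U (\<lambda>q. al q (X q))" by (rule sf_local) (use loc in blast)
qed

text \<open>In an orthonormal frame \<open>\<beta> = - 2 tr A\<close> for the connection matrix \<open>A\<close> of the flat connection, and
  \<open>d (tr A)\<close> is the trace of the curvature.\<close>

lemma d_be_zero: "form2_zero M (ext_deriv1 M (\<lambda>X p. be p (X p)))"
  unfolding form2_zero_def
proof (intro allI impI ballI)
  fix U X Y p assume XU: "vf U X" and YU: "vf U Y" and pU: "p \<in> U"
  obtain V E where V: "opn V" "p \<in> V" "orthonormal_frame_on M g V E"
    using frame_exists[OF vf_points[OF XU pU]] by blast
  let ?W = "U \<inter> V" and ?n = "mdim M"
  have W: "opn ?W" "p \<in> ?W" using vf_open[OF XU] V pU by auto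
  have pM: "p \<in> points M" using W opn_subset by blast
  have E: "vf ?W (E a)" if "a < ?n" for a
    using V(3) that unfolding orthonormal_frame_on_def by (auto intro: vf_mono[OF _ W(1)])
  have on: "onb q (\<lambda>a. E a q)" if "q \<in> ?W" for q using frame_onb[OF V(3)] that by auto
  have X: "vf ?W X" and Y: "vf ?W Y" using vf_mono[OF _ W(1)] XU YU by auto
  define w where "w X q = (\<Sum>a<?n. g q (nab X (E a) q) (E a q))" for X q
  have be_w: "be q (Z q) = - 2 * w Z q" if Z: "vf ?W Z" and q: "q \<in> ?W" for Z q
  proof -
    have "be q (Z q) = (\<Sum>a<?n. Cf Z (E a) (E a) q)"
      unfolding be_onb[OF vf_points[OF Z q] on[OF q] vf_in[OF Z q]] using Ct_Cf[OF Z E E q] by simp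
    also have "\<dots> = (\<Sum>a<?n. - 2 * g q (nab Z (E a) q) (E a q))"
    proof (intro sum.cong refl)
      fix a assume "a \<in> {..<?n}" then have a: "a < ?n" by simp
      \<comment> \<open>The function g(E a, E a) is constant, so only the two connection terms of
        \<open>Cf\<close> remain, and these are equal.\<close>
      have "dd q (Z q) (\<lambda>r. g r (E a r) (E a r)) = dd q (Z q) (\<lambda>r. 1)"
        by (rule dd_cong[OF W(1) q]) (use on a in \<open>auto simp: onb_def\<close>)
      then show "Cf Z (E a) (E a) q = - 2 * g q (nab Z (E a) q) (E a q)"
        using g_sym[OF vf_points[OF Z q] vf_in[OF E[OF a] q] nab_in[OF Z E[OF a] q]]
        by (simp add: Cf_def dd_const)
    qed
    finally show ?thesis by (simp add: w_def sum_distrib_left)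
  qed
  have w_sf: "sf ?W (w Z)" if "vf ?W Z" for Z
    unfolding w_def by (intro sf_sum W g_sf nab_vf that E) auto
  \<comment> \<open>Expanding second covariant derivatives in the frame yields the derivative of the
    trace plus the trace of a product of two connection matrices.\<close>
  have key: "(\<Sum>a<?n. g p (nab X (nab Y (E a)) p) (E a p)) = dd p (X p) (w Y) +
      (\<Sum>a<?n. \<Sum>b<?n. g p (nab Y (E a) p) (E b p) * g p (nab X (E b) p) (E a p))"
    if X: "vf ?W X" and Y: "vf ?W Y" for X Y
  proof -
    have "g p (nab X (nab Y (E a)) p) (E a p) = dd p (X p) (\<lambda>q. g q (nab Y (E a) q) (E a q)) +
        (\<Sum>b<?n. g p (nab Y (E a) p) (E b p) * g p (nab X (E b) p) (E a p))" if a: "a < ?n" for a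
    proof -
      let ?A = "\<lambda>b q. g q (nab Y (E a) q) (E b q)"
      note Ea = vf_in[OF E[OF a] W(2)]
      have exp: "nab Y (E a) q = (\<Sum>b<?n. ?A b q *\<^sub>R E b q)" if "q \<in> ?W" for q
        using onb_expand[OF vf_points[OF Y that] on[OF that] nab_in[OF Y E[OF a] that]] .
      have "nab X (nab Y (E a)) p = (\<Sum>b<?n. dd p (X p) (?A b) *\<^sub>R E b p + ?A b p *\<^sub>R nab X (E b) p)"
        by (rule nab_lincomb[OF X W(2)]) (use g_sf[OF nab_vf[OF Y E[OF a]] E] E nab_vf[OF Y E[OF a]] exp in auto)
      then have "g p (nab X (nab Y (E a)) p) (E a p) =
          g p (\<Sum>b<?n. dd p (X p) (?A b) *\<^sub>R E b p + ?A b p *\<^sub>R nab X (E b) p) (E a p)" by simp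
      also have "\<dots> = (\<Sum>b<?n. g p (dd p (X p) (?A b) *\<^sub>R E b p + ?A b p *\<^sub>R nab X (E b) p) (E a p))"
        by (rule lin_sum[OF g_lin1[OF pM Ea]]) (intro TS_add TS_scale vf_in[OF E W(2)] nab_in[OF X E W(2)]; simp)
      also have "\<dots> = (\<Sum>b<?n. (if b = a then dd p (X p) (?A a) else 0) + ?A b p * g p (nab X (E b) p) (E a p))"
      proof (intro sum.cong refl)
        fix b assume "b \<in> {..<?n}" then have b: "b < ?n" by simp
        show "g p (dd p (X p) (?A b) *\<^sub>R E b p + ?A b p *\<^sub>R nab X (E b) p) (E a p) =
            (if b = a then dd p (X p) (?A a) else 0) + ?A b p * g p (nab X (E b) p) (E a p)"
          using lin_add[OF g_lin1[OF pM Ea] TS_scale[OF vf_in[OF E[OF b] W(2)]] TS_scale[OF nab_in[OF X E[OF b] W(2)]]]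
            lin_scale[OF g_lin1[OF pM Ea] vf_in[OF E[OF b] W(2)]] lin_scale[OF g_lin1[OF pM Ea] nab_in[OF X E[OF b] W(2)]]
            on[OF W(2)] a b by (auto simp: onb_def)
      qed
      finally show ?thesis using a by (simp add: sum.distrib)
    qed
    moreover have "dd p (X p) (w Y) = (\<Sum>a<?n. dd p (X p) (\<lambda>q. g q (nab Y (E a) q) (E a q)))"
      unfolding w_def using g_sf[OF nab_vf[OF Y E] E] by (intro dd_sum[OF W(1) _ W(2)]) auto
    ultimately show ?thesis by (simp add: sum.distrib)
  qed
  \<comment> \<open>The trace of a product of two matrices is symmetric, so the quadratic terms
    cancel in the difference for X and Y.\<close>
  have sw: "(\<Sum>a<?n. \<Sum>b<?n. g p (nab Y (E a) p) (E b p) * g p (nab X (E b) p) (E a p)) =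
      (\<Sum>a<?n. \<Sum>b<?n. g p (nab X (E a) p) (E b p) * g p (nab Y (E b) p) (E a p))"
    by (subst sum.swap) (simp add: mult.commute)
  have "w (lie_bracket M X Y) p = (\<Sum>a<?n. g p (nab X (nab Y (E a)) p) (E a p) - g p (nab Y (nab X (E a)) p) (E a p))"
    unfolding w_def
  proof (intro sum.cong refl)
    fix a assume "a \<in> {..<?n}" then have a: "a < ?n" by simp
    show "g p (nab (lie_bracket M X Y) (E a) p) (E a p) =
        g p (nab X (nab Y (E a)) p) (E a p) - g p (nab Y (nab X (E a)) p) (E a p)"
      unfolding flat[OF X Y E[OF a] W(2)]
      by (rule lin_diff[OF g_lin1[OF pM vf_in[OF E[OF a] W(2)]]]) (intro nab_in[OF _ _ W(2)] nab_vf X Y E a)+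
  qed
  also have "\<dots> = dd p (X p) (w Y) - dd p (Y p) (w X)"
    unfolding sum_subtractf key[OF X Y] key[OF Y X] sw by simp
  finally have br: "w (lie_bracket M X Y) p = dd p (X p) (w Y) - dd p (Y p) (w X)" .
  have dbe: "dd p v (\<lambda>q. be q (Z q)) = - 2 * dd p v (w Z)" if "vf ?W Z" for v Z
    using dd_cong[OF W, of "\<lambda>q. be q (Z q)" "\<lambda>q. - 2 * w Z q" v] be_w[OF that] dd_cmult[OF w_sf[OF that] W(2), of v "-2"] by simp
  show "ext_deriv1 M (\<lambda>X p. be p (X p)) X Y p = 0"
    unfolding ext_deriv1_def dbe[OF X] dbe[OF Y] be_w[OF bracket_vf[OF X Y] W(2)] br by simp
qed

end

section \<open>The tangent bundle as a manifold\<close>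

definition base_coords :: "nat \<Rightarrow> (nat \<Rightarrow> real) \<Rightarrow> nat \<Rightarrow> real" where
  "base_coords n x = (\<lambda>b. if b < n then x b else 0)"

definition fibre_coords :: "nat \<Rightarrow> (nat \<Rightarrow> real) \<Rightarrow> nat \<Rightarrow> real" where
  "fibre_coords n x = (\<lambda>b. if b < n then x (n + b) else 0)"

lemma open_coord_fibred:
  assumes "open_coord n S"
  shows "open_coord (2 * n) {x \<in> coord_space (2 * n). base_coords n x \<in> S \<and>
     (\<forall>a<n. \<bar>x (n + a) - c a\<bar> < r)}"
  unfolding open_coord_iff_box
proof (intro conjI ballI)
  fix x assume x: "x \<in> {x \<in> coord_space (2 * n). base_coords n x \<in> S \<and> (\<forall>a<n. \<bar>x (n + a) - c a\<bar> < r)}"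
  then obtain e where e: "e > 0"
      "\<And>y. \<lbrakk>y \<in> coord_space n; \<And>a. a < n \<Longrightarrow> \<bar>y a - base_coords n x a\<bar> < e\<rbrakk> \<Longrightarrow> y \<in> S"
    using open_coord_boxE[OF assms, of "base_coords n x"] by blast
  define d where "d = Min (insert e ((\<lambda>a. r - \<bar>x (n + a) - c a\<bar>) ` {..<n}))"
  have d: "d > 0" unfolding d_def using x e(1) by (subst Min_gr_iff) auto
  have de: "d \<le> e" unfolding d_def by (intro Min_le) auto
  have dr: "d \<le> r - \<bar>x (n + a) - c a\<bar>" if "a < n" for a unfolding d_def using that by (intro Min_le) auto
  have "y \<in> {x \<in> coord_space (2 * n). base_coords n x \<in> S \<and> (\<forall>a<n. \<bar>x (n + a) - c a\<bar> < r)}"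
    if y: "y \<in> coord_space (2 * n)" "\<forall>a<2*n. \<bar>y a - x a\<bar> < d" for y
  proof -
    have "base_coords n y \<in> S"
    proof (rule e(2))
      show "base_coords n y \<in> coord_space n" by (simp add: base_coords_def)
      show "\<bar>base_coords n y a - base_coords n x a\<bar> < e" if "a < n" for a
        using y(2)[rule_format, of a] that de by (simp add: base_coords_def)
    qed
    moreover have "\<bar>y (n + a) - c a\<bar> < r" if "a < n" for a
      using y(2)[rule_format, of "n + a"] dr[OF that] that by linarith
    ultimately show ?thesis using y(1) by blast
  qed
  then show "\<exists>e>0. \<forall>y\<in>coord_space (2 * n). (\<forall>a<2*n. \<bar>y a - x a\<bar> < e) \<longrightarrow>
      y \<in> {x \<in> coord_space (2 * n). base_coords n x \<in> S \<and> (\<forall>a<n. \<bar>x (n + a) - c a\<bar> < r)}"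
    using d by blast
qed auto

lemma open_coord_base:
  assumes "open_coord n S"
  shows "open_coord (2 * n) {x \<in> coord_space (2 * n). base_coords n x \<in> S}"
  unfolding open_coord_iff_box
proof (intro conjI ballI)
  fix x assume x: "x \<in> {x \<in> coord_space (2 * n). base_coords n x \<in> S}"
  then obtain e where e: "e > 0"
      "\<And>y. \<lbrakk>y \<in> coord_space n; \<And>a. a < n \<Longrightarrow> \<bar>y a - base_coords n x a\<bar> < e\<rbrakk> \<Longrightarrow> y \<in> S"
    using open_coord_boxE[OF assms, of "base_coords n x"] by blast
  have "base_coords n y \<in> S" if y: "\<forall>a<2*n. \<bar>y a - x a\<bar> < e" for y
  proof (rule e(2))
    show "base_coords n y \<in> coord_space n" by (simp add: base_coords_def)
    show "\<bar>base_coords n y a - base_coords n x a\<bar> < e" if "a < n" for a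
      using y[rule_format, of a] that by (simp add: base_coords_def)
  qed
  then show "\<exists>e>0. \<forall>y\<in>coord_space (2 * n). (\<forall>a<2*n. \<bar>y a - x a\<bar> < e) \<longrightarrow>
      y \<in> {x \<in> coord_space (2 * n). base_coords n x \<in> S}"
    using e(1) by blast
qed auto

lemma smooth_base_coords:
  assumes "open_coord (2 * n) S'" "b < n" shows "smooth_coord (2 * n) S' (\<lambda>x. base_coords n x b)"
proof -
  have "(\<lambda>x. base_coords n x b) = (\<lambda>x. x b)" using assms(2) by (auto simp: base_coords_def)
  then show ?thesis using smooth_coord_coord[OF assms(1)] by simp
qed

lemma smooth_coord_base_compose:
  assumes "smooth_coord n S f" "open_coord (2 * n) S'" "\<And>x. x \<in> S' \<Longrightarrow> base_coords n x \<in> S"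
  shows "smooth_coord (2 * n) S' (\<lambda>x. f (base_coords n x))"
  by (rule smooth_coord_compose[OF assms smooth_base_coords[OF assms(2)]])

lemma pderiv_at_base_compose:
  assumes "smooth_coord n S f" "open_coord (2 * n) S'" "\<And>x. x \<in> S' \<Longrightarrow> base_coords n x \<in> S"
    "x \<in> S'" "a < 2 * n"
  shows "pderiv_at a (\<lambda>x. f (base_coords n x)) x = (if a < n then pderiv_at a f (base_coords n x) else 0)"
proof -
  have "pderiv_at a (\<lambda>x. f (base_coords n x)) x =
      (\<Sum>b<n. pderiv_at b f (base_coords n x) * pderiv_at a (\<lambda>x. base_coords n x b) x)"
    by (rule smooth_coord_pderiv_compose[OF assms(1-3) smooth_base_coords[OF assms(2)] assms(5,4)])
  also have "\<dots> = (\<Sum>b<n. if b = a then pderiv_at b f (base_coords n x) else 0)"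
    by (intro sum.cong refl) (auto simp: base_coords_def pderiv_at_coord)
  finally show ?thesis by simp
qed

context smooth_mfd
begin

lemma dd_compose:
  assumes F: "smooth_coord m V F" and \<phi>: "\<And>a. a < m \<Longrightarrow> sf U (\<lambda>q. \<phi> q a)" and U: "opn U"
    and UV: "\<And>q. q \<in> U \<Longrightarrow> \<phi> q \<in> V" and p: "p \<in> U"
  shows "dd p v (\<lambda>q. F (\<phi> q)) = (\<Sum>a<m. pderiv_at a F (\<phi> p) * dd p v (\<lambda>q. \<phi> q a))"
proof -
  define i where "i = (SOME i. chart_around M p i)"
  have "p \<in> points M" using p U opn_subset by blast
  then have i: "i \<in> charts M" "p \<in> cdom M i" using some_chart unfolding i_def by auto
  have c: "pderiv_at b (\<lambda>x. F (\<phi> (param M i x))) (coords M i p) =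
      (\<Sum>a<m. pderiv_at a F (\<phi> p) * pderiv_at b (\<lambda>x. \<phi> (param M i x) a) (coords M i p))" if "b < mdim M" for b
  proof -
    have "pderiv_at b (\<lambda>x. F (\<phi> (param M i x))) (coords M i p) = (\<Sum>a<m. pderiv_at a F (\<phi> (param M i (coords M i p))) *
        pderiv_at b (\<lambda>x. \<phi> (param M i x) a) (coords M i p))"
      by (rule smooth_coord_pderiv_compose[OF F open_coords_image[OF U i(1)] _ sf_coordD[OF \<phi> i(1)] that])
        (use i p UV in auto)
    then show ?thesis using i by simp
  qed
  have "dd p v (\<lambda>q. F (\<phi> q)) = (\<Sum>b<mdim M. \<Sum>a<m. v i b * (pderiv_at a F (\<phi> p) * pderiv_at b (\<lambda>x. \<phi> (param M i x) a) (coords M i p)))"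
    unfolding dirderiv_def Let_def i_def[symmetric] using c by (simp add: sum_distrib_left)
  also have "\<dots> = (\<Sum>a<m. \<Sum>b<mdim M. v i b * (pderiv_at a F (\<phi> p) * pderiv_at b (\<lambda>x. \<phi> (param M i x) a) (coords M i p)))"
    by (rule sum.swap)
  finally show ?thesis
    unfolding dirderiv_def Let_def i_def[symmetric] by (simp add: sum_distrib_left mult.left_commute)
qed

end

section \<open>Charts of the tangent bundle\<close>

locale tmfd = smooth_mfd M for M :: "('a, 'i) tmanifold"
begin

abbreviation "TM \<equiv> tangent_bundle M"
abbreviation "dM \<equiv> mdim M"

definition over :: "('a, 'i) tpoint set \<Rightarrow> ('a, 'i) tpoint set" where
  "over W = {Tan p v | p v. p \<in> W \<and> v \<in> TS p}"

lemma TM_simps [simp]: "mdim TM = 2 * dM" "charts TM = charts M" "cdom TM i = over (cdom M i)"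
    "points TM = over (points M)"
  "coords TM i u = (\<lambda>a. if a < dM then coords M i (proj u) a
                       else if a < 2 * dM then vec u i (a - dM) else 0)"
  by (auto simp: tangent_bundle_def over_def fun_eq_iff)

lemma in_over: "u \<in> over W \<longleftrightarrow> proj u \<in> W \<and> vec u \<in> TS (proj u) \<and> u = Tan (proj u) (vec u)"
  unfolding over_def by (cases u) auto

lemma over_Int: "over (U \<inter> V) = over U \<inter> over V" and over_mono: "U \<subseteq> V \<Longrightarrow> over U \<subseteq> over V"
  by (auto simp: in_over)

lemma Tan_in_over [simp]: "Tan p v \<in> over W \<longleftrightarrow> p \<in> W \<and> v \<in> TS p"
  by (simp add: in_over)

lemma base_coords_TM: "i \<in> charts M \<Longrightarrow> proj u \<in> cdom M i \<Longrightarrow> base_coords dM (coords TM i u) = coords M i (proj u)"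
  using coords_mem[of i "proj u"] by (auto simp: base_coords_def fun_eq_iff)

text \<open>Over a point of W every choice of fibre coordinates occurs, because
  \<open>tvec_of\<close> supplies a tangent vector with prescribed components in chart i.\<close>

lemma coords_TM_image:
  assumes i: "i \<in> charts M" and W: "W \<subseteq> cdom M i"
  shows "coords TM i ` over W = {x \<in> coord_space (2 * dM). base_coords dM x \<in> coords M i ` W}"
proof (intro equalityI subsetI)
  fix x assume "x \<in> coords TM i ` over W"
  then obtain u where u: "u \<in> over W" "x = coords TM i u" by blast
  then have "proj u \<in> W" by (simp add: in_over)
  then have "base_coords dM x = coords M i (proj u)" unfolding u(2) using base_coords_TM i W by blast
  then show "x \<in> {x \<in> coord_space (2 * dM). base_coords dM x \<in> coords M i ` W}"
    using u \<open>proj u \<in> W\<close> by auto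
next
  fix x assume x: "x \<in> {x \<in> coord_space (2 * dM). base_coords dM x \<in> coords M i ` W}"
  then obtain p where p: "p \<in> W" "base_coords dM x = coords M i p" by blast
  have i': "chart_around M p i" using p i W by auto
  let ?u = "Tan p (tvec_of i p (fibre_coords dM x))"
  have "x = coords TM i ?u"
  proof (rule ext)
    fix b
    show "x b = coords TM i ?u b"
      using x fun_cong[OF p(2), of b] tvec_of_comp[OF i', of "b - dM"]
      by (auto simp: base_coords_def fibre_coords_def)
  qed
  moreover have "?u \<in> over W" using p tvec_of_in[OF i'] by simp
  ultimately show "x \<in> coords TM i ` over W" by blast
qed

lemma inj_coords_TM: assumes i: "i \<in> charts M" shows "inj_on (coords TM i) (over (cdom M i))"
proof (rule inj_onI)
  fix u u' assume u: "u \<in> over (cdom M i)" and u': "u' \<in> over (cdom M i)" and eq: "coords TM i u = coords TM i u'"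
  have "coords M i (proj u) = coords M i (proj u')"
    using base_coords_TM[OF i, of u] base_coords_TM[OF i, of u'] u u' eq by (simp add: in_over)
  then have p: "proj u = proj u'" using inj_coords[OF i] u u' by (auto simp: in_over inj_on_def)
  have "vec u i a = vec u' i a" if "a < dM" for a
    using fun_cong[OF eq, of "dM + a"] that by simp
  then have "vec u = vec u'"
    using u u' p i by (intro tangent_ext[of _ "proj u" _ i]) (auto simp: in_over)
  then show "u = u'" using u u' p by (metis in_over)
qed

lemma param_TM: "i \<in> charts M \<Longrightarrow> u \<in> over (cdom M i) \<Longrightarrow> param TM i (coords TM i u) = u"
  unfolding param_def by (simp add: inj_coords_TM inv_into_f_f del: TM_simps(5))

text \<open>The base coordinates change as on M. The fibre coordinates change by the Jacobian, an
  expression linear in the fibre whose coefficients are smooth functions of the base point.\<close>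

lemma smooth_transition_TM:
  assumes i: "i \<in> charts M" and j: "j \<in> charts M" and b: "b < 2 * dM"
  shows "smooth_coord (2 * dM) (coords TM i ` over (cdom M i \<inter> cdom M j)) (\<lambda>x. coords TM j (param TM i x) b)"
proof -
  let ?S = "coords TM i ` over (cdom M i \<inter> cdom M j)"
  have S: "?S = {x \<in> coord_space (2 * dM). base_coords dM x \<in> coords M i ` (cdom M i \<inter> cdom M j)}"
    by (rule coords_TM_image[OF i]) auto
  have oS: "open_coord (2 * dM) ?S" unfolding S by (rule open_coord_base[OF open_coords_overlap[OF i j]])
  have S': "base_coords dM x \<in> coords M i ` (cdom M i \<inter> cdom M j)" if "x \<in> ?S" for x using that unfolding S by blast
  show ?thesis
  proof (cases "b < dM")
    case True
    have "smooth_coord (2 * dM) ?S (\<lambda>x. coords M j (param M i (base_coords dM x)) b)"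
      by (rule smooth_coord_base_compose[OF smooth_transition[OF i j True] oS S'])
    then show ?thesis
    proof (rule smooth_coord_cong)
      fix x assume "x \<in> ?S"
      then obtain u where u: "u \<in> over (cdom M i \<inter> cdom M j)" "x = coords TM i u" by blast
      then have "param TM i x = u" "base_coords dM x = coords M i (proj u)"
        using param_TM[OF i, of u] base_coords_TM[OF i, of u] by (auto simp: in_over simp del: TM_simps(5))
      then show "coords M j (param M i (base_coords dM x)) b = coords TM j (param TM i x) b"
        using True u(1) i by (simp add: in_over)
    qed
  next
    case False
    then have b': "b - dM < dM" using b by auto
    have "smooth_coord (2 * dM) ?S (\<lambda>x. \<Sum>a<dM. pderiv_at a (\<lambda>x. coords M j (param M i x) (b - dM)) (base_coords dM x) * x (dM + a))"
      by (intro smooth_coord_sum[OF oS] smooth_coord_mult smooth_coord_coord[OF oS]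
          smooth_coord_base_compose[OF smooth_coord_pderiv[OF smooth_transition[OF i j b']] oS S']) auto
    then show ?thesis
    proof (rule smooth_coord_cong)
      fix x assume "x \<in> ?S"
      then obtain u where u: "u \<in> over (cdom M i \<inter> cdom M j)" "x = coords TM i u" by blast
      then have 1: "param TM i x = u" "base_coords dM x = coords M i (proj u)"
        using param_TM[OF i, of u] base_coords_TM[OF i, of u] by (auto simp: in_over simp del: TM_simps(5))
      have "vec u j (b - dM) = (\<Sum>a<dM. jac i j (proj u) (b - dM) a * vec u i a)"
        using u(1) i j b' by (intro tangentD(1)) (auto simp: in_over)
      then show "(\<Sum>a<dM. pderiv_at a (\<lambda>x. coords M j (param M i x) (b - dM)) (base_coords dM x) * x (dM + a)) =
          coords TM j (param TM i x) b"
        using False b 1 u(2) by (simp add: jac_def)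
    qed
  qed
qed

lemma smooth_atlas_TM: "smooth_atlas TM"
proof -
  have 1: "(\<Union>i\<in>charts TM. cdom TM i) = points TM" by (auto simp: points_eq in_over)
  have 2: "open_coord (2 * dM) (coords TM i ` over W)" if "i \<in> charts M" "W \<subseteq> cdom M i" "open_coord dM (coords M i ` W)" for i W
    unfolding coords_TM_image[OF that(1,2)] by (rule open_coord_base[OF that(3)])
  show ?thesis unfolding smooth_atlas_def TM_simps(1-4)
  proof (intro conjI ballI allI impI)
    show "(\<Union>i\<in>charts M. over (cdom M i)) = over (points M)" using 1 by simp
    fix i assume i: "i \<in> charts M"
    show "inj_on (coords TM i) (over (cdom M i))" by (rule inj_coords_TM[OF i])
    show "open_coord (2 * dM) (coords TM i ` over (cdom M i))"
      by (rule 2[OF i order_refl open_coords_cdom[OF i]])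
    fix j assume j: "j \<in> charts M"
    show "open_coord (2 * dM) (coords TM i ` (over (cdom M i) \<inter> over (cdom M j)))"
      unfolding over_Int[symmetric] by (rule 2[OF i _ open_coords_overlap[OF i j]]) auto
    show "smooth_coord (2 * dM) (coords TM i ` (over (cdom M i) \<inter> over (cdom M j)))
           (\<lambda>x. coords TM j (param TM i x) b)" if "b < 2 * dM" for b
      unfolding over_Int[symmetric] by (rule smooth_transition_TM[OF i j that])
  qed
qed

sublocale T: smooth_mfd "tangent_bundle M"
  by unfold_locales (rule smooth_atlas_TM)

section \<open>Topology of the tangent bundle\<close>

lemma open_over: assumes "opn U" shows "T.opn (over U)"
  unfolding T.openin_mtop
proof (intro conjI ballI)
  show "over U \<subseteq> points TM" using opn_subset[OF assms] by (simp add: over_mono)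
  fix i assume "i \<in> charts TM"
  then have i: "i \<in> charts M" by simp
  have "coords TM i ` over (U \<inter> cdom M i) = {x \<in> coord_space (2 * dM). base_coords dM x \<in> coords M i ` (U \<inter> cdom M i)}"
    by (rule coords_TM_image[OF i]) auto
  then show "open_coord (mdim TM) (coords TM i ` (over U \<inter> cdom TM i))"
    using open_coord_base[OF open_coords_image[OF assms i]] by (simp add: over_Int del: TM_simps(5))
qed

lemma open_over_box:
  assumes U: "opn U" "U \<subseteq> cdom M i" and i: "i \<in> charts M"
  shows "T.opn {u \<in> over U. \<forall>a<dM. \<bar>vec u i a - c a\<bar> < r}"
proof -
  let ?W = "{x \<in> coord_space (2 * dM). base_coords dM x \<in> coords M i ` U \<and> (\<forall>a<dM. \<bar>x (dM + a) - c a\<bar> < r)}"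
  have oU: "open_coord dM (coords M i ` U)" using open_coords_image[OF U(1) i] U(2) by (simp add: Int_absorb2)
  have img: "coords TM i ` over U = {x \<in> coord_space (2 * dM). base_coords dM x \<in> coords M i ` U}"
    by (rule coords_TM_image[OF i U(2)])
  have ov: "over U \<subseteq> over (cdom M i)" using U(2) by (rule over_mono)
  have "?W \<subseteq> coords TM i ` over U" unfolding img by blast
  also have "\<dots> \<subseteq> coords TM i ` cdom TM i" using ov by (simp add: image_mono del: TM_simps(5))
  finally have "T.opn (param TM i ` ?W)"
    by (intro T.open_param_image) (use i open_coord_fibred[OF oU] in \<open>simp_all del: TM_simps(5)\<close>)
  moreover have "param TM i ` ?W = {u \<in> over U. \<forall>a<dM. \<bar>vec u i a - c a\<bar> < r}"
  proof (intro equalityI subsetI)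
    fix u assume "u \<in> param TM i ` ?W"
    then obtain x where x: "x \<in> ?W" "u = param TM i x" by blast
    then obtain u' where u': "u' \<in> over U" "x = coords TM i u'" using img by blast
    then have "u = u'" using x(2) param_TM[OF i] ov by blast
    then show "u \<in> {u \<in> over U. \<forall>a<dM. \<bar>vec u i a - c a\<bar> < r}" using u' x(1) by auto
  next
    fix u assume u: "u \<in> {u \<in> over U. \<forall>a<dM. \<bar>vec u i a - c a\<bar> < r}"
    then have "coords TM i u \<in> ?W" using img by auto
    moreover have "u = param TM i (coords TM i u)" using u param_TM[OF i, of u] ov by auto
    ultimately show "u \<in> param TM i ` ?W" by blast
  qed
  ultimately show ?thesis by simp
qed

text \<open>Vectors at different points are separated by open sets of the base. Vectors at the same
  point differ in some component of a common chart and are separated by two fibre boxes whose radius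
  is half that difference.\<close>

lemma Hausdorff_TM: assumes "Hausdorff_space (mtop M)" shows "Hausdorff_space (mtop TM)"
  unfolding Hausdorff_space_def
proof (intro allI impI)
  fix u u' assume "u \<in> topspace (mtop TM) \<and> u' \<in> topspace (mtop TM) \<and> u \<noteq> u'"
  then have u: "u \<in> over (points M)" and u': "u' \<in> over (points M)" and ne: "u \<noteq> u'"
    using T.opn_subset[OF openin_topspace] by auto
  have top: "points M \<subseteq> topspace (mtop M)"
    unfolding points_eq using open_cdom openin_subset by (metis UN_least)
  show "\<exists>U V. T.opn U \<and> T.opn V \<and> u \<in> U \<and> u' \<in> V \<and> disjnt U V"
  proof (cases "proj u = proj u'")
    case False
    have "proj u \<in> topspace (mtop M)" "proj u' \<in> topspace (mtop M)" using u u' top by (auto simp: in_over)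
    then obtain U V where "opn U" "opn V" "proj u \<in> U" "proj u' \<in> V" "disjnt U V"
      using assms[unfolded Hausdorff_space_def, rule_format, of "proj u" "proj u'"] False by blast
    then show ?thesis using open_over u u'
      by (intro exI[of _ "over U"] exI[of _ "over V"]) (auto simp: in_over disjnt_def)
  next
    case True
    obtain i where i: "i \<in> charts M" "proj u \<in> cdom M i" using chart_at u by (metis in_over)
    have "vec u \<noteq> vec u'" using True ne u u' by (metis in_over)
    then obtain a where a: "a < dM" "vec u i a \<noteq> vec u' i a"
      using tangent_ext[of "vec u" "proj u" "vec u'" i] u u' True i by (auto simp: in_over)
    define r where "r = \<bar>vec u i a - vec u' i a\<bar> / 2"
    have r: "r > 0" using a by (simp add: r_def)
    let ?B = "\<lambda>c. {w \<in> over (cdom M i). \<forall>a<dM. \<bar>vec w i a - c a\<bar> < r}"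
    have "disjnt (?B (vec u i)) (?B (vec u' i))"
    proof (unfold disjnt_iff, intro allI notI, elim conjE)
      fix w assume "w \<in> ?B (vec u i)" "w \<in> ?B (vec u' i)"
      then have "\<bar>vec w i a - vec u i a\<bar> < r" "\<bar>vec w i a - vec u' i a\<bar> < r" using a(1) by auto
      moreover have "\<bar>vec u i a - vec u' i a\<bar> \<le> \<bar>vec w i a - vec u i a\<bar> + \<bar>vec w i a - vec u' i a\<bar>" by arith
      ultimately show False unfolding r_def by argo
    qed
    moreover have "u \<in> ?B (vec u i)" "u' \<in> ?B (vec u' i)" using u u' i True r by (auto simp: in_over)
    ultimately show ?thesis
      using open_over_box[OF open_cdom[OF i(1)] order_refl i(1), of "vec u i" r]
        open_over_box[OF open_cdom[OF i(1)] order_refl i(1), of "vec u' i" r] by blast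
  qed
qed

text \<open>A countable base is given by the boxes over members of a base of \<open>M\<close>, in countably many charts.\<close>

lemma second_countable_TM: assumes "second_countable (mtop M)" shows "second_countable (mtop TM)"
proof -
  obtain B where B: "countable B" "\<forall>V\<in>B. opn V" "\<forall>U x. opn U \<and> x \<in> U \<longrightarrow> (\<exists>V\<in>B. x \<in> V \<and> V \<subseteq> U)"
    using assms unfolding second_countable_def by blast
  \<comment> \<open>The atlas may be uncountable; only charts assigned to members of the countable
    base B are used.\<close>
  define ch where "ch V = (SOME i. i \<in> charts M \<and> V \<subseteq> cdom M i)" for V
  \<comment> \<open>V0 serves to name a chart, V bounds the base point, and c and r are the rational
    centre and radius of a box in the fibre.\<close>
  define G where "G = (\<lambda>(V0, V, c :: rat list, r :: rat).
     {u \<in> over V. \<forall>a<dM. \<bar>vec u (ch V0) a - real_of_rat (c ! a)\<bar> < real_of_rat r})"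
  define I where "I = {(V0, V, c :: rat list, r :: rat). V0 \<in> B \<and> V \<in> B \<and> ch V0 \<in> charts M \<and> V \<subseteq> cdom M (ch V0)}"
  have "I \<subseteq> B \<times> B \<times> UNIV" unfolding I_def by auto
  then have cI: "countable I"
    by (rule countable_subset) (intro countable_SIGMA B countableI_type)
  have op: "T.opn (G x)" if "x \<in> I" for x
  proof -
    obtain V0 V c r where x: "x = (V0, V, c, r)" by (cases x) auto
    have "opn V" "V \<subseteq> cdom M (ch V0)" "ch V0 \<in> charts M" using that B(2) unfolding x I_def by auto
    from open_over_box[OF this] show ?thesis unfolding x G_def by simp
  qed
  have base: "\<exists>x\<in>I. u \<in> G x \<and> G x \<subseteq> W" if W: "T.opn W" and u: "u \<in> W" for W u
  proof -
    have uo: "u \<in> over (points M)" using T.opn_subset[OF W] u by auto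
    then have "proj u \<in> points M" by (simp add: in_over)
    then obtain j where j: "j \<in> charts M" "proj u \<in> cdom M j" by (rule chart_at)
    then obtain V0 where V0: "V0 \<in> B" "proj u \<in> V0" "V0 \<subseteq> cdom M j" using B(3) open_cdom by blast
    define i where "i = ch V0"
    have i: "i \<in> charts M" "V0 \<subseteq> cdom M i"
      using someI[of "\<lambda>i. i \<in> charts M \<and> V0 \<subseteq> cdom M i" j] V0 j unfolding i_def ch_def by auto
    have "open_coord (2 * dM) (coords TM i ` (W \<inter> over (cdom M i)))"
      using T.open_coords_image[OF W, of i] i by (simp del: TM_simps(5))
    moreover have "coords TM i u \<in> coords TM i ` (W \<inter> over (cdom M i))"
      using u uo V0 i by (intro imageI) (auto simp: in_over)
    ultimately obtain e where e: "e > 0" "\<And>y. \<lbrakk>y \<in> coord_space (2 * dM); \<And>a. a < 2 * dM \<Longrightarrow> \<bar>y a - coords TM i u a\<bar> < e\<rbrakk>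
        \<Longrightarrow> y \<in> coords TM i ` (W \<inter> over (cdom M i))"
      using open_coord_boxE by blast
    define Q where "Q = param M i ` {x \<in> coords M i ` V0. \<forall>a<dM. \<bar>x a - coords M i (proj u) a\<bar> < e}"
    have oV0: "open_coord dM (coords M i ` V0)"
      using open_coords_image[of V0 i] B(2) V0(1) i by (auto simp: Int_absorb2)
    have "open_coord dM {x \<in> coords M i ` V0. \<forall>a<dM. \<bar>x a - coords M i (proj u) a\<bar> < e}"
    proof -
      have "{x \<in> coords M i ` V0. \<forall>a<dM. \<bar>x a - coords M i (proj u) a\<bar> < e} =
          coords M i ` V0 \<inter> (\<Inter>a\<in>{..<dM}. {x. \<bar>x a - coords M i (proj u) a\<bar> < e})" by auto
      moreover have "open (\<Inter>a\<in>{..<dM}. {x :: nat \<Rightarrow> real. \<bar>x a - coords M i (proj u) a\<bar> < e})"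
        by (intro open_INT ballI finite_lessThan open_Collect_less continuous_intros continuous_on_product_coordinates)
      ultimately show ?thesis using openin_Int_open[OF oV0[unfolded Euclidean_space_top_of_set]]
        unfolding Euclidean_space_top_of_set by simp
    qed
    then have "opn Q" unfolding Q_def using i by (intro open_param_image) auto
    moreover have "proj u \<in> Q" unfolding Q_def using V0(2) i e(1)
      by (intro image_eqI[of _ _ "coords M i (proj u)"]) auto
    ultimately obtain V where V: "V \<in> B" "proj u \<in> V" "V \<subseteq> Q" using B(3) by blast
    have Qi: "Q \<subseteq> cdom M i" unfolding Q_def using i by auto
    have Qe: "\<bar>coords M i p a - coords M i (proj u) a\<bar> < e" if "p \<in> Q" "a < dM" for p a
      using that i unfolding Q_def by auto
    \<comment> \<open>Half of e, since two vectors of the box are compared through its rational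
      centre.\<close>
    obtain r where r: "0 < real_of_rat r" "real_of_rat r < e / 2"
      using of_rat_dense[of 0 "e/2"] e(1) by auto
    have "\<forall>a. \<exists>q. \<bar>vec u i a - real_of_rat q\<bar> < real_of_rat r"
    proof
      fix a
      obtain q where "vec u i a < real_of_rat q" "real_of_rat q < vec u i a + real_of_rat r"
        using of_rat_dense[of "vec u i a" "vec u i a + real_of_rat r"] r(1) by auto
      then show "\<exists>q. \<bar>vec u i a - real_of_rat q\<bar> < real_of_rat r" by (intro exI[of _ q]) auto
    qed
    from choice[OF this] obtain q where q: "\<forall>a. \<bar>vec u i a - real_of_rat (q a)\<bar> < real_of_rat r" ..
    define c where "c = map q [0..<dM]"
    have ca: "c ! a = q a" if "a < dM" for a using that by (simp add: c_def)
    have "(V0, V, c, r) \<in> I" unfolding I_def using V0(1) V(1,3) Qi i(1) unfolding i_def by auto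
    moreover have "u \<in> G (V0, V, c, r)"
      unfolding G_def using q V(2) uo ca unfolding i_def by (auto simp: in_over)
    moreover have "G (V0, V, c, r) \<subseteq> W"
    proof
      fix w assume "w \<in> G (V0, V, c, r)"
      then have w: "w \<in> over V" "\<forall>a<dM. \<bar>vec w i a - real_of_rat (q a)\<bar> < real_of_rat r"
        unfolding G_def i_def using ca by auto
      have wQ: "proj w \<in> Q" "w \<in> over (cdom M i)" using w(1) V(3) Qi by (auto simp: in_over)
      have "coords TM i w \<in> coords TM i ` (W \<inter> over (cdom M i))"
      proof (rule e(2))
        show "\<bar>coords TM i w a - coords TM i u a\<bar> < e" if a: "a < 2 * dM" for a
        proof (cases "a < dM")
          case True then show ?thesis using Qe[OF wQ(1) True] by simp
        next
          case False
          have "\<bar>vec w i (a - dM) - real_of_rat (q (a - dM))\<bar> < real_of_rat r" using w(2) a False by auto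
          moreover have "\<bar>vec u i (a - dM) - real_of_rat (q (a - dM))\<bar> < real_of_rat r" using q by blast
          ultimately have "\<bar>vec w i (a - dM) - vec u i (a - dM)\<bar> < e" using r(2) by argo
          then show ?thesis using False a by simp
        qed
      qed auto
      then obtain w' where w': "w' \<in> W" "w' \<in> over (cdom M i)" "coords TM i w = coords TM i w'" by blast
      then have "w = w'" using inj_coords_TM[OF i(1)] wQ(2) unfolding inj_on_def by blast
      then show "w \<in> W" using w' by simp
    qed
    ultimately show ?thesis by blast
  qed
  show ?thesis unfolding second_countable_def
  proof (intro exI[of _ "G ` I"] conjI ballI allI impI)
    show "countable (G ` I)" using cI by simp
    show "T.opn V" if "V \<in> G ` I" for V using that op by auto
    fix U x assume "T.opn U \<and> x \<in> U"
    then obtain y where "y \<in> I" "x \<in> G y" "G y \<subseteq> U" using base[of U x] by auto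
    then show "\<exists>V\<in>G ` I. x \<in> V \<and> V \<subseteq> U" by (intro bexI[of _ "G y"]) auto
  qed
qed

end

section \<open>Horizontal and vertical lifts\<close>

locale tconn = tmfd M + conn_mfd M nab for M :: "('a, 'i) tmanifold" and nab :: "(('a, 'i) tpoint, 'i) conn"
begin

abbreviation "H \<equiv> hlift M nab"
abbreviation "V \<equiv> vlift M"

lemma chart_TM: "chart_around TM u i \<longleftrightarrow> i \<in> charts M \<and> u \<in> over (cdom M i)"
  by simp

lemma over_chart: assumes "u \<in> over (points M)" obtains i where "i \<in> charts M" "proj u \<in> cdom M i" "u \<in> over (cdom M i)"
proof -
  obtain i where "i \<in> charts M" "proj u \<in> cdom M i" using chart_at assms by (metis in_over)
  then show thesis using assms that by (simp add: in_over)
qed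

section \<open>Lifts of fields in charts\<close>

lemma fibre_curve:
  "((\<lambda>t. coords TM i (Tan (proj u) (vec u + t *\<^sub>R x)) b) has_real_derivative
     (if dM \<le> b \<and> b < 2 * dM then x i (b - dM) else 0)) (at 0)"
  by (auto intro!: derivative_eq_intros)

lemma vlift_comp:
  assumes "i \<in> charts M" "u \<in> over (cdom M i)"
  shows "V X u i b = (if dM \<le> b \<and> b < 2 * dM then X (proj u) i (b - dM) else 0)"
  unfolding vlift_def using DERIV_imp_deriv[OF fibre_curve[of i u "X (proj u)" b]] assms chart_TM
  by (simp del: TM_simps(5))

text \<open>The vertical lift is the velocity of a line in the fibre. Computing this velocity in two
  charts and applying the chain rule to the transition map gives the transformation law.\<close>

lemma vlift_in:
  assumes u: "u \<in> over (points M)" and x: "X (proj u) \<in> TS (proj u)"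
  shows "V X u \<in> T.TS u"
proof (rule T.tangentI)
  fix i j b assume "chart_around TM u i" "chart_around TM u j" and "b < mdim TM"
  then have i: "i \<in> charts M" "u \<in> over (cdom M i)" and j: "j \<in> charts M" "u \<in> over (cdom M j)"
    and b: "b < 2 * dM" by auto
  let ?S = "coords TM i ` over (cdom M i \<inter> cdom M j)" and ?F = "\<lambda>x. coords TM j (param TM i x) b"
  let ?c = "\<lambda>t. coords TM i (Tan (proj u) (vec u + t *\<^sub>R X (proj u)))"
  have F: "smooth_coord (2 * dM) ?S ?F" by (rule smooth_transition_TM[OF i(1) j(1) b])
  have in_ov: "Tan (proj u) (vec u + t *\<^sub>R X (proj u)) \<in> over (cdom M i \<inter> cdom M j)" for t
    using i j x by (auto simp: in_over intro: TS_add TS_scale)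
  have u0: "Tan (proj u) (vec u + 0 *\<^sub>R X (proj u)) = u" using u by (simp add: in_over)
  have "((\<lambda>t. ?F (?c t)) has_real_derivative
      (\<Sum>a<2*dM. pderiv_at a ?F (?c 0) * (if dM \<le> a \<and> a < 2 * dM then X (proj u) i (a - dM) else 0))) (at 0)"
  proof (rule chain_rule_curve[OF smooth_coord_open[OF F] smooth_coord_differentiable[OF F]])
    show "continuous_on ?S (pderiv_at a ?F)" if "a < 2 * dM" for a
      using smooth_coord_continuous[OF smooth_coord_pderiv[OF F that]] .
    show "?c 0 \<in> ?S" using in_ov by blast
    show "eventually (\<lambda>t. ?c t \<in> coord_space (2 * dM)) (at 0)" by (simp add: eventually_True)
  qed (rule fibre_curve)
  moreover have "?F (?c t) = coords TM j (Tan (proj u) (vec u + t *\<^sub>R X (proj u))) b" for t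
    using param_TM[OF i(1), of "Tan (proj u) (vec u + t *\<^sub>R X (proj u))"] in_ov[of t] by (simp add: over_Int del: TM_simps(5))
  ultimately have "((\<lambda>t. coords TM j (Tan (proj u) (vec u + t *\<^sub>R X (proj u))) b) has_real_derivative
      (\<Sum>a<2*dM. T.jac i j u b a * V X u i a)) (at 0)"
    unfolding u0 T.jac_def vlift_comp[OF i] by (simp del: TM_simps(5))
  from DERIV_unique[OF this fibre_curve] show "V X u j b = (\<Sum>a<mdim TM. T.jac i j u b a * V X u i a)"
    unfolding vlift_comp[OF j] by simp
next
  fix i b assume "\<not> chart_around TM u i \<or> b \<ge> mdim TM"
  then show "V X u i b = 0"
  proof (cases "chart_around TM u i")
    case False then show ?thesis unfolding vlift_def by (simp only: if_False)
  next
    case True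
    then have "i \<in> charts M" "u \<in> over (cdom M i)" by auto
    from vlift_comp[OF this] show ?thesis using \<open>\<not> chart_around TM u i \<or> b \<ge> mdim TM\<close> True by auto
  qed
qed

text \<open>The difference between the componentwise derivative of Y and \<open>nab X Y\<close> is
  tensorial in Y. It may therefore be evaluated on the coordinate fields, whose components in chart
  i are constant.\<close>

lemma nab_comp:
  assumes X: "vf U X" "p \<in> U" and Y: "vf U' Y" "p \<in> U'" and i: "chart_around M p i" and b: "b < dM"
  shows "nab X Y p i b = dd p (X p) (\<lambda>q. Y q i b) + (\<Sum>c<dM. Y p i c * nab X (cfield i c) p i b)"
proof -
  have ic: "i \<in> charts M" using i by blast
  let ?\<Phi> = "\<lambda>Y. dd p (X p) (\<lambda>q. Y q i b) - nab X Y p i b"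
  have t: "tensorial_at p ?\<Phi>"
  proof (rule tensorialI)
    fix Q Z Z' assume Q: "p \<in> Q" "vf Q Z" "vf Q Z'"
    obtain W where W: "p \<in> W" "vf W X" "vf W Z" "W \<subseteq> U" "W \<subseteq> Q" using common_domain[OF X Q(2,1)] .
    have Z': "vf W Z'" using vf_mono[OF Q(3) vf_open[OF W(2)] W(5)] .
    show "?\<Phi> (Z + Z') = ?\<Phi> Z + ?\<Phi> Z'"
      using nab_add2[OF W(2,3) Z' W(1)] dd_add[OF vf_comp_at(3)[OF W(3,1) i] vf_comp_at(3)[OF Z' W(1) i] vf_comp_at(2)[OF Z' W(1) i]]
      by simp
  next
    fix Q f Z assume Q: "p \<in> Q" "sf Q f" "vf Q Z"
    obtain W where W: "p \<in> W" "vf W X" "vf W Z" "W \<subseteq> U" "W \<subseteq> Q" using common_domain[OF X Q(3,1)] .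
    have f: "sf W f" using sf_mono[OF Q(2) vf_open[OF W(2)] W(5)] .
    note c = vf_comp_at[OF W(3,1) i]
    show "?\<Phi> (fscale f Z) = f p *\<^sub>R ?\<Phi> Z"
      using nab_fscale2[OF f W(2,3,1)] dd_mult[OF sf_mono[OF f c(1)] c(3) c(2)]
      by (simp add: fscale_def algebra_simps)
  qed
  have "dd p (X p) (\<lambda>q. cfield i c q i b) = 0" for c
    using dd_cong[OF open_cdom[OF ic], of p "\<lambda>q. cfield i c q i b" "\<lambda>q. if b = c then 1 else 0" "X p"] i b
    by (auto simp: cfield_self dd_const)
  then have "?\<Phi> Y = (\<Sum>c<dM. - (Y p i c * nab X (cfield i c) p i b))"
    using tensorial_expand[OF t Y i] by simp
  then show ?thesis by (simp add: sum_negf)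
qed

text \<open>The classical chart expression of the horizontal lift at a vector v: the components of X
  followed by those of - \<Gamma>(X, v), where the Christoffel terms are written as derivatives of
  the coordinate fields.\<close>

definition hc :: "'i \<Rightarrow> (('a, 'i) tpoint, 'i) vfield \<Rightarrow> ('a, 'i) tpoint \<Rightarrow> nat \<Rightarrow> real" where
  "hc i X u b = (if b < dM then X (proj u) i b else if b < 2 * dM
     then - (\<Sum>c<dM. vec u i c * nab X (cfield i c) (proj u) i (b - dM)) else 0)"

text \<open>In the fibre components the derivative of Y along X occurs in the differential of the
  section and again in \<open>nab X Y\<close>, and cancels. What remains depends on X and
  \<open>vec u\<close> but not on the section, which makes the definite description of
  \<open>hlift\<close> meaningful.\<close>

lemma section_lift:
  assumes u: "u \<in> over (points M)" and X: "vf U X" "proj u \<in> U" and Y: "vf U' Y" "proj u \<in> U'" "Y (proj u) = vec u"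
  shows "differential M TM (\<lambda>q. Tan q (Y q)) (proj u) (X (proj u)) - V (nab X Y) u =
     (\<lambda>i b. if i \<in> charts M \<and> u \<in> over (cdom M i) then hc i X u b else 0)"
proof (intro ext)
  fix i b
  have uT: "Tan (proj u) (Y (proj u)) = u" using u Y(3) by (simp add: in_over)
  show "(differential M TM (\<lambda>q. Tan q (Y q)) (proj u) (X (proj u)) - V (nab X Y) u) i b =
     (if i \<in> charts M \<and> u \<in> over (cdom M i) then hc i X u b else 0)"
  proof (cases "i \<in> charts M \<and> u \<in> over (cdom M i)")
    case True
    then have i: "i \<in> charts M" "u \<in> over (cdom M i)" "chart_around M (proj u) i" by (auto simp: in_over)
    have D: "differential M TM (\<lambda>q. Tan q (Y q)) (proj u) (X (proj u)) i b =
        dd (proj u) (X (proj u)) (\<lambda>q. coords TM i (Tan q (Y q)) b)"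
      unfolding differential_def uT using True by simp
    consider "b < dM" | "dM \<le> b" "b < 2 * dM" | "2 * dM \<le> b" by linarith
    then show ?thesis
    proof cases
      case 1
      then show ?thesis using True D vlift_comp[OF i(1,2)] dd_coord[OF vf_in[OF X] i(3) 1]
        by (simp add: hc_def)
    next
      case 2
      then have "nab X Y (proj u) i (b - dM) = dd (proj u) (X (proj u)) (\<lambda>q. Y q i (b - dM)) +
          (\<Sum>c<dM. vec u i c * nab X (cfield i c) (proj u) i (b - dM))"
        using nab_comp[OF X Y(1,2) i(3), of "b - dM"] Y(3) by simp
      then show ?thesis using True 2 D vlift_comp[OF i(1,2)] by (simp add: hc_def)
    next
      case 3
      then show ?thesis using True D vlift_comp[OF i(1,2)] by (simp add: hc_def dd_const)
    qed
  next
    case False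
    then have "\<not> chart_around TM u i" by simp
    then show ?thesis using False unfolding differential_def vlift_def uT by (simp only: if_False minus_apply diff_self zero_fun_apply)
  qed
qed

lemma hlift_eq:
  assumes u: "u \<in> over (points M)" and X: "vf U X" "proj u \<in> U"
  shows "H X u = (\<lambda>i b. if i \<in> charts M \<and> u \<in> over (cdom M i) then hc i X u b else 0)"
  unfolding hlift_def
proof (rule the_equality)
  show "\<forall>U Y. proj u \<in> U \<longrightarrow> vf U Y \<longrightarrow> Y (proj u) = vec u \<longrightarrow>
      (\<lambda>i b. if i \<in> charts M \<and> u \<in> over (cdom M i) then hc i X u b else 0) =
      differential M TM (\<lambda>q. Tan q (Y q)) (proj u) (X (proj u)) - V (nab X Y) u"
    using section_lift[OF u X] by simp
  fix w assume w: "\<forall>U Y. proj u \<in> U \<longrightarrow> vf U Y \<longrightarrow> Y (proj u) = vec u \<longrightarrow>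
      w = differential M TM (\<lambda>q. Tan q (Y q)) (proj u) (X (proj u)) - V (nab X Y) u"
  have "proj u \<in> points M" "vec u \<in> TS (proj u)" using u by (auto simp: in_over)
  then obtain Q where Q: "proj u \<in> Q" "vf Q (extend (proj u) (vec u))" "extend (proj u) (vec u) (proj u) = vec u"
    by (rule extend)
  show "w = (\<lambda>i b. if i \<in> charts M \<and> u \<in> over (cdom M i) then hc i X u b else 0)"
    using w[rule_format, OF Q] section_lift[OF u X Q(2,1,3)] by simp
qed

lemma hlift_comp:
  assumes "u \<in> over U" "vf U X" "i \<in> charts M" "proj u \<in> cdom M i"
  shows "H X u i b = hc i X u b"
proof -
  have "u \<in> over (points M)" "proj u \<in> U" "u \<in> over (cdom M i)"
    using assms vf_points[OF assms(2)] by (auto simp: in_over)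
  then show ?thesis using hlift_eq[of u U X] assms by simp
qed

text \<open>Tangency is read off from the description by a section: the differential of a section
  transforms by the chain rule, and the subtracted vertical lift is tangent already.\<close>

lemma hlift_in:
  assumes u: "u \<in> over (points M)" and X: "vf U X" "proj u \<in> U"
  shows "H X u \<in> T.TS u"
proof -
  have "proj u \<in> points M" "vec u \<in> TS (proj u)" using u by (auto simp: in_over)
  then obtain Q where Q: "proj u \<in> Q" "vf Q (extend (proj u) (vec u))" "extend (proj u) (vec u) (proj u) = vec u"
    by (rule extend)
  let ?Y = "extend (proj u) (vec u)" and ?p = "proj u"
  let ?s = "\<lambda>q. Tan q (?Y q)"
  have uT: "Tan ?p (?Y ?p) = u" using u Q(3) by (simp add: in_over)
  obtain W where W: "?p \<in> W" "vf W X" "vf W ?Y" using common_domain[OF X Q(2,1)] .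
  let ?D = "differential M TM ?s ?p (X ?p)"
  have D: "?D \<in> T.TS u"
  proof (rule T.tangentI)
    fix i j b assume ci: "chart_around TM u i" and cj: "chart_around TM u j" and "b < mdim TM"
    then have i: "i \<in> charts M" "?p \<in> cdom M i" and j: "j \<in> charts M" "?p \<in> cdom M j" and b: "b < 2 * dM"
      by (auto simp: in_over)
    let ?R = "W \<inter> (cdom M i \<inter> cdom M j)" and ?\<phi> = "\<lambda>q. coords TM i (?s q)"
    have R: "opn ?R" using vf_open[OF W(2)] open_cdom i j by auto
    have pR: "?p \<in> ?R" using W i j by auto
    have YR: "vf ?R ?Y" using vf_mono[OF W(3) R] by auto
    have "dd ?p (X ?p) (\<lambda>q. coords TM j (?s q) b) = dd ?p (X ?p) (\<lambda>q. coords TM j (param TM i (?\<phi> q)) b)"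
    proof (rule dd_cong[OF R pR])
      fix q assume "q \<in> ?R"
      then have "?s q \<in> over (cdom M i)" using vf_in[OF YR] by simp
      then show "coords TM j (?s q) b = coords TM j (param TM i (?\<phi> q)) b" using param_TM[OF i(1)] by (simp del: TM_simps(5))
    qed
    also have "\<dots> = (\<Sum>a<2*dM. pderiv_at a (\<lambda>x. coords TM j (param TM i x) b) (?\<phi> ?p) * dd ?p (X ?p) (\<lambda>q. ?\<phi> q a))"
    proof (rule dd_compose[OF smooth_transition_TM[OF i(1) j(1) b] _ R _ pR])
      show "?\<phi> q \<in> coords TM i ` over (cdom M i \<inter> cdom M j)" if "q \<in> ?R" for q
        using that vf_in[OF YR] by (intro imageI) simp
      show "sf ?R (\<lambda>q. ?\<phi> q a)" if "a < 2 * dM" for a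
      proof (cases "a < dM")
        case True
        then show ?thesis using sf_mono[OF sf_coord[OF i(1)] R] by auto
      next
        case False
        then show ?thesis using sf_mono[OF vf_comp[OF YR i(1), of "a - dM"] R] that by auto
      qed
    qed
    finally show "?D j b = (\<Sum>a<mdim TM. T.jac i j u b a * ?D i a)"
      unfolding differential_def uT T.jac_def using ci cj uT by (simp del: TM_simps(5))
  next
    fix i b assume *: "\<not> chart_around TM u i \<or> b \<ge> mdim TM"
    show "?D i b = 0"
    proof (cases "chart_around TM u i")
      case True
      then show ?thesis using * unfolding differential_def uT by (simp add: dd_const)
    next
      case False then show ?thesis unfolding differential_def uT by (simp only: if_False)
    qed
  qed
  have "V (nab X ?Y) u \<in> T.TS u" using nab_in[OF W(2,3,1)] by (rule vlift_in[OF u])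
  from T.TS_diff[OF D this] show ?thesis
    unfolding section_lift[OF u X Q(2,1,3)] hlift_eq[OF u X] .
qed

lemma hlift_tensorial:
  assumes u: "u \<in> over (points M)" shows "tensorial_at (proj u) (\<lambda>X. H X u)"
proof (rule tensorialI)
  fix U X Y assume U: "proj u \<in> U" and X: "vf U X" and Y: "vf U Y"
  have "hc i (X + Y) u b = hc i X u b + hc i Y u b" if i: "i \<in> charts M" "u \<in> over (cdom M i)" for i b
  proof -
    have c: "nab (X + Y) (cfield i c) (proj u) = nab X (cfield i c) (proj u) + nab Y (cfield i c) (proj u)" if "c < dM" for c
      using tensorial_add[OF nab_tensorial1[OF cfield_vf[OF i(1) that]] U X Y] i by (auto simp: in_over)
    show ?thesis by (auto simp: hc_def c distrib_left sum.distrib)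
  qed
  then show "H (X + Y) u = H X u + H Y u"
    unfolding hlift_eq[OF u X U] hlift_eq[OF u Y U] hlift_eq[OF u vf_add[OF X Y] U] by (auto simp: fun_eq_iff)
next
  fix U f X assume U: "proj u \<in> U" and f: "sf U f" and X: "vf U X"
  have "hc i (fscale f X) u b = f (proj u) * hc i X u b" if i: "i \<in> charts M" "u \<in> over (cdom M i)" for i b
  proof -
    have c: "nab (fscale f X) (cfield i c) (proj u) = f (proj u) *\<^sub>R nab X (cfield i c) (proj u)" if "c < dM" for c
      using tensorial_fscale[OF nab_tensorial1[OF cfield_vf[OF i(1) that]] U f X] i by (auto simp: in_over)
    show ?thesis by (auto simp: hc_def c fscale_def sum_distrib_left mult.left_commute)
  qed
  then show "H (fscale f X) u = f (proj u) *\<^sub>R H X u"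
    unfolding hlift_eq[OF u X U] hlift_eq[OF u vf_fscale[OF f X] U] by (auto simp: fun_eq_iff)
qed

section \<open>Lifts of single vectors and the splitting into horizontal and vertical parts\<close>

definition hl :: "('a, 'i) tpoint \<Rightarrow> 'i tvec \<Rightarrow> 'i tvec" where "hl u x = H (extend (proj u) x) u"
definition vl :: "('a, 'i) tpoint \<Rightarrow> 'i tvec \<Rightarrow> 'i tvec" where "vl u x = V (\<lambda>p. x) u"

lemma overD: "u \<in> over W \<Longrightarrow> proj u \<in> W" "u \<in> over W \<Longrightarrow> vec u \<in> TS (proj u)"
  by (simp_all add: in_over)

lemma over_points: "u \<in> over W \<Longrightarrow> W \<subseteq> points M \<Longrightarrow> u \<in> over (points M)"
  using over_mono by blast

lemma hlift_hl: assumes "u \<in> over U" "vf U X" shows "H X u = hl u (X (proj u))"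
proof -
  have u: "u \<in> over (points M)" and p: "proj u \<in> U" using over_points assms vf_open opn_subset overD by blast+
  obtain Q where Q: "proj u \<in> Q" "vf Q (extend (proj u) (X (proj u)))" "extend (proj u) (X (proj u)) (proj u) = X (proj u)"
    using extend[OF vf_points[OF assms(2) p] vf_in[OF assms(2) p]] .
  show ?thesis unfolding hl_def
    by (rule tensorial_cong[OF hlift_tensorial[OF u] assms(2) p Q(2,1)]) (simp add: Q(3))
qed

lemma vlift_vl: "V X u = vl u (X (proj u))"
  by (simp add: vl_def vlift_def)

lemma hl_in: assumes "u \<in> over (points M)" "x \<in> TS (proj u)" shows "hl u x \<in> T.TS u"
proof -
  obtain Q where Q: "proj u \<in> Q" "vf Q (extend (proj u) x)" "extend (proj u) x (proj u) = x"
    using extend[OF overD(1)[OF assms(1)] assms(2)] .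
  show ?thesis unfolding hl_def by (rule hlift_in[OF assms(1) Q(2,1)])
qed

lemma vl_in: "u \<in> over (points M) \<Longrightarrow> x \<in> TS (proj u) \<Longrightarrow> vl u x \<in> T.TS u"
  unfolding vl_def by (rule vlift_in)

lemma hl_lin: "u \<in> over (points M) \<Longrightarrow> lin (proj u) (hl u)"
  unfolding hl_def by (rule tensorial_lin[OF hlift_tensorial overD(1)])

lemma vl_lin: assumes "u \<in> over (points M)" shows "lin (proj u) (vl u)"
proof (rule linI)
  have d: "i \<in> charts M \<Longrightarrow> u \<in> over (cdom M i) \<Longrightarrow> vl u x i b = (if dM \<le> b \<and> b < 2 * dM then x i (b - dM) else 0)" for x i b
    unfolding vl_def by (rule vlift_comp)
  have z: "\<not> (i \<in> charts M \<and> u \<in> over (cdom M i)) \<Longrightarrow> vl u x i b = 0" for x i b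
    unfolding vl_def vlift_def chart_TM by (simp only: if_False)
  show "vl u (x + y) = vl u x + vl u y" for x y
  proof (intro ext)
    fix i b show "vl u (x + y) i b = (vl u x + vl u y) i b"
      by (cases "i \<in> charts M \<and> u \<in> over (cdom M i)") (auto simp: d z)
  qed
  show "vl u (c *\<^sub>R x) = c *\<^sub>R vl u x" for c x
  proof (intro ext)
    fix i b show "vl u (c *\<^sub>R x) i b = (c *\<^sub>R vl u x) i b"
      by (cases "i \<in> charts M \<and> u \<in> over (cdom M i)") (auto simp: d z)
  qed
qed

lemma vl_comp: "i \<in> charts M \<Longrightarrow> u \<in> over (cdom M i) \<Longrightarrow>
    vl u x i b = (if dM \<le> b \<and> b < 2 * dM then x i (b - dM) else 0)"
  unfolding vl_def by (rule vlift_comp)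

lemma hl_comp: assumes "i \<in> charts M" "u \<in> over (cdom M i)" "x \<in> TS (proj u)" "b < dM" shows "hl u x i b = x i b"
proof -
  have u: "u \<in> over (points M)" using over_points assms cdom_subset by blast
  obtain Q where Q: "proj u \<in> Q" "vf Q (extend (proj u) x)" "extend (proj u) x (proj u) = x"
    using extend[OF overD(1)[OF u] assms(3)] .
  have "u \<in> over Q" using u Q(1) by (simp add: in_over)
  from hlift_comp[OF this Q(2) assms(1) overD(1)[OF assms(2)]] show ?thesis
    using Q(3) assms(4) by (simp add: hl_def hc_def)
qed

text \<open>Horizontal part and vertical part (connection map) of a tangent vector of \<open>TM\<close> at \<open>u\<close>, both as tangent
  vectors of \<open>M\<close>.\<close>

definition hp :: "('a, 'i) tpoint \<Rightarrow> 'i tvec \<Rightarrow> 'i tvec" where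
  "hp u w = (\<lambda>i b. if chart_around M (proj u) i \<and> b < dM then w i b else 0)"

definition kp :: "('a, 'i) tpoint \<Rightarrow> 'i tvec \<Rightarrow> 'i tvec" where
  "kp u w = (\<lambda>i b. if chart_around M (proj u) i \<and> b < dM then (w - hl u (hp u w)) i (dM + b) else 0)"

lemma tvec_eqI:
  assumes "x \<in> TS p" "\<And>i b. chart_around M p i \<Longrightarrow> b < dM \<Longrightarrow> y i b = x i b"
    "\<And>i b. \<not> (chart_around M p i \<and> b < dM) \<Longrightarrow> y i b = 0"
  shows "y = x"
proof (intro ext)
  fix i b
  show "y i b = x i b"
  proof (cases "chart_around M p i \<and> b < dM")
    case False
    then have "x i b = 0" using tangentD(2)[OF assms(1), of i] tangentD(3)[OF assms(1), of b i] by auto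
    then show ?thesis using assms(3)[OF False] by simp
  qed (use assms(2) in blast)
qed

lemma hp_lift: assumes "u \<in> over (points M)" "x \<in> TS (proj u)" "y \<in> TS (proj u)" shows "hp u (hl u x + vl u y) = x"
  by (rule tvec_eqI[OF assms(2)])
    (use assms hl_comp[OF _ _ assms(2)] vl_comp in \<open>auto simp: hp_def in_over\<close>)

lemma kp_lift: assumes "u \<in> over (points M)" "x \<in> TS (proj u)" "y \<in> TS (proj u)" shows "kp u (hl u x + vl u y) = y"
  by (rule tvec_eqI[OF assms(3)])
    (use assms vl_comp[of _ u y] in \<open>auto simp: kp_def hp_lift[OF assms] in_over\<close>)

text \<open>The base components of w determine the horizontal part; what remains after subtracting
  it has only fibre components and is vertical.\<close>

lemma decomp_exists:
  assumes u: "u \<in> over (points M)" and w: "w \<in> T.TS u"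
  shows "\<exists>x\<in>TS (proj u). \<exists>y\<in>TS (proj u). w = hl u x + vl u y"
proof -
  obtain i where i: "i \<in> charts M" "proj u \<in> cdom M i" "u \<in> over (cdom M i)" using over_chart[OF u] .
  then have ci: "chart_around M (proj u) i" "chart_around TM u i" by auto
  let ?x = "tvec_of i (proj u) (w i)"
  let ?y = "tvec_of i (proj u) (\<lambda>a. (w - hl u ?x) i (dM + a))"
  have x: "?x \<in> TS (proj u)" and y: "?y \<in> TS (proj u)" using tvec_of_in[OF ci(1)] by auto
  have "w = hl u ?x + vl u ?y"
  proof (rule T.tangent_ext[OF w _ ci(2)])
    show "hl u ?x + vl u ?y \<in> T.TS u" by (intro T.TS_add hl_in vl_in u x y)
    fix a assume "a < mdim TM"
    then show "w i a = (hl u ?x + vl u ?y) i a"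
      using hl_comp[OF i(1,3) x, of a] vl_comp[OF i(1,3), of ?y a] tvec_of_comp[OF ci(1), of a] tvec_of_comp[OF ci(1), of "a - dM"]
      by (cases "a < dM") auto
  qed
  then show ?thesis using x y by blast
qed

lemma hp_in: "u \<in> over (points M) \<Longrightarrow> w \<in> T.TS u \<Longrightarrow> hp u w \<in> TS (proj u)"
  and kp_in: "u \<in> over (points M) \<Longrightarrow> w \<in> T.TS u \<Longrightarrow> kp u w \<in> TS (proj u)"
  and decomp: "u \<in> over (points M) \<Longrightarrow> w \<in> T.TS u \<Longrightarrow> w = hl u (hp u w) + vl u (kp u w)"
  using decomp_exists[of u w] hp_lift kp_lift by auto

lemma hp_hl: "u \<in> over (points M) \<Longrightarrow> x \<in> TS (proj u) \<Longrightarrow> hp u (hl u x) = x"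
  and kp_hl: "u \<in> over (points M) \<Longrightarrow> x \<in> TS (proj u) \<Longrightarrow> kp u (hl u x) = 0"
  using hp_lift[of u x 0] kp_lift[of u x 0] TS_zero lin_zero[OF vl_lin, of u] by simp_all

lemma hp_vl: "u \<in> over (points M) \<Longrightarrow> x \<in> TS (proj u) \<Longrightarrow> hp u (vl u x) = 0"
  and kp_vl: "u \<in> over (points M) \<Longrightarrow> x \<in> TS (proj u) \<Longrightarrow> kp u (vl u x) = x"
  using hp_lift[of u 0 x] kp_lift[of u 0 x] TS_zero lin_zero[OF hl_lin, of u] by simp_all

lemma hp_lin: "u \<in> over (points M) \<Longrightarrow> T.lin u (hp u)"
  by (rule T.linI) (auto simp: hp_def fun_eq_iff)

lemma kp_lin: assumes u: "u \<in> over (points M)" shows "T.lin u (kp u)"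
proof (rule T.linI)
  fix w w' assume w: "w \<in> T.TS u" "w' \<in> T.TS u"
  have "hl u (hp u (w + w')) = hl u (hp u w) + hl u (hp u w')"
    using T.lin_add[OF hp_lin[OF u] w] lin_add[OF hl_lin[OF u] hp_in[OF u w(1)] hp_in[OF u w(2)]] by simp
  then show "kp u (w + w') = kp u w + kp u w'" by (auto simp: kp_def fun_eq_iff)
next
  fix c w assume w: "w \<in> T.TS u"
  have "hl u (hp u (c *\<^sub>R w)) = c *\<^sub>R hl u (hp u w)"
    using T.lin_scale[OF hp_lin[OF u] w] lin_scale[OF hl_lin[OF u] hp_in[OF u w]] by simp
  then show "kp u (c *\<^sub>R w) = c *\<^sub>R kp u w" by (auto simp: kp_def fun_eq_iff right_diff_distrib)
qed

section \<open>Functions pulled back from the base, and smoothness of lifts\<close>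

lemma sf_proj: assumes "sf W f" shows "T.sf (over W) (\<lambda>u. f (proj u))"
  unfolding smooth_fun_on_def
proof (intro conjI ballI)
  show "T.opn (over W)" using open_over[OF sf_open[OF assms]] .
  fix i assume "i \<in> charts TM" then have i: "i \<in> charts M" by simp
  let ?S = "coords TM i ` over (W \<inter> cdom M i)"
  have S: "?S = {x \<in> coord_space (2 * dM). base_coords dM x \<in> coords M i ` (W \<inter> cdom M i)}"
    by (rule coords_TM_image[OF i]) auto
  have "open_coord (2 * dM) ?S" unfolding S by (rule open_coord_base[OF open_coords_image[OF sf_open[OF assms] i]])
  then have "smooth_coord (2 * dM) ?S (\<lambda>x. f (param M i (base_coords dM x)))"
    by (rule smooth_coord_base_compose[OF sf_coordD[OF assms i]]) (use S in blast)
  then have "smooth_coord (2 * dM) ?S (\<lambda>x. f (proj (param TM i x)))"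
  proof (rule smooth_coord_cong)
    fix x assume "x \<in> ?S"
    then obtain u where u: "u \<in> over (W \<inter> cdom M i)" "x = coords TM i u" by blast
    then have "u \<in> over (cdom M i)" "proj u \<in> cdom M i" by (auto simp: in_over)
    then show "f (param M i (base_coords dM x)) = f (proj (param TM i x))"
      unfolding u(2) using param_TM[OF i] base_coords_TM[OF i] i by (simp del: TM_simps(5))
  qed
  then show "smooth_coord (mdim TM) (coords TM i ` (over W \<inter> cdom TM i)) (\<lambda>x. f (proj (param TM i x)))"
    by (simp add: over_Int del: TM_simps(5))
qed

text \<open>In a bundle chart a pulled-back function does not depend on the fibre coordinates, so
  only the base components of w enter, and these are the components of
  \<open>hp u w\<close>.\<close>

lemma dd_proj:
  assumes f: "sf W f" and u: "u \<in> over W" and w: "w \<in> T.TS u"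
  shows "T.dd u w (\<lambda>u. f (proj u)) = dd (proj u) (hp u w) f"
proof -
  have uM: "u \<in> over (points M)" and p: "proj u \<in> W" using u over_points sf_open[OF f] opn_subset overD by blast+
  obtain i where i: "i \<in> charts M" "proj u \<in> cdom M i" "u \<in> over (cdom M i)" using over_chart[OF uM] .
  let ?S = "coords TM i ` over (W \<inter> cdom M i)" and ?F = "\<lambda>x. f (param M i x)"
  have S: "?S = {x \<in> coord_space (2 * dM). base_coords dM x \<in> coords M i ` (W \<inter> cdom M i)}"
    by (rule coords_TM_image[OF i(1)]) auto
  have oS: "open_coord (2 * dM) ?S" unfolding S by (rule open_coord_base[OF open_coords_image[OF sf_open[OF f] i(1)]])
  have uS: "coords TM i u \<in> ?S" using u i(3) by (intro imageI) (simp add: over_Int)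
  have c: "pderiv_at a (\<lambda>x. f (proj (param TM i x))) (coords TM i u) =
      (if a < dM then pderiv_at a ?F (coords M i (proj u)) else 0)" if "a < 2 * dM" for a
  proof -
    have "pderiv_at a (\<lambda>x. f (proj (param TM i x))) (coords TM i u) = pderiv_at a (\<lambda>x. ?F (base_coords dM x)) (coords TM i u)"
    proof (rule pderiv_at_cong[OF oS _ uS that])
      fix x assume "x \<in> ?S"
      then obtain u where u: "u \<in> over (W \<inter> cdom M i)" "x = coords TM i u" by blast
      then have "u \<in> over (cdom M i)" "proj u \<in> cdom M i" by (auto simp: in_over)
      then show "f (proj (param TM i x)) = f (param M i (base_coords dM x))"
        unfolding u(2) using param_TM[OF i(1)] base_coords_TM[OF i(1)] i by (simp del: TM_simps(5))
    qed
    also have "\<dots> = (if a < dM then pderiv_at a ?F (base_coords dM (coords TM i u)) else 0)"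
      by (rule pderiv_at_base_compose[OF sf_coordD[OF f i(1)] oS _ uS that]) (use S in blast)
    finally show ?thesis using base_coords_TM[OF i(1,2)] by (simp del: TM_simps(5))
  qed
  have "T.dd u w (\<lambda>u. f (proj u)) = (\<Sum>a<2*dM. w i a * (if a < dM then pderiv_at a ?F (coords M i (proj u)) else 0))"
    using T.dd_chart[OF sf_proj[OF f] u w, of i] i c by (simp del: TM_simps(5))
  also have "\<dots> = (\<Sum>a<dM. w i a * pderiv_at a ?F (coords M i (proj u)))"
    by (rule sum.mono_neutral_cong_right) auto
  also have "\<dots> = dd (proj u) (hp u w) f"
    using dd_chart[OF f p hp_in[OF uM w], of i] i by (simp add: hp_def)
  finally show ?thesis .
qed

lemma sf_fibre: assumes "i \<in> charts M" "c < dM" shows "T.sf (over (cdom M i)) (\<lambda>u. vec u i c)"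
  using T.sf_coord[of i "dM + c"] assms by simp

lemma dd_fibre:
  assumes "i \<in> charts M" "u \<in> over (cdom M i)" "c < dM" "w \<in> T.TS u"
  shows "T.dd u w (\<lambda>u. vec u i c) = w i (dM + c)"
  using T.dd_coord[OF assms(4), of i "dM + c"] assms by simp

lemma hlift_comp_sf:
  assumes X: "vf U X" and i: "i \<in> charts M" and b: "b < 2 * dM"
  shows "T.sf (over (U \<inter> cdom M i)) (\<lambda>u. H X u i b)"
proof -
  let ?W = "U \<inter> cdom M i"
  have W: "opn ?W" using vf_open[OF X] open_cdom[OF i] by auto
  have XW: "vf ?W X" using vf_mono[OF X W] by auto
  have c: "vf ?W (cfield i c)" if "c < dM" for c using vf_mono[OF cfield_vf[OF i that] W] by auto
  have "T.sf (over ?W) (\<lambda>u. hc i X u b)"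
  proof (cases "b < dM")
    case True
    then show ?thesis using sf_proj[OF vf_comp[OF X i, of b]] by (simp add: hc_def)
  next
    case False
    have n: "sf ?W (\<lambda>q. nab X (cfield i c) q i (b - dM))" if "c < dM" for c
      using vf_comp[OF nab_vf[OF XW c[OF that]] i, of "b - dM"] by (simp add: Int_assoc)
    have "T.sf (over ?W) (\<lambda>u. - (\<Sum>c<dM. vec u i c * nab X (cfield i c) (proj u) i (b - dM)))"
      by (intro T.sf_uminus T.sf_sum open_over W T.sf_mult sf_proj n T.sf_mono[OF sf_fibre[OF i] open_over[OF W]])
        (auto simp: in_over)
    then show ?thesis using False b by (simp add: hc_def)
  qed
  then show ?thesis
    by (rule T.sf_cong) (use hlift_comp[OF _ XW i] in \<open>auto simp: in_over\<close>)
qed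

lemma hlift_vf: assumes X: "vf U X" shows "T.vf (over U) (H X)"
proof (rule T.vfI[OF open_over[OF vf_open[OF X]]])
  show "H X u \<in> T.TS u" if "u \<in> over U" for u
    using hlift_in[OF over_points[OF that] X overD(1)[OF that]] opn_subset[OF vf_open[OF X]] by blast
  show "T.sf (over U \<inter> cdom TM i) (\<lambda>q. H X q i a)" if "i \<in> charts TM" "a < mdim TM" for i a
    using hlift_comp_sf[OF X, of i a] that by (simp add: over_Int)
qed

lemma vlift_vf: assumes X: "vf U X" shows "T.vf (over U) (V X)"
proof (rule T.vfI[OF open_over[OF vf_open[OF X]]])
  show "V X u \<in> T.TS u" if "u \<in> over U" for u
    using vlift_in[of u X] over_points[OF that] vf_in[OF X overD(1)[OF that]] opn_subset[OF vf_open[OF X]] by blast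
  fix i a assume "i \<in> charts TM" and a: "a < mdim TM"
  then have i: "i \<in> charts M" by simp
  have o: "opn (U \<inter> cdom M i)" using vf_open[OF X] open_cdom[OF i] by auto
  have "T.sf (over (U \<inter> cdom M i)) (\<lambda>u. if dM \<le> a \<and> a < 2 * dM then X (proj u) i (a - dM) else 0)"
    using sf_proj[OF vf_comp[OF X i, of "a - dM"]] T.sf_const[OF open_over[OF o], of 0]
    by (cases "dM \<le> a \<and> a < 2 * dM") (simp_all only: if_True if_False simp_thms)
  then have "T.sf (over (U \<inter> cdom M i)) (\<lambda>q. V X q i a)"
    by (rule T.sf_cong) (use vlift_comp[OF i] in \<open>auto simp: in_over\<close>)
  then show "T.sf (over U \<inter> cdom TM i) (\<lambda>q. V X q i a)" by (simp add: over_Int)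
qed

section \<open>Projections, complex structure and metric in explicit form\<close>

definition hor :: "('a, 'i) tpoint \<Rightarrow> 'i tvec \<Rightarrow> 'i tvec" where "hor u w = hl u (hp u w)"
definition ver :: "('a, 'i) tpoint \<Rightarrow> 'i tvec \<Rightarrow> 'i tvec" where "ver u w = vl u (kp u w)"
text \<open>The explicit form of \<open>lift_J\<close>, free of the definite description; the two
  agree on tangent vectors by \<open>lift_J_eq\<close>.\<close>

definition Jt :: "('a, 'i) tpoint \<Rightarrow> 'i tvec \<Rightarrow> 'i tvec" where "Jt u w = vl u (hp u w) - hl u (kp u w)"

lemma hor_in: "u \<in> over (points M) \<Longrightarrow> w \<in> T.TS u \<Longrightarrow> hor u w \<in> T.TS u"
  and ver_in: "u \<in> over (points M) \<Longrightarrow> w \<in> T.TS u \<Longrightarrow> ver u w \<in> T.TS u"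
  and Jt_in: "u \<in> over (points M) \<Longrightarrow> w \<in> T.TS u \<Longrightarrow> Jt u w \<in> T.TS u"
  unfolding hor_def ver_def Jt_def by (auto intro: T.TS_diff hl_in vl_in hp_in kp_in)

lemma lin_compose:
  assumes "T.lin u \<phi>" "lin (proj u) \<psi>" "\<And>w. w \<in> T.TS u \<Longrightarrow> \<phi> w \<in> TS (proj u)"
  shows "T.lin u (\<lambda>w. \<psi> (\<phi> w))"
  using assms by (intro T.linI) (auto simp: T.lin_add T.lin_scale lin_add lin_scale)

lemma hor_lin: "u \<in> over (points M) \<Longrightarrow> T.lin u (hor u)"
  and ver_lin: "u \<in> over (points M) \<Longrightarrow> T.lin u (ver u)"
  and Jt_lin: "u \<in> over (points M) \<Longrightarrow> T.lin u (Jt u)"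
  unfolding hor_def ver_def Jt_def
  by (intro T.lin_minus lin_compose[OF hp_lin hl_lin] lin_compose[OF kp_lin vl_lin]
      lin_compose[OF hp_lin vl_lin] lin_compose[OF kp_lin hl_lin] hp_in kp_in; assumption)+

lemma hor_ver: "u \<in> over (points M) \<Longrightarrow> w \<in> T.TS u \<Longrightarrow> hor u w + ver u w = w"
  unfolding hor_def ver_def using decomp by simp

lemma endo_lifts:
  assumes "u \<in> over (points M)" "x \<in> TS (proj u)"
  shows "hor u (hl u x) = hl u x" "hor u (vl u x) = 0" "ver u (hl u x) = 0" "ver u (vl u x) = vl u x"
    "Jt u (hl u x) = vl u x" "Jt u (vl u x) = - hl u x"
  using assms lin_zero[OF hl_lin[OF assms(1)]] lin_zero[OF vl_lin[OF assms(1)]]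
  by (simp_all add: hor_def ver_def Jt_def hp_hl hp_vl kp_hl kp_vl)

lemma TS_points: "T.vf Q W \<Longrightarrow> u \<in> Q \<Longrightarrow> u \<in> over (points M)"
  using T.vf_points by fastforce

lemma hl_expand:
  assumes u: "u \<in> over (cdom M i)" and i: "i \<in> charts M" and x: "x \<in> TS (proj u)"
  shows "hl u x = (\<Sum>c<dM. x i c *\<^sub>R H (cfield i c) u)" "vl u x = (\<Sum>c<dM. x i c *\<^sub>R V (cfield i c) u)"
proof -
  have uM: "u \<in> over (points M)" using over_points u cdom_subset i by blast
  have ci: "chart_around M (proj u) i" using i u overD by blast
  have c: "cfield i c (proj u) \<in> TS (proj u)" for c using cfield_in[OF ci] .
  have "hl u x = hl u (\<Sum>c<dM. x i c *\<^sub>R cfield i c (proj u))" using tvec_expand[OF x ci] by simp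
  also have "\<dots> = (\<Sum>c<dM. x i c *\<^sub>R hl u (cfield i c (proj u)))" by (rule lin_lincomb[OF hl_lin[OF uM] c])
  also have "\<dots> = (\<Sum>c<dM. x i c *\<^sub>R H (cfield i c) u)"
    using hlift_hl[OF u cfield_vf[OF i]] by simp
  finally show "hl u x = (\<Sum>c<dM. x i c *\<^sub>R H (cfield i c) u)" .
  have "vl u x = vl u (\<Sum>c<dM. x i c *\<^sub>R cfield i c (proj u))" using tvec_expand[OF x ci] by simp
  also have "\<dots> = (\<Sum>c<dM. x i c *\<^sub>R vl u (cfield i c (proj u)))" by (rule lin_lincomb[OF vl_lin[OF uM] c])
  finally show "vl u x = (\<Sum>c<dM. x i c *\<^sub>R V (cfield i c) u)" by (simp add: vlift_vl)
qed

text \<open>A is a field along the projection rather than a field on M. Over a chart its lift is a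
  combination of lifted coordinate fields, which are smooth, with the components of A as
  coefficients.\<close>

lemma lift_lincomb_vf:
  assumes Q: "T.opn Q" and A: "\<And>u. u \<in> Q \<Longrightarrow> A u \<in> TS (proj u)" and QM: "Q \<subseteq> over (points M)"
    and sm: "\<And>i c. i \<in> charts M \<Longrightarrow> c < dM \<Longrightarrow> T.sf (Q \<inter> over (cdom M i)) (\<lambda>u. A u i c)"
  shows "T.vf Q (\<lambda>u. hl u (A u))" "T.vf Q (\<lambda>u. vl u (A u))"
proof -
  have "\<exists>W. u \<in> W \<and> W \<subseteq> Q \<and> T.vf W (\<lambda>u. hl u (A u)) \<and> T.vf W (\<lambda>u. vl u (A u))" if u: "u \<in> Q" for u
  proof -
    obtain i where i: "i \<in> charts M" "proj u \<in> cdom M i" "u \<in> over (cdom M i)" using over_chart u QM by blast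
    let ?W = "Q \<inter> over (cdom M i)"
    have W: "T.opn ?W" using Q open_over[OF open_cdom[OF i(1)]] by auto
    have h: "T.vf ?W (H (cfield i c))" "T.vf ?W (V (cfield i c))" if "c < dM" for c
      using T.vf_mono[OF hlift_vf[OF cfield_vf[OF i(1) that]] W] T.vf_mono[OF vlift_vf[OF cfield_vf[OF i(1) that]] W] by auto
    have "T.vf ?W (\<lambda>u. \<Sum>c<dM. A u i c *\<^sub>R H (cfield i c) u)" by (intro T.vf_lincomb W sm i h) auto
    then have "T.vf ?W (\<lambda>u. hl u (A u))"
      by (rule T.vf_cong) (use hl_expand(1)[OF _ i(1) A] in auto)
    moreover have "T.vf ?W (\<lambda>u. \<Sum>c<dM. A u i c *\<^sub>R V (cfield i c) u)" by (intro T.vf_lincomb W sm i h) auto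
    then have "T.vf ?W (\<lambda>u. vl u (A u))"
      by (rule T.vf_cong) (use hl_expand(2)[OF _ i(1) A] in auto)
    ultimately show ?thesis using u i(3) by blast
  qed
  note loc = this
  show "T.vf Q (\<lambda>u. hl u (A u))" by (rule T.vf_local) (use loc in blast)
  show "T.vf Q (\<lambda>u. vl u (A u))" by (rule T.vf_local) (use loc in blast)
qed

lemma hp_sf:
  assumes W: "T.vf Q W" and i: "i \<in> charts M" and c: "c < dM"
  shows "T.sf (Q \<inter> over (cdom M i)) (\<lambda>u. hp u (W u) i c)"
  by (rule T.sf_cong[OF T.vf_comp[OF W, of i c, simplified]]) (use i c in \<open>auto simp: hp_def in_over\<close>)

lemma hor_vf: assumes W: "T.vf Q W" shows "T.vf Q (\<lambda>u. hor u (W u))"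
  unfolding hor_def
  by (rule lift_lincomb_vf(1)[OF T.vf_open[OF W]])
    (use hp_in[OF TS_points[OF W]] T.vf_in[OF W] TS_points[OF W] hp_sf[OF W] in auto)

lemma ver_vf: assumes W: "T.vf Q W" shows "T.vf Q (\<lambda>u. ver u (W u))"
proof (rule T.vf_cong[OF T.vf_diff[OF W hor_vf[OF W]]])
  fix u assume u: "u \<in> Q"
  show "(W - (\<lambda>u. hor u (W u))) u = ver u (W u)"
    using hor_ver[OF TS_points[OF W u] T.vf_in[OF W u]] by (simp add: algebra_simps)
qed

lemma kp_sf:
  assumes W: "T.vf Q W" and i: "i \<in> charts M" and c: "c < dM"
  shows "T.sf (Q \<inter> over (cdom M i)) (\<lambda>u. kp u (W u) i c)"
  by (rule T.sf_cong[OF T.vf_comp[OF ver_vf[OF W], of i "dM + c", simplified]])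
    (use i c in \<open>auto simp: ver_def vl_comp\<close>)

lemma Jt_vf: assumes W: "T.vf Q W" shows "T.vf Q (\<lambda>u. Jt u (W u))"
proof -
  have 1: "T.vf Q (\<lambda>u. vl u (hp u (W u)))"
    by (rule lift_lincomb_vf(2)[OF T.vf_open[OF W]])
      (use hp_in[OF TS_points[OF W]] T.vf_in[OF W] TS_points[OF W] hp_sf[OF W] in auto)
  have 2: "T.vf Q (\<lambda>u. hl u (kp u (W u)))"
    by (rule lift_lincomb_vf(1)[OF T.vf_open[OF W]])
      (use kp_in[OF TS_points[OF W]] T.vf_in[OF W] TS_points[OF W] kp_sf[OF W] in auto)
  show ?thesis by (rule T.vf_cong[OF T.vf_diff[OF 1 2]]) (simp add: Jt_def)
qed

text \<open>Supplies the witnesses for the descriptions in \<open>lift_J\<close> and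
  \<open>lift_metric\<close>: every tangent vector of the bundle is a value of lifted
  fields.\<close>

lemma lift_fields:
  assumes u: "u \<in> over (points M)" and w: "w \<in> T.TS u"
  obtains U X Y where "proj u \<in> U" "vf U X" "vf U Y" "w = H X u + V Y u" "X (proj u) = hp u w" "Y (proj u) = kp u w"
proof -
  have p: "proj u \<in> points M" using overD(1)[OF u] .
  obtain Q where Q: "proj u \<in> Q" "vf Q (extend (proj u) (hp u w))" "extend (proj u) (hp u w) (proj u) = hp u w"
    using extend[OF p hp_in[OF u w]] .
  obtain R where R: "proj u \<in> R" "vf R (extend (proj u) (kp u w))" "extend (proj u) (kp u w) (proj u) = kp u w"
    using extend[OF p kp_in[OF u w]] .
  obtain U where U: "proj u \<in> U" "vf U (extend (proj u) (hp u w))" "vf U (extend (proj u) (kp u w))"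
    using common_domain[OF Q(2,1) R(2,1)] .
  have uU: "u \<in> over U" using u U(1) by (simp add: in_over)
  have "w = H (extend (proj u) (hp u w)) u + V (extend (proj u) (kp u w)) u"
    using decomp[OF u w] hlift_hl[OF uU U(2)] vlift_vl[of "extend (proj u) (kp u w)" u] Q(3) R(3) by simp
  then show thesis using that U Q(3) R(3) by blast
qed

lemma lift_J_eq:
  assumes u: "u \<in> over (points M)" and w: "w \<in> T.TS u"
  shows "lift_J M nab u w = Jt u w"
  unfolding lift_J_def
proof (rule the_equality)
  obtain U X Y where U: "proj u \<in> U" "vf U X" "vf U Y" "w = H X u + V Y u" "X (proj u) = hp u w" "Y (proj u) = kp u w"
    using lift_fields[OF u w] .
  have uU: "u \<in> over U" using u U(1) by (simp add: in_over)
  have "Jt u w = V X u - H Y u" unfolding Jt_def hlift_hl[OF uU U(3)] vlift_vl[of X] U(5,6) ..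
  then show "\<exists>U X Y. proj u \<in> U \<and> vf U X \<and> vf U Y \<and> w = H X u + V Y u \<and> Jt u w = V X u - H Y u" using U by blast
next
  fix w' assume "\<exists>U X Y. proj u \<in> U \<and> vf U X \<and> vf U Y \<and> w = H X u + V Y u \<and> w' = V X u - H Y u"
  then obtain U X Y where U: "proj u \<in> U" "vf U X" "vf U Y" "w = H X u + V Y u" "w' = V X u - H Y u" by blast
  have uU: "u \<in> over U" using u U(1) by (simp add: in_over)
  show "w' = Jt u w"
    unfolding Jt_def U(4,5) hlift_hl[OF uU U(2)] hlift_hl[OF uU U(3)] vlift_vl[of X] vlift_vl[of Y]
      hp_lift[OF u vf_in[OF U(2,1)] vf_in[OF U(3,1)]] kp_lift[OF u vf_in[OF U(2,1)] vf_in[OF U(3,1)]] ..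
qed

definition gt :: "(('a, 'i) tpoint, 'i) metric_tensor \<Rightarrow> (('a, 'i) tpoint, 'i) metric_tensor" where
  "gt g u w w' = g (proj u) (hp u w) (hp u w') + g (proj u) (kp u w) (kp u w')"

lemma lift_metric_eq:
  assumes u: "u \<in> over (points M)" and w: "w \<in> T.TS u" and w': "w' \<in> T.TS u"
  shows "lift_metric M nab g u w w' = gt g u w w'"
  unfolding lift_metric_def
proof (rule the_equality)
  obtain U X Y where U: "proj u \<in> U" "vf U X" "vf U Y" "w = H X u + V Y u" "X (proj u) = hp u w" "Y (proj u) = kp u w"
    using lift_fields[OF u w] .
  obtain U' X' Y' where U': "proj u \<in> U'" "vf U' X'" "vf U' Y'" "w' = H X' u + V Y' u" "X' (proj u) = hp u w'" "Y' (proj u) = kp u w'"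
    using lift_fields[OF u w'] .
  have o: "opn (U \<inter> U')" using vf_open U U' by auto
  show "\<exists>U X Y X' Y'. proj u \<in> U \<and> vf U X \<and> vf U Y \<and> vf U X' \<and> vf U Y' \<and>
     w = H X u + V Y u \<and> w' = H X' u + V Y' u \<and>
     gt g u w w' = g (proj u) (X (proj u)) (X' (proj u)) + g (proj u) (Y (proj u)) (Y' (proj u))"
    apply (rule exI[of _ "U \<inter> U'"], rule exI[of _ X], rule exI[of _ Y], rule exI[of _ X'], rule exI[of _ Y'])
    using U U' vf_mono[OF _ o] by (simp add: gt_def)
next
  fix r assume "\<exists>U X Y X' Y'. proj u \<in> U \<and> vf U X \<and> vf U Y \<and> vf U X' \<and> vf U Y' \<and>
     w = H X u + V Y u \<and> w' = H X' u + V Y' u \<and>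
     r = g (proj u) (X (proj u)) (X' (proj u)) + g (proj u) (Y (proj u)) (Y' (proj u))"
  then obtain U X Y X' Y' where U: "proj u \<in> U" "vf U X" "vf U Y" "vf U X'" "vf U Y'"
     "w = H X u + V Y u" "w' = H X' u + V Y' u"
     "r = g (proj u) (X (proj u)) (X' (proj u)) + g (proj u) (Y (proj u)) (Y' (proj u))" by blast
  have uU: "u \<in> over U" using u U(1) by (simp add: in_over)
  show "r = gt g u w w'"
    unfolding gt_def U(6-8) hlift_hl[OF uU U(2)] hlift_hl[OF uU U(4)] vlift_vl[of Y] vlift_vl[of Y']
      hp_lift[OF u vf_in[OF U(2,1)] vf_in[OF U(3,1)]] kp_lift[OF u vf_in[OF U(2,1)] vf_in[OF U(3,1)]]
      hp_lift[OF u vf_in[OF U(4,1)] vf_in[OF U(5,1)]] kp_lift[OF u vf_in[OF U(4,1)] vf_in[OF U(5,1)]] ..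
qed

end

section \<open>The lifted connection\<close>

context smooth_mfd
begin

lemma bracket_local:
  assumes "opn U" "p \<in> U" "\<And>q. q \<in> U \<Longrightarrow> X q = X' q" "\<And>q. q \<in> U \<Longrightarrow> Y q = Y' q"
  shows "lie_bracket M X Y p = lie_bracket M X' Y' p"
proof (intro ext)
  fix i b
  have "dd p v (\<lambda>q. X q i b) = dd p v (\<lambda>q. X' q i b)" "dd p v (\<lambda>q. Y q i b) = dd p v (\<lambda>q. Y' q i b)" for v
    using assms(3,4) by (auto intro!: dd_cong[OF assms(1,2)])
  then show "lie_bracket M X Y p i b = lie_bracket M X' Y' p i b"
    using assms(2-4) by (simp add: lie_bracket_def)
qed

lemma bracket_zero1: "lie_bracket M 0 Y p = 0" and bracket_zero2: "lie_bracket M Y 0 p = 0"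
  by (simp_all add: lie_bracket_def fun_eq_iff dd_const dd_zero_vec)

lemma bracket_uminus2:
  assumes "vf U X" "vf U Y" "p \<in> U" shows "lie_bracket M X (- Y) p = - lie_bracket M X Y p"
proof -
  have "fscale (\<lambda>q. -1) Y = - Y" by (auto simp: fscale_def fun_eq_iff)
  then show ?thesis
    using bracket_fscale[OF sf_const[OF vf_open[OF assms(1)], of "-1"] assms] by (simp add: dd_const)
qed

end

section \<open>Torsion and curvature as tensors\<close>

context conn_mfd
begin

definition tor :: "('p, 'i) vfield \<Rightarrow> ('p, 'i) vfield \<Rightarrow> ('p, 'i) vfield" where
  "tor X Y p = nab X Y p - nab Y X p - lie_bracket M X Y p"

lemma tor_antisym: "tor X Y p = - tor Y X p"
  unfolding tor_def by (subst bracket_antisym) (simp add: algebra_simps)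

text \<open>The derivative of f produced by the connection is cancelled by the one produced by the
  bracket. Vanishing of the torsion on the bundle can therefore be tested on lifts.\<close>

lemma tor_tensorial1:
  assumes "vf U Y" "p \<in> U" shows "tensorial_at p (\<lambda>X. tor X Y p)"
proof (rule tensorialI)
  fix Q X X' assume Q: "p \<in> Q" "vf Q X" "vf Q X'"
  obtain W where W: "p \<in> W" "vf W X" "vf W Y" "W \<subseteq> Q" "W \<subseteq> U" using common_domain[OF Q(2,1) assms] .
  have X': "vf W X'" using vf_mono[OF Q(3) vf_open[OF W(2)] W(4)] .
  show "tor (X + X') Y p = tor X Y p + tor X' Y p"
    unfolding tor_def nab_add1[OF W(2) X' W(3,1)] nab_add2[OF W(3,2) X' W(1)] bracket_add1[OF W(2) X' W(3,1)]
    by (simp add: algebra_simps)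
next
  fix Q f X assume Q: "p \<in> Q" "sf Q f" "vf Q X"
  obtain W where W: "p \<in> W" "vf W X" "vf W Y" "W \<subseteq> Q" "W \<subseteq> U" using common_domain[OF Q(3,1) assms] .
  have f: "sf W f" using sf_mono[OF Q(2) vf_open[OF W(2)] W(4)] .
  show "tor (fscale f X) Y p = f p *\<^sub>R tor X Y p"
    unfolding tor_def nab_fscale1[OF f W(2,3,1)] nab_fscale2[OF f W(3,2,1)] bracket_fscale1[OF f W(2,3,1)]
    by (simp add: algebra_simps)
qed

lemma curv_antisym:
  assumes "vf U X" "vf U Y" "vf U Z" "p \<in> U" shows "curvature M nab X Y Z p = - curvature M nab Y X Z p"
proof -
  have "nab (lie_bracket M X Y) Z p = nab (fscale (\<lambda>q. -1) (lie_bracket M Y X)) Z p"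
    by (rule tensorial_cong[OF nab_tensorial1[OF assms(3,4)] bracket_vf[OF assms(1,2)] assms(4)
          vf_fscale[OF sf_const[OF vf_open[OF assms(1)]] bracket_vf[OF assms(2,1)]] assms(4)])
      (subst bracket_antisym, simp add: fscale_def)
  then have "nab (lie_bracket M X Y) Z p = - nab (lie_bracket M Y X) Z p"
    using nab_fscale1[OF sf_const[OF vf_open[OF assms(1)], of "-1"] bracket_vf[OF assms(2,1)] assms(3,4)] by simp
  then show ?thesis by (simp add: curvature_def)
qed

text \<open>The bracket of f X with Y contributes - Y(f) X; the derivative of Z along it cancels the
  Leibniz term of \<open>nab Y (nab (fscale f X) Z)\<close>.\<close>

lemma curv_tensorial1:
  assumes "vf U Y" "vf U Z" "p \<in> U" shows "tensorial_at p (\<lambda>X. curvature M nab X Y Z p)"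
proof (rule tensorialI)
  fix Q X X' assume Q: "p \<in> Q" "vf Q X" "vf Q X'"
  obtain W where W: "p \<in> W" "vf W X" "vf W Y" "W \<subseteq> Q" "W \<subseteq> U" using common_domain[OF Q(2,1) assms(1,3)] .
  have X': "vf W X'" and Z: "vf W Z" using vf_mono vf_open[OF W(2)] Q(3) assms(2) W(4,5) by blast+
  note bv = bracket_vf[OF W(2,3)] bracket_vf[OF X' W(3)]
  have 1: "nab (lie_bracket M (X + X') Y) Z p = nab (lie_bracket M X Y + lie_bracket M X' Y) Z p"
    by (rule tensorial_cong[OF nab_tensorial1[OF Z W(1)] bracket_vf[OF vf_add[OF W(2) X'] W(3)] W(1) vf_add[OF bv] W(1)])
      (use bracket_add1[OF W(2) X' W(3,1)] in simp)
  have 2: "nab Y (nab (X + X') Z) p = nab Y (nab X Z + nab X' Z) p"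
    by (rule nab_local[OF W(3) nab_vf[OF vf_add[OF W(2) X'] Z] vf_add[OF nab_vf[OF W(2) Z] nab_vf[OF X' Z]] W(1)])
      (use nab_add1[OF W(2) X' Z] in simp)
  show "curvature M nab (X + X') Y Z p = curvature M nab X Y Z p + curvature M nab X' Y Z p"
    unfolding curvature_def 1 2 nab_add1[OF bv Z W(1)] nab_add2[OF W(3) nab_vf[OF W(2) Z] nab_vf[OF X' Z] W(1)]
      nab_add1[OF W(2) X' nab_vf[OF W(3) Z] W(1)] by (simp add: algebra_simps)
next
  fix Q f X assume Q: "p \<in> Q" "sf Q f" "vf Q X"
  obtain W where W: "p \<in> W" "vf W X" "vf W Y" "W \<subseteq> Q" "W \<subseteq> U" using common_domain[OF Q(3,1) assms(1,3)] .
  have f: "sf W f" and Z: "vf W Z" using sf_mono vf_mono vf_open[OF W(2)] Q(2) assms(2) W(4,5) by blast+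
  let ?h = "\<lambda>q. - dd q (Y q) f"
  have h: "sf W ?h" using sf_uminus[OF dd_sf[OF W(3) f]] .
  note bv = vf_fscale[OF f bracket_vf[OF W(2,3)]] vf_fscale[OF h W(2)]
  have 1: "nab (lie_bracket M (fscale f X) Y) Z p = nab (fscale f (lie_bracket M X Y) + fscale ?h X) Z p"
    by (rule tensorial_cong[OF nab_tensorial1[OF Z W(1)] bracket_vf[OF vf_fscale[OF f W(2)] W(3)] W(1) vf_add[OF bv] W(1)])
      (use bracket_fscale1[OF f W(2,3,1)] in \<open>simp add: fscale_def\<close>)
  have 2: "nab Y (nab (fscale f X) Z) p = nab Y (fscale f (nab X Z)) p"
    by (rule nab_local[OF W(3) nab_vf[OF vf_fscale[OF f W(2)] Z] vf_fscale[OF f nab_vf[OF W(2) Z]] W(1)])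
      (use nab_fscale1[OF f W(2) Z] in \<open>simp add: fscale_def\<close>)
  show "curvature M nab (fscale f X) Y Z p = f p *\<^sub>R curvature M nab X Y Z p"
    unfolding curvature_def 1 2 nab_add1[OF bv Z W(1)] nab_fscale1[OF f bracket_vf[OF W(2,3)] Z W(1)]
      nab_fscale1[OF h W(2) Z W(1)] nab_fscale2[OF f W(3) nab_vf[OF W(2) Z] W(1)]
      nab_fscale1[OF f W(2) nab_vf[OF W(3) Z] W(1)] by (simp add: algebra_simps)
qed

text \<open>The second derivatives of f along X and Y combine to its derivative along the bracket,
  which cancels against the Leibniz term of the bracket derivative; the mixed first-order terms are
  symmetric in X and Y.\<close>

lemma curv_tensorial3:
  assumes "vf U X" "vf U Y" "p \<in> U" shows "tensorial_at p (\<lambda>Z. curvature M nab X Y Z p)"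
proof (rule tensorialI)
  fix Q Z Z' assume Q: "p \<in> Q" "vf Q Z" "vf Q Z'"
  obtain W where W: "p \<in> W" "vf W Z" "vf W X" "W \<subseteq> Q" "W \<subseteq> U" using common_domain[OF Q(2,1) assms(1,3)] .
  have Z': "vf W Z'" and Y: "vf W Y" using vf_mono vf_open[OF W(2)] Q(3) assms(2) W(4,5) by blast+
  have 1: "nab A (nab B (Z + Z')) p = nab A (nab B Z) p + nab A (nab B Z') p" if "vf W A" "vf W B" for A B
  proof -
    have "nab A (nab B (Z + Z')) p = nab A (nab B Z + nab B Z') p"
      by (rule nab_local[OF that(1) nab_vf[OF that(2) vf_add[OF W(2) Z']] vf_add[OF nab_vf[OF that(2) W(2)] nab_vf[OF that(2) Z']] W(1)])
        (use nab_add2[OF that(2) W(2) Z'] in simp)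
    then show ?thesis using nab_add2[OF that(1) nab_vf[OF that(2) W(2)] nab_vf[OF that(2) Z'] W(1)] by simp
  qed
  show "curvature M nab X Y (Z + Z') p = curvature M nab X Y Z p + curvature M nab X Y Z' p"
    unfolding curvature_def 1[OF W(3) Y] 1[OF Y W(3)] nab_add2[OF bracket_vf[OF W(3) Y] W(2) Z' W(1)]
    by (simp add: algebra_simps)
next
  fix Q f Z assume Q: "p \<in> Q" "sf Q f" "vf Q Z"
  obtain W where W: "p \<in> W" "vf W Z" "vf W X" "W \<subseteq> Q" "W \<subseteq> U" using common_domain[OF Q(3,1) assms(1,3)] .
  have f: "sf W f" and Y: "vf W Y" using sf_mono vf_mono vf_open[OF W(2)] Q(2) assms(2) W(4,5) by blast+
  have 1: "nab A (nab B (fscale f Z)) p = dd p (A p) (\<lambda>q. dd q (B q) f) *\<^sub>R Z p + dd p (B p) f *\<^sub>R nab A Z p +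
      (dd p (A p) f *\<^sub>R nab B Z p + f p *\<^sub>R nab A (nab B Z) p)" if A: "vf W A" and B: "vf W B" for A B
  proof -
    let ?h = "\<lambda>q. dd q (B q) f"
    have h: "sf W ?h" using dd_sf[OF B f] .
    note v = vf_fscale[OF h W(2)] vf_fscale[OF f nab_vf[OF B W(2)]]
    have "nab A (nab B (fscale f Z)) p = nab A (fscale ?h Z + fscale f (nab B Z)) p"
      by (rule nab_local[OF A nab_vf[OF B vf_fscale[OF f W(2)]] vf_add[OF v] W(1)])
        (use nab_fscale2[OF f B W(2)] in \<open>simp add: fscale_def\<close>)
    then show ?thesis
      using nab_add2[OF A v W(1)] nab_fscale2[OF h A W(2,1)] nab_fscale2[OF f A nab_vf[OF B W(2)] W(1)] by simp
  qed
  show "curvature M nab X Y (fscale f Z) p = f p *\<^sub>R curvature M nab X Y Z p"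
    unfolding curvature_def 1[OF W(3) Y] 1[OF Y W(3)] nab_fscale2[OF f bracket_vf[OF W(3) Y] W(2,1)]
      bracket_dd[OF W(3) Y f W(1)] by (simp add: algebra_simps)
qed

end

section \<open>Brackets of lifts\<close>

context tconn
begin

lemma dd_H_low:
  assumes "vf U X" "i \<in> charts M" "u \<in> over (U \<inter> cdom M i)" "w \<in> T.TS u" "a < dM"
  shows "T.dd u w (\<lambda>u. H X u i a) = dd (proj u) (hp u w) (\<lambda>q. X q i a)"
proof -
  have c: "sf (U \<inter> cdom M i) (\<lambda>q. X q i a)" by (rule vf_comp[OF assms(1,2)])
  have "T.dd u w (\<lambda>u. H X u i a) = T.dd u w (\<lambda>u. X (proj u) i a)"
    by (rule T.dd_cong[OF open_over[OF sf_open[OF c]] assms(3)])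
      (use hlift_comp[OF _ assms(1,2)] assms(5) in \<open>auto simp: in_over hc_def\<close>)
  then show ?thesis using dd_proj[OF c assms(3,4)] by simp
qed

text \<open>The fibre components of \<open>H X\<close> are linear in the fibre coordinate with
  coefficients from M; the product rule separates the derivative along the fibre from the one along
  the base.\<close>

lemma dd_H_high:
  assumes X: "vf U X" and i: "i \<in> charts M" and u: "u \<in> over (U \<inter> cdom M i)" and w: "w \<in> T.TS u" and b: "b < dM"
  shows "T.dd u w (\<lambda>u. H X u i (dM + b)) = - (\<Sum>c<dM. w i (dM + c) * nab X (cfield i c) (proj u) i b +
      vec u i c * dd (proj u) (hp u w) (\<lambda>q. nab X (cfield i c) q i b))"
proof -
  let ?W = "U \<inter> cdom M i"
  have W: "opn ?W" using vf_open[OF X] open_cdom[OF i] by auto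
  have XW: "vf ?W X" using vf_mono[OF X W] by auto
  have c: "vf ?W (cfield i c)" if "c < dM" for c using vf_mono[OF cfield_vf[OF i that] W] by auto
  have n: "sf ?W (\<lambda>q. nab X (cfield i c) q i b)" if "c < dM" for c
    using vf_comp[OF nab_vf[OF XW c[OF that]] i, of b] by (simp add: Int_assoc)
  have nT: "T.sf (over ?W) (\<lambda>u. nab X (cfield i c) (proj u) i b)" if "c < dM" for c using sf_proj[OF n[OF that]] .
  have fT: "T.sf (over ?W) (\<lambda>u. vec u i c)" if "c < dM" for c
    by (rule T.sf_mono[OF sf_fibre[OF i that] open_over[OF W]]) (auto simp: in_over)
  have ui: "u \<in> over (cdom M i)" using u by (simp add: over_Int)
  have "T.dd u w (\<lambda>u. H X u i (dM + b)) = T.dd u w (\<lambda>u. - (\<Sum>c<dM. vec u i c * nab X (cfield i c) (proj u) i b))"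
    by (rule T.dd_cong[OF open_over[OF W] u]) (use hlift_comp[OF _ X i] b in \<open>auto simp: in_over hc_def\<close>)
  also have "\<dots> = - T.dd u w (\<lambda>u. \<Sum>c<dM. vec u i c * nab X (cfield i c) (proj u) i b)"
    by (rule T.dd_uminus[OF T.sf_sum[OF open_over[OF W] T.sf_mult[OF fT nT]] u]) auto
  also have "T.dd u w (\<lambda>u. \<Sum>c<dM. vec u i c * nab X (cfield i c) (proj u) i b) =
      (\<Sum>c<dM. T.dd u w (\<lambda>u. vec u i c * nab X (cfield i c) (proj u) i b))"
    by (rule T.dd_sum[OF open_over[OF W] T.sf_mult[OF fT nT] u]) auto
  also have "\<dots> = (\<Sum>c<dM. w i (dM + c) * nab X (cfield i c) (proj u) i b +
      vec u i c * dd (proj u) (hp u w) (\<lambda>q. nab X (cfield i c) q i b))"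
    using T.dd_mult[OF fT nT u] dd_fibre[OF i ui _ w] dd_proj[OF n u w] by (intro sum.cong) auto
  finally show ?thesis .
qed

lemma dd_V:
  assumes X: "vf U X" and i: "i \<in> charts M" and u: "u \<in> over (U \<inter> cdom M i)" and w: "w \<in> T.TS u"
  shows "a < dM \<Longrightarrow> T.dd u w (\<lambda>u. V X u i a) = 0"
    "b < dM \<Longrightarrow> T.dd u w (\<lambda>u. V X u i (dM + b)) = dd (proj u) (hp u w) (\<lambda>q. X q i b)"
proof -
  have c: "sf (U \<inter> cdom M i) (\<lambda>q. X q i b)" for b by (rule vf_comp[OF X i])
  note o = open_over[OF sf_open[OF c]]
  show "T.dd u w (\<lambda>u. V X u i a) = 0" if "a < dM"
  proof -
    have "T.dd u w (\<lambda>u. V X u i a) = T.dd u w (\<lambda>u. 0)"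
      by (rule T.dd_cong[OF o u]) (use vlift_comp[OF i] that in \<open>auto simp: over_Int\<close>)
    then show ?thesis by (simp add: T.dd_const)
  qed
  show "T.dd u w (\<lambda>u. V X u i (dM + b)) = dd (proj u) (hp u w) (\<lambda>q. X q i b)" if "b < dM"
  proof -
    have "T.dd u w (\<lambda>u. V X u i (dM + b)) = T.dd u w (\<lambda>u. X (proj u) i b)"
      by (rule T.dd_cong[OF o u]) (use vlift_comp[OF i] that in \<open>auto simp: over_Int\<close>)
    then show ?thesis using dd_proj[OF c u w] by simp
  qed
qed

lemma TM_ext:
  assumes u: "u \<in> over (points M)" and w: "w \<in> T.TS u" "w' \<in> T.TS u" and i: "i \<in> charts M" "u \<in> over (cdom M i)"
    and lo: "\<And>a. a < dM \<Longrightarrow> w i a = w' i a" and hi: "\<And>b. b < dM \<Longrightarrow> w i (dM + b) = w' i (dM + b)"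
  shows "w = w'"
proof (rule T.tangent_ext[OF w])
  show "chart_around TM u i" using i by simp
  fix a assume "a < mdim TM"
  then show "w i a = w' i a" using lo[of a] hi[of "a - dM"] by (cases "a < dM") auto
qed

lemma lift_at:
  assumes "vf U X" "u \<in> over U"
  shows "u \<in> over (points M)" "proj u \<in> U" "X (proj u) \<in> TS (proj u)" "H X u \<in> T.TS u" "V X u \<in> T.TS u"
    "hp u (H X u) = X (proj u)" "hp u (V X u) = 0" "kp u (H X u) = 0" "kp u (V X u) = X (proj u)"
proof -
  show u: "u \<in> over (points M)" using over_points[OF assms(2)] opn_subset[OF vf_open[OF assms(1)]] by blast
  show p: "proj u \<in> U" using overD(1)[OF assms(2)] .
  show x: "X (proj u) \<in> TS (proj u)" using vf_in[OF assms(1) p] .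
  show "H X u \<in> T.TS u" "V X u \<in> T.TS u" using T.vf_in hlift_vf[OF assms(1)] vlift_vf[OF assms(1)] assms(2) by blast+
  show "hp u (H X u) = X (proj u)" "hp u (V X u) = 0" "kp u (H X u) = 0" "kp u (V X u) = X (proj u)"
    unfolding hlift_hl[OF assms(2,1)] vlift_vl by (intro hp_hl hp_vl kp_hl kp_vl u x)+
qed

text \<open>The base components vanish because vertical lifts have none and those of
  \<open>H X\<close> do not vary along the fibre. In the fibre, the derivative of Y along X and that
  of the linear term - \<Gamma>(X, v) along Y combine to the coordinate formula for
  \<open>nab X Y\<close>.\<close>

lemma bracket_HV:
  assumes X: "vf U X" and Y: "vf U Y" and u: "u \<in> over U"
  shows "lie_bracket TM (H X) (V Y) u = V (nab X Y) u"
proof -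
  note lX = lift_at[OF X u] and lY = lift_at[OF Y u]
  obtain i where i: "i \<in> charts M" "proj u \<in> cdom M i" "u \<in> over (cdom M i)" using over_chart[OF lX(1)] .
  have ui: "u \<in> over (U \<inter> cdom M i)" using u i by (simp add: over_Int)
  have ct: "chart_around TM u i" using i by simp
  show ?thesis
  proof (rule TM_ext[OF lX(1) T.bracket_in[OF hlift_vf[OF X] vlift_vf[OF Y] u] lift_at(5)[OF nab_vf[OF X Y] u] i(1,3)])
    fix a assume a: "a < dM"
    show "lie_bracket TM (H X) (V Y) u i a = V (nab X Y) u i a"
      unfolding lie_bracket_def vlift_comp[OF i(1,3)] if_P[OF ct] dd_V(1)[OF Y i(1) ui lX(4) a] dd_H_low[OF X i(1) ui lY(5) a] lY(7)
      using a by (simp add: dd_zero_vec)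
  next
    fix b assume b: "b < dM"
    have "V Y u i (dM + c) = Y (proj u) i c" if "c < dM" for c using vlift_comp[OF i(1,3)] that by simp
    then show "lie_bracket TM (H X) (V Y) u i (dM + b) = V (nab X Y) u i (dM + b)"
      unfolding lie_bracket_def vlift_comp[OF i(1,3)] if_P[OF ct] dd_V(2)[OF Y i(1) ui lX(4) b] dd_H_high[OF X i(1) ui lY(5) b] lY(7) lX(6)
      using b nab_comp[OF X lX(2) Y lX(2) _ b, of i] i by (simp add: dd_zero_vec)
  qed
qed

text \<open>The components of vertical lifts are constant along the fibres.\<close>

lemma bracket_VV:
  assumes X: "vf U X" and Y: "vf U Y" and u: "u \<in> over U"
  shows "lie_bracket TM (V X) (V Y) u = 0"
proof -
  note lX = lift_at[OF X u] and lY = lift_at[OF Y u]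
  obtain i where i: "i \<in> charts M" "proj u \<in> cdom M i" "u \<in> over (cdom M i)" using over_chart[OF lX(1)] .
  have ui: "u \<in> over (U \<inter> cdom M i)" using u i by (simp add: over_Int)
  have ct: "chart_around TM u i" using i by simp
  show ?thesis
  proof (rule TM_ext[OF lX(1) T.bracket_in[OF vlift_vf[OF X] vlift_vf[OF Y] u] T.TS_zero i(1,3)])
    fix a assume a: "a < dM"
    show "lie_bracket TM (V X) (V Y) u i a = 0 i a"
      unfolding lie_bracket_def if_P[OF ct] dd_V(1)[OF Y i(1) ui lX(5) a] dd_V(1)[OF X i(1) ui lY(5) a] by simp
    show "lie_bracket TM (V X) (V Y) u i (dM + a) = 0 i (dM + a)"
      unfolding lie_bracket_def if_P[OF ct] dd_V(2)[OF Y i(1) ui lX(5) a] dd_V(2)[OF X i(1) ui lY(5) a] lX(7) lY(7)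
      by (simp add: dd_zero_vec)
  qed
qed

lemma endo_rules:
  assumes u: "u \<in> over (points M)" and w: "w \<in> T.TS u"
  shows "ver u (hor u w) = 0" "hor u (ver u w) = 0" "hor u (hor u w) = hor u w" "ver u (ver u w) = ver u w"
    "Jt u (Jt u w) = - w" "hor u (Jt u (ver u w)) = Jt u (ver u w)" "ver u (Jt u (hor u w)) = Jt u (hor u w)"
proof -
  note e = endo_lifts[OF u hp_in[OF u w]] endo_lifts[OF u kp_in[OF u w]]
  note i = hl_in[OF u hp_in[OF u w]] vl_in[OF u hp_in[OF u w]] hl_in[OF u kp_in[OF u w]] vl_in[OF u kp_in[OF u w]]
  show "ver u (hor u w) = 0" "hor u (hor u w) = hor u w" unfolding hor_def[of u w] by (simp_all add: e)
  show "hor u (ver u w) = 0" "ver u (ver u w) = ver u w" unfolding ver_def[of u w] by (simp_all add: e)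
  show "hor u (Jt u (ver u w)) = Jt u (ver u w)"
    unfolding ver_def[of u w] using T.lin_neg[OF hor_lin[OF u] i(3)] by (simp add: e)
  show "ver u (Jt u (hor u w)) = Jt u (hor u w)" unfolding hor_def[of u w] by (simp add: e)
  have "Jt u (Jt u w) = Jt u (vl u (hp u w)) - Jt u (hl u (kp u w))"
    unfolding Jt_def[of u w] by (rule T.lin_diff[OF Jt_lin[OF u] i(2,3)])
  also have "\<dots> = - (hl u (hp u w) + vl u (kp u w))" by (simp add: e)
  finally show "Jt u (Jt u w) = - w" using decomp[OF u w] by simp
qed

section \<open>Construction of the lifted connection\<close>

abbreviation "hF \<equiv> \<lambda>W u. hor u (W u)"
abbreviation "vF \<equiv> \<lambda>W u. ver u (W u)"
abbreviation "JF \<equiv> \<lambda>W u. Jt u (W u)"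

text \<open>On vertical fields the lifted connection is expressed through Lie brackets with the
  bundle maps \<open>hor\<close>, \<open>ver\<close> and \<open>Jt\<close>, so that no gluing of local definitions is needed.\<close>

definition Dv :: "(('a, 'i) tpoint, 'i) conn" where
  "Dv W Y u = ver u (lie_bracket TM (hF W) Y u) - Jt u (hor u (lie_bracket TM (vF W) (JF Y) u))"

text \<open>The complex structure is meant to be parallel: a horizontal part is turned into a
  vertical one by J, differentiated by \<open>Dv\<close>, and turned back by - J.\<close>

definition nab1 :: "(('a, 'i) tpoint, 'i) conn" where
  "nab1 W Y u = Dv W (vF Y) u - Jt u (Dv W (JF (hF Y)) u)"

lemma endo_field_add:
  assumes "T.vf Q W" "T.vf Q W'" "u \<in> Q"
  shows "hF (W + W') u = (hF W + hF W') u" "vF (W + W') u = (vF W + vF W') u" "JF (W + W') u = (JF W + JF W') u"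
  using T.lin_add[OF hor_lin] T.lin_add[OF ver_lin] T.lin_add[OF Jt_lin] TS_points[OF assms(1,3)] T.vf_in assms by auto

lemma endo_field_fscale:
  assumes "T.vf Q W" "u \<in> Q"
  shows "hF (fscale f W) u = fscale f (hF W) u" "vF (fscale f W) u = fscale f (vF W) u"
    "JF (fscale f W) u = fscale f (JF W) u"
  using T.lin_scale[OF hor_lin] T.lin_scale[OF ver_lin] T.lin_scale[OF Jt_lin] TS_points[OF assms] T.vf_in assms
  by (auto simp: fscale_def)

lemma Dv_vf: assumes "T.vf Q W" "T.vf Q Y" shows "T.vf Q (Dv W Y)"
  by (rule T.vf_cong[OF T.vf_diff[OF ver_vf[OF T.bracket_vf[OF hor_vf[OF assms(1)] assms(2)]]
          Jt_vf[OF hor_vf[OF T.bracket_vf[OF ver_vf[OF assms(1)] Jt_vf[OF assms(2)]]]]]])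
    (simp add: Dv_def)

lemma Dv_local:
  assumes "T.opn Q" "u \<in> Q" "\<And>q. q \<in> Q \<Longrightarrow> Y q = Y' q"
  shows "Dv W Y u = Dv W Y' u"
  unfolding Dv_def
  using T.bracket_local[OF assms(1,2), of "hF W" "hF W" Y Y'] T.bracket_local[OF assms(1,2), of "vF W" "vF W" "JF Y" "JF Y'"] assms(3)
  by simp

lemma Dv_local1:
  assumes "T.opn Q" "u \<in> Q" "\<And>q. q \<in> Q \<Longrightarrow> hF W q = A q" "\<And>q. q \<in> Q \<Longrightarrow> vF W q = B q"
  shows "Dv W Y u = ver u (lie_bracket TM A Y u) - Jt u (hor u (lie_bracket TM B (JF Y) u))"
  unfolding Dv_def
  using T.bracket_local[OF assms(1,2), of "hF W" A Y Y] T.bracket_local[OF assms(1,2), of "vF W" B "JF Y" "JF Y"] assms(3,4)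
  by simp

lemma Dv_add1:
  assumes W: "T.vf Q W" "T.vf Q W'" and Y: "T.vf Q Y" and u: "u \<in> Q"
  shows "Dv (W + W') Y u = Dv W Y u + Dv W' Y u"
proof -
  note uM = TS_points[OF Y u] and o = T.vf_open[OF Y]
  note b1 = T.bracket_in[OF hor_vf[OF W(1)] Y u] T.bracket_in[OF hor_vf[OF W(2)] Y u]
  note b2 = T.bracket_in[OF ver_vf[OF W(1)] Jt_vf[OF Y] u] T.bracket_in[OF ver_vf[OF W(2)] Jt_vf[OF Y] u]
  have "Dv (W + W') Y u = ver u (lie_bracket TM (hF W + hF W') Y u) - Jt u (hor u (lie_bracket TM (vF W + vF W') (JF Y) u))"
    by (rule Dv_local1[OF o u]) (rule endo_field_add[OF W], assumption)+
  then show ?thesis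
    unfolding T.bracket_add1[OF hor_vf[OF W(1)] hor_vf[OF W(2)] Y u] T.bracket_add1[OF ver_vf[OF W(1)] ver_vf[OF W(2)] Jt_vf[OF Y] u]
      T.lin_add[OF ver_lin[OF uM] b1] T.lin_add[OF hor_lin[OF uM] b2]
      T.lin_add[OF Jt_lin[OF uM] hor_in[OF uM b2(1)] hor_in[OF uM b2(2)]] Dv_def by simp
qed

lemma Dv_add2:
  assumes W: "T.vf Q W" and Y: "T.vf Q Y" "T.vf Q Y'" and u: "u \<in> Q"
  shows "Dv W (Y + Y') u = Dv W Y u + Dv W Y' u"
proof -
  note uM = TS_points[OF W u] and o = T.vf_open[OF W]
  note b1 = T.bracket_in[OF hor_vf[OF W] Y(1) u] T.bracket_in[OF hor_vf[OF W] Y(2) u]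
  note b2 = T.bracket_in[OF ver_vf[OF W] Jt_vf[OF Y(1)] u] T.bracket_in[OF ver_vf[OF W] Jt_vf[OF Y(2)] u]
  have "lie_bracket TM (vF W) (JF (Y + Y')) u = lie_bracket TM (vF W) (JF Y + JF Y') u"
    by (rule T.bracket_local[OF o u]) (use endo_field_add(3)[OF Y] in auto)
  then show ?thesis
    unfolding Dv_def T.bracket_add[OF hor_vf[OF W] Y u] 
    using T.bracket_add[OF ver_vf[OF W] Jt_vf[OF Y(1)] Jt_vf[OF Y(2)] u]
      T.lin_add[OF ver_lin[OF uM] b1] T.lin_add[OF hor_lin[OF uM] b2]
      T.lin_add[OF Jt_lin[OF uM] hor_in[OF uM b2(1)] hor_in[OF uM b2(2)]] by simp
qed

text \<open>The derivatives of f created by the brackets multiply the horizontal part of W under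
  \<open>ver\<close> and its vertical part under \<open>hor\<close>, and so disappear.\<close>

lemma Dv_fscale1:
  assumes f: "T.sf Q f" and W: "T.vf Q W" and Y: "T.vf Q Y" and u: "u \<in> Q"
  shows "Dv (fscale f W) Y u = f u *\<^sub>R Dv W Y u"
proof -
  note uM = TS_points[OF Y u] and o = T.vf_open[OF Y]
  note w = T.vf_in[OF W u]
  note b1 = T.bracket_in[OF hor_vf[OF W] Y u] and b2 = T.bracket_in[OF ver_vf[OF W] Jt_vf[OF Y] u]
  let ?r = "T.dd u (Y u) f" and ?s = "T.dd u (JF Y u) f"
  have "Dv (fscale f W) Y u = ver u (lie_bracket TM (fscale f (hF W)) Y u) - Jt u (hor u (lie_bracket TM (fscale f (vF W)) (JF Y) u))"
    by (rule Dv_local1[OF o u]) (rule endo_field_fscale[OF W], assumption)+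
  also have "ver u (lie_bracket TM (fscale f (hF W)) Y u) = f u *\<^sub>R ver u (lie_bracket TM (hF W) Y u)"
    unfolding T.bracket_fscale1[OF f hor_vf[OF W] Y u]
    using T.lin_diff[OF ver_lin[OF uM] T.TS_scale[OF b1] T.TS_scale[OF hor_in[OF uM w]]]
      T.lin_scale[OF ver_lin[OF uM] b1] T.lin_scale[OF ver_lin[OF uM] hor_in[OF uM w]] endo_rules(1)[OF uM w] by simp
  also have "hor u (lie_bracket TM (fscale f (vF W)) (JF Y) u) = f u *\<^sub>R hor u (lie_bracket TM (vF W) (JF Y) u)"
    unfolding T.bracket_fscale1[OF f ver_vf[OF W] Jt_vf[OF Y] u]
    using T.lin_diff[OF hor_lin[OF uM] T.TS_scale[OF b2] T.TS_scale[OF ver_in[OF uM w]]]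
      T.lin_scale[OF hor_lin[OF uM] b2] T.lin_scale[OF hor_lin[OF uM] ver_in[OF uM w]] endo_rules(2)[OF uM w] by simp
  finally have eq: "Dv (fscale f W) Y u = f u *\<^sub>R ver u (lie_bracket TM (hF W) Y u) -
      Jt u (f u *\<^sub>R hor u (lie_bracket TM (vF W) (JF Y) u))" .
  show ?thesis unfolding eq
    unfolding Dv_def T.lin_scale[OF Jt_lin[OF uM] hor_in[OF uM b2]] by (simp only: scaleR_diff_right)
qed

text \<open>The two brackets of \<open>Dv\<close> share the Leibniz rule between them: one yields
  the derivative of f along the horizontal part of W, the other, rotated back by J, the derivative
  along the vertical part. Verticality of Y ensures that \<open>ver\<close> fixes Y and
  \<open>hor\<close> fixes J Y.\<close>

lemma Dv_fscale2:
  assumes f: "T.sf Q f" and W: "T.vf Q W" and Y: "T.vf Q Y" and u: "u \<in> Q" and vert: "ver u (Y u) = Y u"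
  shows "Dv W (fscale f Y) u = T.dd u (W u) f *\<^sub>R Y u + f u *\<^sub>R Dv W Y u"
proof -
  note uM = TS_points[OF Y u] and o = T.vf_open[OF Y]
  note w = T.vf_in[OF W u] and y = T.vf_in[OF Y u]
  note b1 = T.bracket_in[OF hor_vf[OF W] Y u] and b2 = T.bracket_in[OF ver_vf[OF W] Jt_vf[OF Y] u]
  let ?r = "T.dd u (hor u (W u)) f" and ?s = "T.dd u (ver u (W u)) f"
  have rs: "T.dd u (W u) f = ?r + ?s" using hor_ver[OF uM w] T.dd_add_vec by metis
  have hJ: "hor u (Jt u (Y u)) = Jt u (Y u)" using endo_rules(6)[OF uM y] vert by simp
  have 1: "ver u (lie_bracket TM (hF W) (fscale f Y) u) = ?r *\<^sub>R Y u + f u *\<^sub>R ver u (lie_bracket TM (hF W) Y u)"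
    unfolding T.bracket_fscale[OF f hor_vf[OF W] Y u]
    using T.lin_add[OF ver_lin[OF uM] T.TS_scale[OF y] T.TS_scale[OF b1]]
      T.lin_scale[OF ver_lin[OF uM] y] T.lin_scale[OF ver_lin[OF uM] b1] vert by simp
  have "lie_bracket TM (vF W) (JF (fscale f Y)) u = lie_bracket TM (vF W) (fscale f (JF Y)) u"
    by (rule T.bracket_local[OF o u]) (use endo_field_fscale(3)[OF Y] in auto)
  then have 2: "hor u (lie_bracket TM (vF W) (JF (fscale f Y)) u) = ?s *\<^sub>R Jt u (Y u) + f u *\<^sub>R hor u (lie_bracket TM (vF W) (JF Y) u)"
    unfolding T.bracket_fscale[OF f ver_vf[OF W] Jt_vf[OF Y] u]
    using T.lin_add[OF hor_lin[OF uM] T.TS_scale[OF Jt_in[OF uM y]] T.TS_scale[OF b2]]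
      T.lin_scale[OF hor_lin[OF uM] Jt_in[OF uM y]] T.lin_scale[OF hor_lin[OF uM] b2] hJ by simp
  have 3: "Jt u (?s *\<^sub>R Jt u (Y u) + f u *\<^sub>R hor u (lie_bracket TM (vF W) (JF Y) u)) =
      - (?s *\<^sub>R Y u) + f u *\<^sub>R Jt u (hor u (lie_bracket TM (vF W) (JF Y) u))"
    using T.lin_add[OF Jt_lin[OF uM] T.TS_scale[OF Jt_in[OF uM y]] T.TS_scale[OF hor_in[OF uM b2]]]
      T.lin_scale[OF Jt_lin[OF uM] Jt_in[OF uM y]] T.lin_scale[OF Jt_lin[OF uM] hor_in[OF uM b2]] endo_rules(5)[OF uM y] by simp
  show ?thesis unfolding Dv_def 1 2 3 rs by (simp add: algebra_simps)
qed

lemma connection_nab1: "connection TM nab1"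
  unfolding connection_def
proof (intro conjI allI impI ballI)
  fix Q W Y assume W: "T.vf Q W" and Y: "T.vf Q Y"
  show "T.vf Q (nab1 W Y)"
    by (rule T.vf_cong[OF T.vf_diff[OF Dv_vf[OF W ver_vf[OF Y]] Jt_vf[OF Dv_vf[OF W Jt_vf[OF hor_vf[OF Y]]]]]])
      (simp add: nab1_def)
next
  fix Q W W' Y u assume W: "T.vf Q W" "T.vf Q W'" and Y: "T.vf Q Y" and u: "u \<in> Q"
  note uM = TS_points[OF Y u] and JY = Jt_vf[OF hor_vf[OF Y]]
  show "nab1 (W + W') Y u = nab1 W Y u + nab1 W' Y u"
    unfolding nab1_def Dv_add1[OF W ver_vf[OF Y] u] Dv_add1[OF W JY u]
      T.lin_add[OF Jt_lin[OF uM] T.vf_in[OF Dv_vf[OF W(1) JY] u] T.vf_in[OF Dv_vf[OF W(2) JY] u]]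
    by simp
next
  fix Q W Y Y' u assume W: "T.vf Q W" and Y: "T.vf Q Y" "T.vf Q Y'" and u: "u \<in> Q"
  note uM = TS_points[OF W u] and JY = Jt_vf[OF hor_vf[OF Y(1)]] Jt_vf[OF hor_vf[OF Y(2)]]
  note o = T.vf_open[OF W]
  have 1: "Dv W (vF (Y + Y')) u = Dv W (vF Y + vF Y') u"
    by (rule Dv_local[OF o u]) (rule endo_field_add(2)[OF Y])
  have 2: "Dv W (JF (hF (Y + Y'))) u = Dv W (JF (hF Y) + JF (hF Y')) u"
    by (rule Dv_local[OF o u])
      (use endo_field_add(1)[OF Y] endo_field_add(3)[OF hor_vf[OF Y(1)] hor_vf[OF Y(2)]] in simp)
  show "nab1 W (Y + Y') u = nab1 W Y u + nab1 W Y' u"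
    unfolding nab1_def 1 2 Dv_add2[OF W ver_vf[OF Y(1)] ver_vf[OF Y(2)] u] Dv_add2[OF W JY u]
      T.lin_add[OF Jt_lin[OF uM] T.vf_in[OF Dv_vf[OF W JY(1)] u] T.vf_in[OF Dv_vf[OF W JY(2)] u]]
    by simp
next
  fix Q f W Y u assume f: "T.sf Q f" and W: "T.vf Q W" and Y: "T.vf Q Y" and u: "u \<in> Q"
  note uM = TS_points[OF Y u] and JY = Jt_vf[OF hor_vf[OF Y]]
  show "nab1 (fscale f W) Y u = f u *\<^sub>R nab1 W Y u"
    unfolding nab1_def Dv_fscale1[OF f W ver_vf[OF Y] u] Dv_fscale1[OF f W JY u]
      T.lin_scale[OF Jt_lin[OF uM] T.vf_in[OF Dv_vf[OF W JY] u]]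
    by (simp add: scaleR_diff_right)
next
  fix Q f W Y u assume f: "T.sf Q f" and W: "T.vf Q W" and Y: "T.vf Q Y" and u: "u \<in> Q"
  note uM = TS_points[OF Y u] and JY = Jt_vf[OF hor_vf[OF Y]] and o = T.vf_open[OF W] and y = T.vf_in[OF Y u]
  note hy = hor_in[OF uM y]
  have 1: "Dv W (vF (fscale f Y)) u = Dv W (fscale f (vF Y)) u"
    by (rule Dv_local[OF o u]) (rule endo_field_fscale(2)[OF Y])
  have 2: "Dv W (JF (hF (fscale f Y))) u = Dv W (fscale f (JF (hF Y))) u"
    by (rule Dv_local[OF o u])
      (use endo_field_fscale(1)[OF Y] endo_field_fscale(3)[OF hor_vf[OF Y]] in simp)
  have 3: "Jt u (T.dd u (W u) f *\<^sub>R Jt u (hor u (Y u)) + f u *\<^sub>R Dv W (JF (hF Y)) u) =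
      - (T.dd u (W u) f *\<^sub>R hor u (Y u)) + f u *\<^sub>R Jt u (Dv W (JF (hF Y)) u)"
    using T.lin_add[OF Jt_lin[OF uM] T.TS_scale[OF Jt_in[OF uM hy]] T.TS_scale[OF T.vf_in[OF Dv_vf[OF W JY] u]]]
      T.lin_scale[OF Jt_lin[OF uM] Jt_in[OF uM hy]] T.lin_scale[OF Jt_lin[OF uM] T.vf_in[OF Dv_vf[OF W JY] u]] endo_rules(5)[OF uM hy] by simp
  have 4: "T.dd u (W u) f *\<^sub>R Y u = T.dd u (W u) f *\<^sub>R hor u (Y u) + T.dd u (W u) f *\<^sub>R ver u (Y u)"
    using hor_ver[OF uM y] by (metis scaleR_add_right)
  show "nab1 W (fscale f Y) u = T.dd u (W u) f *\<^sub>R Y u + f u *\<^sub>R nab1 W Y u"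
    unfolding nab1_def 1 2 Dv_fscale2[OF f W ver_vf[OF Y] u endo_rules(4)[OF uM y]]
      Dv_fscale2[OF f W JY u endo_rules(7)[OF uM y]] 3 4 by (simp add: algebra_simps)
qed

lemma endo_field_lifts:
  assumes "vf U X" "u \<in> over U"
  shows "hF (H X) u = H X u" "hF (V X) u = 0" "vF (H X) u = 0" "vF (V X) u = V X u"
    "JF (H X) u = V X u" "JF (V X) u = (- H X) u"
  using endo_lifts[OF lift_at(1,3)[OF assms]] hlift_hl[OF assms(2,1)] vlift_vl[of X u] by simp_all

lemma Jt_zero: "u \<in> over (points M) \<Longrightarrow> Jt u 0 = 0"
  using T.lin_zero[OF Jt_lin] .

lemma Dv_lifts:
  assumes X: "vf U X" and Y: "vf U Y" and u: "u \<in> over U"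
  shows "Dv (H X) (V Y) u = V (nab X Y) u" "Dv (V X) (V Y) u = 0" "Dv W 0 u = 0"
proof -
  note o = open_over[OF vf_open[OF X]] and uM = lift_at(1)[OF X u]
  note z = T.lin_zero[OF hor_lin[OF uM]] T.lin_zero[OF ver_lin[OF uM]] Jt_zero[OF uM]
  have "Dv (H X) (V Y) u = ver u (lie_bracket TM (H X) (V Y) u) - Jt u (hor u (lie_bracket TM 0 (JF (V Y)) u))"
    by (rule Dv_local1[OF o u]) (use endo_field_lifts[OF X] in auto)
  then show "Dv (H X) (V Y) u = V (nab X Y) u"
    using bracket_HV[OF X Y u] endo_field_lifts(4)[OF nab_vf[OF X Y] u] by (simp add: T.bracket_zero1 z)
  have "Dv (V X) (V Y) u = ver u (lie_bracket TM 0 (V Y) u) - Jt u (hor u (lie_bracket TM (V X) (JF (V Y)) u))"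
    by (rule Dv_local1[OF o u]) (use endo_field_lifts[OF X] in auto)
  moreover have "lie_bracket TM (V X) (JF (V Y)) u = lie_bracket TM (V X) (- H Y) u"
    by (rule T.bracket_local[OF o u]) (use endo_field_lifts(6)[OF Y] in auto)
  moreover have "\<dots> = lie_bracket TM (H Y) (V X) u"
    using T.bracket_uminus2[OF vlift_vf[OF X] hlift_vf[OF Y] u] T.bracket_antisym[of "V X" "H Y" u] by simp
  moreover have "hor u (lie_bracket TM (H Y) (V X) u) = 0"
    using bracket_HV[OF Y X u] endo_field_lifts(2)[OF nab_vf[OF Y X] u] by simp
  ultimately show "Dv (V X) (V Y) u = 0" by (simp add: T.bracket_zero1 z)
  have "lie_bracket TM (vF W) (JF 0) u = lie_bracket TM (vF W) 0 u"
    by (rule T.bracket_local[OF o u]) (use Jt_zero lift_at(1)[OF X] in auto)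
  then show "Dv W 0 u = 0" unfolding Dv_def by (simp add: T.bracket_zero2 z)
qed

text \<open>Existence of a lifted connection, which gives content to the choice in
  \<open>lift_conn\<close>.\<close>

lemma is_lift_conn_nab1: "is_lift_conn M nab nab1"
  unfolding is_lift_conn_def
proof (intro conjI allI impI ballI)
  show "connection TM nab1" by (rule connection_nab1)
  fix U X Y u assume X: "vf U X" and Y: "vf U Y" and "u \<in> points TM" and p: "proj u \<in> U"
  then have u: "u \<in> over U" by (auto simp: in_over)
  note o = open_over[OF vf_open[OF X]] and uM = lift_at(1)[OF X u]
  note e = endo_field_lifts[OF Y]
  have 1: "Dv W (vF (H Y)) u = 0" for W
    using Dv_local[OF o u, of "vF (H Y)" 0 W] e(3) Dv_lifts(3)[OF X Y u] by auto
  have 2: "Dv W (JF (hF (H Y))) u = Dv W (V Y) u" for W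
    by (rule Dv_local[OF o u]) (use e(1,5) in auto)
  have 3: "Dv W (vF (V Y)) u = Dv W (V Y) u" for W
    by (rule Dv_local[OF o u]) (use e(4) in auto)
  have 4: "Dv W (JF (hF (V Y))) u = 0" for W
    using Dv_local[OF o u, of "JF (hF (V Y))" 0 W] e(2) Dv_lifts(3)[OF X Y u] Jt_zero lift_at(1)[OF X] by auto
  note d = Dv_lifts(1,2)[OF X Y u]
  show "nab1 (H X) (H Y) u = H (nab X Y) u"
    using endo_field_lifts(6)[OF nab_vf[OF X Y] u] by (simp add: nab1_def 1 2 d)
  show "nab1 (H X) (V Y) u = V (nab X Y) u" by (simp add: nab1_def 3 4 d Jt_zero[OF uM])
  show "nab1 (V X) (H Y) u = 0" by (simp add: nab1_def 1 2 d Jt_zero[OF uM])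
  show "nab1 (V X) (V Y) u = 0" by (simp add: nab1_def 3 4 d Jt_zero[OF uM])
qed

lemma lift_conn_spec: "is_lift_conn M nab (lift_conn M nab)"
  unfolding lift_conn_def by (rule someI[where P = "is_lift_conn M nab"]) (rule is_lift_conn_nab1)

text \<open>Lifts of base fields span every tangent space of the bundle. Tensorial identities for
  general fields on the bundle are reduced to lifts through this statement.\<close>

lemma lift_zero:
  assumes "T.tensorial_at u \<Phi>" "T.vf Q W" "u \<in> Q"
    "\<And>U X. proj u \<in> U \<Longrightarrow> u \<in> over U \<Longrightarrow> vf U X \<Longrightarrow> \<Phi> (H X) = 0"
    "\<And>U X. proj u \<in> U \<Longrightarrow> u \<in> over U \<Longrightarrow> vf U X \<Longrightarrow> \<Phi> (V X) = 0"
  shows "\<Phi> W = 0"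
proof -
  have uM: "u \<in> over (points M)" using TS_points[OF assms(2,3)] .
  obtain U X Y where U: "proj u \<in> U" "vf U X" "vf U Y" "W u = H X u + V Y u"
    "X (proj u) = hp u (W u)" "Y (proj u) = kp u (W u)"
    by (rule lift_fields[OF uM T.vf_in[OF assms(2,3)]])
  have u: "u \<in> over U" using uM U(1) by (simp add: in_over)
  have "\<Phi> W = \<Phi> (H X + V Y)"
    by (rule T.tensorial_cong[OF assms(1-3) T.vf_add[OF hlift_vf[OF U(2)] vlift_vf[OF U(3)]] u]) (use U(4) in simp)
  also have "\<dots> = \<Phi> (H X) + \<Phi> (V Y)" by (rule T.tensorial_add[OF assms(1) u hlift_vf[OF U(2)] vlift_vf[OF U(3)]])
  finally show ?thesis using assms(4)[OF U(1) u U(2)] assms(5)[OF U(1) u U(3)] by simp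
qed

end

section \<open>The tangent bundle of an affine-Riemann manifold\<close>

locale taff = affr M nab g for M :: "('a, 'i) tmanifold" and nab g

sublocale taff \<subseteq> tconn M nab by unfold_locales

context taff
begin

abbreviation "nT \<equiv> lift_conn M nab"
abbreviation "gT \<equiv> lift_metric M nab g"

lemma connection_nT: "connection TM nT"
  using lift_conn_spec unfolding is_lift_conn_def by blast

sublocale N: conn_mfd "tangent_bundle M" "lift_conn M nab"
  by unfold_locales (rule connection_nT)

text \<open>The flag selects the horizontal (\<open>True\<close>) or the vertical
  (\<open>False\<close>) lift, so that the rules for all combinations of types become one
  statement.\<close>

definition lft :: "bool \<Rightarrow> (('a, 'i) tpoint, 'i) vfield \<Rightarrow> (('a, 'i) tpoint, 'i) vfield" where
  "lft s X = (if s then H X else V X)"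
definition lf :: "bool \<Rightarrow> ('a, 'i) tpoint \<Rightarrow> 'i tvec \<Rightarrow> 'i tvec" where
  "lf s = (if s then hl else vl)"

lemma lft_vf: "vf U X \<Longrightarrow> T.vf (over U) (lft s X)"
  by (simp add: lft_def hlift_vf vlift_vf)

lemma lft_lf: "vf U X \<Longrightarrow> u \<in> over U \<Longrightarrow> lft s X u = lf s u (X (proj u))"
  by (simp add: lft_def lf_def hlift_hl vlift_vl)

lemma lf_in: "u \<in> over (points M) \<Longrightarrow> x \<in> TS (proj u) \<Longrightarrow> lf s u x \<in> T.TS u"
  by (simp add: lf_def hl_in vl_in)

lemma lf_lin: "u \<in> over (points M) \<Longrightarrow> lin (proj u) (lf s u)"
  by (simp add: lf_def hl_lin vl_lin)

lemma lf_parts: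
  assumes "u \<in> over (points M)" "x \<in> TS (proj u)"
  shows "hp u (lf s u x) = (if s then x else 0)" "kp u (lf s u x) = (if s then 0 else x)"
  using assms by (auto simp: lf_def hp_hl hp_vl kp_hl kp_vl)

lemma nT_lft:
  assumes "vf U X" "vf U Y" "u \<in> over U"
  shows "nT (lft s X) (lft t Y) u = (if s then lft t (nab X Y) u else 0)"
proof -
  have "u \<in> points TM" "proj u \<in> U" using lift_at(1,2)[OF assms(1,3)] by simp_all
  then show ?thesis using lift_conn_spec assms(1,2) unfolding is_lift_conn_def lft_def by auto
qed

text \<open>In general the vertical part of such a bracket is, up to sign, the curvature applied to
  the vector \<open>vec u\<close>; flatness makes it vanish.\<close>

lemma bracket_HH:
  assumes X: "vf U X" and Y: "vf U Y" and u: "u \<in> over U"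
  shows "lie_bracket TM (H X) (H Y) u = H (lie_bracket M X Y) u"
proof -
  note lX = lift_at[OF X u] and lY = lift_at[OF Y u] and lB = lift_at[OF bracket_vf[OF X Y] u]
  obtain i where i: "i \<in> charts M" "proj u \<in> cdom M i" "u \<in> over (cdom M i)" using over_chart[OF lX(1)] .
  have ui: "u \<in> over (U \<inter> cdom M i)" using u i by (simp add: over_Int)
  have ct: "chart_around TM u i" and ci: "chart_around M (proj u) i" using i by simp_all
  let ?W = "U \<inter> cdom M i" and ?p = "proj u"
  have W: "opn ?W" "?p \<in> ?W" using vf_open[OF X] open_cdom[OF i(1)] lX(2) i by auto
  have XW: "vf ?W X" and YW: "vf ?W Y" using vf_mono[OF _ W(1)] X Y by auto
  have c: "vf ?W (cfield i c)" if "c < dM" for c using vf_mono[OF cfield_vf[OF i(1) that] W(1)] by auto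
  show ?thesis
  proof (rule TM_ext[OF lX(1) T.bracket_in[OF hlift_vf[OF X] hlift_vf[OF Y] u] lB(4) i(1,3)])
    fix a assume a: "a < dM"
    show "lie_bracket TM (H X) (H Y) u i a = H (lie_bracket M X Y) u i a"
      unfolding lie_bracket_def[of TM] if_P[OF ct] dd_H_low[OF Y i(1) ui lX(4) a] dd_H_low[OF X i(1) ui lY(4) a] lX(6) lY(6)
        hlift_comp[OF u bracket_vf[OF X Y] i(1,2)]
      using a ci by (simp add: hc_def lie_bracket_def)
  next
    fix b assume b: "b < dM"
    define v where "v c = vec u i c" for c
    define A where "A c b = nab X (cfield i c) ?p i b" for c b
    define B where "B c b = nab Y (cfield i c) ?p i b" for c b
    have hX: "H X u i (dM + c) = - (\<Sum>d<dM. v d * A d c)" if "c < dM" for c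
      using hlift_comp[OF u X i(1,2)] that by (simp add: hc_def v_def A_def)
    have hY: "H Y u i (dM + c) = - (\<Sum>d<dM. v d * B d c)" if "c < dM" for c
      using hlift_comp[OF u Y i(1,2)] that by (simp add: hc_def v_def B_def)
    have dY: "dd ?p (X ?p) (\<lambda>q. nab Y (cfield i c) q i b) = nab X (nab Y (cfield i c)) ?p i b - (\<Sum>d<dM. B c d * A d b)"
      if "c < dM" for c
      using nab_comp[OF XW W(2) nab_vf[OF YW c[OF that]] W(2) ci b] by (simp add: A_def B_def)
    have dX: "dd ?p (Y ?p) (\<lambda>q. nab X (cfield i c) q i b) = nab Y (nab X (cfield i c)) ?p i b - (\<Sum>d<dM. A c d * B d b)"
      if "c < dM" for c
      using nab_comp[OF YW W(2) nab_vf[OF XW c[OF that]] W(2) ci b] by (simp add: A_def B_def)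
    have br: "nab (lie_bracket M X Y) (cfield i c) ?p i b = nab X (nab Y (cfield i c)) ?p i b - nab Y (nab X (cfield i c)) ?p i b"
      if "c < dM" for c
      using fun_cong[OF fun_cong[OF flat[OF XW YW c[OF that] W(2)], of i], of b] by simp
    \<comment> \<open>Products of Christoffel terms that come from differentiating the fibre
      coordinate take, after exchanging the sums, the form of those that come from differentiating
      the coefficients, and cancel in the bracket.\<close>
    have sw: "(\<Sum>c<dM. (\<Sum>d<dM. v d * P d c) * R c b) = (\<Sum>c<dM. v c * (\<Sum>d<dM. P c d * R d b))" for P R :: "nat \<Rightarrow> nat \<Rightarrow> real"
    proof -
      have "(\<Sum>c<dM. (\<Sum>d<dM. v d * P d c) * R c b) = (\<Sum>c<dM. \<Sum>d<dM. v d * P d c * R c b)" by (simp add: sum_distrib_right)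
      also have "\<dots> = (\<Sum>d<dM. \<Sum>c<dM. v d * P d c * R c b)" by (rule sum.swap)
      finally show ?thesis by (simp add: sum_distrib_left mult.assoc)
    qed
    have 1: "T.dd u (H X u) (\<lambda>u. H Y u i (dM + b)) = (\<Sum>c<dM. (\<Sum>d<dM. v d * A d c) * B c b) -
        (\<Sum>c<dM. v c * nab X (nab Y (cfield i c)) ?p i b) + (\<Sum>c<dM. v c * (\<Sum>d<dM. B c d * A d b))"
      unfolding dd_H_high[OF Y i(1) ui lX(4) b] lX(6)
      using hX dY by (simp add: v_def[symmetric] B_def[symmetric] sum.distrib sum_subtractf sum_negf right_diff_distrib)
    have 2: "T.dd u (H Y u) (\<lambda>u. H X u i (dM + b)) = (\<Sum>c<dM. (\<Sum>d<dM. v d * B d c) * A c b) -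
        (\<Sum>c<dM. v c * nab Y (nab X (cfield i c)) ?p i b) + (\<Sum>c<dM. v c * (\<Sum>d<dM. A c d * B d b))"
      unfolding dd_H_high[OF X i(1) ui lY(4) b] lY(6)
      using hY dX by (simp add: v_def[symmetric] A_def[symmetric] sum.distrib sum_subtractf sum_negf right_diff_distrib)
    have "H (lie_bracket M X Y) u i (dM + b) = - (\<Sum>c<dM. v c * nab (lie_bracket M X Y) (cfield i c) ?p i b)"
      using hlift_comp[OF u bracket_vf[OF X Y] i(1,2)] b by (simp add: hc_def v_def)
    also have "\<dots> = - (\<Sum>c<dM. v c * nab X (nab Y (cfield i c)) ?p i b) + (\<Sum>c<dM. v c * nab Y (nab X (cfield i c)) ?p i b)"
      using br by (simp add: right_diff_distrib sum_subtractf)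
    finally show "lie_bracket TM (H X) (H Y) u i (dM + b) = H (lie_bracket M X Y) u i (dM + b)"
      unfolding lie_bracket_def[of TM] if_P[OF ct] 1 2 sw by simp
  qed
qed

section \<open>Torsion and curvature of the lifted connection\<close>

lemma common3:
  assumes "vf U X" "p \<in> U" "vf U' Y" "p \<in> U'" "vf U'' Z" "p \<in> U''"
  obtains W where "p \<in> W" "vf W X" "vf W Y" "vf W Z"
proof (rule that)
  have o: "opn (U \<inter> U' \<inter> U'')" using assms vf_open by auto
  show "p \<in> U \<inter> U' \<inter> U''" "vf (U \<inter> U' \<inter> U'') X" "vf (U \<inter> U' \<inter> U'') Y" "vf (U \<inter> U' \<inter> U'') Z"
    using assms vf_mono[OF _ o] by auto
qed

lemma over_at: "u \<in> over (points M) \<Longrightarrow> proj u \<in> W \<Longrightarrow> u \<in> over W"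
  by (simp add: in_over)

lemma lift_zero_lft:
  assumes "T.tensorial_at u \<Phi>" "T.vf Q W" "u \<in> Q"
    "\<And>U X s. proj u \<in> U \<Longrightarrow> u \<in> over U \<Longrightarrow> vf U X \<Longrightarrow> \<Phi> (lft s X) = 0"
  shows "\<Phi> W = 0"
  by (rule lift_zero[OF assms(1-3)]) (use assms(4)[of _ _ True] assms(4)[of _ _ False] in \<open>auto simp: lft_def\<close>)

lemma tor_lft:
  assumes X: "vf U X" and Y: "vf U Y" and u: "u \<in> over U"
  shows "N.tor (lft s X) (lft t Y) u = 0"
proof -
  note uM = lift_at(1,2)[OF X u]
  note n = nab_in[OF X Y uM(2)] nab_in[OF Y X uM(2)]
  have h: "H (nab X Y) u - H (nab Y X) u - H (lie_bracket M X Y) u = 0"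
    unfolding hlift_hl[OF u nab_vf[OF X Y]] hlift_hl[OF u nab_vf[OF Y X]] hlift_hl[OF u bracket_vf[OF X Y]]
      torsion[OF X Y uM(2), symmetric] lin_diff[OF hl_lin[OF uM(1)] n] by simp
  have vh: "lie_bracket TM (V X) (H Y) u = - V (nab Y X) u"
    using T.bracket_antisym[of "V X" "H Y" u] bracket_HV[OF Y X u] by simp
  show ?thesis unfolding N.tor_def nT_lft[OF X Y u] nT_lft[OF Y X u]
    using h vh bracket_HH[OF X Y u] bracket_HV[OF X Y u] bracket_VV[OF X Y u]
    by (cases s; cases t) (simp_all add: lft_def)
qed

text \<open>Tensoriality is available in the first argument and antisymmetry transfers it to the
  second, so the two fields are replaced by lifts one after the other.\<close>

lemma tor_zero:
  assumes A: "T.vf Q A" and B: "T.vf Q B" and u: "u \<in> Q" shows "N.tor A B u = 0"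
proof -
  have 1: "N.tor A (lft t Y) u = 0" if A: "T.vf Q A" and u: "u \<in> Q" and Y: "vf U Y" "u \<in> over U" for A Q U Y t
  proof (rule lift_zero_lft[OF N.tor_tensorial1[OF lft_vf[OF Y(1)] Y(2)] A u])
    fix U' X s assume X: "proj u \<in> U'" "vf U' X"
    obtain W where W: "proj u \<in> W" "vf W X" "vf W Y" using common_domain[OF X(2,1) Y(1) overD(1)[OF Y(2)]] .
    show "N.tor (lft s X) (lft t Y) u = 0"
      by (rule tor_lft[OF W(2,3) over_at[OF TS_points[OF A u] W(1)]])
  qed
  have "N.tor B A u = 0"
    by (rule lift_zero_lft[OF N.tor_tensorial1[OF A u] B u]) (subst N.tor_antisym, use 1[OF A u] in simp)
  then show ?thesis by (subst N.tor_antisym) simp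
qed

lemma torsion_free_nT: "torsion_free TM nT"
  unfolding torsion_free_def using tor_zero unfolding N.tor_def by simp

text \<open>Derivatives along vertical lifts vanish, and a bracket involving a vertical lift is
  vertical or zero. There remains the case of horizontal X and Y, where the result is the lift of
  the curvature of \<open>nab\<close>.\<close>

lemma curv_lft:
  assumes X: "vf U X" and Y: "vf U Y" and Z: "vf U Z" and u: "u \<in> over U"
  shows "curvature TM nT (lft s X) (lft t Y) (lft r Z) u = 0"
proof -
  note uM = lift_at(1,2)[OF X u] and o = open_over[OF vf_open[OF X]]
  have nest: "nT (lft s X) (nT (lft t Y) (lft r Z)) u = (if s \<and> t then lft r (nab X (nab Y Z)) u else 0)"
    if X: "vf U X" and Y: "vf U Y" for X Y s t
  proof (cases t)
    case True
    have "nT (lft s X) (nT (lft t Y) (lft r Z)) u = nT (lft s X) (lft r (nab Y Z)) u"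
      by (rule N.nab_local[OF lft_vf[OF X] N.nab_vf[OF lft_vf[OF Y] lft_vf[OF Z]] lft_vf[OF nab_vf[OF Y Z]] u])
        (use nT_lft[OF Y Z] True in simp)
    then show ?thesis using nT_lft[OF X nab_vf[OF Y Z] u] True by simp
  next
    case False
    have "nT (lft s X) (nT (lft t Y) (lft r Z)) u = nT (lft s X) 0 u"
      by (rule N.nab_local[OF lft_vf[OF X] N.nab_vf[OF lft_vf[OF Y] lft_vf[OF Z]] T.vf_zero[OF o] u])
        (use nT_lft[OF Y Z] False in simp)
    also have "\<dots> = 0" using N.nab_sum2[OF o lft_vf[OF X], of "{}" "\<lambda>x. 0" u] u by simp
    finally show ?thesis using False by simp
  qed
  \<comment> \<open>The connection depends on its first argument only through the value at u, hence
    brackets may be replaced by lifts with the same value there.\<close>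
  have rep: "nT A (lft r Z) u = nT B (lft r Z) u" if "T.vf (over U) A" "T.vf (over U) B" "A u = B u" for A B
    by (rule T.tensorial_cong[OF N.nab_tensorial1[OF lft_vf[OF Z] u] that(1) u that(2) u that(3)])
  have br: "nT (lie_bracket TM (lft s X) (lft t Y)) (lft r Z) u = (if s \<and> t then lft r (nab (lie_bracket M X Y) Z) u else 0)"
  proof -
    note bv = T.bracket_vf[OF lft_vf[OF X] lft_vf[OF Y]]
    consider "s" "t" | "s" "\<not> t" | "\<not> s" "t" | "\<not> s" "\<not> t" by blast
    then show ?thesis
    proof cases
      case 1
      have "nT (lie_bracket TM (lft s X) (lft t Y)) (lft r Z) u = nT (lft True (lie_bracket M X Y)) (lft r Z) u"
        by (rule rep[OF bv lft_vf[OF bracket_vf[OF X Y]]]) (use 1 bracket_HH[OF X Y u] in \<open>simp add: lft_def\<close>)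
      then show ?thesis using 1 nT_lft[OF bracket_vf[OF X Y] Z u, of True r] by simp
    next
      case 2
      have "nT (lie_bracket TM (lft s X) (lft t Y)) (lft r Z) u = nT (lft False (nab X Y)) (lft r Z) u"
        by (rule rep[OF bv lft_vf[OF nab_vf[OF X Y]]]) (use 2 bracket_HV[OF X Y u] in \<open>simp add: lft_def\<close>)
      then show ?thesis using 2 nT_lft[OF nab_vf[OF X Y] Z u, of False r] by simp
    next
      case 3
      have m: "vf U (- nab Y X)" using vf_uminus[OF nab_vf[OF Y X]] .
      have "V (- nab Y X) u = - V (nab Y X) u"
        unfolding vlift_vl using lin_neg[OF vl_lin[OF uM(1)] nab_in[OF Y X uM(2)]] by simp
      then have "nT (lie_bracket TM (lft s X) (lft t Y)) (lft r Z) u = nT (lft False (- nab Y X)) (lft r Z) u"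
        using 3 bracket_HV[OF Y X u] T.bracket_antisym[of "V X" "H Y" u]
        by (intro rep[OF bv lft_vf[OF m]]) (simp add: lft_def)
      then show ?thesis using 3 nT_lft[OF m Z u, of False r] by simp
    next
      case 4
      \<comment> \<open>A field vanishing at u is obtained as 0 times a smooth field, which brings
        linearity in the first argument into play.\<close>
      have "nT (lie_bracket TM (lft s X) (lft t Y)) (lft r Z) u = nT (fscale (\<lambda>q. 0) (lft s X)) (lft r Z) u"
        by (rule rep[OF bv T.vf_fscale[OF T.sf_const[OF o] lft_vf[OF X]]])
          (use 4 bracket_VV[OF X Y u] in \<open>simp add: lft_def fscale_def\<close>)
      then show ?thesis using 4 N.nab_fscale1[OF T.sf_const[OF o] lft_vf[OF X] lft_vf[OF Z] u] by simp
    qed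
  qed
  note v = nab_vf[OF X nab_vf[OF Y Z]] nab_vf[OF Y nab_vf[OF X Z]] nab_vf[OF bracket_vf[OF X Y] Z]
  have "lft r (nab (lie_bracket M X Y) Z) u - lft r (nab X (nab Y Z)) u + lft r (nab Y (nab X Z)) u = 0"
    unfolding lft_lf[OF v(1) u] lft_lf[OF v(2) u] lft_lf[OF v(3) u] flat[OF X Y Z uM(2)]
      lin_diff[OF lf_lin[OF uM(1)] vf_in[OF v(1) uM(2)] vf_in[OF v(2) uM(2)]] by simp
  then show ?thesis unfolding curvature_def nest[OF X Y] nest[OF Y X] br by auto
qed

text \<open>The arguments are replaced by lifts one at a time: the third and the first by
  tensoriality, the second by antisymmetry in the first two.\<close>

lemma flat_nT: "flat_connection TM nT"
proof -
  have 1: "curvature TM nT (lft s X) (lft t Y) C u = 0"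
    if h: "T.vf Q C" "u \<in> Q" "vf U X" "vf U Y" "u \<in> over U" for Q C u U X Y s t
  proof (rule lift_zero_lft[OF N.curv_tensorial3[OF lft_vf[OF h(3)] lft_vf[OF h(4)] h(5)] h(1,2)])
    fix U' Z r assume Z: "proj u \<in> U'" "vf U' Z"
    obtain W where W: "proj u \<in> W" "vf W X" "vf W Y" "vf W Z"
      using common3[OF h(3) overD(1)[OF h(5)] h(4) overD(1)[OF h(5)] Z(2,1)] .
    show "curvature TM nT (lft s X) (lft t Y) (lft r Z) u = 0"
      by (rule curv_lft[OF W(2-4) over_at[OF TS_points[OF h(1,2)] W(1)]])
  qed
  have 2: "curvature TM nT A (lft t Y) C u = 0"
    if A: "T.vf Q A" and C: "T.vf Q C" and u: "u \<in> Q" and Y: "vf U Y" "u \<in> over U" for Q A C u U Y t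
  proof -
    obtain R where R: "u \<in> R" "T.vf R C" "T.vf R (lft t Y)" "R \<subseteq> Q" "R \<subseteq> over U"
      using T.common_domain[OF C u lft_vf[OF Y(1), of t] Y(2)] .
    show ?thesis
    proof (rule lift_zero_lft[OF N.curv_tensorial1[OF R(3,2,1)] A u])
      fix U' X s assume X: "proj u \<in> U'" "vf U' X"
      obtain W where W: "proj u \<in> W" "vf W X" "vf W Y" using common_domain[OF X(2,1) Y(1) overD(1)[OF Y(2)]] .
      show "curvature TM nT (lft s X) (lft t Y) C u = 0"
        by (rule 1[OF C u W(2,3) over_at[OF TS_points[OF A u] W(1)]])
    qed
  qed
  show ?thesis unfolding flat_connection_def
  proof (intro allI impI ballI)
    fix Q A B C u assume A: "T.vf Q A" and B: "T.vf Q B" and C: "T.vf Q C" and u: "u \<in> Q"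
    have "curvature TM nT B A C u = 0"
    proof (rule lift_zero_lft[OF N.curv_tensorial1[OF A C u] B u])
      fix U X s assume X: "proj u \<in> U" "u \<in> over U" "vf U X"
      obtain R where R: "u \<in> R" "T.vf R A" "T.vf R (lft s X)" "R \<subseteq> Q" "R \<subseteq> over U"
        using T.common_domain[OF A u lft_vf[OF X(3), of s] X(2)] .
      have C': "T.vf R C" using T.vf_mono[OF C T.vf_open[OF R(2)] R(4)] .
      show "curvature TM nT (lft s X) A C u = 0"
        using N.curv_antisym[OF R(3,2) C' R(1)] 2[OF A C u X(3,2)] by simp
    qed
    then show "curvature TM nT A B C u = 0" using N.curv_antisym[OF A B C u] by simp
  qed
qed

section \<open>The lifted metric and its covariant derivative\<close>

lemma gT_eq: "u \<in> over (points M) \<Longrightarrow> w \<in> T.TS u \<Longrightarrow> w' \<in> T.TS u \<Longrightarrow>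
    gT u w w' = g (proj u) (hp u w) (hp u w') + g (proj u) (kp u w) (kp u w')"
  using lift_metric_eq unfolding gt_def .

lemma metric_gT: "riemannian_metric TM gT"
  unfolding riemannian_metric_def
proof (intro conjI ballI allI impI)
  fix u assume "u \<in> points TM"
  then have u: "u \<in> over (points M)" by simp
  note p = overD(1)[OF u]
  { fix x y assume x: "x \<in> T.TS u" and y: "y \<in> T.TS u"
    show "gT u x y = gT u y x"
      using g_sym[OF p hp_in[OF u x] hp_in[OF u y]] g_sym[OF p kp_in[OF u x] kp_in[OF u y]]
      by (simp add: gT_eq[OF u x y] gT_eq[OF u y x])
    fix c
    show "gT u (c *\<^sub>R x) y = c * gT u x y"
      using T.lin_scale[OF hp_lin[OF u] x] T.lin_scale[OF kp_lin[OF u] x]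
        lin_scale[OF g_lin1[OF p hp_in[OF u y]] hp_in[OF u x]] lin_scale[OF g_lin1[OF p kp_in[OF u y]] kp_in[OF u x]]
      by (simp add: gT_eq[OF u x y] gT_eq[OF u T.TS_scale[OF x] y] distrib_left)
  next
    fix x y z assume x: "x \<in> T.TS u" and y: "y \<in> T.TS u" and z: "z \<in> T.TS u"
    show "gT u (x + y) z = gT u x z + gT u y z"
      using T.lin_add[OF hp_lin[OF u] x y] T.lin_add[OF kp_lin[OF u] x y]
        lin_add[OF g_lin1[OF p hp_in[OF u z]] hp_in[OF u x] hp_in[OF u y]] lin_add[OF g_lin1[OF p kp_in[OF u z]] kp_in[OF u x] kp_in[OF u y]]
      by (simp add: gT_eq[OF u x z] gT_eq[OF u y z] gT_eq[OF u T.TS_add[OF x y] z])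
  next
    fix x assume x: "x \<in> T.TS u" and "x \<noteq> 0"
    have nn: "g (proj u) y y \<ge> 0" if "y \<in> TS (proj u)" for y
      using g_pos[OF p that] lin_zero[OF g_lin1[OF p that]] by (cases "y = 0") auto
    have "hp u x \<noteq> 0 \<or> kp u x \<noteq> 0"
      using decomp[OF u x] \<open>x \<noteq> 0\<close> lin_zero[OF hl_lin[OF u]] lin_zero[OF vl_lin[OF u]] by auto
    then show "gT u x x > 0"
      using g_pos[OF p hp_in[OF u x]] g_pos[OF p kp_in[OF u x]] nn[OF hp_in[OF u x]] nn[OF kp_in[OF u x]]
      unfolding gT_eq[OF u x x] by linarith
  }
next
  fix Q A B assume A: "T.vf Q A" and B: "T.vf Q B"
  show "T.sf Q (\<lambda>u. gT u (A u) (B u))"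
  proof (rule T.sf_local)
    fix u assume u: "u \<in> Q"
    obtain i where i: "i \<in> charts M" "proj u \<in> cdom M i" "u \<in> over (cdom M i)" using over_chart[OF TS_points[OF A u]] .
    let ?R = "Q \<inter> over (cdom M i)"
    have R: "T.opn ?R" using T.vf_open[OF A] open_over[OF open_cdom[OF i(1)]] by auto
    have gi: "T.sf ?R (\<lambda>u. g (proj u) (cfield i c (proj u)) (cfield i d (proj u)))" if "c < dM" "d < dM" for c d
      by (rule T.sf_mono[OF sf_proj[OF g_sf[OF cfield_vf[OF i(1) that(1)] cfield_vf[OF i(1) that(2)]]] R]) auto
    \<comment> \<open>Horizontal and vertical parts of fields on the bundle need not come from
      fields on M, so smoothness is reduced to the coefficients of g in a chart and the components
      of these parts.\<close>
    have exp: "g (proj q) x y = (\<Sum>c<dM. \<Sum>d<dM. x i c * y i d * g (proj q) (cfield i c (proj q)) (cfield i d (proj q)))"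
      if q: "q \<in> ?R" and x: "x \<in> TS (proj q)" and y: "y \<in> TS (proj q)" for q x y
    proof -
      have ci: "chart_around M (proj q) i" using q i overD by auto
      have p: "proj q \<in> points M" using ci cdom_subset by blast
      note cT = cfield_in[OF ci]
      have "g (proj q) x y = g (proj q) (\<Sum>c<dM. x i c *\<^sub>R cfield i c (proj q)) y" using tvec_expand[OF x ci] by simp
      also have "\<dots> = (\<Sum>c<dM. x i c *\<^sub>R g (proj q) (cfield i c (proj q)) y)" by (rule lin_lincomb[OF g_lin1[OF p y] cT])
      also have "\<dots> = (\<Sum>c<dM. x i c *\<^sub>R g (proj q) (cfield i c (proj q)) (\<Sum>d<dM. y i d *\<^sub>R cfield i d (proj q)))"
        using tvec_expand[OF y ci] by simp
      also have "\<dots> = (\<Sum>c<dM. x i c *\<^sub>R (\<Sum>d<dM. y i d *\<^sub>R g (proj q) (cfield i c (proj q)) (cfield i d (proj q))))"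
        by (intro sum.cong refl arg_cong2[of _ _ _ _ "(*\<^sub>R)"] lin_lincomb[OF g_lin2[OF p cT] cT])
      finally show ?thesis by (simp add: sum_distrib_left mult.assoc)
    qed
    have "T.sf ?R (\<lambda>u. (\<Sum>c<dM. \<Sum>d<dM. hp u (A u) i c * hp u (B u) i d * g (proj u) (cfield i c (proj u)) (cfield i d (proj u))) +
        (\<Sum>c<dM. \<Sum>d<dM. kp u (A u) i c * kp u (B u) i d * g (proj u) (cfield i c (proj u)) (cfield i d (proj u))))"
      by (intro T.sf_add T.sf_sum R T.sf_mult gi hp_sf[OF A i(1)] hp_sf[OF B i(1)] kp_sf[OF A i(1)] kp_sf[OF B i(1)]) auto
    then have "T.sf ?R (\<lambda>u. gT u (A u) (B u))"
    proof (rule T.sf_cong)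
      fix q assume q: "q \<in> ?R"
      then have qM: "q \<in> over (points M)" using TS_points[OF A] by blast
      have a: "A q \<in> T.TS q" and b: "B q \<in> T.TS q" using T.vf_in A B q by auto
      show "(\<Sum>c<dM. \<Sum>d<dM. hp q (A q) i c * hp q (B q) i d * g (proj q) (cfield i c (proj q)) (cfield i d (proj q))) +
        (\<Sum>c<dM. \<Sum>d<dM. kp q (A q) i c * kp q (B q) i d * g (proj q) (cfield i c (proj q)) (cfield i d (proj q))) = gT q (A q) (B q)"
        unfolding gT_eq[OF qM a b] exp[OF q hp_in[OF qM a] hp_in[OF qM b]] exp[OF q kp_in[OF qM a] kp_in[OF qM b]] ..
    qed
    then show "\<exists>W. u \<in> W \<and> W \<subseteq> Q \<and> T.sf W (\<lambda>u. gT u (A u) (B u))" using u i(3) by blast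
  qed
qed

lemma smooth_manifold_TM: "smooth_manifold TM"
  using aff smooth_atlas_TM Hausdorff_TM second_countable_TM
  unfolding affine_riemann_def smooth_manifold_iff by blast

lemma affine_riemann_TM: "affine_riemann TM nT gT"
  unfolding affine_riemann_def
  using smooth_manifold_TM connection_nT torsion_free_nT flat_nT metric_gT by blast

sublocale A1: affr "tangent_bundle M" "lift_conn M nab" "lift_metric M nab g"
  by unfold_locales (rule affine_riemann_TM)

lemma gT_lf:
  assumes "u \<in> over (points M)" "x \<in> TS (proj u)" "y \<in> TS (proj u)"
  shows "gT u (lf s u x) (lf t u y) = (if s = t then g (proj u) x y else 0)"
proof -
  note p = overD(1)[OF assms(1)]
  have z: "g (proj u) 0 x = 0" "g (proj u) x 0 = 0" if "x \<in> TS (proj u)" for x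
    using lin_zero[OF g_lin1[OF p that]] lin_zero[OF g_lin2[OF p that]] by auto
  show ?thesis
    unfolding gT_eq[OF assms(1) lf_in[OF assms(1,2)] lf_in[OF assms(1,3)]] lf_parts[OF assms(1,2)] lf_parts[OF assms(1,3)]
    using z[OF assms(2)] z[OF assms(3)] z[OF TS_zero] by auto
qed

text \<open>The metric of two lifts is zero or the pull-back of a function on M. Hence it has no
  derivative in vertical directions, where \<open>nT\<close> of lifts vanishes too; in horizontal
  directions the three terms of \<open>Cf\<close> are those of M.\<close>

lemma C1_lf:
  assumes u: "u \<in> over (points M)" and x: "x \<in> TS (proj u)" and y: "y \<in> TS (proj u)" and z: "z \<in> TS (proj u)"
  shows "A1.Ct u (lf s u x) (lf t u y) (lf r u z) = (if s \<and> t = r then Ct (proj u) x y z else 0)"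
proof -
  note p = overD(1)[OF u]
  obtain U where U: "proj u \<in> U" "vf U (extend (proj u) x)" "vf U (extend (proj u) y)" "vf U (extend (proj u) z)"
    "extend (proj u) x (proj u) = x" "extend (proj u) y (proj u) = y" "extend (proj u) z (proj u) = z"
    by (rule extend3[OF p x y z])
  define X where "X = extend (proj u) x"
  define Y where "Y = extend (proj u) y"
  define Z where "Z = extend (proj u) z"
  note X = U(2)[folded X_def] and Y = U(3)[folded Y_def] and Z = U(4)[folded Z_def]
  note v = U(5)[folded X_def] U(6)[folded Y_def] U(7)[folded Z_def]
  have uU: "u \<in> over U" by (rule over_at[OF u U(1)])
  note l = lft_lf[OF X uU] lft_lf[OF Y uU] lft_lf[OF Z uU]
  have "A1.Ct u (lf s u x) (lf t u y) (lf r u z) = A1.Cf (lft s X) (lft t Y) (lft r Z) u"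
    using A1.Ct_Cf[OF lft_vf[OF X] lft_vf[OF Y] lft_vf[OF Z] uU, of s t r] l v by simp
  also have "\<dots> = (if s \<and> t = r then Cf X Y Z (proj u) else 0)"
  proof -
    let ?f = "\<lambda>q. if t = r then g q (Y q) (Z q) else 0"
    have fs: "sf U ?f" using g_sf[OF Y Z] sf_const[OF vf_open[OF X], of 0] by (cases "t = r") simp_all
    have "T.dd u (lft s X u) (\<lambda>q. gT q (lft t Y q) (lft r Z q)) = T.dd u (lft s X u) (\<lambda>q. ?f (proj q))"
    proof (rule T.dd_cong[OF open_over[OF vf_open[OF X]] uU])
      fix q assume q: "q \<in> over U"
      show "gT q (lft t Y q) (lft r Z q) = ?f (proj q)"
        unfolding lft_lf[OF Y q] lft_lf[OF Z q] using gT_lf[OF lift_at(1)[OF X q] lift_at(3)[OF Y q] lift_at(3)[OF Z q]] by simp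
    qed
    also have "\<dots> = dd (proj u) (hp u (lft s X u)) ?f" by (rule dd_proj[OF fs uU T.vf_in[OF lft_vf[OF X] uU]])
    also have "\<dots> = (if s then dd (proj u) (X (proj u)) ?f else 0)"
      unfolding l lf_parts[OF u vf_in[OF X U(1)]] by (simp add: dd_zero_vec)
    finally have 1: "T.dd u (lft s X u) (\<lambda>q. gT q (lft t Y q) (lft r Z q)) = (if s then dd (proj u) (X (proj u)) ?f else 0)" .
    have 2: "gT u (nT (lft s X) (lft t Y) u) (lft r Z u) = (if s \<and> t = r then g (proj u) (nab X Y (proj u)) (Z (proj u)) else 0)"
      using nT_lft[OF X Y uU, of s t] gT_lf[OF u nab_in[OF X Y U(1)] vf_in[OF Z U(1)], of t r] lft_lf[OF nab_vf[OF X Y] uU, of t] l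
        T.lin_zero[OF A1.g_lin1, of u "lft r Z u"] T.vf_in[OF lft_vf[OF Z] uU, of r] u by auto
    have 3: "gT u (lft t Y u) (nT (lft s X) (lft r Z) u) = (if s \<and> t = r then g (proj u) (Y (proj u)) (nab X Z (proj u)) else 0)"
      using nT_lft[OF X Z uU, of s r] gT_lf[OF u vf_in[OF Y U(1)] nab_in[OF X Z U(1)], of t r] lft_lf[OF nab_vf[OF X Z] uU, of r] l
        T.lin_zero[OF A1.g_lin2, of u "lft t Y u"] T.vf_in[OF lft_vf[OF Y] uU, of t] u by auto
    show ?thesis unfolding A1.Cf_def 1 2 3 by (auto simp: Cf_def dd_const)
  qed
  also have "Cf X Y Z (proj u) = Ct (proj u) x y z" using Ct_Cf[OF X Y Z U(1)] v by simp
  finally show ?thesis .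
qed

end

section \<open>Hermitian structures parallel for the flat connection\<close>

context smooth_mfd
begin

text \<open>The derivative of f arising from \<eta>(f X) is cancelled by the bracket term.
  Closedness on the bundle can therefore be tested on lifts.\<close>

lemma ext_deriv1_tensorial:
  assumes l: "\<And>p. p \<in> points M \<Longrightarrow> lin p (\<eta> p)" and s: "\<And>U X. vf U X \<Longrightarrow> sf U (\<lambda>q. \<eta> q (X q))"
    and Y: "vf U Y" "p \<in> U"
  shows "tensorial_at p (\<lambda>X. ext_deriv1 M (\<lambda>X p. \<eta> p (X p)) X Y p)"
proof (rule tensorialI)
  fix Q X X' assume Q: "p \<in> Q" "vf Q X" "vf Q X'"
  obtain W where W: "p \<in> W" "vf W X" "vf W Y" "W \<subseteq> Q" "W \<subseteq> U" using common_domain[OF Q(2,1) Y] .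
  have X': "vf W X'" using vf_mono[OF Q(3) vf_open[OF W(2)] W(4)] .
  have "dd p (Y p) (\<lambda>q. \<eta> q ((X + X') q)) = dd p (Y p) (\<lambda>q. \<eta> q (X q) + \<eta> q (X' q))"
  proof (rule dd_cong[OF vf_open[OF W(2)] W(1)])
    fix q assume q: "q \<in> W"
    show "\<eta> q ((X + X') q) = \<eta> q (X q) + \<eta> q (X' q)"
      using lin_add[OF l[OF vf_points[OF X' q]] vf_in[OF W(2) q] vf_in[OF X' q]] by simp
  qed
  then have "dd p (Y p) (\<lambda>q. \<eta> q ((X + X') q)) = dd p (Y p) (\<lambda>q. \<eta> q (X q)) + dd p (Y p) (\<lambda>q. \<eta> q (X' q))"
    using dd_add[OF s[OF W(2)] s[OF X'] W(1)] by simp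
  moreover have "\<eta> p (lie_bracket M (X + X') Y p) = \<eta> p (lie_bracket M X Y p) + \<eta> p (lie_bracket M X' Y p)"
    unfolding bracket_add1[OF W(2) X' W(3,1)]
    by (rule lin_add[OF l[OF vf_points[OF X' W(1)]] bracket_in[OF W(2,3,1)] bracket_in[OF X' W(3,1)]])
  ultimately show "ext_deriv1 M (\<lambda>X p. \<eta> p (X p)) (X + X') Y p =
      ext_deriv1 M (\<lambda>X p. \<eta> p (X p)) X Y p + ext_deriv1 M (\<lambda>X p. \<eta> p (X p)) X' Y p"
    by (simp add: ext_deriv1_def dd_add_vec)
next
  fix Q f X assume Q: "p \<in> Q" "sf Q f" "vf Q X"
  obtain W where W: "p \<in> W" "vf W X" "vf W Y" "W \<subseteq> Q" "W \<subseteq> U" using common_domain[OF Q(3,1) Y] .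
  have f: "sf W f" using sf_mono[OF Q(2) vf_open[OF W(2)] W(4)] .
  note lp = l[OF vf_points[OF W(2,1)]]
  have "dd p (Y p) (\<lambda>q. \<eta> q (fscale f X q)) = dd p (Y p) (\<lambda>q. f q * \<eta> q (X q))"
  proof (rule dd_cong[OF vf_open[OF W(2)] W(1)])
    fix q assume q: "q \<in> W"
    show "\<eta> q (fscale f X q) = f q * \<eta> q (X q)"
      using lin_scale[OF l[OF vf_points[OF W(2) q]] vf_in[OF W(2) q]] by (simp add: fscale_def)
  qed
  then have "dd p (Y p) (\<lambda>q. \<eta> q (fscale f X q)) = dd p (Y p) f * \<eta> p (X p) + f p * dd p (Y p) (\<lambda>q. \<eta> q (X q))"
    using dd_mult[OF f s[OF W(2)] W(1)] by simp
  moreover have "\<eta> p (lie_bracket M (fscale f X) Y p) = f p * \<eta> p (lie_bracket M X Y p) - dd p (Y p) f * \<eta> p (X p)"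
    unfolding bracket_fscale1[OF f W(2,3,1)]
    using lin_diff[OF lp TS_scale[OF bracket_in[OF W(2,3,1)]] TS_scale[OF vf_in[OF W(2,1)]]]
      lin_scale[OF lp bracket_in[OF W(2,3,1)]] lin_scale[OF lp vf_in[OF W(2,1)]] by simp
  ultimately show "ext_deriv1 M (\<lambda>X p. \<eta> p (X p)) (fscale f X) Y p = f p *\<^sub>R ext_deriv1 M (\<lambda>X p. \<eta> p (X p)) X Y p"
    by (simp add: ext_deriv1_def fscale_def dd_scale_vec algebra_simps)
qed

lemma ext_deriv1_antisym:
  assumes "p \<in> U" "vf U X" "vf U Y" "lin p (\<eta> p)"
  shows "ext_deriv1 M (\<lambda>X p. \<eta> p (X p)) X Y p = - ext_deriv1 M (\<lambda>X p. \<eta> p (X p)) Y X p"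
  using lin_neg[OF assms(4) bracket_in[OF assms(3,2,1)]] bracket_antisym[of X Y p]
  by (simp add: ext_deriv1_def)

end

section \<open>Closedness of traces, and connections given by tensors\<close>

context affr
begin

text \<open>Both \<xi>, with c = 1, and the Lee form, with c = -1, have this shape. As
  \<open>be\<close> is closed, only the differential of \<open>al\<close> counts.\<close>

lemma d_scaled_al:
  assumes \<alpha>: "\<And>U X p. vf U X \<Longrightarrow> p \<in> U \<Longrightarrow> \<alpha> X p = c * (al p (X p) - be p (X p) / 2)" and c: "c \<noteq> 0"
  shows "form2_zero M (ext_deriv1 M \<alpha>) \<longleftrightarrow> form2_zero M (ext_deriv1 M (\<lambda>X p. al p (X p)))"
proof -
  have "ext_deriv1 M \<alpha> X Y p = c * ext_deriv1 M (\<lambda>X p. al p (X p)) X Y p" if *: "vf U X" "vf U Y" "p \<in> U" for U X Y p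
  proof -
    have d: "dd p v (\<alpha> Z) = c * (dd p v (\<lambda>q. al q (Z q)) - dd p v (\<lambda>q. be q (Z q)) / 2)" if Z: "vf U Z" for v Z
    proof -
      have b: "sf U (\<lambda>q. (1/2) * be q (Z q))" using sf_cmult[OF be_sf(1)[OF Z]] .
      have "dd p v (\<alpha> Z) = dd p v (\<lambda>q. c * (al q (Z q) - (1/2) * be q (Z q)))"
        by (rule dd_cong[OF vf_open[OF Z] *(3)]) (use \<alpha>[OF Z] in simp)
      also have "\<dots> = c * (dd p v (\<lambda>q. al q (Z q)) - (1/2) * dd p v (\<lambda>q. be q (Z q)))"
        unfolding dd_cmult[OF sf_diff[OF al_sf[OF Z] b] *(3)] dd_diff[OF al_sf[OF Z] b *(3)] dd_cmult[OF be_sf(1)[OF Z] *(3)] ..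
      finally show ?thesis by simp
    qed
    have "ext_deriv1 M (\<lambda>X p. be p (X p)) X Y p = 0" using d_be_zero * unfolding form2_zero_def by blast
    then show ?thesis
      unfolding ext_deriv1_def d[OF *(1)] d[OF *(2)] \<alpha>[OF bracket_vf[OF *(1,2)] *(3)]
      by (simp add: algebra_simps)
  qed
  then show ?thesis using c unfolding form2_zero_def by (metis mult_eq_0_iff)
qed

lemma xi_form_closed_iff:
  "form2_zero M (ext_deriv1 M (xi_form M nab g)) \<longleftrightarrow> form2_zero M (ext_deriv1 M (\<lambda>X p. al p (X p)))"
  by (rule d_scaled_al[of _ 1]) (use g_tr_gamma vf_points vf_in in \<open>auto simp: xi_form_def\<close>)

definition trilin :: "('p \<Rightarrow> 'i tvec \<Rightarrow> 'i tvec \<Rightarrow> 'i tvec \<Rightarrow> real) \<Rightarrow> bool" where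
  "trilin R \<longleftrightarrow> (\<forall>p\<in>points M. \<forall>x\<in>TS p. \<forall>y\<in>TS p.
     lin p (\<lambda>z. R p x y z) \<and> lin p (\<lambda>z. R p x z y) \<and> lin p (\<lambda>z. R p z x y))"

definition smooth3 :: "('p \<Rightarrow> 'i tvec \<Rightarrow> 'i tvec \<Rightarrow> 'i tvec \<Rightarrow> real) \<Rightarrow> bool" where
  "smooth3 R \<longleftrightarrow> (\<forall>U X Y Z. vf U X \<longrightarrow> vf U Y \<longrightarrow> vf U Z \<longrightarrow> sf U (\<lambda>q. R q (X q) (Y q) (Z q)))"

lemma trilinD:
  assumes "trilin R" "p \<in> points M" "x \<in> TS p" "y \<in> TS p"
  shows "lin p (\<lambda>z. R p x y z)" "lin p (\<lambda>z. R p x z y)" "lin p (\<lambda>z. R p z x y)"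
  using assms unfolding trilin_def by blast+

lemma connection_riesz:
  assumes R: "trilin R" "smooth3 R"
    and D: "\<And>U X Y p. vf U X \<Longrightarrow> vf U Y \<Longrightarrow> p \<in> U \<Longrightarrow> D X Y p = nab X Y p + riesz p (R p (X p) (Y p))"
  shows "connection M D"
proof (rule connection_plus_tensor[where S = "\<lambda>p x y. riesz p (R p x y)", OF _ _ _ D])
  fix U X Y assume X: "vf U X" and Y: "vf U Y"
  show "vf U (\<lambda>q. riesz q (R q (X q) (Y q)))"
  proof (rule vf_of_pairing[OF vf_open[OF X]])
    show "riesz q (R q (X q) (Y q)) \<in> TS q" if "q \<in> U" for q using riesz_in vf_points[OF X that] .
    fix V Z assume Z: "vf V Z" "V \<subseteq> U"
    have X': "vf V X" and Y': "vf V Y" using vf_mono vf_open[OF Z(1)] Z(2) X Y by blast+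
    have "sf V (\<lambda>q. R q (X q) (Y q) (Z q))" using R(2) X' Y' Z(1) unfolding smooth3_def by blast
    then show "sf V (\<lambda>q. g q (riesz q (R q (X q) (Y q))) (Z q))"
      by (rule sf_cong) (use g_riesz[OF _ trilinD(1)[OF R(1)]] vf_points[OF X'] vf_in X' Y' Z(1) in auto)
  qed
next
  have s: "lin p (\<lambda>y. \<phi> y *\<^sub>R v)" if "lin p \<phi>" for p v and \<phi> :: "'i tvec \<Rightarrow> real"
    using that by (intro linI) (auto simp: lin_add lin_scale scaleR_add_left)
  fix p x assume p: "p \<in> points M" and x: "x \<in> TS p"
  show "lin p (\<lambda>y. riesz p (R p x y))" unfolding riesz_def
    by (intro lin_sum_fun s trilinD(2)[OF R(1) p x] fr_in[OF p]) simp
  show "lin p (\<lambda>y. riesz p (R p y x))" unfolding riesz_def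
    by (intro lin_sum_fun s trilinD(3)[OF R(1) p x] fr_in[OF p]) simp
qed

text \<open>The common core of the definite descriptions \<open>bismut\<close> and
  \<open>chern\<close>: a tangent vector is determined by its products with the values of local
  fields, and \<open>riesz\<close> produces the one required.\<close>

lemma THE_conn:
  assumes *: "vf Q X" "vf Q Y" "p \<in> Q" and l: "lin p \<phi>"
    and rhs: "\<And>U Z. p \<in> U \<Longrightarrow> vf U Z \<Longrightarrow> rhs Z = g p (nab X Y p) (Z p) + \<phi> (Z p)"
  shows "(THE w. w \<in> TS p \<and> (\<forall>U Z. p \<in> U \<longrightarrow> vf U Z \<longrightarrow> g p w (Z p) = rhs Z)) = nab X Y p + riesz p \<phi>"
proof (rule the_equality)
  note pM = vf_points[OF *(1,3)] and n = nab_in[OF *]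
  have w: "nab X Y p + riesz p \<phi> \<in> TS p" by (intro TS_add n riesz_in pM)
  have gw: "g p (nab X Y p + riesz p \<phi>) z = g p (nab X Y p) z + \<phi> z" if z: "z \<in> TS p" for z
    using lin_add[OF g_lin1[OF pM z] n riesz_in[OF pM]] g_riesz[OF pM l z] by simp
  show "nab X Y p + riesz p \<phi> \<in> TS p \<and> (\<forall>U Z. p \<in> U \<longrightarrow> vf U Z \<longrightarrow> g p (nab X Y p + riesz p \<phi>) (Z p) = rhs Z)"
    using w gw rhs vf_in by simp
  fix v assume v: "v \<in> TS p \<and> (\<forall>U Z. p \<in> U \<longrightarrow> vf U Z \<longrightarrow> g p v (Z p) = rhs Z)"
  show "v = nab X Y p + riesz p \<phi>"
  proof (rule g_nondegenerate[OF pM conjunct1[OF v] w])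
    fix z assume z: "z \<in> TS p"
    obtain V where V: "p \<in> V" "vf V (extend p z)" "extend p z p = z" using extend[OF pM z] .
    have "g p v (extend p z p) = rhs (extend p z)" using v V(1,2) by blast
    then show "g p v z = g p (nab X Y p + riesz p \<phi>) z" using rhs[OF V(1,2)] V(3) gw[OF z] by simp
  qed
qed

end

text \<open>Abstracts what the tangent bundle provides: an affine-Riemann manifold with an
  orthogonal J, parallel for the flat connection. Integrability of J is a consequence.\<close>

locale herm = affr M nab g for M :: "('p, 'i) manifold" and nab g +
  fixes J :: "('p, 'i) endo"
  assumes J_in: "p \<in> points M \<Longrightarrow> x \<in> TS p \<Longrightarrow> J p x \<in> TS p"
    and J_lin: "p \<in> points M \<Longrightarrow> lin p (J p)"
    and JJ: "p \<in> points M \<Longrightarrow> x \<in> TS p \<Longrightarrow> J p (J p x) = - x"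
    and g_JJ: "p \<in> points M \<Longrightarrow> x \<in> TS p \<Longrightarrow> y \<in> TS p \<Longrightarrow> g p (J p x) (J p y) = g p x y"
    and J_vf: "vf U X \<Longrightarrow> vf U (endo_field J X)"
    and nab_J: "vf U X \<Longrightarrow> vf U Y \<Longrightarrow> p \<in> U \<Longrightarrow> nab X (endo_field J Y) p = J p (nab X Y p)"
begin

lemma endo_field_apply [simp]: "endo_field J X p = J p (X p)"
  by (simp add: endo_field_def)

lemma g_J: assumes "p \<in> points M" "x \<in> TS p" "y \<in> TS p" shows "g p (J p x) y = - g p x (J p y)"
  using g_JJ[OF assms(1) J_in[OF assms(1,2)] assms(3)] JJ[OF assms(1,2)]
    lin_neg[OF g_lin1[OF assms(1) J_in[OF assms(1,3)]] assms(2)] by simp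

lemma Ct_neg:
  assumes "p \<in> points M" "x \<in> TS p" "y \<in> TS p" "z \<in> TS p"
  shows "Ct p (- x) y z = - Ct p x y z" "Ct p x (- y) z = - Ct p x y z" "Ct p x y (- z) = - Ct p x y z"
  using lin_neg[OF Ct_lin1[OF assms(1,3,4)] assms(2)] lin_neg[OF Ct_lin2[OF assms(1,2,4)] assms(3)]
    lin_neg[OF Ct_lin3[OF assms(1,2,3)] assms(4)] by auto

text \<open>The functions g(JY, JZ) and g(Y, Z) have the same derivatives, and J passes through
  \<open>nab\<close> in the two connection terms.\<close>

lemma Ct_J:
  assumes "p \<in> points M" "x \<in> TS p" "y \<in> TS p" "z \<in> TS p"
  shows "Ct p x (J p y) (J p z) = Ct p x y z"
proof -
  obtain U where U: "p \<in> U" "vf U (extend p x)" "vf U (extend p y)" "vf U (extend p z)"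
    "extend p x p = x" "extend p y p = y" "extend p z p = z"
    by (rule extend3[OF assms])
  let ?X = "extend p x" and ?Y = "extend p y" and ?Z = "extend p z"
  have "dd p x (\<lambda>q. g q (endo_field J ?Y q) (endo_field J ?Z q)) = dd p x (\<lambda>q. g q (?Y q) (?Z q))"
    by (rule dd_cong[OF vf_open[OF U(2)] U(1)]) (use g_JJ vf_points[OF U(2)] vf_in U(3,4) in auto)
  then have "Cf ?X (endo_field J ?Y) (endo_field J ?Z) p = Cf ?X ?Y ?Z p"
    unfolding Cf_def nab_J[OF U(2,3,1)] nab_J[OF U(2,4,1)]
    using g_JJ[OF assms(1) nab_in[OF U(2,3,1)] assms(4)] g_JJ[OF assms(1) assms(3) nab_in[OF U(2,4,1)]] U(5-7) by simp
  then show ?thesis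
    using Ct_Cf[OF U(2) J_vf[OF U(3)] J_vf[OF U(4)] U(1)] Ct_Cf[OF U(2-4,1)] U(5-7) by simp
qed

lemma Ct_J1:
  assumes "p \<in> points M" "x \<in> TS p" "y \<in> TS p" "z \<in> TS p"
  shows "Ct p x (J p y) z = - Ct p x y (J p z)"
  using Ct_J[OF assms(1-3) J_in[OF assms(1,4)]] JJ[OF assms(1,4)] Ct_neg(3)[OF assms(1,2) J_in[OF assms(1,3)] assms(4)] by simp

text \<open>The differential of the fundamental form.\<close>

definition omt :: "'p \<Rightarrow> 'i tvec \<Rightarrow> 'i tvec \<Rightarrow> 'i tvec \<Rightarrow> real" where
  "omt p x y z = Ct p x (J p y) z + Ct p y (J p z) x + Ct p z (J p x) y"

lemma dd_om:
  assumes "vf U X" "vf U Y" "vf U Z" "p \<in> U"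
  shows "dd p (X p) (fundamental_form J g Y Z) = Ct p (X p) (J p (Y p)) (Z p) +
     g p (J p (nab X Y p)) (Z p) + g p (J p (Y p)) (nab X Z p)"
proof -
  have "fundamental_form J g Y Z = (\<lambda>q. g q (endo_field J Y q) (Z q))" by (auto simp: fundamental_form_def)
  then show ?thesis
    using Ct_Cf[OF assms(1) J_vf[OF assms(2)] assms(3,4)] nab_J[OF assms(1,2,4)] by (simp add: Cf_def)
qed

text \<open>With the brackets written as differences of covariant derivatives, all connection terms
  cancel because g(J x, y) is skew; the terms with C remain.\<close>

lemma d_om:
  assumes *: "vf U X" "vf U Y" "vf U Z" "p \<in> U"
  shows "ext_deriv2 M (fundamental_form J g) X Y Z p = omt p (X p) (Y p) (Z p)"
proof -
  note pM = vf_points[OF *(1,4)]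
  have br: "g p (J p (lie_bracket M A B p)) c = g p (J p (nab A B p)) c - g p (J p (nab B A p)) c"
    if "vf U A" "vf U B" "c \<in> TS p" for A B c
    unfolding torsion[OF that(1,2) *(4), symmetric] lin_diff[OF J_lin[OF pM] nab_in[OF that(1,2) *(4)] nab_in[OF that(2,1) *(4)]]
    by (rule lin_diff[OF g_lin1[OF pM that(3)] J_in[OF pM nab_in[OF that(1,2) *(4)]] J_in[OF pM nab_in[OF that(2,1) *(4)]]])
  have as: "g p (J p (Y p)) n = - g p (J p n) (Y p)" if "vf U Y" "n \<in> TS p" for Y n
    using g_J[OF pM vf_in[OF that(1) *(4)] that(2)] g_sym[OF pM vf_in[OF that(1) *(4)] J_in[OF pM that(2)]] by simp
  show ?thesis
    unfolding ext_deriv2_def omt_def dd_om[OF *(1,2,3,4)] dd_om[OF *(2,3,1,4)] dd_om[OF *(3,1,2,4)]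
    unfolding fundamental_form_def br[OF *(1,2) vf_in[OF *(3,4)]] br[OF *(2,3) vf_in[OF *(1,4)]] br[OF *(3,1) vf_in[OF *(2,4)]]
    using as[OF *(1) nab_in[OF *(3,2,4)]] as[OF *(2) nab_in[OF *(1,3,4)]] as[OF *(3) nab_in[OF *(2,1,4)]] by simp
qed

text \<open>In the Nijenhuis expression every bracket becomes a difference of covariant derivatives,
  J is pulled out of them, and the terms cancel in pairs.\<close>

lemma hermitian: "hermitian_manifold M J g"
  unfolding hermitian_manifold_def
proof (intro conjI ballI)
  show "smooth_manifold M" "riemannian_metric M g" using aff unfolding affine_riemann_def by auto
  show "g p (J p x) (J p y) = g p x y" if "p \<in> points M" "x \<in> TS p" "y \<in> TS p" for p x y by (rule g_JJ[OF that])
  show "complex_structure M J" unfolding complex_structure_def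
  proof (intro conjI ballI allI impI)
    fix p assume p: "p \<in> points M"
    show "J p x \<in> TS p" "J p (J p x) = - x" if "x \<in> TS p" for x using J_in[OF p that] JJ[OF p that] .
    show "J p (x + y) = J p x + J p y" if "x \<in> TS p" "y \<in> TS p" for x y using lin_add[OF J_lin[OF p] that] .
    show "J p (c *\<^sub>R x) = c *\<^sub>R J p x" if "x \<in> TS p" for c x using lin_scale[OF J_lin[OF p] that] .
  next
    show "vf U (endo_field J X)" if "vf U X" for U X by (rule J_vf[OF that])
  next
    fix U X Y p assume *: "vf U X" "vf U Y" "p \<in> U"
    note pM = vf_points[OF *(1,3)] and JX = J_vf[OF *(1)] and JY = J_vf[OF *(2)]
    let ?JX = "endo_field J X" and ?JY = "endo_field J Y"
    have b1: "lie_bracket M ?JX ?JY p = J p (nab ?JX Y p) - J p (nab ?JY X p)"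
      unfolding torsion[OF JX JY *(3), symmetric] nab_J[OF JX *(2,3)] nab_J[OF JY *(1,3)] ..
    have b2: "J p (lie_bracket M ?JX Y p) = J p (nab ?JX Y p) + nab Y X p"
      unfolding torsion[OF JX *(2,3), symmetric] nab_J[OF *(2,1,3)]
        lin_diff[OF J_lin[OF pM] nab_in[OF JX *(2,3)] J_in[OF pM nab_in[OF *(2,1,3)]]] JJ[OF pM nab_in[OF *(2,1,3)]] by simp
    have b3: "J p (lie_bracket M X ?JY p) = - nab X Y p - J p (nab ?JY X p)"
      unfolding torsion[OF *(1) JY *(3), symmetric] nab_J[OF *(1,2,3)]
        lin_diff[OF J_lin[OF pM] J_in[OF pM nab_in[OF *(1,2,3)]] nab_in[OF JY *(1,3)]] JJ[OF pM nab_in[OF *(1,2,3)]] by simp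
    show "lie_bracket M ?JX ?JY p - J p (lie_bracket M ?JX Y p) - J p (lie_bracket M X ?JY p) - lie_bracket M X Y p = 0"
      unfolding b1 b2 b3 torsion[OF *, symmetric] by (simp add: algebra_simps)
  qed
qed

lemma kahler_iff:
  "kahler M J g \<longleftrightarrow> (\<forall>p\<in>points M. \<forall>x\<in>TS p. \<forall>y\<in>TS p. \<forall>z\<in>TS p. omt p x y z = 0)"
proof -
  have "omt p x y z = 0" if f: "form3_zero M (ext_deriv2 M (fundamental_form J g))"
    and t: "p \<in> points M" "x \<in> TS p" "y \<in> TS p" "z \<in> TS p" for p x y z
  proof -
    obtain U where U: "p \<in> U" "vf U (extend p x)" "vf U (extend p y)" "vf U (extend p z)"
      "extend p x p = x" "extend p y p = y" "extend p z p = z"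
      by (rule extend3[OF t])
    have "ext_deriv2 M (fundamental_form J g) (extend p x) (extend p y) (extend p z) p = 0"
      using f U(1-4) unfolding form3_zero_def by blast
    then show ?thesis using d_om[OF U(2-4,1)] U(5-7) by simp
  qed
  moreover have "form3_zero M (ext_deriv2 M (fundamental_form J g))"
    if "\<forall>p\<in>points M. \<forall>x\<in>TS p. \<forall>y\<in>TS p. \<forall>z\<in>TS p. omt p x y z = 0"
    unfolding form3_zero_def
  proof (intro allI impI ballI)
    fix U X Y Z p assume *: "vf U X" "vf U Y" "vf U Z" "p \<in> U"
    show "ext_deriv2 M (fundamental_form J g) X Y Z p = 0"
      unfolding d_om[OF *] using that vf_points[OF *(1,4)] vf_in[OF *(1,4)] vf_in[OF *(2,4)] vf_in[OF *(3,4)] by blast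
  qed
  ultimately show ?thesis unfolding kahler_def using hermitian by blast
qed

text \<open>The derivative of \<omega> contributes C(x, Jy, z) = K(x, Jy, z) + K(x, z, Jy).
  Replacing \<open>nab\<close> by the Levi-Civita connection removes the second summand and adds
  K(x, y, Jz).\<close>

lemma cov_om:
  assumes *: "vf U X" "vf U Y" "vf U Z" "p \<in> U"
  shows "cov_form2 M (levi_civita M g) (fundamental_form J g) X Y Z p =
     Kt p (X p) (J p (Y p)) (Z p) + Kt p (X p) (Y p) (J p (Z p))"
proof -
  note pM = vf_points[OF *(1,4)] and x = vf_in[OF *(1,4)] and y = vf_in[OF *(2,4)] and z = vf_in[OF *(3,4)]
  have "g p (J p (levi_civita M g X Y p)) (Z p) = g p (J p (nab X Y p)) (Z p) + g p (J p (gam p (X p) (Y p))) (Z p)"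
    unfolding lc_eq[OF *(1,2,4)] lin_add[OF J_lin[OF pM] nab_in[OF *(1,2,4)] gam_in[OF pM]]
    by (rule lin_add[OF g_lin1[OF pM z] J_in[OF pM nab_in[OF *(1,2,4)]] J_in[OF pM gam_in[OF pM]]])
  moreover have "g p (J p (gam p (X p) (Y p))) (Z p) = - Kt p (X p) (Y p) (J p (Z p))"
    using g_J[OF pM gam_in[OF pM] z] g_gam[OF pM x y J_in[OF pM z]] by simp
  moreover have "g p (J p (Y p)) (levi_civita M g X Z p) = g p (J p (Y p)) (nab X Z p) + Kt p (X p) (Z p) (J p (Y p))"
    using lc_eq[OF *(1,3,4)] lin_add[OF g_lin2[OF pM J_in[OF pM y]] nab_in[OF *(1,3,4)] gam_in[OF pM]]
      g_sym[OF pM J_in[OF pM y] gam_in[OF pM]] g_gam[OF pM x z J_in[OF pM y]] by simp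
  moreover have "Ct p (X p) (J p (Y p)) (Z p) = Kt p (X p) (J p (Y p)) (Z p) + Kt p (X p) (Z p) (J p (Y p))"
    using Ct_sym[OF pM x J_in[OF pM y] z] Ct_sym[OF pM J_in[OF pM y] x z] Ct_sym[OF pM z x J_in[OF pM y]]
    by (simp add: Kt_def field_simps)
  ultimately show ?thesis
    unfolding cov_form2_def dd_om[OF *] by (simp add: fundamental_form_def)
qed

lemma onb_J: assumes "p \<in> points M" "onb p E" shows "onb p (\<lambda>a. J p (E a))"
  using assms J_in g_JJ unfolding onb_def by simp

text \<open>\<open>\<gamma>\<close> is symmetric, and replacing an orthonormal basis \<open>E\<close> by \<open>J E\<close> changes the sign of this trace.\<close>

lemma trace_KJ: assumes p: "p \<in> points M" and z: "z \<in> TS p"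
  shows "(\<Sum>a<mdim M. Kt p (fr p a) (J p (fr p a)) z) = 0"
proof -
  have l: "lin p (\<lambda>y. Kt p x (J p y) z)" if "x \<in> TS p" for x
    by (intro linI) (use lin_add[OF J_lin[OF p]] lin_scale[OF J_lin[OF p]] lin_add[OF Kt_lin(2)[OF p that z]]
        lin_scale[OF Kt_lin(2)[OF p that z]] J_in[OF p] in auto)
  have "bilin p (\<lambda>x y. Kt p x (J p y) z)"
    unfolding bilin_def using l Kt_lin(3)[OF p J_in[OF p] z] by blast
  from trace_onb[OF p fr_onb[OF p] onb_J[OF p fr_onb[OF p]] this]
  have "(\<Sum>a<mdim M. Kt p (fr p a) (J p (fr p a)) z) = (\<Sum>a<mdim M. Kt p (J p (fr p a)) (J p (J p (fr p a))) z)" .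
  also have "\<dots> = (\<Sum>a<mdim M. - Kt p (fr p a) (J p (fr p a)) z)"
  proof (intro sum.cong refl)
    fix a assume "a \<in> {..<mdim M}"
    then have a: "fr p a \<in> TS p" using fr_in[OF p] by simp
    show "Kt p (J p (fr p a)) (J p (J p (fr p a))) z = - Kt p (fr p a) (J p (fr p a)) z"
      unfolding JJ[OF p a] lin_neg[OF Kt_lin(2)[OF p J_in[OF p a] z] a] using Kt_sym[OF p J_in[OF p a] a z] by simp
  qed
  finally show ?thesis by (simp add: sum_negf)
qed

text \<open>At JX the trace of the covariant derivative of \<omega> has two parts. One is the
  vanishing trace of \<open>trace_KJ\<close>; the other is the trace of K with JJX = - X in the last
  slot, that is, minus the pairing of X with the trace of \<gamma>.\<close>

lemma lee_form_eq:
  assumes X: "vf U X" and p: "p \<in> U"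
  shows "lee_form M J g X p = - (al p (X p) - be p (X p) / 2)"
proof -
  note pM = vf_points[OF X p] and x = vf_in[OF X p]
  obtain V where V: "opn V" "p \<in> V" "\<forall>a<mdim M. vf V (frame_at M g p a)" using frame_at_vf[OF pM] .
  let ?W = "U \<inter> V"
  have W: "opn ?W" "p \<in> ?W" using vf_open[OF X] V p by auto
  have E: "vf ?W (frame_at M g p a)" if "a < mdim M" for a using V(3) that vf_mono[OF _ W(1)] by blast
  have XW: "vf ?W X" using vf_mono[OF X W(1)] by blast
  have "lee_form M J g X p = (\<Sum>a<mdim M. Kt p (fr p a) (J p (fr p a)) (J p (X p)) + Kt p (fr p a) (fr p a) (J p (J p (X p))))"
    unfolding lee_form_def codiff_fundamental_def using cov_om[OF E E J_vf[OF XW] W(2)] by simp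
  also have "\<dots> = (\<Sum>a<mdim M. Kt p (fr p a) (fr p a) (J p (J p (X p))))"
    unfolding sum.distrib trace_KJ[OF pM J_in[OF pM x]] by simp
  also have "\<dots> = (\<Sum>a<mdim M. - Kt p (fr p a) (fr p a) (X p))"
    unfolding JJ[OF pM x] using lin_neg[OF Kt_lin(1)[OF pM fr_in[OF pM] fr_in[OF pM]] x] by (intro sum.cong) auto
  also have "\<dots> = - (al p (X p) - be p (X p) / 2)"
    by (simp add: Kt_def al_def be_def sum_negf sum_subtractf sum_divide_distrib[symmetric] sum_distrib_left[symmetric] field_simps)
  finally show ?thesis .
qed

lemma balanced_iff: "balanced M J g \<longleftrightarrow> (\<forall>p\<in>points M. \<forall>x\<in>TS p. al p x = (1/2) * be p x)"
proof -
  have "al p x = (1/2) * be p x" if f: "form1_zero M (lee_form M J g)" and t: "p \<in> points M" "x \<in> TS p" for p x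
  proof -
    obtain U where U: "p \<in> U" "vf U (extend p x)" "extend p x p = x" using extend[OF t] .
    have "lee_form M J g (extend p x) p = 0" using f U(1,2) unfolding form1_zero_def by blast
    then show ?thesis using lee_form_eq[OF U(2,1)] U(3) by simp
  qed
  moreover have "form1_zero M (lee_form M J g)" if h: "\<forall>p\<in>points M. \<forall>x\<in>TS p. al p x = (1/2) * be p x"
    unfolding form1_zero_def
  proof (intro allI impI ballI)
    fix U X p assume *: "vf U X" "p \<in> U"
    show "lee_form M J g X p = 0" using lee_form_eq[OF *] h vf_points[OF *] vf_in[OF *] by simp
  qed
  ultimately show ?thesis unfolding balanced_def using hermitian by blast
qed

lemma loc_conf_balanced_iff:
  "loc_conf_balanced M J g \<longleftrightarrow> form2_zero M (ext_deriv1 M (\<lambda>X p. al p (X p)))"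
  unfolding loc_conf_balanced_def using hermitian d_scaled_al[of "lee_form M J g" "-1"] lee_form_eq by simp

section \<open>Bismut and Chern connections relative to the flat connection\<close>

lemma lin_J: "p \<in> points M \<Longrightarrow> lin p \<phi> \<Longrightarrow> lin p (\<lambda>x. \<phi> (J p x))"
  using lin_add[OF J_lin] lin_scale[OF J_lin] J_in unfolding lin_def by simp

lemma omt_lin:
  assumes p: "p \<in> points M" and x: "x \<in> TS p" and y: "y \<in> TS p"
  shows "lin p (\<lambda>z. omt p x y z)" "lin p (\<lambda>z. omt p x z y)" "lin p (\<lambda>z. omt p z x y)"
proof -
  have a: "lin p (\<lambda>z. Ct p u (J p z) v)" if "u \<in> TS p" "v \<in> TS p" for u v
    using lin_J[OF p Ct_lin2[OF p that]] .
  show "lin p (\<lambda>z. omt p x y z)" unfolding omt_def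
    by (rule lin_plus[OF lin_plus[OF Ct_lin3[OF p x J_in[OF p y]] a[OF y x]] Ct_lin1[OF p J_in[OF p x] y]])
  show "lin p (\<lambda>z. omt p x z y)" unfolding omt_def
    by (rule lin_plus[OF lin_plus[OF a[OF x y] Ct_lin1[OF p J_in[OF p y] x]] Ct_lin3[OF p y J_in[OF p x]]])
  show "lin p (\<lambda>z. omt p z x y)" unfolding omt_def
    by (rule lin_plus[OF lin_plus[OF Ct_lin1[OF p J_in[OF p x] y] Ct_lin3[OF p x J_in[OF p y]]] a[OF y x]])
qed

lemma omt_sf: assumes "vf U X" "vf U Y" "vf U Z" shows "sf U (\<lambda>q. omt q (X q) (Y q) (Z q))"
  using sf_add[OF sf_add[OF Ct_sf[OF assms(1) J_vf[OF assms(2)] assms(3)] Ct_sf[OF assms(2) J_vf[OF assms(3)] assms(1)]]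
      Ct_sf[OF assms(3) J_vf[OF assms(1)] assms(2)]] by (simp add: omt_def)

text \<open>Difference tensors, lowered by \<open>g\<close>, of the Bismut and Chern connections relative to the flat connection.\<close>

definition RB :: "'p \<Rightarrow> 'i tvec \<Rightarrow> 'i tvec \<Rightarrow> 'i tvec \<Rightarrow> real" where
  "RB p x y z = Kt p x y z + (1/2) * omt p (J p x) (J p y) (J p z)"
definition RC :: "'p \<Rightarrow> 'i tvec \<Rightarrow> 'i tvec \<Rightarrow> 'i tvec \<Rightarrow> real" where
  "RC p x y z = Kt p x y z - (1/2) * omt p (J p x) y z"

lemma RB_tensor: "trilin RB" "smooth3 RB"
proof -
  have h: "lin p (\<lambda>x. (1/2) * \<phi> x)" if "lin p \<phi>" for p and \<phi> :: "'i tvec \<Rightarrow> real"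
    using lin_cmult[OF that, of "1/2"] by simp
  show "trilin RB" unfolding trilin_def RB_def
  proof (intro ballI)
    fix p x y assume p: "p \<in> points M" and x: "x \<in> TS p" and y: "y \<in> TS p"
    note o = omt_lin[OF p J_in[OF p x] J_in[OF p y]]
    show "lin p (\<lambda>z. Kt p x y z + (1/2) * omt p (J p x) (J p y) (J p z)) \<and>
        lin p (\<lambda>z. Kt p x z y + (1/2) * omt p (J p x) (J p z) (J p y)) \<and>
        lin p (\<lambda>z. Kt p z x y + (1/2) * omt p (J p z) (J p x) (J p y))"
      using lin_plus[OF Kt_lin(1)[OF p x y] h[OF lin_J[OF p o(1)]]] lin_plus[OF Kt_lin(2)[OF p x y] h[OF lin_J[OF p o(2)]]]
        lin_plus[OF Kt_lin(3)[OF p x y] h[OF lin_J[OF p o(3)]]] by simp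
  qed
  show "smooth3 RB" unfolding smooth3_def RB_def
  proof (intro allI impI)
    fix U X Y Z assume *: "vf U X" "vf U Y" "vf U Z"
    show "sf U (\<lambda>q. Kt q (X q) (Y q) (Z q) + (1/2) * omt q (J q (X q)) (J q (Y q)) (J q (Z q)))"
      using sf_add[OF Kt_sf[OF *] sf_cmult[OF omt_sf[OF J_vf[OF *(1)] J_vf[OF *(2)] J_vf[OF *(3)]], of "1/2"]] by simp
  qed
qed

lemma RC_tensor: "trilin RC" "smooth3 RC"
proof -
  have h: "lin p (\<lambda>x. (1/2) * \<phi> x)" if "lin p \<phi>" for p and \<phi> :: "'i tvec \<Rightarrow> real"
    using lin_cmult[OF that, of "1/2"] by simp
  show "trilin RC" unfolding trilin_def RC_def
  proof (intro ballI)
    fix p x y assume p: "p \<in> points M" and x: "x \<in> TS p" and y: "y \<in> TS p"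
    show "lin p (\<lambda>z. Kt p x y z - (1/2) * omt p (J p x) y z) \<and>
        lin p (\<lambda>z. Kt p x z y - (1/2) * omt p (J p x) z y) \<and>
        lin p (\<lambda>z. Kt p z x y - (1/2) * omt p (J p z) x y)"
      using lin_minus[OF Kt_lin(1)[OF p x y] h[OF omt_lin(1)[OF p J_in[OF p x] y]]]
        lin_minus[OF Kt_lin(2)[OF p x y] h[OF omt_lin(2)[OF p J_in[OF p x] y]]]
        lin_minus[OF Kt_lin(3)[OF p x y] h[OF lin_J[OF p omt_lin(3)[OF p x y]]]] by simp
  qed
  show "smooth3 RC" unfolding smooth3_def RC_def
  proof (intro allI impI)
    fix U X Y Z assume *: "vf U X" "vf U Y" "vf U Z"
    show "sf U (\<lambda>q. Kt q (X q) (Y q) (Z q) - (1/2) * omt q (J q (X q)) (Y q) (Z q))"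
      using sf_diff[OF Kt_sf[OF *] sf_cmult[OF omt_sf[OF J_vf[OF *(1)] *(2,3)], of "1/2"]] by simp
  qed
qed

text \<open>With J inserted in all arguments, each summand of \<open>omt\<close> contains J applied
  twice to one vector, which becomes a sign.\<close>

lemma RB_eq:
  assumes p: "p \<in> points M" and x: "x \<in> TS p" and y: "y \<in> TS p" and z: "z \<in> TS p"
  shows "2 * RB p x y z = Ct p x y z + Ct p y x z - Ct p z x y - Ct p (J p x) y (J p z) - Ct p (J p y) z (J p x) - Ct p (J p z) x (J p y)"
  using Ct_neg(2)[OF p J_in[OF p x] y J_in[OF p z]] Ct_neg(2)[OF p J_in[OF p y] z J_in[OF p x]] Ct_neg(2)[OF p J_in[OF p z] x J_in[OF p y]]
  by (simp add: RB_def omt_def Kt_def JJ[OF p x] JJ[OF p y] JJ[OF p z] field_simps)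

text \<open>As J is skew for g, this says that the Bismut connection commutes with J. It is a linear
  consequence of finitely many instances of the symmetry of C and its behaviour under J.\<close>

lemma RB_J:
  assumes p: "p \<in> points M" and x: "x \<in> TS p" and y: "y \<in> TS p" and z: "z \<in> TS p"
  shows "RB p x (J p y) z + RB p x y (J p z) = 0"
proof -
  note jx = J_in[OF p x] and jy = J_in[OF p y] and jz = J_in[OF p z]
  have "2 * (RB p x (J p y) z + RB p x y (J p z)) = 0"
    unfolding distrib_left RB_eq[OF p x jy z] RB_eq[OF p x y jz] JJ[OF p y] JJ[OF p z]
    using Ct_J1[OF p x y z] Ct_J[OF p jx y z] Ct_J1[OF p y x z] Ct_sym[OF p y z jx] Ct_sym[OF p y jz x] Ct_J[OF p jy z x] Ct_sym[OF p jy z x]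
      Ct_neg(1)[OF p y z jx] Ct_neg(1)[OF p z x jy] Ct_neg(3)[OF p jz x y] Ct_neg(3)[OF p jx y z] Ct_J1[OF p y z x]
      Ct_sym[OF p y x jz] by linarith
  then show ?thesis by simp
qed

text \<open>The Koszul terms with y or z in the first slot cancel against summands of d \<omega>,
  because C is invariant under J in its last two arguments.\<close>

lemma RC_eq:
  assumes p: "p \<in> points M" and x: "x \<in> TS p" and y: "y \<in> TS p" and z: "z \<in> TS p"
  shows "2 * RC p x y z = Ct p x y z - Ct p (J p x) (J p y) z"
  using Ct_neg(2)[OF p z x y] Ct_J[OF p y z x] Ct_sym[OF p y x z]
  by (simp add: RC_def omt_def Kt_def JJ[OF p x] field_simps)

lemma RC_J:
  assumes p: "p \<in> points M" and x: "x \<in> TS p" and y: "y \<in> TS p" and z: "z \<in> TS p"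
  shows "RC p x (J p y) z + RC p x y (J p z) = 0"
proof -
  note jx = J_in[OF p x] and jy = J_in[OF p y] and jz = J_in[OF p z]
  have "2 * (RC p x (J p y) z + RC p x y (J p z)) = 0"
    unfolding distrib_left RC_eq[OF p x jy z] RC_eq[OF p x y jz] JJ[OF p y]
    using Ct_J1[OF p x y z] Ct_J[OF p jx y z] Ct_neg(2)[OF p jx y z] by linarith
  then show ?thesis by simp
qed

lemma bismut_eq: assumes *: "vf Q X" "vf Q Y" "p \<in> Q" shows "bismut M J g X Y p = nab X Y p + riesz p (RB p (X p) (Y p))"
proof -
  note pM = vf_points[OF *(1,3)] and x = vf_in[OF *(1,3)] and y = vf_in[OF *(2,3)]
  show ?thesis unfolding bismut_def
  proof (rule THE_conn[OF * trilinD(1)[OF RB_tensor(1) pM x y]])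
    fix U Z assume Z: "p \<in> U" "vf U Z"
    obtain W where W: "p \<in> W" "vf W X" "vf W Z" "W \<subseteq> Q" "W \<subseteq> U" using common_domain[OF *(1,3) Z(2,1)] .
    have Y: "vf W Y" using vf_mono[OF *(2) vf_open[OF W(2)] W(4)] .
    show "g p (levi_civita M g X Y p) (Z p) + 1/2 * ext_deriv2 M (fundamental_form J g) (endo_field J X) (endo_field J Y) (endo_field J Z) p =
        g p (nab X Y p) (Z p) + RB p (X p) (Y p) (Z p)"
      unfolding d_om[OF J_vf[OF W(2)] J_vf[OF Y] J_vf[OF W(3)] W(1)] lc_eq[OF *] RB_def
      using lin_add[OF g_lin1[OF pM vf_in[OF Z(2,1)]] nab_in[OF *] gam_in[OF pM]] g_gam[OF pM x y vf_in[OF Z(2,1)]] by simp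
  qed
qed

lemma chern_eq: assumes *: "vf Q X" "vf Q Y" "p \<in> Q" shows "chern M J g X Y p = nab X Y p + riesz p (RC p (X p) (Y p))"
proof -
  note pM = vf_points[OF *(1,3)] and x = vf_in[OF *(1,3)] and y = vf_in[OF *(2,3)]
  show ?thesis unfolding chern_def
  proof (rule THE_conn[OF * trilinD(1)[OF RC_tensor(1) pM x y]])
    fix U Z assume Z: "p \<in> U" "vf U Z"
    obtain W where W: "p \<in> W" "vf W X" "vf W Z" "W \<subseteq> Q" "W \<subseteq> U" using common_domain[OF *(1,3) Z(2,1)] .
    have Y: "vf W Y" using vf_mono[OF *(2) vf_open[OF W(2)] W(4)] .
    show "g p (levi_civita M g X Y p) (Z p) - 1/2 * ext_deriv2 M (fundamental_form J g) (endo_field J X) Y Z p =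
        g p (nab X Y p) (Z p) + RC p (X p) (Y p) (Z p)"
      unfolding d_om[OF J_vf[OF W(2)] Y W(3,1)] lc_eq[OF *] RC_def
      using lin_add[OF g_lin1[OF pM vf_in[OF Z(2,1)]] nab_in[OF *] gam_in[OF pM]] g_gam[OF pM x y vf_in[OF Z(2,1)]] by simp
  qed
qed

end

section \<open>Ricci forms\<close>

lemma sum_lessThan_add: "(\<Sum>a<m + k. f a) = (\<Sum>a<m. f a) + (\<Sum>a<k. f (m + a :: nat))"
  by (induction k) (simp_all add: add.assoc)

lemma sum_lessThan_double: "(\<Sum>a<2 * m. f a) = (\<Sum>a<m. f a) + (\<Sum>a<m. f (m + a :: nat))"
  using sum_lessThan_add[of f m m] by (simp add: mult_2)

context conn_mfd
begin

lemma nab_uminus2: assumes "vf U X" "vf U Y" "p \<in> U" shows "nab X (- Y) p = - nab X Y p"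
proof -
  have "fscale (\<lambda>q. -1) Y = - Y" by (auto simp: fscale_def fun_eq_iff)
  then show ?thesis
    using nab_fscale2[OF sf_const[OF vf_open[OF assms(1)], of "-1"] assms] by (simp add: dd_const)
qed

end

context herm
begin

text \<open>J is skew for g, so the hypothesis lets J move from the second slot of R to the
  representing vector.\<close>

lemma riesz_J:
  assumes R: "trilin R" and RJ: "\<And>z. z \<in> TS p \<Longrightarrow> R p x (J p y) z + R p x y (J p z) = 0"
    and p: "p \<in> points M" and x: "x \<in> TS p" and y: "y \<in> TS p"
  shows "riesz p (R p x (J p y)) = J p (riesz p (R p x y))"
proof (rule riesz_eqI[symmetric, OF p trilinD(1)[OF R p x J_in[OF p y]] J_in[OF p riesz_in[OF p]]])
  fix z assume z: "z \<in> TS p"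
  show "g p (J p (riesz p (R p x y))) z = R p x (J p y) z"
    using g_J[OF p riesz_in[OF p] z] g_riesz[OF p trilinD(1)[OF R p x y] J_in[OF p z]] RJ[OF z] by simp
qed

text \<open>A connection commuting with \<open>J\<close> has a complex connection matrix in the frame \<open>e\<close>; its trace has the
  imaginary part \<open>\<Sum> g(D e\<^sub>a, J e\<^sub>a)\<close>, whose differential is the Ricci form.\<close>

lemma ricci_zero:
  assumes R: "trilin R" "smooth3 R"
    and RJ: "\<And>p x y z. \<lbrakk>p \<in> points M; x \<in> TS p; y \<in> TS p; z \<in> TS p\<rbrakk> \<Longrightarrow> R p x (J p y) z + R p x y (J p z) = 0"
    and D: "\<And>U X Y p. vf U X \<Longrightarrow> vf U Y \<Longrightarrow> p \<in> U \<Longrightarrow> D X Y p = nab X Y p + riesz p (R p (X p) (Y p))"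
    and m: "mdim M = 2 * m" and U: "opn U" "p \<in> U"
    and e: "\<And>a. a < m \<Longrightarrow> vf U (e a)"
    and on: "\<And>q. q \<in> U \<Longrightarrow> onb q (\<lambda>a. if a < m then e a q else J q (e (a - m) q))"
    and tr: "\<And>V X q. vf V X \<Longrightarrow> V \<subseteq> U \<Longrightarrow> q \<in> V \<Longrightarrow> (\<Sum>a<m. g q (D X (e a) q) (J q (e a q))) = 0"
    and XQ: "vf Q X" and YQ: "vf Q Y" and pQ: "p \<in> Q"
  shows "ricci_form M J g D X Y p = 0"
proof -
  have cD: "connection M D"
  proof (rule connection_riesz[where R = R and D = D, OF R])
    show "D X Y p = nab X Y p + riesz p (R p (X p) (Y p))" if "vf U X" "vf U Y" "p \<in> U" for U X Y p
      by (rule D[OF that])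
  qed
  interpret D: conn_mfd M D by unfold_locales (rule cD)
  let ?W = "U \<inter> Q"
  have W: "opn ?W" "p \<in> ?W" "?W \<subseteq> U" using U vf_open[OF XQ] pQ by auto
  have pM: "p \<in> points M" using W opn_subset by blast
  have X: "vf ?W X" and Y: "vf ?W Y" using vf_mono[OF _ W(1)] XQ YQ by auto
  have eW: "vf ?W (e a)" if "a < m" for a using vf_mono[OF e[OF that] W(1)] by auto
  have DJ: "D A (endo_field J B) q = J q (D A B q)" if A: "vf V A" and B: "vf V B" and q: "q \<in> V" for V A B q
  proof -
    note qM = vf_points[OF A q]
    have "riesz q (R q (A q) (J q (B q))) = J q (riesz q (R q (A q) (B q)))"
    proof (rule riesz_J[where R = R, OF R(1) _ qM vf_in[OF A q] vf_in[OF B q]])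
      show "R q (A q) (J q (B q)) z + R q (A q) (B q) (J q z) = 0" if "z \<in> TS q" for z
        by (rule RJ[OF qM vf_in[OF A q] vf_in[OF B q] that])
    qed
    then show ?thesis
      unfolding D[OF A J_vf[OF B] q] D[OF A B q] nab_J[OF A B q]
        lin_add[OF J_lin[OF qM] nab_in[OF A B q] riesz_in[OF qM]] by simp
  qed
  have DDJ: "D A (D B (endo_field J Z)) p = J p (D A (D B Z) p)"
    if A: "vf ?W A" and B: "vf ?W B" and Z: "vf ?W Z" for A B Z
  proof -
    have "D A (D B (endo_field J Z)) p = D A (endo_field J (D B Z)) p"
      by (rule D.nab_local[OF A D.nab_vf[OF B J_vf[OF Z]] J_vf[OF D.nab_vf[OF B Z]] W(2)]) (use DJ[OF B Z] in simp)
    then show ?thesis using DJ[OF A D.nab_vf[OF B Z] W(2)] by simp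
  qed
  have curv_in: "curvature M D X Y Z p \<in> TS p" if Z: "vf ?W Z" for Z
    unfolding curvature_def
    by (intro TS_add TS_diff D.nab_in[OF bracket_vf[OF X Y] Z W(2)] D.nab_in[OF X D.nab_vf[OF Y Z] W(2)] D.nab_in[OF Y D.nab_vf[OF X Z] W(2)])
  have curvJ: "curvature M D X Y (endo_field J Z) p = J p (curvature M D X Y Z p)" if Z: "vf ?W Z" for Z
  proof -
    note i = D.nab_in[OF bracket_vf[OF X Y] Z W(2)] D.nab_in[OF X D.nab_vf[OF Y Z] W(2)] D.nab_in[OF Y D.nab_vf[OF X Z] W(2)]
    show ?thesis
      unfolding curvature_def DDJ[OF X Y Z] DDJ[OF Y X Z] DJ[OF bracket_vf[OF X Y] Z W(2)]
        lin_add[OF J_lin[OF pM] TS_diff[OF i(1,2)] i(3)] lin_diff[OF J_lin[OF pM] i(1,2)] ..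
  qed
  \<comment> \<open>The real orthonormal frame that belongs to the complex frame e: the fields e a
    followed by the fields J e a.\<close>
  define F where "F b = (if b < m then e b else endo_field J (e (b - m)))" for b
  have F: "vf ?W (F b)" if "b < 2 * m" for b using that eW J_vf by (auto simp: F_def)
  have onF: "onb q (\<lambda>b. F b q)" if "q \<in> ?W" for q
  proof -
    have "(\<lambda>b. F b q) = (\<lambda>a. if a < m then e a q else J q (e (a - m) q))" by (auto simp: F_def)
    then show ?thesis using on that by simp
  qed
  have FT: "F b p \<in> TS p" if "b < 2 * m" for b using vf_in[OF F[OF that] W(2)] .
  \<comment> \<open>P and S are the real and imaginary parts of the complex connection matrix along
    Z in the frame e.\<close>
  define P where "P Z a b = g p (D Z (e a) p) (e b p)" for Z a b
  define S where "S Z a b = g p (D Z (e a) p) (J p (e b p))" for Z a b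
  \<comment> \<open>The left side is the imaginary part of a diagonal entry of a second derivative:
    it consists of the derivative of the imaginary part of the matrix and the imaginary part of a
    matrix product.\<close>
  have key: "g p (D A (D B (e a)) p) (J p (e a p)) = dd p (A p) (\<lambda>q. g q (D B (e a) q) (J q (e a q))) +
      ((\<Sum>b<m. P B a b * S A b a) + (\<Sum>b<m. S B a b * P A b a))" if A: "vf ?W A" and B: "vf ?W B" and a: "a < m" for A B a
  proof -
    let ?c = "\<lambda>b q. g q (D B (e a) q) (F b q)"
    have Fa: "F (m + a) p = J p (e a p)" by (simp add: F_def)
    have a2: "m + a < 2 * m" using a by simp
    note Fin = FT[OF a2]
    have exp: "D B (e a) q = (\<Sum>b<2*m. ?c b q *\<^sub>R F b q)" if "q \<in> ?W" for q
      using onb_expand[OF vf_points[OF B that] onF[OF that] D.nab_in[OF B eW[OF a] that]] m by simp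
    have "D A (D B (e a)) p = (\<Sum>b<2*m. dd p (A p) (?c b) *\<^sub>R F b p + ?c b p *\<^sub>R D A (F b) p)"
      by (rule D.nab_lincomb[OF A W(2)]) (use g_sf[OF D.nab_vf[OF B eW[OF a]] F] F D.nab_vf[OF B eW[OF a]] exp in auto)
    then have "g p (D A (D B (e a)) p) (F (m + a) p) =
        g p (\<Sum>b<2*m. dd p (A p) (?c b) *\<^sub>R F b p + ?c b p *\<^sub>R D A (F b) p) (F (m + a) p)" by simp
    also have "\<dots> = (\<Sum>b<2*m. g p (dd p (A p) (?c b) *\<^sub>R F b p + ?c b p *\<^sub>R D A (F b) p) (F (m + a) p))"
      by (rule lin_sum[OF g_lin1[OF pM Fin]]) (intro TS_add TS_scale FT D.nab_in[OF A F W(2)]; simp)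
    also have "\<dots> = (\<Sum>b<2*m. (if b = m + a then dd p (A p) (?c (m + a)) else 0) + ?c b p * g p (D A (F b) p) (F (m + a) p))"
    proof (intro sum.cong refl)
      fix b assume "b \<in> {..<2*m}" then have b: "b < 2 * m" by simp
      show "g p (dd p (A p) (?c b) *\<^sub>R F b p + ?c b p *\<^sub>R D A (F b) p) (F (m + a) p) =
          (if b = m + a then dd p (A p) (?c (m + a)) else 0) + ?c b p * g p (D A (F b) p) (F (m + a) p)"
        using lin_add[OF g_lin1[OF pM Fin] TS_scale[OF FT[OF b]] TS_scale[OF D.nab_in[OF A F[OF b] W(2)]]]
          lin_scale[OF g_lin1[OF pM Fin] FT[OF b]] lin_scale[OF g_lin1[OF pM Fin] D.nab_in[OF A F[OF b] W(2)]]
          onF[OF W(2)] a2 b m by (auto simp: onb_def)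
    qed
    also have "\<dots> = dd p (A p) (?c (m + a)) + (\<Sum>b<2*m. ?c b p * g p (D A (F b) p) (F (m + a) p))"
      using a2 by (simp add: sum.distrib)
    also have "(\<Sum>b<2*m. ?c b p * g p (D A (F b) p) (F (m + a) p)) = (\<Sum>b<m. P B a b * S A b a) + (\<Sum>b<m. S B a b * P A b a)"
      unfolding sum_lessThan_double
    proof (intro arg_cong2[of _ _ _ _ "(+)"] sum.cong refl)
      fix b assume "b \<in> {..<m}" then have b: "b < m" by simp
      show "?c b p * g p (D A (F b) p) (F (m + a) p) = P B a b * S A b a" using b by (simp add: F_def P_def S_def)
      have "D A (F (m + b)) p = J p (D A (e b) p)" using DJ[OF A eW[OF b] W(2)] by (simp add: F_def)
      then show "?c (m + b) p * g p (D A (F (m + b)) p) (F (m + a) p) = S B a b * P A b a"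
        using g_JJ[OF pM D.nab_in[OF A eW[OF b] W(2)] vf_in[OF eW[OF a] W(2)]] by (simp add: F_def P_def S_def)
    qed
    finally show ?thesis using Fa by (simp add: F_def)
  qed
  have trz: "dd p (A p) (\<lambda>q. \<Sum>a<m. g q (D B (e a) q) (J q (e a q))) = 0" if B: "vf ?W B" for A B
    using dd_cong[OF W(1,2), of "\<lambda>q. \<Sum>a<m. g q (D B (e a) q) (J q (e a q))" "\<lambda>q. 0" "A p"] tr[OF B W(3)] by (simp add: dd_const)
  have sum_key: "(\<Sum>a<m. g p (D A (D B (e a)) p) (J p (e a p))) =
      (\<Sum>a<m. \<Sum>b<m. P B a b * S A b a) + (\<Sum>a<m. \<Sum>b<m. S B a b * P A b a)" if A: "vf ?W A" and B: "vf ?W B" for A B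
  proof -
    have s: "sf ?W (\<lambda>q. g q (D B (e a) q) (J q (e a q)))" if "a < m" for a
      using g_sf[OF D.nab_vf[OF B eW[OF that]] J_vf[OF eW[OF that]]] by simp
    have "(\<Sum>a<m. dd p (A p) (\<lambda>q. g q (D B (e a) q) (J q (e a q)))) = dd p (A p) (\<lambda>q. \<Sum>a<m. g q (D B (e a) q) (J q (e a q)))"
      using s by (intro dd_sum[OF W(1) _ W(2), symmetric]) auto
    then show ?thesis using key[OF A B] trz[OF B, of A] by (simp add: sum.distrib)
  qed
  \<comment> \<open>The trace of a product of complex matrices is symmetric, so the quadratic terms
    for (X, Y) and (Y, X) agree.\<close>
  have sw: "(\<Sum>a<m. \<Sum>b<m. P Y a b * S X b a) = (\<Sum>a<m. \<Sum>b<m. S X a b * P Y b a)"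
    "(\<Sum>a<m. \<Sum>b<m. P X a b * S Y b a) = (\<Sum>a<m. \<Sum>b<m. S Y a b * P X b a)"
    by (subst sum.swap, simp add: mult.commute)+
  have "(\<Sum>a<m. g p (curvature M D X Y (e a) p) (J p (e a p))) =
      (\<Sum>a<m. g p (D (lie_bracket M X Y) (e a) p) (J p (e a p))) - (\<Sum>a<m. g p (D X (D Y (e a)) p) (J p (e a p))) +
      (\<Sum>a<m. g p (D Y (D X (e a)) p) (J p (e a p)))"
    unfolding sum_subtractf[symmetric] sum.distrib[symmetric]
  proof (intro sum.cong refl)
    fix a assume "a \<in> {..<m}" then have a: "a < m" by simp
    note Z = eW[OF a] and Jea = J_in[OF pM vf_in[OF eW[OF a] W(2)]]
    note i = D.nab_in[OF bracket_vf[OF X Y] Z W(2)] D.nab_in[OF X D.nab_vf[OF Y Z] W(2)] D.nab_in[OF Y D.nab_vf[OF X Z] W(2)]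
    show "g p (curvature M D X Y (e a) p) (J p (e a p)) = g p (D (lie_bracket M X Y) (e a) p) (J p (e a p)) -
        g p (D X (D Y (e a)) p) (J p (e a p)) + g p (D Y (D X (e a)) p) (J p (e a p))"
      unfolding curvature_def lin_add[OF g_lin1[OF pM Jea] TS_diff[OF i(1,2)] i(3)] lin_diff[OF g_lin1[OF pM Jea] i(1,2)] ..
  qed
  also have "\<dots> = 0"
    unfolding sum_key[OF X Y] sum_key[OF Y X] tr[OF bracket_vf[OF X Y] W(3,2)] using sw by simp
  finally have half: "(\<Sum>a<m. g p (curvature M D X Y (e a) p) (J p (e a p))) = 0" .
  \<comment> \<open>The Ricci form sums over \<open>frame_at\<close>; as the trace of a bilinear map
    it can be computed in the frame F instead. Tensoriality of the curvature in its last argument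
    provides the bilinear map.\<close>
  let ?B = "\<lambda>x y. g p (curvature M D X Y (extend p x) p) (J p y)"
  have t: "tensorial_at p (\<lambda>Z. curvature M D X Y Z p)" by (rule D.curv_tensorial3[OF X Y W(2)])
  have rep: "curvature M D X Y (extend p (Z p)) p = curvature M D X Y Z p" if Z: "vf V Z" "p \<in> V" for V Z
  proof -
    obtain V' where V': "p \<in> V'" "vf V' (extend p (Z p))" "extend p (Z p) p = Z p"
      using extend[OF pM vf_in[OF Z]] .
    show ?thesis by (rule tensorial_cong[OF t V'(2,1) Z V'(3)])
  qed
  have cin: "curvature M D X Y (extend p x) p \<in> TS p" if x: "x \<in> TS p" for x
  proof -
    obtain V where V: "p \<in> V" "vf V (extend p x)" "extend p x p = x" using extend[OF pM x] .
    let ?V = "?W \<inter> V"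
    have o: "opn ?V" using W(1) vf_open[OF V(2)] by auto
    have p: "p \<in> ?V" using W(2) V(1) by blast
    have x: "vf ?V X" and y: "vf ?V Y" and z: "vf ?V (extend p x)" using vf_mono[OF _ o] X Y V(2) by blast+
    show ?thesis unfolding curvature_def
      by (intro TS_add TS_diff D.nab_in[OF bracket_vf[OF x y] z p] D.nab_in[OF x D.nab_vf[OF y z] p] D.nab_in[OF y D.nab_vf[OF x z] p])
  qed
  have bil: "bilin p ?B" unfolding bilin_def
  proof (intro conjI ballI)
    fix x assume x: "x \<in> TS p"
    show "lin p (\<lambda>y. ?B x y)" by (rule lin_J[OF pM g_lin2[OF pM cin[OF x]]])
    note tl = tensorial_lin[OF t pM] and gl = g_lin1[OF pM J_in[OF pM x]]
    show "lin p (\<lambda>y. ?B y x)"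
    proof (rule linI)
      fix y z assume y: "y \<in> TS p" and z: "z \<in> TS p"
      show "?B (y + z) x = ?B y x + ?B z x" unfolding lin_add[OF tl y z] by (rule lin_add[OF gl cin[OF y] cin[OF z]])
    next
      fix c y assume y: "y \<in> TS p"
      show "?B (c *\<^sub>R y) x = c *\<^sub>R ?B y x" unfolding lin_scale[OF tl y] by (rule lin_scale[OF gl cin[OF y]])
    qed
  qed
  obtain V where V: "opn V" "p \<in> V" "\<forall>a<mdim M. vf V (frame_at M g p a)" using frame_at_vf[OF pM] .
  have "(\<Sum>a<mdim M. g p (curvature M D X Y (frame_at M g p a) p) (J p (fr p a))) = (\<Sum>a<mdim M. ?B (fr p a) (fr p a))"
    using rep V(2,3) by (intro sum.cong) auto
  also have "\<dots> = (\<Sum>a<mdim M. ?B (F a p) (F a p))" by (rule trace_onb[OF pM fr_onb[OF pM] onF[OF W(2)] bil])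
  also have "\<dots> = (\<Sum>a<2*m. g p (curvature M D X Y (F a) p) (J p (F a p)))"
    unfolding m using rep[OF F W(2)] by (intro sum.cong) auto
  \<comment> \<open>The curvature commutes with J and J is orthogonal, so the fields J e a
    contribute as much as the fields e a.\<close>
  also have "\<dots> = (\<Sum>a<m. g p (curvature M D X Y (e a) p) (J p (e a p))) + (\<Sum>a<m. g p (curvature M D X Y (e a) p) (J p (e a p)))"
    unfolding sum_lessThan_double
  proof (intro arg_cong2[of _ _ _ _ "(+)"] sum.cong refl)
    fix a assume "a \<in> {..<m}" then have a: "a < m" by simp
    show "g p (curvature M D X Y (F a) p) (J p (F a p)) = g p (curvature M D X Y (e a) p) (J p (e a p))" using a by (simp add: F_def)
    show "g p (curvature M D X Y (F (m + a)) p) (J p (F (m + a) p)) = g p (curvature M D X Y (e a) p) (J p (e a p))"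
      using curvJ[OF eW[OF a]] g_JJ[OF pM curv_in[OF eW[OF a]] J_in[OF pM vf_in[OF eW[OF a] W(2)]]] by (simp add: F_def)
  qed
  finally show ?thesis unfolding ricci_form_def half by simp
qed

end

section \<open>The Hermitian structure of the tangent bundle\<close>

context affr
begin

lemma Czero_gam: assumes Czero and p: "p \<in> points M" and "x \<in> TS p" "y \<in> TS p" shows "gam p x y = 0"
  by (rule g_nondegenerate[OF p gam_in[OF p] TS_zero])
    (use assms lin_zero[OF g_lin1[OF p]] in \<open>auto simp: g_gam Kt_def Czero_def\<close>)

lemma Czero_levi_civita: assumes Czero shows "is_levi_civita M g nab"
  by (rule is_levi_civita_gam) (use Czero_gam[OF assms] vf_points vf_in in auto)

lemma Czero_flat: assumes Czero shows "flat_connection M (levi_civita M g)"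
proof -
  have lc: "levi_civita M g X Y p = nab X Y p" if "vf U X" "vf U Y" "p \<in> U" for U X Y p
    using lc_eq[OF that] Czero_gam[OF assms vf_points[OF that(1,3)] vf_in[OF that(1,3)] vf_in[OF that(2,3)]] by simp
  have lc_vf: "vf U (levi_civita M g X Y)" if "vf U X" "vf U Y" for U X Y
    by (rule vf_cong[OF nab_vf[OF that]]) (use lc[OF that] in simp)
  show ?thesis unfolding flat_connection_def curvature_def
  proof (intro allI impI ballI)
    fix U X Y Z p assume *: "vf U X" "vf U Y" "vf U Z" "p \<in> U"
    have n: "levi_civita M g A (levi_civita M g B Z) p = nab A (nab B Z) p" if "vf U A" "vf U B" for A B
      using lc[OF that(1) lc_vf[OF that(2) *(3)] *(4)]
        nab_local[OF that(1) lc_vf[OF that(2) *(3)] nab_vf[OF that(2) *(3)] *(4) lc[OF that(2) *(3)]] by simp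
    show "levi_civita M g (lie_bracket M X Y) Z p - levi_civita M g X (levi_civita M g Y Z) p
        + levi_civita M g Y (levi_civita M g X Z) p = 0"
      unfolding n[OF *(1,2)] n[OF *(2,1)] lc[OF bracket_vf[OF *(1,2)] *(3,4)] flat[OF *] by simp
  qed
qed

text \<open>Paired with x, the equation of traces reads al - be / 2 = c * be / 2.\<close>

lemma tr_gamma_eq_iff:
  "(\<forall>p\<in>points M. tr_gamma M nab g p = c *\<^sub>R tr_gamma_adj M nab g p) \<longleftrightarrow>
   (\<forall>p\<in>points M. \<forall>x\<in>TS p. al p x = ((c + 1) / 2) * be p x)"
proof (intro iffI ballI)
  fix p x assume h: "\<forall>p\<in>points M. tr_gamma M nab g p = c *\<^sub>R tr_gamma_adj M nab g p" and p: "p \<in> points M" and x: "x \<in> TS p"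
  have "g p (tr_gamma M nab g p) x = c * g p (tr_gamma_adj M nab g p) x"
    using h p lin_scale[OF g_lin1[OF p x] tr_gamma_adj_in(1)[OF p]] by simp
  then show "al p x = ((c + 1) / 2) * be p x"
    unfolding g_tr_gamma[OF p x] g_tr_gamma_adj[OF p x] by (simp add: field_simps)
next
  fix p assume h: "\<forall>p\<in>points M. \<forall>x\<in>TS p. al p x = ((c + 1) / 2) * be p x" and p: "p \<in> points M"
  show "tr_gamma M nab g p = c *\<^sub>R tr_gamma_adj M nab g p"
  proof (rule g_nondegenerate[OF p tr_gamma_in(1)[OF p] TS_scale[OF tr_gamma_adj_in(1)[OF p]]])
    fix z assume z: "z \<in> TS p"
    show "g p (tr_gamma M nab g p) z = g p (c *\<^sub>R tr_gamma_adj M nab g p) z"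
      using h p z lin_scale[OF g_lin1[OF p z] tr_gamma_adj_in(1)[OF p]]
      unfolding g_tr_gamma[OF p z] g_tr_gamma_adj[OF p z] by (simp add: field_simps)
  qed
qed

lemma tr_zero:
  assumes "\<forall>p\<in>points M. tr_gamma M nab g p = 0" "\<forall>p\<in>points M. tr_gamma_adj M nab g p = 0"
  shows "\<forall>p\<in>points M. \<forall>x\<in>TS p. al p x = 0 \<and> be p x = 0"
proof (intro ballI)
  fix p x assume p: "p \<in> points M" and x: "x \<in> TS p"
  have z: "g p 0 x = 0" using lin_zero[OF g_lin1[OF p x]] .
  show "al p x = 0 \<and> be p x = 0"
    using g_tr_gamma[OF p x] g_tr_gamma_adj[OF p x] assms p z by simp
qed

end

section \<open>The complex structure of the bundle is parallel\<close>

context taff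
begin

abbreviation "JT \<equiv> lift_J M nab"

lemma Jt_parts:
  assumes "u \<in> over (points M)" "w \<in> T.TS u" shows "hp u (Jt u w) = - kp u w" "kp u (Jt u w) = hp u w"
proof -
  have "Jt u w = hl u (- kp u w) + vl u (hp u w)"
    unfolding Jt_def using lin_neg[OF hl_lin[OF assms(1)] kp_in[OF assms]] by simp
  then show "hp u (Jt u w) = - kp u w" "kp u (Jt u w) = hp u w"
    using hp_lift[OF assms(1) TS_neg[OF kp_in[OF assms]] hp_in[OF assms]] kp_lift[OF assms(1) TS_neg[OF kp_in[OF assms]] hp_in[OF assms]] by simp_all
qed

lemma JF_endo: "T.vf Q W \<Longrightarrow> u \<in> Q \<Longrightarrow> endo_field JT W u = JF W u"
  unfolding endo_field_def using lift_J_eq[OF TS_points T.vf_in] by simp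

lemma endo_JT_vf: "T.vf Q W \<Longrightarrow> T.vf Q (endo_field JT W)"
  by (rule T.vf_cong[OF Jt_vf]) (simp_all add: JF_endo)

text \<open>The difference of both sides is tensorial in A and in B. On lifts it vanishes, because
  \<open>nT\<close> preserves the type of its second argument and J exchanges the types up to
  sign.\<close>

lemma nT_JF:
  assumes A: "T.vf Q A" and B: "T.vf Q B" and u: "u \<in> Q"
  shows "nT A (JF B) u = Jt u (nT A B u)"
proof -
  note uM = TS_points[OF A u]
  have lifts: "nT (lft s X) (JF (lft t Y)) u = Jt u (nT (lft s X) (lft t Y) u)"
    if X: "vf U X" and Y: "vf U Y" and uU: "u \<in> over U" for U X Y s t
  proof (cases t)
    case True
    have "nT (lft s X) (JF (lft t Y)) u = nT (lft s X) (lft False Y) u"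
      by (rule N.nab_local[OF lft_vf[OF X] Jt_vf[OF lft_vf[OF Y]] lft_vf[OF Y] uU])
        (use True endo_field_lifts(5)[OF Y] in \<open>simp add: lft_def\<close>)
    then show ?thesis
      unfolding nT_lft[OF X Y uU] using True endo_field_lifts(5)[OF nab_vf[OF X Y] uU] Jt_zero[OF uM] by (auto simp: lft_def)
  next
    case False
    have m: "T.vf (over U) (- lft True Y)" using T.vf_uminus[OF lft_vf[OF Y]] .
    have "nT (lft s X) (JF (lft t Y)) u = nT (lft s X) (- lft True Y) u"
      by (rule N.nab_local[OF lft_vf[OF X] Jt_vf[OF lft_vf[OF Y]] m uU])
        (use False endo_field_lifts(6)[OF Y] in \<open>simp add: lft_def\<close>)
    also have "\<dots> = - nT (lft s X) (lft True Y) u" by (rule N.nab_uminus2[OF lft_vf[OF X] lft_vf[OF Y] uU])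
    finally show ?thesis
      unfolding nT_lft[OF X Y uU] using False endo_field_lifts(6)[OF nab_vf[OF X Y] uU] Jt_zero[OF uM] by (auto simp: lft_def)
  qed
  have t1: "T.tensorial_at u (\<lambda>A. nT A (JF B) u - Jt u (nT A B u))" if B: "T.vf Q B" and u: "u \<in> Q" for B Q
  proof (rule T.tensorialI)
    fix R A A' assume R: "u \<in> R" "T.vf R A" "T.vf R A'"
    obtain S where S: "u \<in> S" "T.vf S A" "T.vf S B" "S \<subseteq> R" using T.common_domain[OF R(2,1) B u] .
    have A': "T.vf S A'" using T.vf_mono[OF R(3) T.vf_open[OF S(2)] S(4)] .
    show "nT (A + A') (JF B) u - Jt u (nT (A + A') B u) = (nT A (JF B) u - Jt u (nT A B u)) + (nT A' (JF B) u - Jt u (nT A' B u))"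
      unfolding N.nab_add1[OF S(2) A' Jt_vf[OF S(3)] S(1)] N.nab_add1[OF S(2) A' S(3,1)]
        T.lin_add[OF Jt_lin[OF uM] N.nab_in[OF S(2,3,1)] N.nab_in[OF A' S(3,1)]] by simp
  next
    fix R f A assume R: "u \<in> R" "T.sf R f" "T.vf R A"
    obtain S where S: "u \<in> S" "T.vf S A" "T.vf S B" "S \<subseteq> R" using T.common_domain[OF R(3,1) B u] .
    have f: "T.sf S f" using T.sf_mono[OF R(2) T.vf_open[OF S(2)] S(4)] .
    show "nT (fscale f A) (JF B) u - Jt u (nT (fscale f A) B u) = f u *\<^sub>R (nT A (JF B) u - Jt u (nT A B u))"
      unfolding N.nab_fscale1[OF f S(2) Jt_vf[OF S(3)] S(1)] N.nab_fscale1[OF f S(2,3,1)]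
        T.lin_scale[OF Jt_lin[OF uM] N.nab_in[OF S(2,3,1)]] by (simp only: scaleR_diff_right)
  qed
  have t2: "T.tensorial_at u (\<lambda>B. nT A (JF B) u - Jt u (nT A B u))" if A: "T.vf Q A" and u: "u \<in> Q" for A Q
  proof (rule T.tensorialI)
    fix R B B' assume R: "u \<in> R" "T.vf R B" "T.vf R B'"
    obtain S where S: "u \<in> S" "T.vf S B" "T.vf S A" "S \<subseteq> R" using T.common_domain[OF R(2,1) A u] .
    have B': "T.vf S B'" using T.vf_mono[OF R(3) T.vf_open[OF S(2)] S(4)] .
    have "nT A (JF (B + B')) u = nT A (JF B + JF B') u"
      by (rule N.nab_local[OF S(3) Jt_vf[OF T.vf_add[OF S(2) B']] T.vf_add[OF Jt_vf[OF S(2)] Jt_vf[OF B']] S(1)])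
        (rule endo_field_add(3)[OF S(2) B'])
    then show "nT A (JF (B + B')) u - Jt u (nT A (B + B') u) = (nT A (JF B) u - Jt u (nT A B u)) + (nT A (JF B') u - Jt u (nT A B' u))"
      unfolding N.nab_add2[OF S(3,2) B' S(1)] T.lin_add[OF Jt_lin[OF uM] N.nab_in[OF S(3,2,1)] N.nab_in[OF S(3) B' S(1)]]
      using N.nab_add2[OF S(3) Jt_vf[OF S(2)] Jt_vf[OF B'] S(1)] by simp
  next
    fix R f B assume R: "u \<in> R" "T.sf R f" "T.vf R B"
    obtain S where S: "u \<in> S" "T.vf S B" "T.vf S A" "S \<subseteq> R" using T.common_domain[OF R(3,1) A u] .
    have f: "T.sf S f" using T.sf_mono[OF R(2) T.vf_open[OF S(2)] S(4)] .
    note b = T.vf_in[OF S(2,1)] and n = N.nab_in[OF S(3,2,1)]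
    have 1: "nT A (JF (fscale f B)) u = nT A (fscale f (JF B)) u"
      by (rule N.nab_local[OF S(3) Jt_vf[OF T.vf_fscale[OF f S(2)]] T.vf_fscale[OF f Jt_vf[OF S(2)]] S(1)])
        (rule endo_field_fscale(3)[OF S(2)])
    show "nT A (JF (fscale f B)) u - Jt u (nT A (fscale f B) u) = f u *\<^sub>R (nT A (JF B) u - Jt u (nT A B u))"
      unfolding 1 N.nab_fscale2[OF f S(3) Jt_vf[OF S(2)] S(1)] N.nab_fscale2[OF f S(3,2,1)]
        T.lin_add[OF Jt_lin[OF uM] T.TS_scale[OF b] T.TS_scale[OF n]] T.lin_scale[OF Jt_lin[OF uM] b] T.lin_scale[OF Jt_lin[OF uM] n]
      by (simp add: algebra_simps)
  qed
  have 1: "nT (lft s X) (JF B) u - Jt u (nT (lft s X) B u) = 0" if X: "vf U X" "u \<in> over U" for U X s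
  proof (rule lift_zero_lft[OF t2[OF lft_vf[OF X(1)] X(2)] B u])
    fix U' Y t assume Y: "proj u \<in> U'" "vf U' Y"
    obtain W where W: "proj u \<in> W" "vf W X" "vf W Y" using common_domain[OF X(1) overD(1)[OF X(2)] Y(2,1)] .
    show "nT (lft s X) (JF (lft t Y)) u - Jt u (nT (lft s X) (lft t Y) u) = 0"
      using lifts[OF W(2,3) over_at[OF uM W(1)]] by simp
  qed
  have "nT A (JF B) u - Jt u (nT A B u) = 0"
    by (rule lift_zero_lft[OF t1[OF B u] A u]) (use 1 in blast)
  then show ?thesis by simp
qed

lemma JT_eq: "u \<in> points TM \<Longrightarrow> w \<in> T.TS u \<Longrightarrow> JT u w = Jt u w"
  using lift_J_eq by simp

sublocale HM: herm "tangent_bundle M" "lift_conn M nab" "lift_metric M nab g" "lift_J M nab"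
proof unfold_locales
  fix u x assume "u \<in> points TM" and x: "x \<in> T.TS u"
  then have u: "u \<in> over (points M)" and uT: "u \<in> points TM" by simp_all
  show "JT u x \<in> T.TS u" unfolding JT_eq[OF uT x] by (rule Jt_in[OF u x])
  show "JT u (JT u x) = - x" unfolding JT_eq[OF uT x] JT_eq[OF uT Jt_in[OF u x]] by (rule endo_rules(5)[OF u x])
  fix y assume y: "y \<in> T.TS u"
  note p = overD(1)[OF u] and kx = kp_in[OF u x] and ky = kp_in[OF u y]
  show "gT u (JT u x) (JT u y) = gT u x y"
    unfolding JT_eq[OF uT x] JT_eq[OF uT y] gT_eq[OF u Jt_in[OF u x] Jt_in[OF u y]] gT_eq[OF u x y] Jt_parts[OF u x] Jt_parts[OF u y]
    using lin_neg[OF g_lin1[OF p TS_neg[OF ky]] kx] lin_neg[OF g_lin2[OF p kx] ky] by simp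
next
  fix u assume uT: "u \<in> points TM"
  then have u: "u \<in> over (points M)" by simp
  show "T.lin u (JT u)"
    using Jt_lin[OF u] JT_eq[OF uT] T.TS_add T.TS_scale unfolding T.lin_def by simp
next
  show "T.vf Q (endo_field JT W)" if "T.vf Q W" for Q W by (rule endo_JT_vf[OF that])
next
  fix Q A B u assume *: "T.vf Q A" "T.vf Q B" "u \<in> Q"
  have "nT A (endo_field JT B) u = nT A (JF B) u"
    by (rule N.nab_local[OF *(1) endo_JT_vf[OF *(2)] Jt_vf[OF *(2)] *(3)]) (rule JF_endo[OF *(2)])
  then show "nT A (endo_field JT B) u = JT u (nT A B u)"
    using nT_JF[OF *] JT_eq[OF T.vf_points[OF *(1,3)] N.nab_in[OF *]] by simp
qed

text \<open>Splitting all three arguments gives eight terms, of which \<open>C1_lf\<close> leaves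
  two.\<close>

lemma C1_eq:
  assumes u: "u \<in> over (points M)" and w: "w1 \<in> T.TS u" "w2 \<in> T.TS u" "w3 \<in> T.TS u"
  shows "A1.Ct u w1 w2 w3 = Ct (proj u) (hp u w1) (hp u w2) (hp u w3) + Ct (proj u) (hp u w1) (kp u w2) (kp u w3)"
proof -
  have uT: "u \<in> points TM" using u by simp
  note h = hp_in[OF u] and k = kp_in[OF u]
  note hh = hl_in[OF u h] and vv = vl_in[OF u k]
  have 3: "A1.Ct u a b w3 = A1.Ct u a b (hl u (hp u w3)) + A1.Ct u a b (vl u (kp u w3))" if "a \<in> T.TS u" "b \<in> T.TS u" for a b
    using T.lin_add[OF A1.Ct_lin3[OF uT that] hh[OF w(3)] vv[OF w(3)]] decomp[OF u w(3)] by simp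
  have 2: "A1.Ct u a w2 c = A1.Ct u a (hl u (hp u w2)) c + A1.Ct u a (vl u (kp u w2)) c" if "a \<in> T.TS u" "c \<in> T.TS u" for a c
    using T.lin_add[OF A1.Ct_lin2[OF uT that] hh[OF w(2)] vv[OF w(2)]] decomp[OF u w(2)] by simp
  have 1: "A1.Ct u w1 b c = A1.Ct u (hl u (hp u w1)) b c + A1.Ct u (vl u (kp u w1)) b c" if "b \<in> T.TS u" "c \<in> T.TS u" for b c
    using T.lin_add[OF A1.Ct_lin1[OF uT that] hh[OF w(1)] vv[OF w(1)]] decomp[OF u w(1)] by simp
  have c: "A1.Ct u (hl u x) (hl u y) (hl u z) = Ct (proj u) x y z" "A1.Ct u (hl u x) (hl u y) (vl u z) = 0"
    "A1.Ct u (hl u x) (vl u y) (hl u z) = 0" "A1.Ct u (hl u x) (vl u y) (vl u z) = Ct (proj u) x y z"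
    "A1.Ct u (vl u x) (hl u y) (hl u z) = 0" "A1.Ct u (vl u x) (hl u y) (vl u z) = 0"
    "A1.Ct u (vl u x) (vl u y) (hl u z) = 0" "A1.Ct u (vl u x) (vl u y) (vl u z) = 0"
    if t: "x \<in> TS (proj u)" "y \<in> TS (proj u)" "z \<in> TS (proj u)" for x y z
    using C1_lf[OF u t, of True True True] C1_lf[OF u t, of True True False] C1_lf[OF u t, of True False True] C1_lf[OF u t, of True False False]
      C1_lf[OF u t, of False True True] C1_lf[OF u t, of False True False] C1_lf[OF u t, of False False True] C1_lf[OF u t, of False False False]
    by (simp_all add: lf_def)
  show ?thesis
    using w by (simp add: 1[OF w(2,3)] 2[OF hh[OF w(1)] w(3)] 2[OF vv[OF w(1)] w(3)] 3 hh vv c h k)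
qed

section \<open>Traces and closedness on the bundle\<close>

lemma onb_TM:
  assumes u: "u \<in> over (points M)" and E: "onb (proj u) E"
  shows "A1.onb u (\<lambda>a. if a < dM then hl u (E a) else vl u (E (a - dM)))"
proof -
  have E': "E a \<in> TS (proj u)" if "a < dM" for a using E that by (simp add: onb_def)
  have l: "gT u (hl u x) (hl u y) = g (proj u) x y" "gT u (vl u x) (vl u y) = g (proj u) x y"
    "gT u (hl u x) (vl u y) = 0" "gT u (vl u x) (hl u y) = 0" if "x \<in> TS (proj u)" "y \<in> TS (proj u)" for x y
    using gT_lf[OF u that, of True True] gT_lf[OF u that, of False False] gT_lf[OF u that, of True False] gT_lf[OF u that, of False True]
    by (simp_all add: lf_def)
  show ?thesis unfolding A1.onb_def
  proof (intro conjI allI impI)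
    fix a assume a: "a < mdim TM"
    have a': "\<not> a < dM \<Longrightarrow> a - dM < dM" using a by auto
    show "(if a < dM then hl u (E a) else vl u (E (a - dM))) \<in> T.TS u"
      using hl_in[OF u E'[of a]] vl_in[OF u E'[OF a']] by auto
    fix b assume b: "b < mdim TM"
    have b': "\<not> b < dM \<Longrightarrow> b - dM < dM" using b by auto
    show "gT u (if a < dM then hl u (E a) else vl u (E (a - dM))) (if b < dM then hl u (E b) else vl u (E (b - dM))) = (if a = b then 1 else 0)"
      using E E' a' b' l unfolding onb_def by (cases "a < dM"; cases "b < dM") auto
  qed
qed

text \<open>In the basis of horizontal and vertical lifts, the half of \<alpha> with vertical
  vectors in the first slot vanishes, whereas both halves of \<beta> contribute the value on M. All
  powers of 2 in the theorem originate here.\<close>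

lemma al_TM: assumes u: "u \<in> over (points M)" and w: "w \<in> T.TS u" shows "A1.al u w = al (proj u) (hp u w)"
  and be_TM: "A1.be u w = 2 * be (proj u) (hp u w)"
proof -
  note p = overD(1)[OF u] and uT = u[folded TM_simps(4)]
  note E = fr_in[OF p] and x = hp_in[OF u w] and y = kp_in[OF u w]
  note hE = hl_in[OF u E] and vE = vl_in[OF u E]
  note z1 = lin_zero[OF Ct_lin1[OF p]] and z2 = lin_zero[OF Ct_lin2[OF p]]
  note pt = hp_hl[OF u E] hp_vl[OF u E] kp_hl[OF u E] kp_vl[OF u E]
  show "A1.al u w = al (proj u) (hp u w)"
    unfolding A1.al_onb[OF uT onb_TM[OF u fr_onb[OF p]] w] TM_simps(1) sum_lessThan_double al_def
    using C1_eq[OF u hE hE w] C1_eq[OF u vE vE w] z1[OF TS_zero x] z1[OF E y] z2[OF E y]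
    by (simp add: pt)
  show "A1.be u w = 2 * be (proj u) (hp u w)"
    unfolding A1.be_onb[OF uT onb_TM[OF u fr_onb[OF p]] w] TM_simps(1) sum_lessThan_double be_def
    using C1_eq[OF u w hE hE] C1_eq[OF u w vE vE] z2[OF x TS_zero]
    by (simp add: pt)
qed

text \<open>Identities pulled back to the bundle are brought down to M by evaluating them at zero
  vectors.\<close>

lemma zero_section: "p \<in> points M \<Longrightarrow> Tan p 0 \<in> over (points M)"
  by (simp add: TS_zero)

lemma balance_TM_iff:
  "(\<forall>u\<in>points TM. \<forall>w\<in>T.TS u. A1.al u w = c * A1.be u w) \<longleftrightarrow> (\<forall>p\<in>points M. \<forall>x\<in>TS p. al p x = (2 * c) * be p x)"
proof (intro iffI ballI)
  fix p x assume h: "\<forall>u\<in>points TM. \<forall>w\<in>T.TS u. A1.al u w = c * A1.be u w" and p: "p \<in> points M" and x: "x \<in> TS p"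
  let ?u = "Tan p 0"
  have u: "?u \<in> over (points M)" using zero_section[OF p] .
  have x': "x \<in> TS (proj ?u)" using x by simp
  show "al p x = (2 * c) * be p x"
    using h u hl_in[OF u x'] al_TM[OF u hl_in[OF u x']] be_TM[OF u hl_in[OF u x']] hp_hl[OF u x'] by simp
next
  fix u w assume h: "\<forall>p\<in>points M. \<forall>x\<in>TS p. al p x = (2 * c) * be p x" and "u \<in> points TM" and w: "w \<in> T.TS u"
  then have u: "u \<in> over (points M)" by simp
  show "A1.al u w = c * A1.be u w"
    using h overD(1)[OF u] hp_in[OF u w] al_TM[OF u w] be_TM[OF u w] by simp
qed

lemma be_zero_TM: "\<forall>p\<in>points M. \<forall>x\<in>TS p. al p x = 0 \<and> be p x = 0 \<Longrightarrow> \<forall>u\<in>points TM. \<forall>w\<in>T.TS u. A1.al u w = 0 \<and> A1.be u w = 0"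
  using al_TM be_TM hp_in overD(1) by simp

text \<open>The form upstairs is the pull-back of \<open>al\<close>. On two horizontal lifts its
  differential is that of M. If one lift is vertical every term vanishes: the form is zero on
  vertical vectors, its values on lifts are constant along the fibres, and the bracket is vertical
  or zero.\<close>

lemma closed_TM_iff:
  "form2_zero TM (ext_deriv1 TM (\<lambda>X p. A1.al p (X p))) \<longleftrightarrow> form2_zero M (ext_deriv1 M (\<lambda>X p. al p (X p)))"
proof -
  have lifts: "ext_deriv1 TM (\<lambda>X p. A1.al p (X p)) (lft s X) (lft t Y) u =
      (if s \<and> t then ext_deriv1 M (\<lambda>X p. al p (X p)) X Y (proj u) else 0)"
    if X: "vf U X" and Y: "vf U Y" and u: "u \<in> over U" for U X Y s t u
  proof -
    note uM = lift_at(1,2)[OF X u] and o = open_over[OF vf_open[OF X]]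
    have z: "al (proj q) 0 = 0" if "q \<in> over U" for q using lin_zero[OF al_lin[OF overD(1)[OF lift_at(1)[OF X that]]]] .
    have al_l: "A1.al q (lft s Z q) = (if s then al (proj q) (Z (proj q)) else 0)" if Z: "vf U Z" and q: "q \<in> over U" for Z q s
      using al_TM[OF lift_at(1)[OF X q] T.vf_in[OF lft_vf[OF Z] q]] lft_lf[OF Z q] lf_parts[OF lift_at(1)[OF X q] lift_at(3)[OF Z q]] z[OF q] by simp
    have d: "T.dd u (lft s A u) (\<lambda>q. A1.al q (lft t Z q)) = (if s \<and> t then dd (proj u) (A (proj u)) (\<lambda>q. al q (Z q)) else 0)"
      if A: "vf U A" and Z: "vf U Z" for A Z s t
    proof -
      have "T.dd u (lft s A u) (\<lambda>q. A1.al q (lft t Z q)) = T.dd u (lft s A u) (\<lambda>q. if t then al (proj q) (Z (proj q)) else 0)"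
        by (rule T.dd_cong[OF o u]) (rule al_l[OF Z])
      also have "\<dots> = (if t then dd (proj u) (hp u (lft s A u)) (\<lambda>q. al q (Z q)) else 0)"
        using dd_proj[OF al_sf[OF Z] u T.vf_in[OF lft_vf[OF A] u]] by (simp add: T.dd_const)
      finally show ?thesis
        using lft_lf[OF A u, of s] lf_parts(1)[OF uM(1) vf_in[OF A uM(2)], of s] by (auto simp: dd_zero_vec)
    qed
    have b: "A1.al u (lie_bracket TM (lft s X) (lft t Y) u) = (if s \<and> t then al (proj u) (lie_bracket M X Y (proj u)) else 0)"
    proof -
      have v: "A1.al u (V (nab A B) u) = 0" if "vf U A" "vf U B" for A B
        using al_l[OF nab_vf[OF that] u, of False] by (simp add: lft_def)
      have "A1.al u (- V (nab Y X) u) = 0"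
        using T.lin_neg[OF A1.al_lin lift_at(5)[OF nab_vf[OF Y X] u]] v[OF Y X] uM by simp
      then show ?thesis
        using al_l[OF bracket_vf[OF X Y] u, of True] v[OF X Y] T.lin_zero[OF A1.al_lin, of u] uM
          bracket_HH[OF X Y u] bracket_HV[OF X Y u] bracket_VV[OF X Y u] bracket_HV[OF Y X u] T.bracket_antisym[of "V X" "H Y" u]
        by (cases s; cases t) (simp_all add: lft_def)
    qed
    show ?thesis unfolding ext_deriv1_def d[OF X Y] d[OF Y X] b by auto
  qed
  have t1: "T.tensorial_at u (\<lambda>X. ext_deriv1 TM (\<lambda>X p. A1.al p (X p)) X Y u)" if "T.vf U Y" "u \<in> U" for U Y u
    by (rule T.ext_deriv1_tensorial[where \<eta> = A1.al, OF _ _ that]) (simp_all add: A1.al_lin A1.al_sf del: TM_simps)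
  show ?thesis
  proof
    assume h: "form2_zero TM (ext_deriv1 TM (\<lambda>X p. A1.al p (X p)))"
    show "form2_zero M (ext_deriv1 M (\<lambda>X p. al p (X p)))" unfolding form2_zero_def
    proof (intro allI impI ballI)
      fix U X Y p assume X: "vf U X" and Y: "vf U Y" and p: "p \<in> U"
      have u: "Tan p 0 \<in> over U" using p by (simp add: TS_zero)
      have "ext_deriv1 TM (\<lambda>X p. A1.al p (X p)) (lft True X) (lft True Y) (Tan p 0) = 0"
        using h lft_vf[OF X] lft_vf[OF Y] u unfolding form2_zero_def by blast
      then show "ext_deriv1 M (\<lambda>X p. al p (X p)) X Y p = 0" using lifts[OF X Y u, of True True] by simp
    qed
  next
    assume h: "form2_zero M (ext_deriv1 M (\<lambda>X p. al p (X p)))"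
    have 1: "ext_deriv1 TM (\<lambda>X p. A1.al p (X p)) A (lft t Y) u = 0"
      if A: "T.vf Q A" and u: "u \<in> Q" and Y: "vf U Y" "u \<in> over U" for Q A u U Y t
    proof (rule lift_zero_lft[OF t1[OF lft_vf[OF Y(1)] Y(2)] A u])
      fix U' X s assume X: "proj u \<in> U'" "vf U' X"
      obtain W where W: "proj u \<in> W" "vf W X" "vf W Y" using common_domain[OF X(2,1) Y(1) overD(1)[OF Y(2)]] .
      have "ext_deriv1 M (\<lambda>X p. al p (X p)) X Y (proj u) = 0" using h W unfolding form2_zero_def by blast
      then show "ext_deriv1 TM (\<lambda>X p. A1.al p (X p)) (lft s X) (lft t Y) u = 0"
        using lifts[OF W(2,3) over_at[OF TS_points[OF A u] W(1)]] by simp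
    qed
    show "form2_zero TM (ext_deriv1 TM (\<lambda>X p. A1.al p (X p)))" unfolding form2_zero_def
    proof (intro allI impI ballI)
      fix Q A B u assume A: "T.vf Q A" and B: "T.vf Q B" and u: "u \<in> Q"
      note uT = T.vf_points[OF A u]
      have "ext_deriv1 TM (\<lambda>X p. A1.al p (X p)) B A u = 0"
      proof (rule lift_zero_lft[OF t1[OF A u] B u])
        fix U X s assume X: "proj u \<in> U" "u \<in> over U" "vf U X"
        obtain R where R: "u \<in> R" "T.vf R A" "T.vf R (lft s X)" using T.common_domain[OF A u lft_vf[OF X(3), of s] X(2)] .
        show "ext_deriv1 TM (\<lambda>X p. A1.al p (X p)) (lft s X) A u = 0"
          using T.ext_deriv1_antisym[where \<eta> = A1.al, OF R(1,3,2) A1.al_lin[OF uT]] 1[OF A u X(3,2)] by simp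
      qed
      then show "ext_deriv1 TM (\<lambda>X p. A1.al p (X p)) A B u = 0"
        using T.ext_deriv1_antisym[where \<eta> = A1.al, OF u A B A1.al_lin[OF uT]] by simp
    qed
  qed
qed

section \<open>The Kaehler condition on the bundle\<close>

lemma Czero_TM: assumes Czero shows "A1.Czero"
  unfolding A1.Czero_def using assms C1_eq hp_in kp_in overD(1) by (simp add: Czero_def)

lemma kahler_TM: assumes Czero shows "kahler TM JT gT"
  unfolding HM.kahler_iff HM.omt_def using Czero_TM[OF assms] HM.J_in unfolding A1.Czero_def by auto

text \<open>On one horizontal and two vertical lifts the lifted tensor is C(x,y,z) if the horizontal
  one stands in the first slot, and 0 after it is exchanged with a vertical one.\<close>

lemma Ct_sym_zero:
  assumes h: "\<forall>u\<in>points TM. \<forall>x\<in>T.TS u. \<forall>y\<in>T.TS u. \<forall>z\<in>T.TS u. A1.Ct u x y z = A1.Ct u y x z"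
  shows Czero
  unfolding Czero_def
proof (intro ballI)
  fix p x y z assume p: "p \<in> points M" and t: "x \<in> TS p" "y \<in> TS p" "z \<in> TS p"
  let ?u = "Tan p 0"
  have u: "?u \<in> over (points M)" using zero_section[OF p] .
  have t': "x \<in> TS (proj ?u)" "y \<in> TS (proj ?u)" "z \<in> TS (proj ?u)" using t by simp_all
  have "A1.Ct ?u (lf True ?u x) (lf False ?u y) (lf False ?u z) = A1.Ct ?u (lf False ?u y) (lf True ?u x) (lf False ?u z)"
    using h u lf_in[OF u t'(1)] lf_in[OF u t'(2)] lf_in[OF u t'(3)] by simp
  then show "Ct p x y z = 0"
    using C1_lf[OF u t', of True False False] C1_lf[OF u t'(2,1,3), of False True False] by simp
qed

text \<open>Evaluated on two horizontal vectors and a vertical one, d \<omega> = 0 becomes C(x,y,z)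
  = C(y,z,x); the remaining summand has a vertical vector in the first slot.\<close>

lemma kahler_sym:
  assumes k: "kahler TM JT gT" and p: "p \<in> points M" and t: "x \<in> TS p" "y \<in> TS p" "z \<in> TS p"
  shows "Ct p x y z = Ct p y x z"
proof -
  let ?u = "Tan p 0"
  have u: "?u \<in> over (points M)" using zero_section[OF p] .
  have uT: "?u \<in> points TM" using u by simp
  have t': "x \<in> TS (proj ?u)" "y \<in> TS (proj ?u)" "z \<in> TS (proj ?u)" using t by simp_all
  note h = hl_in[OF u t'(1)] hl_in[OF u t'(2)] hl_in[OF u t'(3)] and v = vl_in[OF u t'(1)] vl_in[OF u t'(2)] vl_in[OF u t'(3)]
  have "HM.omt ?u (hl ?u x) (hl ?u y) (vl ?u z) = 0"
    using k uT h v unfolding HM.kahler_iff by blast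
  moreover have "JT ?u (hl ?u x) = vl ?u x" "JT ?u (hl ?u y) = vl ?u y" "JT ?u (vl ?u z) = - hl ?u z"
    unfolding JT_eq[OF uT h(1)] JT_eq[OF uT h(2)] JT_eq[OF uT v(3)] using endo_lifts[OF u t'(1)] endo_lifts[OF u t'(2)] endo_lifts[OF u t'(3)] by simp_all
  ultimately have "A1.Ct ?u (hl ?u x) (vl ?u y) (vl ?u z) - A1.Ct ?u (hl ?u y) (hl ?u z) (hl ?u x) + A1.Ct ?u (vl ?u z) (vl ?u x) (hl ?u y) = 0"
    using HM.Ct_neg(2)[OF uT h(2) h(3) h(1)] by (simp add: HM.omt_def)
  then have "Ct p x y z - Ct p y z x = 0"
    using C1_lf[OF u t', of True False False] C1_lf[OF u t'(2,3,1), of True True True] C1_lf[OF u t'(3,1,2), of False False True]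
    by (simp add: lf_def)
  then show ?thesis using Ct_sym[OF p t(2,1,3)] by simp
qed

section \<open>Ricci forms of the bundle\<close>

lemma lift_frame:
  assumes p: "u \<in> over (points M)"
  obtains U E where "opn U" "u \<in> over U" "\<forall>a<dM. vf U (E a)" "\<forall>q\<in>U. onb q (\<lambda>a. E a q)"
proof -
  obtain E U where U: "opn U" "proj u \<in> U" "orthonormal_frame_on M g U E"
    using frame_exists[OF overD(1)[OF p]] by blast
  have "\<forall>a<dM. vf U (E a)" using U(3) unfolding orthonormal_frame_on_def by blast
  moreover have "\<forall>q\<in>U. onb q (\<lambda>a. E a q)" using frame_onb[OF U(3)] by blast
  ultimately show thesis using that[OF U(1) over_at[OF p U(2)]] by blast
qed

text \<open>For horizontal lifts of an orthonormal frame of M the flat part of D drops out: its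
  derivatives of horizontal lifts are horizontal, while J makes these lifts vertical. The trace
  required by \<open>ricci_zero\<close> is thus a trace of R.\<close>

lemma ricci_TM:
  assumes R: "A1.trilin R" "A1.smooth3 R"
    and RJ: "\<And>p x y z. \<lbrakk>p \<in> points TM; x \<in> T.TS p; y \<in> T.TS p; z \<in> T.TS p\<rbrakk> \<Longrightarrow> R p x (JT p y) z + R p x y (JT p z) = 0"
    and D: "\<And>U X Y p. T.vf U X \<Longrightarrow> T.vf U Y \<Longrightarrow> p \<in> U \<Longrightarrow> D X Y p = nT X Y p + A1.riesz p (R p (X p) (Y p))"
    and tr: "\<And>u w E. \<lbrakk>u \<in> over (points M); w \<in> T.TS u; onb (proj u) E\<rbrakk> \<Longrightarrow> (\<Sum>a<dM. R u w (hl u (E a)) (vl u (E a))) = 0"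
  shows "form2_zero TM (ricci_form TM JT gT D)"
  unfolding form2_zero_def
proof (intro allI impI ballI)
  fix Q A B u assume A: "T.vf Q A" and B: "T.vf Q B" and u: "u \<in> Q"
  note uM = TS_points[OF A u]
  obtain U E where U: "opn U" "u \<in> over U" "\<forall>a<dM. vf U (E a)" "\<forall>q\<in>U. onb q (\<lambda>a. E a q)" using lift_frame[OF uM] .
  have UM: "over U \<subseteq> over (points M)" using over_mono[OF opn_subset[OF U(1)]] .
  have HE: "H (E a) q = hl q (E a (proj q))" and JHE: "JT q (H (E a) q) = vl q (E a (proj q))" if q: "q \<in> over U" and a: "a < dM" for q a
  proof -
    have vfE: "vf U (E a)" using U(3) a by blast
    show *: "H (E a) q = hl q (E a (proj q))" by (rule hlift_hl[OF q vfE])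
    show "JT q (H (E a) q) = vl q (E a (proj q))"
      using JT_eq[OF _ lift_at(4)[OF vfE q]] lift_at(1)[OF vfE q] endo_field_lifts(5)[OF vfE q] vlift_vl[of "E a" q] by simp
  qed
  show "ricci_form TM JT gT D A B u = 0"
  proof (rule HM.ricci_zero[where R = R and D = D and m = dM and U = "over U" and e = "\<lambda>a. H (E a)", OF R])
    show "R p x (JT p y) z + R p x y (JT p z) = 0" if "p \<in> points TM" "x \<in> T.TS p" "y \<in> T.TS p" "z \<in> T.TS p" for p x y z
      by (rule RJ[OF that])
    show "D X Y p = nT X Y p + A1.riesz p (R p (X p) (Y p))" if "T.vf V X" "T.vf V Y" "p \<in> V" for V X Y p by (rule D[OF that])
    show "mdim TM = 2 * dM" by simp
    show "T.opn (over U)" by (rule open_over[OF U(1)])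
    show "u \<in> over U" by (rule U(2))
    show "T.vf (over U) (H (E a))" if "a < dM" for a using hlift_vf U(3) that by blast
    show "A1.onb q (\<lambda>a. if a < dM then H (E a) q else JT q (H (E (a - dM)) q))" if q: "q \<in> over U" for q
    proof -
      have "A1.onb q (\<lambda>a. if a < dM then hl q (E a (proj q)) else vl q (E (a - dM) (proj q)))"
        using onb_TM[of q "\<lambda>a. E a (proj q)"] UM q U(4) overD(1)[OF q] by blast
      moreover have "(if a < dM then H (E a) q else JT q (H (E (a - dM)) q)) =
          (if a < dM then hl q (E a (proj q)) else vl q (E (a - dM) (proj q)))" if "a < mdim TM" for a
        using HE[OF q, of a] JHE[OF q, of "a - dM"] that by auto
      ultimately show ?thesis by (simp only: A1.onb_def simp_thms cong: conj_cong imp_cong)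
    qed
    show "T.vf Q A" "T.vf Q B" "u \<in> Q" by fact+
    fix V X q assume X: "T.vf V X" and VU: "V \<subseteq> over U" and q: "q \<in> V"
    have qU: "q \<in> over U" using q VU by blast
    note qM = TS_points[OF X q] and w = T.vf_in[OF X q]
    have qT: "q \<in> points TM" using qM by simp
    have "gT q (D X (H (E a)) q) (JT q (H (E a) q)) = R q (X q) (hl q (E a (proj q))) (vl q (E a (proj q)))" if a: "a < dM" for a
    proof -
      have vfE: "vf U (E a)" using U(3) a by blast
      have HV: "T.vf V (H (E a))" using T.vf_mono[OF hlift_vf[OF vfE] T.vf_open[OF X] VU] .
      have Ea: "E a (proj q) \<in> TS (proj q)" using lift_at(3)[OF vfE qU] .
      note v = vl_in[OF qM Ea] and h = hl_in[OF qM Ea]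
      have "gT q (nT X (H (E a)) q) (vl q (E a (proj q))) = 0"
      proof (rule lift_zero_lft[where \<Phi> = "\<lambda>X. gT q (nT X (H (E a)) q) (vl q (E a (proj q)))", OF _ X q])
        show "T.tensorial_at q (\<lambda>X. gT q (nT X (H (E a)) q) (vl q (E a (proj q))))"
        proof (rule T.tensorialI)
          fix S Y Y' assume S: "q \<in> S" "T.vf S Y" "T.vf S Y'"
          obtain S' where S': "q \<in> S'" "T.vf S' Y" "T.vf S' (H (E a))" "S' \<subseteq> S" using T.common_domain[OF S(2,1) HV q] .
          have Y': "T.vf S' Y'" using T.vf_mono[OF S(3) T.vf_open[OF S'(2)] S'(4)] .
          show "gT q (nT (Y + Y') (H (E a)) q) (vl q (E a (proj q))) =
              gT q (nT Y (H (E a)) q) (vl q (E a (proj q))) + gT q (nT Y' (H (E a)) q) (vl q (E a (proj q)))"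
            unfolding N.nab_add1[OF S'(2) Y' S'(3,1)]
            by (rule T.lin_add[OF A1.g_lin1[OF qT v] N.nab_in[OF S'(2,3,1)] N.nab_in[OF Y' S'(3,1)]])
        next
          fix S f Y assume S: "q \<in> S" "T.sf S f" "T.vf S Y"
          obtain S' where S': "q \<in> S'" "T.vf S' Y" "T.vf S' (H (E a))" "S' \<subseteq> S" using T.common_domain[OF S(3,1) HV q] .
          have f: "T.sf S' f" using T.sf_mono[OF S(2) T.vf_open[OF S'(2)] S'(4)] .
          show "gT q (nT (fscale f Y) (H (E a)) q) (vl q (E a (proj q))) = f q *\<^sub>R gT q (nT Y (H (E a)) q) (vl q (E a (proj q)))"
            unfolding N.nab_fscale1[OF f S'(2,3,1)] by (rule T.lin_scale[OF A1.g_lin1[OF qT v] N.nab_in[OF S'(2,3,1)]])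
        qed
        fix U' Y s assume Y: "proj q \<in> U'" "vf U' Y"
        obtain W where W: "proj q \<in> W" "vf W Y" "vf W (E a)" using common_domain[OF Y(2,1) vfE overD(1)[OF qU]] .
        have qW: "q \<in> over W" by (rule over_at[OF qM W(1)])
        show "gT q (nT (lft s Y) (H (E a)) q) (vl q (E a (proj q))) = 0"
          using nT_lft[OF W(2,3) qW, of s True] gT_lf[OF qM nab_in[OF W(2,3,1)] Ea, of True False]
            lft_lf[OF nab_vf[OF W(2,3)] qW, of True] T.lin_zero[OF A1.g_lin1[OF qT v]] by (simp add: lft_def lf_def split: if_splits)
      qed
      then show ?thesis
        unfolding D[OF X HV q] HE[OF qU a] JHE[OF qU a, unfolded HE[OF qU a]] T.lin_add[OF A1.g_lin1[OF qT v] N.nab_in[OF X HV q] A1.riesz_in[OF qT]]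
        using A1.g_riesz[OF qT A1.trilinD(1)[OF R(1) qT w h] v] by simp
    qed
    then show "(\<Sum>a<dM. gT q (D X (H (E a)) q) (JT q (H (E a) q))) = 0"
      using tr[OF qM w, of "\<lambda>a. E a (proj q)"] U(4) overD(1)[OF qU] by simp
  qed
qed

text \<open>Only terms with a horizontal part in the first slot and equal types in the other two
  survive. The vertical part of w enters in two ways: through a later slot, or through the first
  slot as - \<open>kp u w\<close>, the horizontal part of J w.\<close>

lemma ricci_traces:
  assumes u: "u \<in> over (points M)" and w: "w \<in> T.TS u" and E: "onb (proj u) E"
  shows "(\<Sum>a<dM. HM.RB u w (hl u (E a)) (vl u (E a))) = al (proj u) (kp u w) - (1/2) * be (proj u) (kp u w)"
    "(\<Sum>a<dM. HM.RC u w (hl u (E a)) (vl u (E a))) = (1/2) * be (proj u) (kp u w)"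
proof -
  note p = overD(1)[OF u] and uT = u[folded TM_simps(4)]
  have E': "E a \<in> TS (proj u)" if "a < dM" for a using E that by (simp add: onb_def)
  note k = kp_in[OF u w] and hw = hp_in[OF u w]
  note z1 = lin_zero[OF Ct_lin1[OF p]] and z2 = lin_zero[OF Ct_lin2[OF p]] and z3 = lin_zero[OF Ct_lin3[OF p]]
  have both: "2 * HM.RB u w (hl u (E a)) (vl u (E a)) = 2 * Ct (proj u) (E a) (E a) (kp u w) - Ct (proj u) (kp u w) (E a) (E a) \<and>
      2 * HM.RC u w (hl u (E a)) (vl u (E a)) = Ct (proj u) (kp u w) (E a) (E a)" if "a < dM" for a
  proof -
    define e where "e = E a"
    have e: "e \<in> TS (proj u)" using E'[OF that] by (simp add: e_def)
    note h = hl_in[OF u e] and v = vl_in[OF u e] and jw = HM.J_in[OF uT w]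
    have J: "JT u (hl u e) = vl u e" "JT u (vl u e) = - hl u e" "JT u w = Jt u w"
      using endo_lifts(5,6)[OF u e] JT_eq[OF uT h] JT_eq[OF uT v] JT_eq[OF uT w] by simp_all
    note pt = hp_hl[OF u e] kp_hl[OF u e] hp_vl[OF u e] kp_vl[OF u e] Jt_parts[OF u w]
    have jw': "Jt u w \<in> T.TS u" using Jt_in[OF u w] .
    have neg: "Ct (proj u) (- kp u w) e e = - Ct (proj u) (kp u w) e e" using lin_neg[OF Ct_lin1[OF p e e] k] .
    have n1: "A1.Ct u (Jt u w) (hl u e) (- hl u e) = - A1.Ct u (Jt u w) (hl u e) (hl u e)" by (rule HM.Ct_neg(3)[OF uT jw' h h])
    have n2: "A1.Ct u (- hl u e) w (vl u e) = - A1.Ct u (hl u e) w (vl u e)" by (rule HM.Ct_neg(1)[OF uT h w v])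
    have s: "Ct (proj u) e (kp u w) e = Ct (proj u) e e (kp u w)" by (rule Ct_sym[OF p e k e])
    have z: "Ct (proj u) x 0 y = 0" "Ct (proj u) x y 0 = 0" "Ct (proj u) 0 x y = 0" if "x \<in> TS (proj u)" "y \<in> TS (proj u)" for x y
      using z1[OF that] z2[OF that] z3[OF that] by simp_all
    have t: "A1.Ct u w (hl u e) (vl u e) = 0" "A1.Ct u (hl u e) w (vl u e) = Ct (proj u) e (kp u w) e" "A1.Ct u (vl u e) w (hl u e) = 0"
      "A1.Ct u (Jt u w) (hl u e) (hl u e) = - Ct (proj u) (kp u w) e e" "A1.Ct u (vl u e) (vl u e) (Jt u w) = 0"
      "A1.Ct u (Jt u w) (vl u e) (vl u e) = - Ct (proj u) (kp u w) e e"
      using C1_eq[OF u w h v] C1_eq[OF u h w v] C1_eq[OF u v w h] C1_eq[OF u jw' h h] C1_eq[OF u v v jw'] C1_eq[OF u jw' v v]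
      by (simp_all add: pt z e k hw neg TS_zero TS_neg[OF k])
    show ?thesis unfolding e_def[symmetric]
      using HM.RB_eq[OF uT w h v] HM.RC_eq[OF uT w h v] by (simp add: J n1 n2 t s)
  qed
  have "2 * (\<Sum>a<dM. HM.RB u w (hl u (E a)) (vl u (E a))) = 2 * al (proj u) (kp u w) - be (proj u) (kp u w)"
    unfolding al_onb[OF p E k] be_onb[OF p E k] sum_distrib_left using both by (simp add: sum_subtractf[symmetric] sum_distrib_left)
  then show "(\<Sum>a<dM. HM.RB u w (hl u (E a)) (vl u (E a))) = al (proj u) (kp u w) - (1/2) * be (proj u) (kp u w)" by simp
  have "2 * (\<Sum>a<dM. HM.RC u w (hl u (E a)) (vl u (E a))) = be (proj u) (kp u w)"
    unfolding be_onb[OF p E k] sum_distrib_left using both by simp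
  then show "(\<Sum>a<dM. HM.RC u w (hl u (E a)) (vl u (E a))) = (1/2) * be (proj u) (kp u w)" by simp
qed

text \<open>The condition concerns M rather than the bundle. When M is itself a later step of the
  sequence it is the balanced condition of that step.\<close>

lemma calabi_yau_TM:
  assumes h: "\<forall>p\<in>points M. \<forall>x\<in>TS p. al p x = (1/2) * be p x" shows "calabi_yau_torsion TM JT gT"
  unfolding calabi_yau_torsion_def
proof (intro conjI HM.hermitian)
  show "form2_zero TM (ricci_form TM JT gT (bismut TM JT gT))"
  proof (rule ricci_TM[where R = HM.RB, OF HM.RB_tensor])
    show "(\<Sum>a<dM. HM.RB u w (hl u (E a)) (vl u (E a))) = 0" if "u \<in> over (points M)" "w \<in> T.TS u" "onb (proj u) E" for u w E
      using ricci_traces(1)[OF that] h overD(1)[OF that(1)] kp_in[OF that(1,2)] by simp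
  qed (fact HM.RB_J, fact HM.bismut_eq)
qed

lemma chern_ricci_TM:
  assumes h: "\<forall>p\<in>points M. \<forall>x\<in>TS p. be p x = 0" shows "form2_zero TM (ricci_form TM JT gT (chern TM JT gT))"
proof (rule ricci_TM[where R = HM.RC, OF HM.RC_tensor])
  show "(\<Sum>a<dM. HM.RC u w (hl u (E a)) (vl u (E a))) = 0" if "u \<in> over (points M)" "w \<in> T.TS u" "onb (proj u) E" for u w E
    using ricci_traces(2)[OF that] h overD(1)[OF that(1)] kp_in[OF that(1,2)] by simp
qed (fact HM.RC_J, fact HM.chern_eq)

end

section \<open>Induction along the canonical sequence\<close>

context affr
begin

definition al_closed :: bool where
  "al_closed \<longleftrightarrow> form2_zero M (ext_deriv1 M (\<lambda>X p. al p (X p)))"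

definition proportional :: "real \<Rightarrow> bool" where
  "proportional c \<longleftrightarrow> (\<forall>p\<in>points M. \<forall>x\<in>TS p. al p x = c * be p x)"

definition traceless :: bool where
  "traceless \<longleftrightarrow> (\<forall>p\<in>points M. \<forall>x\<in>TS p. al p x = 0 \<and> be p x = 0)"

text \<open>\<open>be\<close> is closed and c is constant.\<close>

lemma proportional_closed:
  assumes h: "proportional c" shows al_closed
  unfolding al_closed_def form2_zero_def
proof (intro allI impI ballI)
  fix U X Y p assume X: "vf U X" and Y: "vf U Y" and p: "p \<in> U"
  have e: "al q (Z q) = c * be q (Z q)" if "vf U Z" "q \<in> U" for Z q
    using h vf_points[OF that] vf_in[OF that] unfolding proportional_def by blast
  have d: "dd p v (\<lambda>q. al q (Z q)) = c * dd p v (\<lambda>q. be q (Z q))" if "vf U Z" for v Z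
    using dd_cong[OF vf_open[OF that] p e[OF that]] dd_cmult[OF be_sf(1)[OF that] p] by simp
  have "ext_deriv1 M (\<lambda>X p. be p (X p)) X Y p = 0" using d_be_zero X Y p unfolding form2_zero_def by blast
  then show "ext_deriv1 M (\<lambda>X p. al p (X p)) X Y p = 0"
    unfolding ext_deriv1_def d[OF X] d[OF Y] e[OF bracket_vf[OF X Y] p]
    by (simp add: right_diff_distrib[symmetric])
qed

lemma traceless_proportional: "traceless \<Longrightarrow> proportional c"
  unfolding traceless_def proportional_def by simp

end

context taff
begin

text \<open>Each step is again an affine-Riemann manifold, so what has been proved for M and its
  tangent bundle holds for any two consecutive steps.\<close>

lemma level: "taff (iter_tangent M k) (conn_seq M nab k) (metric_seq M nab g k)"
proof (induction k)
  case 0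
  show ?case by (simp add: taff_axioms)
next
  case (Suc k)
  then show ?case using taff.affine_riemann_TM by (simp add: taff_def affr_def)
qed

text \<open>For the descent to M it suffices that a vanishing tensor on the bundle is
  symmetric.\<close>

lemma Czero_A1_iff: "A1.Czero \<longleftrightarrow> Czero"
  using Czero_TM Ct_sym_zero unfolding A1.Czero_def by auto

lemma Czero_level: "affr.Czero (iter_tangent M k) (conn_seq M nab k) (metric_seq M nab g k) \<longleftrightarrow> Czero"
proof (induction k)
  case (Suc k)
  interpret L: taff "iter_tangent M k" "conn_seq M nab k" "metric_seq M nab g k" by (rule level)
  show ?case using L.Czero_A1_iff Suc by simp
qed simp

lemma closed_level: "affr.al_closed (iter_tangent M k) (conn_seq M nab k) (metric_seq M nab g k) \<longleftrightarrow> al_closed"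
proof (induction k)
  case (Suc k)
  interpret L: taff "iter_tangent M k" "conn_seq M nab k" "metric_seq M nab g k" by (rule level)
  show ?case using L.closed_TM_iff Suc by (simp add: L.al_closed_def L.A1.al_closed_def)
qed simp

text \<open>At each step \<alpha> is pulled back and \<beta> doubled, so a ratio c at step k is the
  ratio 2^k c on M.\<close>

lemma proportional_level:
  "affr.proportional (iter_tangent M k) (conn_seq M nab k) (metric_seq M nab g k) c \<longleftrightarrow> proportional (2 ^ k * c)"
proof (induction k arbitrary: c)
  case (Suc k)
  interpret L: taff "iter_tangent M k" "conn_seq M nab k" "metric_seq M nab g k" by (rule level)
  have "L.A1.proportional c \<longleftrightarrow> L.proportional (2 * c)"
    unfolding L.A1.proportional_def L.proportional_def by (rule L.balance_TM_iff)
  then show ?case using Suc[of "2 * c"] by (simp add: mult_ac)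
qed simp

lemma traceless_level:
  "traceless \<Longrightarrow> affr.traceless (iter_tangent M k) (conn_seq M nab k) (metric_seq M nab g k)"
proof (induction k)
  case (Suc k)
  interpret L: taff "iter_tangent M k" "conn_seq M nab k" "metric_seq M nab g k" by (rule level)
  have "L.A1.traceless" using L.be_zero_TM Suc unfolding L.traceless_def L.A1.traceless_def by blast
  then show ?case by simp
qed simp

text \<open>Hermitian structures exist from the first step on, hence the index \<open>Suc k\<close>.
  The Kaehler criterion starts one step later, because the vanishing of C is read off from the
  symmetry of a tensor that is itself lifted.\<close>

lemma structures_level:
  defines "N \<equiv> \<lambda>k. iter_tangent M k" and "J \<equiv> \<lambda>k. J_seq M nab k" and "h \<equiv> \<lambda>k. metric_seq M nab g k"
  shows "Czero \<Longrightarrow> is_levi_civita (N k) (h k) (conn_seq M nab k)"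
    and "Czero \<Longrightarrow> kahler_flat (N (Suc k)) (J (Suc k)) (h (Suc k))"
    and "kahler (N (Suc (Suc k))) (J (Suc (Suc k))) (h (Suc (Suc k))) \<longleftrightarrow> Czero"
    and "loc_conf_balanced (N (Suc k)) (J (Suc k)) (h (Suc k)) \<longleftrightarrow> al_closed"
    and "balanced (N (Suc k)) (J (Suc k)) (h (Suc k)) \<longleftrightarrow> proportional (2 ^ k)"
    and "proportional (2 ^ k / 2) \<Longrightarrow> calabi_yau_torsion (N (Suc k)) (J (Suc k)) (h (Suc k))"
    and "traceless \<Longrightarrow> form2_zero (N (Suc k)) (ricci_form (N (Suc k)) (J (Suc k)) (h (Suc k)) (chern (N (Suc k)) (J (Suc k)) (h (Suc k))))"
proof -
  interpret L: taff "iter_tangent M k" "conn_seq M nab k" "metric_seq M nab g k" by (rule level)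
  interpret S: taff "iter_tangent M (Suc k)" "conn_seq M nab (Suc k)" "metric_seq M nab g (Suc k)" by (rule level)
  note cz = Czero_level[of k] Czero_level[of "Suc k"]
  note eqs = N_def J_def h_def J_seq_def
  show "is_levi_civita (N k) (h k) (conn_seq M nab k)" if Czero
    using L.Czero_levi_civita cz(1) that by (simp add: eqs)
  show "kahler_flat (N (Suc k)) (J (Suc k)) (h (Suc k))" if Czero
    using L.kahler_TM S.Czero_flat cz that by (simp add: eqs kahler_flat_def)
  show "kahler (N (Suc (Suc k))) (J (Suc (Suc k))) (h (Suc (Suc k))) \<longleftrightarrow> Czero"
  proof
    \<comment> \<open>The Kaehler condition at step k + 2 makes C symmetric at step k + 1; there it
      is lifted from step k, so it vanishes at step k.\<close>
    assume "kahler (N (Suc (Suc k))) (J (Suc (Suc k))) (h (Suc (Suc k)))"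
    then have "kahler (tangent_bundle (iter_tangent M (Suc k))) (lift_J (iter_tangent M (Suc k)) (conn_seq M nab (Suc k)))
        (lift_metric (iter_tangent M (Suc k)) (conn_seq M nab (Suc k)) (metric_seq M nab g (Suc k)))" by (simp add: eqs)
    note sym = S.kahler_sym[OF this, unfolded iter_tangent.simps conn_seq.simps metric_seq.simps]
    have "L.Czero" by (rule L.Ct_sym_zero) (intro ballI sym)
    then show Czero using cz(1) by simp
  next
    assume Czero
    then show "kahler (N (Suc (Suc k))) (J (Suc (Suc k))) (h (Suc (Suc k)))"
      using S.kahler_TM cz(2) by (simp add: eqs)
  qed
  show "loc_conf_balanced (N (Suc k)) (J (Suc k)) (h (Suc k)) \<longleftrightarrow> al_closed"
    using L.HM.loc_conf_balanced_iff L.A1.al_closed_def closed_level[of "Suc k"] by (simp add: eqs)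
  \<comment> \<open>The ratio 1/2 at step k + 1 becomes 2^(k+1) / 2 on M.\<close>
  show "balanced (N (Suc k)) (J (Suc k)) (h (Suc k)) \<longleftrightarrow> proportional (2 ^ k)"
    using L.HM.balanced_iff L.A1.proportional_def[of "1/2"] proportional_level[of "Suc k" "1/2"] by (simp add: eqs)
  show "calabi_yau_torsion (N (Suc k)) (J (Suc k)) (h (Suc k))" if "proportional (2 ^ k / 2)"
    using L.calabi_yau_TM L.proportional_def[of "1/2"] proportional_level[of k "1/2"] that by (simp add: eqs)
  show "form2_zero (N (Suc k)) (ricci_form (N (Suc k)) (J (Suc k)) (h (Suc k)) (chern (N (Suc k)) (J (Suc k)) (h (Suc k))))" if traceless
    using L.chern_ricci_TM traceless_level[OF that, of k] by (simp add: eqs L.traceless_def)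
qed

end

theorem theorem6p1:
  fixes M :: "('a, 'i) tmanifold"
    and nab :: "(('a, 'i) tpoint, 'i) conn"
    and g :: "(('a, 'i) tpoint, 'i) metric_tensor"
  assumes "affine_riemann M nab g"
  shows
    "(diff_tensor_zero M nab g \<longrightarrow>
        (\<forall>k\<ge>1. is_levi_civita (iter_tangent M k) (metric_seq M nab g k) (conn_seq M nab k) \<and>
               kahler_flat (iter_tangent M k) (J_seq M nab k) (metric_seq M nab g k)))
     \<and>
     (\<forall>k\<ge>2. kahler (iter_tangent M k) (J_seq M nab k) (metric_seq M nab g k) \<longleftrightarrow>
            diff_tensor_zero M nab g)
     \<and>
     (\<forall>k\<ge>1. (loc_conf_balanced (iter_tangent M k) (J_seq M nab k) (metric_seq M nab g k) \<longleftrightarrow>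
             loc_conf_balanced (iter_tangent M 1) (J_seq M nab 1) (metric_seq M nab g 1)) \<and>
            (loc_conf_balanced (iter_tangent M 1) (J_seq M nab 1) (metric_seq M nab g 1) \<longleftrightarrow>
             form2_zero M (ext_deriv1 M (xi_form M nab g))))
     \<and>
     (\<forall>k\<^sub>0\<ge>1.
        (balanced (iter_tangent M k\<^sub>0) (J_seq M nab k\<^sub>0) (metric_seq M nab g k\<^sub>0) \<longleftrightarrow>
         (\<forall>p\<in>points M. tr_gamma M nab g p = ((2::real) ^ k\<^sub>0 - 1) *\<^sub>R tr_gamma_adj M nab g p)) \<and>
        (balanced (iter_tangent M k\<^sub>0) (J_seq M nab k\<^sub>0) (metric_seq M nab g k\<^sub>0) \<longrightarrow>
         calabi_yau_torsion (iter_tangent M (k\<^sub>0 + 1)) (J_seq M nab (k\<^sub>0 + 1))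
           (metric_seq M nab g (k\<^sub>0 + 1)) \<and>
         (\<forall>k\<ge>1. k \<noteq> k\<^sub>0 \<longrightarrow>
            loc_conf_balanced (iter_tangent M k) (J_seq M nab k) (metric_seq M nab g k))))
     \<and>
     ((\<forall>p\<in>points M. tr_gamma M nab g p = 0) \<and> (\<forall>p\<in>points M. tr_gamma_adj M nab g p = 0) \<longrightarrow>
        (\<forall>k\<ge>1. balanced (iter_tangent M k) (J_seq M nab k) (metric_seq M nab g k) \<and>
               calabi_yau_torsion (iter_tangent M k) (J_seq M nab k) (metric_seq M nab g k) \<and>
               form2_zero (iter_tangent M k)
                 (ricci_form (iter_tangent M k) (J_seq M nab k) (metric_seq M nab g k)
                    (chern (iter_tangent M k) (J_seq M nab k) (metric_seq M nab g k)))))"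
proof -
  interpret taff M nab g using assms by (simp add: taff_def affr_def)
  note st = structures_level
  have one: "\<exists>j. k = Suc j" if "1 \<le> k" for k using that by (cases k) auto
  have two: "\<exists>j. k = Suc (Suc j)" if "2 \<le> k" for k using that by (cases k; cases "k - 1") auto
  have lcb: "loc_conf_balanced (iter_tangent M k) (J_seq M nab k) (metric_seq M nab g k) \<longleftrightarrow> al_closed" if "1 \<le> k" for k
    using st(4) one[OF that] by blast
  have p1: "is_levi_civita (iter_tangent M k) (metric_seq M nab g k) (conn_seq M nab k) \<and>
      kahler_flat (iter_tangent M k) (J_seq M nab k) (metric_seq M nab g k)"
    if "diff_tensor_zero M nab g" "1 \<le> k" for k
    using st(1,2) one[OF that(2)] that(1) diff_tensor_zero_iff by blast
  have p2: "kahler (iter_tangent M k) (J_seq M nab k) (metric_seq M nab g k) \<longleftrightarrow> diff_tensor_zero M nab g" if "2 \<le> k" for k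
    using st(3) two[OF that] diff_tensor_zero_iff by blast
  have p3: "loc_conf_balanced (iter_tangent M 1) (J_seq M nab 1) (metric_seq M nab g 1) \<longleftrightarrow>
      form2_zero M (ext_deriv1 M (xi_form M nab g))"
    unfolding lcb[OF order_refl] xi_form_closed_iff al_closed_def ..
  \<comment> \<open>With c = 2^(j+1) - 1 the factor (c + 1) / 2 of \<open>tr_gamma_eq_iff\<close> is
    2^j.\<close>
  have tr: "(\<forall>p\<in>points M. tr_gamma M nab g p = ((2::real) ^ Suc j - 1) *\<^sub>R tr_gamma_adj M nab g p) \<longleftrightarrow> proportional (2 ^ j)" for j
    unfolding tr_gamma_eq_iff proportional_def by simp
  have p4: "(balanced (iter_tangent M k) (J_seq M nab k) (metric_seq M nab g k) \<longleftrightarrow>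
         (\<forall>p\<in>points M. tr_gamma M nab g p = ((2::real) ^ k - 1) *\<^sub>R tr_gamma_adj M nab g p)) \<and>
        (balanced (iter_tangent M k) (J_seq M nab k) (metric_seq M nab g k) \<longrightarrow>
         calabi_yau_torsion (iter_tangent M (k + 1)) (J_seq M nab (k + 1)) (metric_seq M nab g (k + 1)) \<and>
         (\<forall>l\<ge>1. l \<noteq> k \<longrightarrow> loc_conf_balanced (iter_tangent M l) (J_seq M nab l) (metric_seq M nab g l)))"
    if k: "1 \<le> k" for k
  proof -
    obtain j where j: "k = Suc j" using one[OF k] by blast
    \<comment> \<open>The criterion at step k + 1 asks for the ratio 2^k / 2 on M. Since k = j + 1,
      this is 2^j, the balanced ratio at step k.\<close>
    have cyt: "proportional (2 ^ j) \<Longrightarrow>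
        calabi_yau_torsion (iter_tangent M (k + 1)) (J_seq M nab (k + 1)) (metric_seq M nab g (k + 1))"
      using st(6)[of k] by (simp add: j)
    show ?thesis unfolding j tr st(5) using cyt[unfolded j] lcb proportional_closed by blast
  qed
  have p5: "balanced (iter_tangent M k) (J_seq M nab k) (metric_seq M nab g k) \<and>
      calabi_yau_torsion (iter_tangent M k) (J_seq M nab k) (metric_seq M nab g k) \<and>
      form2_zero (iter_tangent M k) (ricci_form (iter_tangent M k) (J_seq M nab k) (metric_seq M nab g k)
        (chern (iter_tangent M k) (J_seq M nab k) (metric_seq M nab g k)))"
    if h: "\<forall>p\<in>points M. tr_gamma M nab g p = 0" "\<forall>p\<in>points M. tr_gamma_adj M nab g p = 0" and k: "1 \<le> k" for k
  proof -
    obtain j where j: "k = Suc j" using one[OF k] by blast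
    have "traceless" using tr_zero[OF h] unfolding traceless_def .
    then show ?thesis unfolding j using st(5,6,7) traceless_proportional by blast
  qed
  have p3': "loc_conf_balanced (iter_tangent M k) (J_seq M nab k) (metric_seq M nab g k) \<longleftrightarrow>
      loc_conf_balanced (iter_tangent M 1) (J_seq M nab 1) (metric_seq M nab g 1)" if "1 \<le> k" for k
    unfolding lcb[OF that] lcb[OF order_refl] ..
  show ?thesis
    by (rule conjI, use p1 in blast, rule conjI, use p2 in blast, rule conjI, use p3 p3' in blast,
        rule conjI, use p4 in blast, use p5 in blast)
qed

end
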